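(* There is a deterministic algorithm which, given an integer $n\ge 1$ and a sequence of integers $a_1,\ldots,a_{2n-1}$, outputs a set of indices $I\subseteq\{1,\ldots,2n-1\}$ with $|I|=n$ and $\sum_{i\in I}a_i\equiv 0\pmod n$, and runs in $O(n)$ time and $O(n)$ space.
   Context: Computational model: the word RAM, in which arithmetic, division with remainder, and modular inverses on $O(\log n)$-bit words are constant-time operations. (The existence of such an index set $I$ is the Erdős–Ginzburg–Ziv theorem; the claim is about finding one.) *)

theory Defs
  imports Complex_Main "HOL-Number_Theory.Modular_Inverse" "HOL-Library.Landau_Symbols"
begin

text \<open>
  A word RAM with \<open>w\<close>-bit two's complement words.  A program is a fixed finite list of
  instructions, so it mentions only a constant number of registers; the memory is addressed
  through registers.
\<close>

datatype binop = Add | Sub | Mul | Div | Mod | ModInv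

datatype instr =
    Const nat int
  | Op binop nat nat nat
  | Load nat nat
  | Store nat nat
  | Jump nat
  | JumpLess nat nat nat
  | JumpEq nat nat nat

type_synonym program = "instr list"

record config =
  pc  :: nat
  reg :: "nat \<Rightarrow> int"
  mem :: "int \<Rightarrow> int"

definition is_word :: "nat \<Rightarrow> int \<Rightarrow> bool" where
  "is_word w x \<longleftrightarrow> w \<ge> 1 \<and> - (2 ^ (w - 1)) \<le> x \<and> x < 2 ^ (w - 1)"

text \<open>Reduction modulo \<open>2 ^ w\<close> into the range of \<^const>\<open>is_word\<close> (for \<open>w \<ge> 1\<close>).\<close>

definition wrap :: "nat \<Rightarrow> int \<Rightarrow> int" where
  "wrap w x = signed_take_bit (w - 1) x"

text \<open>
  Division by zero and inverses of non-units follow the HOL conventions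
  \<open>x div 0 = 0\<close>, \<open>x mod 0 = x\<close> and \<open>modular_inverse m x = 0\<close>.
  The second operand of \<open>ModInv\<close> is the modulus.
\<close>

fun binop_val :: "binop \<Rightarrow> int \<Rightarrow> int \<Rightarrow> int" where
  "binop_val Add x y = x + y"
| "binop_val Sub x y = x - y"
| "binop_val Mul x y = x * y"
| "binop_val Div x y = x div y"
| "binop_val Mod x y = x mod y"
| "binop_val ModInv x y = modular_inverse y x"

fun exec_instr :: "nat \<Rightarrow> instr \<Rightarrow> config \<Rightarrow> config" where
  "exec_instr w (Const r x) s =
     s\<lparr>pc := pc s + 1, reg := (reg s)(r := wrap w x)\<rparr>"
| "exec_instr w (Op f r r1 r2) s =
     s\<lparr>pc := pc s + 1, reg := (reg s)(r := wrap w (binop_val f (reg s r1) (reg s r2)))\<rparr>"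
| "exec_instr w (Load r ra) s =
     s\<lparr>pc := pc s + 1, reg := (reg s)(r := mem s (reg s ra))\<rparr>"
| "exec_instr w (Store ra r) s =
     s\<lparr>pc := pc s + 1, mem := (mem s)(reg s ra := reg s r)\<rparr>"
| "exec_instr w (Jump l) s = s\<lparr>pc := l\<rparr>"
| "exec_instr w (JumpLess r1 r2 l) s =
     s\<lparr>pc := (if reg s r1 < reg s r2 then l else pc s + 1)\<rparr>"
| "exec_instr w (JumpEq r1 r2 l) s =
     s\<lparr>pc := (if reg s r1 = reg s r2 then l else pc s + 1)\<rparr>"

definition halted :: "program \<Rightarrow> config \<Rightarrow> bool" where
  "halted P s \<longleftrightarrow> length P \<le> pc s"

definition step :: "nat \<Rightarrow> program \<Rightarrow> config \<Rightarrow> config" where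
  "step w P s = (if halted P s then s else exec_instr w (P ! pc s) s)"

definition run :: "nat \<Rightarrow> program \<Rightarrow> nat \<Rightarrow> config \<Rightarrow> config" where
  "run w P t s = (step w P ^^ t) s"

fun instr_addrs :: "instr \<Rightarrow> config \<Rightarrow> int set" where
  "instr_addrs (Load r ra) s = {reg s ra}"
| "instr_addrs (Store ra r) s = {reg s ra}"
| "instr_addrs _ s = {}"

definition accessed :: "program \<Rightarrow> config \<Rightarrow> int set" where
  "accessed P s = (if halted P s then {} else instr_addrs (P ! pc s) s)"

text \<open>
  Space is measured by the extent of the memory segment starting at address 0 that contains all
  accessed cells, not merely by the number of accessed cells (which the running time bounds
  trivially).  The constantly many registers are not counted.
\<close>

definition halts_within :: "nat \<Rightarrow> program \<Rightarrow> config \<Rightarrow> nat \<Rightarrow> nat \<Rightarrow> config \<Rightarrow> bool" where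
  "halts_within w P s time space s' \<longleftrightarrow>
     (\<exists>t\<le>time. run w P t s = s' \<and> halted P s' \<and>
        (\<forall>u<t. accessed P (run w P u s) \<subseteq> {0..<int space}))"

text \<open>Cell 0 holds \<open>n\<close>, and cell \<open>i\<close> holds \<open>a i\<close> for \<open>1 \<le> i \<le> 2 * n - 1\<close>.\<close>

definition input_config :: "nat \<Rightarrow> (nat \<Rightarrow> int) \<Rightarrow> config" where
  "input_config n a =
     \<lparr>pc = 0, reg = (\<lambda>_. 0),
      mem = (\<lambda>x. if x = 0 then int n
                 else if 1 \<le> x \<and> x \<le> 2 * int n - 1 then a (nat x) else 0)\<rparr>"

text \<open>
  The output is listed in cells \<open>1, \<dots>, n\<close>; if \<open>card I = n\<close>, the list has no repetitions.
\<close>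

definition outputs :: "config \<Rightarrow> nat \<Rightarrow> nat set \<Rightarrow> bool" where
  "outputs s n I \<longleftrightarrow> mem s ` {1..int n} = int ` I"

end

theory Submission
  imports Defs
begin

text \<open>
  The statement is multiplicative in \<open>n\<close>: if \<open>n = p * q\<close>, then among \<open>2 * n - 1\<close> items one finds
  \<open>2 * q - 1\<close> disjoint groups of \<open>p\<close> items with sum divisible by \<open>p\<close>, since \<open>2 * p - 1\<close> items are
  left before each of them is chosen, and one continues with the groups and \<open>q\<close>. If a prime \<open>p\<close> takes
  time \<open>O(p)\<close>, such a round takes time \<open>O(n)\<close>, and the rounds add up to a geometric series; trial
  division finds the primes in time \<open>O(n)\<close>.

  For a prime \<open>p\<close>, either some residue occurs \<open>p\<close> times, or, in sorted order, the \<open>p - 1\<close> differences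
  of items at distance \<open>p - 1\<close> are nonzero. Choosing one item of each pair, the task is to write a
  given residue as a subset sum of \<open>p - 1\<close> nonzero residues. By Cauchy-Davenport each of them adds
  a new subset sum; the set of subset sums is grown explicitly, with amortised time \<open>O(1)\<close> for each
  new sum, as long as equal residues come in large classes. When only small classes remain, differences
  of residues at a fixed distance in sorted order are again small positive numbers. With scaling,
  the residue 1 is frequent among those already processed, so that a greedy choice among these
  numbers covers an interval that is longer than every gap of the set of subset sums.
\<close>

section \<open>A structured language and its compilation to the word RAM\<close>

text \<open>Each change of the step costs one pass over the residues not yet reached, so a class of
  equal residues pays for itself only if its size is a constant fraction of their number. With many
  small classes this would be quadratic; hence the growth is stopped early. After i residues at most
  p - 1 - i are unreached, so descending from the target one meets a reached residue after e \<le> p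
  - 1 - i steps, and only the deficit e is left to the greedy choice. Positive numbers that are at
  most L + 1, together with L units, attain everything up to L plus their sum. The same units also
  serve the growth: those that it uses are not selected at once but added to the deficit, so none is
  spent twice. Choices are always made between the two ends of a pair. This turns differences into
  coefficients without changing the number of selected items, and it can be iterated on the
  differences themselves. The constants are not optimised: 10000000 separates two regimes in each of
  which the pairs with too large a difference cost only a fraction of the total.\<close>

datatype exp = N int | V nat | A nat exp | B binop exp exp
datatype bexp = Lt exp exp | Eq exp exp
datatype com =
    Skip
  | Asg nat exp (infix "::=" 62)
  | Sto nat exp exp
  | Seq com com (infixr ";;" 60)
  | Cond bexp com com
  | Loop bexp com

record st =
  vr :: "nat \<Rightarrow> int"
  ar :: "nat \<Rightarrow> int \<Rightarrow> int"
  tk :: nat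

abbreviation eadd (infixl ".+" 65) where "a .+ b \<equiv> B Add a b"
abbreviation esub (infixl ".-" 65) where "a .- b \<equiv> B Sub a b"
abbreviation emul (infixl ".*" 70) where "a .* b \<equiv> B Mul a b"
abbreviation ediv (infixl ".div" 70) where "a .div b \<equiv> B Div a b"
abbreviation emod (infixl ".mod" 70) where "a .mod b \<equiv> B Mod a b"

fun ev :: "exp \<Rightarrow> st \<Rightarrow> int" where
  "ev (N k) s = k"
| "ev (V x) s = vr s x"
| "ev (A k e) s = ar s k (ev e s)"
| "ev (B f a b) s = binop_val f (ev a s) (ev b s)"

fun bev :: "bexp \<Rightarrow> st \<Rightarrow> bool" where
  "bev (Lt a b) s \<longleftrightarrow> ev a s < ev b s"
| "bev (Eq a b) s \<longleftrightarrow> ev a s = ev b s"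

text \<open>
  Register 99 holds the size of an array segment, and registers from 100 on are used for the
  evaluation of expressions.
\<close>

fun ce :: "exp \<Rightarrow> nat \<Rightarrow> instr list" where
  "ce (N k) d = [Const d k]"
| "ce (V x) d = [Const d 0, Op Add d x d]"
| "ce (A k e) d = ce e d @ [Const (d+1) (int k), Op Mul (d+1) (d+1) 99, Op Add d d (d+1), Load d d]"
| "ce (B f a b) d = ce a d @ ce b (d+1) @ [Op f d d (d+1)]"

fun cb :: "bexp \<Rightarrow> nat \<Rightarrow> nat \<Rightarrow> instr list" where
  "cb (Lt a b) l m = ce a 100 @ ce b 101 @
     [JumpLess 100 101 (l + length (ce a 100) + length (ce b 101) + 2), Jump m]"
| "cb (Eq a b) l m = ce a 100 @ ce b 101 @
     [JumpEq 100 101 (l + length (ce a 100) + length (ce b 101) + 2), Jump m]"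

fun blen :: "bexp \<Rightarrow> nat" where
  "blen (Lt a b) = length (ce a 100) + length (ce b 101) + 2"
| "blen (Eq a b) = length (ce a 100) + length (ce b 101) + 2"

fun clen :: "com \<Rightarrow> nat" where
  "clen Skip = 0"
| "clen (x ::= e) = length (ce e 100) + 2"
| "clen (Sto k e1 e2) = length (ce e1 100) + length (ce e2 101) + 4"
| "clen (c1 ;; c2) = clen c1 + clen c2"
| "clen (Cond b c1 c2) = blen b + clen c1 + 1 + clen c2"
| "clen (Loop b c) = blen b + clen c + 1"

text \<open>Jump targets are absolute, so code is generated for a load address \<open>l\<close>, and
  the lengths \<open>blen\<close> and \<open>clen\<close> are computed separately, ahead of the
  code. A copy between registers is an addition of 0.\<close>

fun cc :: "com \<Rightarrow> nat \<Rightarrow> instr list" where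
  "cc Skip l = []"
| "cc (x ::= e) l = ce e 100 @ [Const 101 0, Op Add x 100 101]"
| "cc (Sto k e1 e2) l = ce e1 100 @ ce e2 101 @
     [Const 102 (int k), Op Mul 102 102 99, Op Add 100 100 102, Store 100 101]"
| "cc (c1 ;; c2) l = cc c1 l @ cc c2 (l + clen c1)"
| "cc (Cond b c1 c2) l = cb b l (l + blen b + clen c1 + 1) @ cc c1 (l + blen b) @
     [Jump (l + blen b + clen c1 + 1 + clen c2)] @ cc c2 (l + blen b + clen c1 + 1)"
| "cc (Loop b c) l = cb b l (l + blen b + clen c + 1) @ cc c (l + blen b) @ [Jump l]"

lemma length_cb [simp]: "length (cb b l m) = blen b"
  by (cases b) auto

lemma length_cc [simp]: "length (cc c l) = clen c"
  by (induction c arbitrary: l) auto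

definition code_at :: "program \<Rightarrow> nat \<Rightarrow> instr list \<Rightarrow> bool" where
  "code_at P l is \<longleftrightarrow> l + length is \<le> length P \<and> (\<forall>i<length is. P ! (l + i) = is ! i)"

lemma code_at_append [simp]:
  "code_at P l (xs @ ys) \<longleftrightarrow> code_at P l xs \<and> code_at P (l + length xs) ys"
proof
  assume a: "code_at P l (xs @ ys)"
  have "P ! (l + i) = xs ! i" if "i < length xs" for i
    using a that by (auto simp: code_at_def nth_append dest: spec[of _ i])
  moreover have "P ! (l + length xs + i) = ys ! i" if "i < length ys" for i
  proof -
    have "P ! (l + (length xs + i)) = (xs @ ys) ! (length xs + i)"
      using a that unfolding code_at_def by (metis length_append nat_add_left_cancel_less)
    then show ?thesis by (simp add: add.assoc)
  qed
  ultimately show "code_at P l xs \<and> code_at P (l + length xs) ys"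
    using a by (auto simp: code_at_def)
next
  assume a: "code_at P l xs \<and> code_at P (l + length xs) ys"
  have "P ! (l + i) = (xs @ ys) ! i" if "i < length xs + length ys" for i
  proof (cases "i < length xs")
    case True then show ?thesis using a by (auto simp: code_at_def nth_append)
  next
    case False
    then have "i - length xs < length ys" using that by simp
    then have "P ! (l + length xs + (i - length xs)) = ys ! (i - length xs)"
      using a unfolding code_at_def by blast
    moreover have "l + length xs + (i - length xs) = l + i" using False by simp
    ultimately show ?thesis using False by (simp add: nth_append)
  qed
  then show "code_at P l (xs @ ys)" using a by (auto simp: code_at_def)
qed

lemma code_at_Nil [simp]: "code_at P l [] \<longleftrightarrow> l \<le> length P"
  by (simp add: code_at_def)

lemma code_at_Cons [simp]:
  "code_at P l (x # xs) \<longleftrightarrow> l < length P \<and> P ! l = x \<and> code_at P (Suc l) xs"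
proof -
  have "code_at P l ([x] @ xs) \<longleftrightarrow> code_at P l [x] \<and> code_at P (l + 1) xs"
    by (subst code_at_append) simp
  moreover have "code_at P l [x] \<longleftrightarrow> l < length P \<and> P ! l = x" by (auto simp: code_at_def)
  ultimately show ?thesis by simp
qed

lemma wrap_word: "is_word w x \<Longrightarrow> wrap w x = x"
  unfolding is_word_def wrap_def by (rule signed_take_bit_int_eq_self) auto

text \<open>\<open>sz\<close> is the length of one array segment. The bound \<open>room\<close> is
  quadratic because scaling multiplies two residues; the factor \<open>2 ^ 60\<close> leaves space
  for the numerals of the program.\<close>

locale ram =
  fixes sz :: int and w :: nat
  assumes sz_pos: "0 < sz" and room: "is_word w (2 ^ 60 * sz * sz)" and w_large: "w \<ge> 20"
begin

abbreviation fits :: "int \<Rightarrow> bool" where "fits \<equiv> is_word w"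

lemma fits_alt: "fits x \<longleftrightarrow> - (2 ^ (w - 1)) \<le> x \<and> x < 2 ^ (w - 1)"
  using w_large by (simp add: is_word_def)

lemma fits_mono: "fits y \<Longrightarrow> \<bar>x\<bar> \<le> y \<Longrightarrow> fits x"
  unfolding fits_alt by linarith

lemma fits_big: "\<bar>x\<bar> \<le> 2 ^ 60 * sz * sz \<Longrightarrow> fits x"
  using fits_mono[OF room] by simp

lemma fits_mid: "\<bar>x\<bar> \<le> 2 ^ 60 * sz \<Longrightarrow> fits x"
proof (rule fits_big)
  assume "\<bar>x\<bar> \<le> 2 ^ 60 * sz"
  moreover have "2 ^ 60 * sz * 1 \<le> 2 ^ 60 * sz * sz"
    using sz_pos by (intro mult_left_mono) auto
  ultimately show "\<bar>x\<bar> \<le> 2 ^ 60 * sz * sz" by simp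
qed

lemma fits_small: "\<bar>x\<bar> \<le> 100 * sz \<Longrightarrow> fits x"
  using sz_pos by (intro fits_mid) auto

lemma fits_prod: "\<bar>x\<bar> \<le> sz \<Longrightarrow> \<bar>y\<bar> \<le> sz \<Longrightarrow> fits (x * y)"
proof (rule fits_big)
  assume "\<bar>x\<bar> \<le> sz" "\<bar>y\<bar> \<le> sz"
  then have "\<bar>x\<bar> * \<bar>y\<bar> \<le> 1 * (sz * sz)" using sz_pos by (simp add: mult_mono)
  also have "\<dots> \<le> 2 ^ 60 * (sz * sz)" using sz_pos by (intro mult_right_mono) auto
  finally show "\<bar>x * y\<bar> \<le> 2 ^ 60 * sz * sz" by (simp add: abs_mult)
qed

section \<open>Big-step semantics and correctness of the compilation\<close>

fun ok :: "exp \<Rightarrow> st \<Rightarrow> bool" where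
  "ok (N k) s \<longleftrightarrow> fits k"
| "ok (V x) s \<longleftrightarrow> x < 99"
| "ok (A k e) s \<longleftrightarrow> k < 50 \<and> ok e s \<and> 0 \<le> ev e s \<and> ev e s < sz"
| "ok (B f a b) s \<longleftrightarrow> ok a s \<and> ok b s \<and> fits (binop_val f (ev a s) (ev b s))"

fun bok :: "bexp \<Rightarrow> st \<Rightarrow> bool" where
  "bok (Lt a b) s \<longleftrightarrow> ok a s \<and> ok b s"
| "bok (Eq a b) s \<longleftrightarrow> ok a s \<and> ok b s"

text \<open>The side conditions \<open>ok\<close> and \<open>bok\<close> rule out overflow and
  accesses outside an array, so expressions can be evaluated over the integers. A derivation
  witnesses at once termination, safety and, through \<open>tk\<close>, the running time.\<close>

inductive bs :: "com \<Rightarrow> st \<Rightarrow> st \<Rightarrow> bool" where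
  Skip: "bs Skip s s"
| Asg: "x < 99 \<Longrightarrow> ok e s \<Longrightarrow> bs (x ::= e) s (s\<lparr>vr := (vr s)(x := ev e s)\<rparr>)"
| Sto: "k < 50 \<Longrightarrow> ok e1 s \<Longrightarrow> ok e2 s \<Longrightarrow> 0 \<le> ev e1 s \<Longrightarrow> ev e1 s < sz \<Longrightarrow>
    bs (Sto k e1 e2) s (s\<lparr>ar := (ar s)(k := (ar s k)(ev e1 s := ev e2 s))\<rparr>)"
| Seq: "bs c1 s1 s2 \<Longrightarrow> bs c2 s2 s3 \<Longrightarrow> bs (c1 ;; c2) s1 s3"
| CondT: "bok b s \<Longrightarrow> bev b s \<Longrightarrow> bs c1 s s' \<Longrightarrow> bs (Cond b c1 c2) s s'"
| CondF: "bok b s \<Longrightarrow> \<not> bev b s \<Longrightarrow> bs c2 s s' \<Longrightarrow> bs (Cond b c1 c2) s s'"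
| LoopF: "bok b s \<Longrightarrow> \<not> bev b s \<Longrightarrow> bs (Loop b c) s s"
| LoopT: "bok b s1 \<Longrightarrow> bev b s1 \<Longrightarrow> bs c (s1\<lparr>tk := tk s1 + 1\<rparr>) s2 \<Longrightarrow> bs (Loop b c) s2 s3 \<Longrightarrow>
    bs (Loop b c) s1 s3"

definition matches :: "st \<Rightarrow> config \<Rightarrow> bool" where
  "matches s cf \<longleftrightarrow>
     (\<forall>x<99. reg cf x = vr s x \<and> fits (vr s x)) \<and> reg cf 99 = sz \<and>
     (\<forall>k<50. \<forall>i. 0 \<le> i \<and> i < sz \<longrightarrow> mem cf (int k * sz + i) = ar s k i \<and> fits (ar s k i))"

text \<open>Besides reaching the result, a run has to stay inside the 50 array segments; this is the
  source of the space bound.\<close>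

definition exs :: "program \<Rightarrow> nat \<Rightarrow> config \<Rightarrow> config \<Rightarrow> bool" where
  "exs P t cf cf' \<longleftrightarrow> run w P t cf = cf' \<and> (\<forall>u<t. accessed P (run w P u cf) \<subseteq> {0..<50 * sz})"

lemma exs_0 [simp]: "exs P 0 cf cf' \<longleftrightarrow> cf = cf'"
  by (auto simp: exs_def run_def)

lemma run_add: "run w P (t1 + t2) s = run w P t2 (run w P t1 s)"
  by (simp add: run_def funpow_add add.commute[of t1])

lemma exs_trans: "exs P t1 a b \<Longrightarrow> exs P t2 b c \<Longrightarrow> exs P (t1 + t2) a c"
  unfolding exs_def
proof (intro conjI allI impI; elim conjE)
  fix u assume h: "u < t1 + t2" "run w P t1 a = b" "run w P t2 b = c"
    "\<forall>u<t1. accessed P (run w P u a) \<subseteq> {0..<50 * sz}"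
    "\<forall>u<t2. accessed P (run w P u b) \<subseteq> {0..<50 * sz}"
  show "accessed P (run w P u a) \<subseteq> {0..<50 * sz}"
  proof (cases "u < t1")
    case False
    then have "run w P u a = run w P (u - t1) b" using run_add[of P t1 "u - t1" a] h by simp
    then show ?thesis using h False by auto
  qed (use h in auto)
qed (simp add: run_add)

lemma exs_step:
  assumes "pc cf < length P" "instr_addrs (P ! pc cf) cf \<subseteq> {0..<50 * sz}"
  shows "exs P 1 cf (exec_instr w (P ! pc cf) cf)"
  using assms by (auto simp: exs_def run_def step_def halted_def accessed_def)

lemma exs_Suc:
  assumes "pc cf < length P" "instr_addrs (P ! pc cf) cf \<subseteq> {0..<50 * sz}"
    "exs P t (exec_instr w (P ! pc cf) cf) cf'"
  shows "exs P (Suc t) cf cf'"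
  using exs_trans[OF exs_step[OF assms(1,2)] assms(3)] by simp

lemma fits_id: "k < 50 \<Longrightarrow> fits (int k)" "k < 50 \<Longrightarrow> fits (int k * sz)" "fits 0"
proof -
  assume k: "k < 50"
  have "int k * sz \<le> 50 * sz" using k sz_pos by (intro mult_right_mono) auto
  then show "fits (int k * sz)" using k sz_pos by (intro fits_small) (auto simp: abs_mult)
  show "fits (int k)" using k sz_pos by (intro fits_small) auto
next
  show "fits 0" using sz_pos by (intro fits_small) auto
qed

lemma addr:
  assumes "k < 50" "0 \<le> i" "i < sz"
  shows "0 \<le> i + int k * sz" "i + int k * sz < 50 * sz" "fits (i + int k * sz)"
proof -
  have "(int k + 1) * sz \<le> 50 * sz" using assms sz_pos by (intro mult_right_mono) auto
  then show "i + int k * sz < 50 * sz" using assms unfolding distrib_right by linarith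
  moreover show "0 \<le> i + int k * sz" using assms by simp
  ultimately show "fits (i + int k * sz)" using sz_pos by (intro fits_small) auto
qed

text \<open>Registers from \<open>d\<close> on serve as a stack: the first operand waits in
  \<open>d\<close> while the second one is computed in \<open>d + 1\<close>. For this the induction
  needs that registers below \<open>d\<close> are preserved.\<close>

lemma ce_correct:
  assumes "code_at P l (ce e d)" "pc cf = l" "matches s cf" "ok e s" "d \<ge> 100"
  shows "\<exists>cf'. exs P (length (ce e d)) cf cf' \<and> pc cf' = l + length (ce e d) \<and>
    reg cf' d = ev e s \<and> (\<forall>r<d. reg cf' r = reg cf r) \<and> mem cf' = mem cf \<and> fits (ev e s)"
  using assms
proof (induction e arbitrary: d l cf)
  case (N k)
  let ?c = "cf\<lparr>pc := l + 1, reg := (reg cf)(d := k)\<rparr>"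
  have "exs P 1 cf ?c" using N exs_step[of cf P] by (auto simp: wrap_word)
  then show ?case using N by (intro exI[of _ ?c]) auto
next
  case (V x)
  let ?c1 = "cf\<lparr>pc := l + 1, reg := (reg cf)(d := 0)\<rparr>"
  let ?c = "cf\<lparr>pc := l + 2, reg := (reg cf)(d := vr s x)\<rparr>"
  have x: "reg cf x = vr s x" "fits (vr s x)" "x \<noteq> d" using V by (auto simp: matches_def)
  have "exs P 1 ?c1 ?c" using V x exs_step[of ?c1 P] by (auto simp: wrap_word)
  then have "exs P (Suc 1) cf ?c"
    using V x by (intro exs_Suc) (auto simp: wrap_word fits_id)
  then show ?case using V x by (intro exI[of _ ?c]) (auto simp: numeral_2_eq_2)
next
  case (A k e)
  have "\<exists>cf'. exs P (length (ce e d)) cf cf' \<and> pc cf' = l + length (ce e d) \<and>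
    reg cf' d = ev e s \<and> (\<forall>r<d. reg cf' r = reg cf r) \<and> mem cf' = mem cf \<and> fits (ev e s)"
    using A.prems by (intro A.IH) auto
  then obtain c1 where c1: "exs P (length (ce e d)) cf c1" "pc c1 = l + length (ce e d)"
    "reg c1 d = ev e s" "\<forall>r<d. reg c1 r = reg cf r" "mem c1 = mem cf"
    by blast
  let ?l = "l + length (ce e d)"
  have r99: "reg c1 99 = sz" using c1 A by (auto simp: matches_def)
  have k: "k < 50" "0 \<le> ev e s" "ev e s < sz" using A by auto
  have m: "mem cf (ev e s + int k * sz) = ar s k (ev e s)" "fits (ar s k (ev e s))"
    using A k by (auto simp: matches_def algebra_simps)
  let ?c = "c1\<lparr>pc := ?l + 4, reg := (reg c1)(d + 1 := int k * sz, d := ar s k (ev e s))\<rparr>"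
  have code: "P ! ?l = Const (d+1) (int k)" "P ! (?l+1) = Op Mul (d+1) (d+1) 99"
    "P ! (?l+2) = Op Add d d (d+1)" "P ! (?l+3) = Load d d" "?l + 4 \<le> length P"
    using A.prems by (auto simp: numeral_2_eq_2 numeral_3_eq_3)
  let ?d1 = "c1\<lparr>pc := ?l + 1, reg := (reg c1)(d + 1 := int k)\<rparr>"
  let ?d2 = "c1\<lparr>pc := ?l + 2, reg := (reg c1)(d + 1 := int k * sz)\<rparr>"
  let ?d3 = "c1\<lparr>pc := ?l + 3, reg := (reg c1)(d + 1 := int k * sz, d := ev e s + int k * sz)\<rparr>"
  have "exs P 1 c1 ?d1" using exs_step[of c1 P] code c1 k by (auto simp: wrap_word fits_id)
  moreover have "exs P 1 ?d1 ?d2"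
    using exs_step[of ?d1 P] code c1 k r99 A.prems by (auto simp: wrap_word fits_id)
  moreover have "exs P 1 ?d2 ?d3"
    using exs_step[of ?d2 P] code c1 k addr[OF k] by (auto simp: wrap_word numeral_3_eq_3)
  moreover have "exs P 1 ?d3 ?c"
    using exs_step[of ?d3 P] code c1 k addr[OF k] m
    by (auto simp: wrap_word eval_nat_numeral)
  ultimately have "exs P (length (ce e d) + (1 + (1 + (1 + 1)))) cf ?c"
    by (blast intro: exs_trans c1(1))
  then show ?case using c1 m by (intro exI[of _ ?c]) auto
next
  case (B f a b)
  obtain c1 where c1: "exs P (length (ce a d)) cf c1" "pc c1 = l + length (ce a d)"
    "reg c1 d = ev a s" "\<forall>r<d. reg c1 r = reg cf r" "mem c1 = mem cf"
    using B.IH(1)[of l d cf] B.prems by auto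
  have m1: "matches s c1" using B.prems c1 by (auto simp: matches_def)
  obtain c2 where c2: "exs P (length (ce b (d+1))) c1 c2"
    "pc c2 = l + length (ce a d) + length (ce b (d+1))"
    "reg c2 (d+1) = ev b s" "\<forall>r<d+1. reg c2 r = reg c1 r" "mem c2 = mem c1"
    using B.IH(2)[of "l + length (ce a d)" "d+1" c1] B.prems m1 c1(2) by auto
  let ?c = "c2\<lparr>pc := pc c2 + 1, reg := (reg c2)(d := binop_val f (ev a s) (ev b s))\<rparr>"
  have code: "P ! pc c2 = Op f d d (d+1)" "pc c2 < length P" using B.prems c2 by auto
  have "exs P 1 c2 ?c"
    using exs_step[of c2 P] code c2 c1 B.prems by (auto simp: wrap_word)
  then have "exs P (length (ce a d) + (length (ce b (d+1)) + 1)) cf ?c"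
    using c1(1) c2(1) by (blast intro: exs_trans)
  then show ?case using c1 c2 B.prems by (intro exI[of _ ?c]) auto
qed

lemma matches_cong:
  "matches s cf \<Longrightarrow> (\<forall>r<100. reg cf' r = reg cf r) \<Longrightarrow> mem cf' = mem cf \<Longrightarrow> matches s cf'"
  by (auto simp: matches_def)

lemma ce2_correct:
  assumes "code_at P l (ce a 100 @ ce b 101)" "pc cf = l" "matches s cf" "ok a s" "ok b s"
  shows "\<exists>cf'. exs P (length (ce a 100) + length (ce b 101)) cf cf' \<and>
    pc cf' = l + length (ce a 100) + length (ce b 101) \<and>
    reg cf' 100 = ev a s \<and> reg cf' 101 = ev b s \<and> mem cf' = mem cf \<and> matches s cf' \<and>
    fits (ev a s) \<and> fits (ev b s)"
proof -
  obtain c1 where c1: "exs P (length (ce a 100)) cf c1" "pc c1 = l + length (ce a 100)"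
    "reg c1 100 = ev a s" "\<forall>r<100. reg c1 r = reg cf r" "mem c1 = mem cf" "fits (ev a s)"
    using ce_correct[of P l a 100 cf s] assms by auto
  have m1: "matches s c1" using matches_cong assms c1 by blast
  obtain c2 where c2: "exs P (length (ce b 101)) c1 c2"
    "pc c2 = l + length (ce a 100) + length (ce b 101)"
    "reg c2 101 = ev b s" "\<forall>r<101. reg c2 r = reg c1 r" "mem c2 = mem c1" "fits (ev b s)"
    using ce_correct[of P "l + length (ce a 100)" b 101 c1 s] assms m1 c1(2) by auto
  have "matches s c2" using matches_cong[OF m1] c2 by auto
  then show ?thesis using exs_trans[OF c1(1) c2(1)] c1 c2 by (intro exI[of _ c2]) auto
qed

lemma cb_correct:
  assumes "code_at P l (cb b l m)" "pc cf = l" "matches s cf" "bok b s"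
  shows "\<exists>t cf'. t \<le> blen b \<and> exs P t cf cf' \<and> matches s cf' \<and>
    pc cf' = (if bev b s then l + blen b else m)"
proof -
  obtain x y j where b: "(b = Lt x y \<and> j = JumpLess) \<or> (b = Eq x y \<and> j = JumpEq)"
    by (cases b) auto
  let ?n = "length (ce x 100) + length (ce y 101)"
  have "code_at P l (ce x 100 @ ce y 101)" "ok x s" "ok y s"
    and code: "P ! (l + ?n) = j 100 101 (l + ?n + 2)" "P ! (l + ?n + 1) = Jump m"
       "l + ?n + 2 \<le> length P"
    using assms b by (auto simp: add.assoc)
  from ce2_correct[OF this(1) assms(2,3) this(2,3)] obtain c1 where
    c1: "exs P ?n cf c1" "pc c1 = l + ?n" "reg c1 100 = ev x s" "reg c1 101 = ev y s"
      "matches s c1" by (auto simp: add.assoc)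
  have bl: "blen b = ?n + 2" using b by auto
  show ?thesis
  proof (cases "bev b s")
    case True
    let ?c = "c1\<lparr>pc := l + ?n + 2\<rparr>"
    have "exs P 1 c1 ?c" using exs_step[of c1 P] c1 code b True by auto
    then have "exs P (?n + 1) cf ?c" using exs_trans c1(1) by blast
    then show ?thesis using True c1 bl
      by (intro exI[of _ "?n + 1"] exI[of _ ?c]) (auto simp: matches_def)
  next
    case False
    let ?d = "c1\<lparr>pc := l + ?n + 1\<rparr>"
    let ?c = "c1\<lparr>pc := m\<rparr>"
    have "exs P 1 c1 ?d" using exs_step[of c1 P] c1 code b False by auto
    moreover have "exs P 1 ?d ?c" using exs_step[of ?d P] code by auto
    ultimately have "exs P (?n + (1 + 1)) cf ?c" using exs_trans c1(1) by blast
    then show ?thesis using False c1 bl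
      by (intro exI[of _ "?n + (1 + 1)"] exI[of _ ?c]) (auto simp: matches_def)
  qed
qed

lemma bs_tk: "bs c s s' \<Longrightarrow> tk s \<le> tk s'"
  by (induction rule: bs.induct) auto

text \<open>
  Only loop iterations are counted in \<^const>\<open>tk\<close>: between two of them, a compiled program executes
  each of its instructions at most once.
\<close>

theorem cc_correct:
  assumes "bs c s s'" "code_at P l (cc c l)" "pc cf = l" "matches s cf"
  shows "\<exists>t cf'. t \<le> clen c * (1 + (tk s' - tk s)) \<and> exs P t cf cf' \<and> matches s' cf' \<and>
    pc cf' = l + clen c"
  using assms
proof (induction arbitrary: l cf rule: bs.induct)
  case (Skip s)
  then show ?case by (intro exI[of _ 0]) auto
next
  case (Asg x e s)
  then obtain c1 where c1: "exs P (length (ce e 100)) cf c1" "pc c1 = l + length (ce e 100)"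
    "reg c1 100 = ev e s" "\<forall>r<100. reg c1 r = reg cf r" "mem c1 = mem cf" "fits (ev e s)"
    using ce_correct[of P l e 100 cf s] by auto
  let ?d = "c1\<lparr>pc := pc c1 + 1, reg := (reg c1)(101 := 0)\<rparr>"
  let ?c = "c1\<lparr>pc := pc c1 + 2, reg := (reg c1)(101 := 0, x := ev e s)\<rparr>"
  have "exs P 1 c1 ?d" using exs_step[of c1 P] c1 Asg by (auto simp: wrap_word fits_id)
  moreover have "exs P 1 ?d ?c" using exs_step[of ?d P] c1 Asg by (auto simp: wrap_word)
  ultimately have "exs P (length (ce e 100) + (1 + 1)) cf ?c" using exs_trans c1(1) by blast
  then show ?case using Asg c1
    by (intro exI[of _ "length (ce e 100) + (1 + 1)"] exI[of _ ?c]) (auto simp: matches_def)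
next
  case (Sto k e1 s e2)
  let ?n = "length (ce e1 100) + length (ce e2 101)"
  from Sto ce2_correct[of P l e1 e2 cf s] obtain c1 where
    c1: "exs P ?n cf c1" "pc c1 = l + ?n" "reg c1 100 = ev e1 s" "reg c1 101 = ev e2 s"
      "matches s c1" "fits (ev e2 s)" "mem c1 = mem cf" by (auto simp: add.assoc)
  note k = Sto.hyps(1,4,5)
  have code: "P ! (l + ?n) = Const 102 (int k)" "P ! (l + ?n + 1) = Op Mul 102 102 99"
    "P ! (l + ?n + 2) = Op Add 100 100 102" "P ! (l + ?n + 3) = Store 100 101"
    "l + ?n + 4 \<le> length P"
    using Sto.prems by (auto simp: add.assoc eval_nat_numeral)
  have r99: "reg c1 99 = sz" using c1 by (auto simp: matches_def)
  let ?d1 = "c1\<lparr>pc := l + ?n + 1, reg := (reg c1)(102 := int k)\<rparr>"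
  let ?d2 = "c1\<lparr>pc := l + ?n + 2, reg := (reg c1)(102 := int k * sz)\<rparr>"
  let ?a = "ev e1 s + int k * sz"
  let ?d3 = "c1\<lparr>pc := l + ?n + 3, reg := (reg c1)(102 := int k * sz, 100 := ?a)\<rparr>"
  let ?c = "c1\<lparr>pc := l + ?n + 4, reg := (reg c1)(102 := int k * sz, 100 := ?a),
    mem := (mem c1)(?a := ev e2 s)\<rparr>"
  have "exs P 1 c1 ?d1" using exs_step[of c1 P] code c1 k by (auto simp: wrap_word fits_id)
  moreover have "exs P 1 ?d1 ?d2"
    using exs_step[of ?d1 P] code c1 k r99 by (auto simp: wrap_word fits_id)
  moreover have "exs P 1 ?d2 ?d3"
    using exs_step[of ?d2 P] code c1 k addr[OF k] by (auto simp: wrap_word numeral_3_eq_3)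
  moreover have "exs P 1 ?d3 ?c"
  proof -
    have "exec_instr w (P ! pc ?d3) ?d3 = ?c" using code(4) c1(4) by simp
    then show ?thesis using exs_step[of ?d3 P] code(4,5) addr[OF k] by auto
  qed
  ultimately have ex: "exs P (?n + (1 + (1 + (1 + 1)))) cf ?c"
    by (blast intro: exs_trans c1(1))
  \<comment> \<open>Division by \<open>sz\<close> recovers the segment and the offset from an
    address, so a store changes a single array entry.\<close>
  have inj: "int k' * sz + i = ev e1 s + int k * sz \<longleftrightarrow> k' = k \<and> i = ev e1 s"
    if "0 \<le> i" "i < sz" for k' i
  proof
    assume eq: "int k' * sz + i = ev e1 s + int k * sz"
    have "(i + int k' * sz) div sz = int k'" "(ev e1 s + int k * sz) div sz = int k"
      using that k sz_pos by auto
    then show "k' = k \<and> i = ev e1 s" using eq by (auto simp: algebra_simps)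
  qed auto
  have "matches (s\<lparr>ar := (ar s)(k := (ar s k)(ev e1 s := ev e2 s))\<rparr>) ?c"
    using c1 k inj unfolding matches_def by auto
  then show ?case using ex
    by (intro exI[of _ "?n + (1 + (1 + (1 + 1)))"] exI[of _ ?c]) auto
next
  case (Seq c1 s1 s2 c2 s3)
  obtain t1 d1 where 1: "t1 \<le> clen c1 * (1 + (tk s2 - tk s1))" "exs P t1 cf d1"
    "matches s2 d1" "pc d1 = l + clen c1"
    using Seq.IH(1)[of l cf] Seq.prems by auto
  obtain t2 d2 where 2: "t2 \<le> clen c2 * (1 + (tk s3 - tk s2))" "exs P t2 d1 d2"
    "matches s3 d2" "pc d2 = l + clen c1 + clen c2"
    using Seq.IH(2)[of "l + clen c1" d1] Seq.prems 1 by auto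
  have "tk s1 \<le> tk s2" "tk s2 \<le> tk s3" using Seq bs_tk by auto
  then have "clen c1 * (1 + (tk s2 - tk s1)) \<le> clen c1 * (1 + (tk s3 - tk s1))"
    "clen c2 * (1 + (tk s3 - tk s2)) \<le> clen c2 * (1 + (tk s3 - tk s1))"
    by (auto intro!: mult_le_mono)
  then have "t1 + t2 \<le> clen (c1 ;; c2) * (1 + (tk s3 - tk s1))"
    using 1 2 unfolding clen.simps(4) add_mult_distrib by linarith
  then show ?case using exs_trans[OF 1(2) 2(2)] 2 by (intro exI[of _ "t1+t2"] exI[of _ d2]) auto
next
  case (CondT b s c1 s' c2)
  obtain t1 d1 where 1: "t1 \<le> blen b" "exs P t1 cf d1" "matches s d1" "pc d1 = l + blen b"
    using cb_correct[of P l b "l + blen b + clen c1 + 1" cf s] CondT by auto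
  obtain t2 d2 where 2: "t2 \<le> clen c1 * (1 + (tk s' - tk s))" "exs P t2 d1 d2"
    "matches s' d2" "pc d2 = l + blen b + clen c1"
    using CondT.IH[of "l + blen b" d1] CondT.prems 1 by auto
  let ?c = "d2\<lparr>pc := l + blen b + clen c1 + 1 + clen c2\<rparr>"
  have 3: "exs P 1 d2 ?c" using exs_step[of d2 P] 2 CondT.prems by auto
  have "exs P (t1 + (t2 + 1)) cf ?c" using exs_trans 1 2 3 by blast
  moreover have "t1 + (t2 + 1) \<le> clen (Cond b c1 c2) * (1 + (tk s' - tk s))"
    using 1 2 by (auto simp: algebra_simps)
  ultimately show ?case using 2
    by (intro exI[of _ "t1 + (t2 + 1)"] exI[of _ ?c]) (auto simp: matches_def)
next
  case (CondF b s c2 s' c1)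
  obtain t1 d1 where 1: "t1 \<le> blen b" "exs P t1 cf d1" "matches s d1"
    "pc d1 = l + blen b + clen c1 + 1"
    using cb_correct[of P l b "l + blen b + clen c1 + 1" cf s] CondF by auto
  obtain t2 d2 where 2: "t2 \<le> clen c2 * (1 + (tk s' - tk s))" "exs P t2 d1 d2"
    "matches s' d2" "pc d2 = l + blen b + clen c1 + 1 + clen c2"
    using CondF.IH[of "l + blen b + clen c1 + 1" d1] CondF.prems 1 by auto
  have "exs P (t1 + t2) cf d2" using exs_trans 1 2 by blast
  moreover have "t1 + t2 \<le> clen (Cond b c1 c2) * (1 + (tk s' - tk s))"
    using 1 2 by (auto simp: algebra_simps)
  ultimately show ?case using 2 by (intro exI[of _ "t1 + t2"] exI[of _ d2]) auto
next
  case (LoopF b s c)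
  obtain t1 d1 where 1: "t1 \<le> blen b" "exs P t1 cf d1" "matches s d1"
    "pc d1 = l + blen b + clen c + 1"
    using cb_correct[of P l b "l + blen b + clen c + 1" cf s] LoopF by auto
  then show ?case by (intro exI[of _ t1] exI[of _ d1]) auto
next
  case (LoopT b s1 c s2 s3)
  obtain t1 d1 where 1: "t1 \<le> blen b" "exs P t1 cf d1" "matches s1 d1" "pc d1 = l + blen b"
    using cb_correct[of P l b "l + blen b + clen c + 1" cf s1] LoopT by auto
  have "matches (s1\<lparr>tk := tk s1 + 1\<rparr>) d1" using 1 by (auto simp: matches_def)
  then obtain t2 d2 where 2: "t2 \<le> clen c * (1 + (tk s2 - (tk s1 + 1)))" "exs P t2 d1 d2"
    "matches s2 d2" "pc d2 = l + blen b + clen c"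
    using LoopT.IH(1)[of "l + blen b" d1] LoopT.prems 1 by auto
  let ?c = "d2\<lparr>pc := l\<rparr>"
  have 3: "exs P 1 d2 ?c" using exs_step[of d2 P] 2 LoopT.prems by auto
  obtain t3 d3 where 4: "t3 \<le> clen (Loop b c) * (1 + (tk s3 - tk s2))" "exs P t3 ?c d3"
    "matches s3 d3" "pc d3 = l + clen (Loop b c)"
    using LoopT.IH(2)[of l ?c] LoopT.prems 2 by (auto simp: matches_def)
  have le: "tk s1 + 1 \<le> tk s2" "tk s2 \<le> tk s3" using LoopT.hyps bs_tk by fastforce+
  then obtain x y where xy: "tk s2 = tk s1 + 1 + x" "tk s3 = tk s2 + y"
    by (metis le_Suc_ex)
  \<comment> \<open>The tick of this iteration pays for the second summand 1.\<close>
  have "t1 + (t2 + (1 + t3)) \<le> clen (Loop b c) * (1 + x) + clen (Loop b c) * (1 + y)"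
    using 1 2 4 xy by (auto simp: algebra_simps)
  also have "\<dots> = clen (Loop b c) * (1 + (tk s3 - tk s1))"
    using xy by (auto simp: algebra_simps)
  finally show ?case using 4 exs_trans[OF 1(2) exs_trans[OF 2(2) exs_trans[OF 3 4(2)]]]
    by (intro exI[of _ "t1 + (t2 + (1 + t3))"] exI[of _ d3]) auto
qed

end

section \<open>Weakest preconditions\<close>

fun modv :: "com \<Rightarrow> nat set" where
  "modv Skip = {}"
| "modv (x ::= e) = {x}"
| "modv (Sto k e1 e2) = {}"
| "modv (c1 ;; c2) = modv c1 \<union> modv c2"
| "modv (Cond b c1 c2) = modv c1 \<union> modv c2"
| "modv (Loop b c) = modv c"

fun moda :: "com \<Rightarrow> nat set" where
  "moda Skip = {}"
| "moda (x ::= e) = {}"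
| "moda (Sto k e1 e2) = {k}"
| "moda (c1 ;; c2) = moda c1 \<union> moda c2"
| "moda (Cond b c1 c2) = moda c1 \<union> moda c2"
| "moda (Loop b c) = moda c"

definition For :: "nat \<Rightarrow> nat \<Rightarrow> com \<Rightarrow> com" where
  "For x y c = (x ::= N 0 ;; Loop (Lt (V x) (V y)) (c ;; x ::= V x .+ N 1))"

lemma mod_For [simp]: "modv (For x y c) = insert x (modv c)" "moda (For x y c) = moda c"
  by (auto simp: For_def)

definition frame :: "com \<Rightarrow> st \<Rightarrow> st \<Rightarrow> bool" where
  "frame c s t \<longleftrightarrow> (\<forall>z. z \<notin> modv c \<longrightarrow> vr t z = vr s z) \<and> (\<forall>k. k \<notin> moda c \<longrightarrow> ar t k = ar s k)"

lemma frameD: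
  "frame c s t \<Longrightarrow> z \<notin> modv c \<Longrightarrow> vr t z = vr s z"
  "frame c s t \<Longrightarrow> k \<notin> moda c \<Longrightarrow> ar t k = ar s k"
  by (auto simp: frame_def)

context ram
begin

text \<open>Total correctness: \<open>bs\<close> relates a state only to the outcome of a
  terminating run without range violations.\<close>

definition wp :: "com \<Rightarrow> (st \<Rightarrow> bool) \<Rightarrow> st \<Rightarrow> bool" where
  "wp c Q s \<longleftrightarrow> (\<exists>s'. bs c s s' \<and> Q s')"

inductive_cases SkipE: "bs Skip s s'"
inductive_cases AsgE: "bs (x ::= e) s s'"
inductive_cases StoE: "bs (Sto k e1 e2) s s'"
inductive_cases SeqE: "bs (c1 ;; c2) s s'"
inductive_cases CondE: "bs (Cond b c1 c2) s s'"

lemma wp_simps: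
  "wp Skip Q s \<longleftrightarrow> Q s"
  "wp (x ::= e) Q s \<longleftrightarrow> x < 99 \<and> ok e s \<and> Q (s\<lparr>vr := (vr s)(x := ev e s)\<rparr>)"
  "wp (Sto k e1 e2) Q s \<longleftrightarrow> k < 50 \<and> ok e1 s \<and> ok e2 s \<and> 0 \<le> ev e1 s \<and> ev e1 s < sz \<and>
     Q (s\<lparr>ar := (ar s)(k := (ar s k)(ev e1 s := ev e2 s))\<rparr>)"
  "wp (c1 ;; c2) Q s \<longleftrightarrow> wp c1 (wp c2 Q) s"
  "wp (Cond b c1 c2) Q s \<longleftrightarrow> bok b s \<and> (if bev b s then wp c1 Q s else wp c2 Q s)"
  unfolding wp_def
  by (auto intro: bs.intros elim: SkipE AsgE StoE CondE; blast intro: bs.intros elim: SeqE)+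

lemma bs_frame: "bs c s s' \<Longrightarrow> frame c s s'"
  by (induction rule: bs.induct) (auto simp: frame_def)

lemma wp_conseq: "wp c Q s \<Longrightarrow> (\<And>t. Q t \<Longrightarrow> frame c s t \<Longrightarrow> tk s \<le> tk t \<Longrightarrow> Q' t) \<Longrightarrow> wp c Q' s"
  unfolding wp_def using bs_frame bs_tk by blast

text \<open>The frame relative to the initial state is supplied to every premise, so an invariant
  has to mention only what the body changes.\<close>

lemma wp_Loop:
  assumes "I s"
    and "\<And>t. I t \<Longrightarrow> frame c s t \<Longrightarrow> bok b t"
    and "\<And>t. I t \<Longrightarrow> frame c s t \<Longrightarrow> bev b t \<Longrightarrow>
           wp c (\<lambda>t'. I t' \<and> m t' < (m t :: nat)) (t\<lparr>tk := tk t + 1\<rparr>)"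
    and "\<And>t. I t \<Longrightarrow> frame c s t \<Longrightarrow> \<not> bev b t \<Longrightarrow> Q t"
  shows "wp (Loop b c) Q s"
proof -
  have "wp (Loop b c) Q t" if "I t" "frame c s t" for t
    using that
  proof (induction "m t" arbitrary: t rule: less_induct)
    case less
    show ?case
    proof (cases "bev b t")
      case True
      obtain u where u: "bs c (t\<lparr>tk := tk t + 1\<rparr>) u" "I u" "m u < m t"
        using assms(3)[OF less.prems True] unfolding wp_def by blast
      have "frame c s u" using bs_frame[OF u(1)] less.prems(2) by (auto simp: frame_def)
      then show ?thesis using less.hyps[of u] u True assms(2)[OF less.prems]
        unfolding wp_def by (blast intro: bs.LoopT)
    next
      case False
      then show ?thesis using assms(2,4)[OF less.prems]
        unfolding wp_def by (blast intro: bs.LoopF)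
    qed
  qed
  then show ?thesis using assms(1) by (simp add: frame_def)
qed

lemma wp_For:
  assumes "P 0 (s\<lparr>vr := (vr s)(x := 0)\<rparr>)"
    and "\<And>k t. 0 \<le> k \<Longrightarrow> k < vr s y \<Longrightarrow> P k t \<Longrightarrow> vr t x = k \<Longrightarrow> frame (For x y c) s t \<Longrightarrow>
           wp c (\<lambda>t'. P (k + 1) (t'\<lparr>vr := (vr t')(x := k + 1)\<rparr>)) (t\<lparr>tk := tk t + 1\<rparr>)"
    and "\<And>t. P (vr s y) t \<Longrightarrow> vr t x = vr s y \<Longrightarrow> frame (For x y c) s t \<Longrightarrow> Q t"
    and "x \<noteq> y" "x < 99" "y < 99" "x \<notin> modv c" "y \<notin> modv c" "0 \<le> vr s y" "vr s y \<le> 50 * sz"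
  shows "wp (For x y c) Q s"
proof -
  let ?s = "s\<lparr>vr := (vr s)(x := 0)\<rparr>"
  have fr: "frame (For x y c) s t" if "frame (c ;; x ::= V x .+ N 1) ?s t" for t
    using that by (auto simp: frame_def)
  have "wp (Loop (Lt (V x) (V y)) (c ;; x ::= V x .+ N 1)) Q ?s"
  proof (rule wp_Loop[where I = "\<lambda>t. 0 \<le> vr t x \<and> vr t x \<le> vr s y \<and> P (vr t x) t"
        and m = "\<lambda>t. nat (vr s y - vr t x)"], goal_cases)
    case 1
    then show ?case using assms by auto
  next
    case (2 t)
    then show ?case using assms by auto
  next
    case (3 t)
    have y: "vr t y = vr s y" using frameD(1)[OF 3(2), of y] assms by auto
    then have lt: "vr t x < vr s y" using 3(3) by simp
    have "wp c (\<lambda>t'. P (vr t x + 1) (t'\<lparr>vr := (vr t')(x := vr t x + 1)\<rparr>)) (t\<lparr>tk := tk t + 1\<rparr>)"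
      using assms(2)[OF _ lt _ refl fr[OF 3(2)]] 3 by auto
    then show ?case unfolding wp_simps(4)
    proof (rule wp_conseq)
      fix u assume u: "P (vr t x + 1) (u\<lparr>vr := (vr u)(x := vr t x + 1)\<rparr>)"
        "frame c (t\<lparr>tk := tk t + 1\<rparr>) u"
      have "vr u x = vr t x" using frameD(1)[OF u(2), of x] assms by auto
      moreover have "fits (vr t x + 1)" using lt 3 assms sz_pos by (intro fits_small) auto
      moreover have "fits 1" using sz_pos by (intro fits_small) auto
      ultimately show "wp (x ::= V x .+ N 1) (\<lambda>t'. (0 \<le> vr t' x \<and> vr t' x \<le> vr s y \<and>
          P (vr t' x) t') \<and> nat (vr s y - vr t' x) < nat (vr s y - vr t x)) u"
        using u 3 lt assms by (auto simp: wp_simps)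
    qed
  next
    case (4 t)
    have y: "vr t y = vr s y" using frameD(1)[OF 4(2), of y] assms by auto
    then have "vr t x = vr s y" using 4 by simp
    then show ?case using assms(3)[of t] fr 4 by auto
  qed
  then show ?thesis unfolding For_def wp_simps(4) using assms fits_id
    by (auto simp: wp_simps)
qed

end

section \<open>Lists in arrays and bucket sort\<close>

definition lst :: "(int \<Rightarrow> int) \<Rightarrow> int \<Rightarrow> int list" where
  "lst f k = map (\<lambda>i. f (int i)) [0..<nat k]"

lemma length_lst [simp]: "length (lst f k) = nat k"
  by (simp add: lst_def)

lemma nth_lst [simp]: "i < nat k \<Longrightarrow> lst f k ! i = f (int i)"
  by (simp add: lst_def)

lemma set_lst: "set (lst f k) = f ` {0..<k}"
proof -
  have "{0..<k} = int ` {0..<nat k}"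
    by (metis atLeast_upt image_int_atLeastLessThan int_nat_eq less_eq_int_code(1) linorder_le_cases atLeastLessThan_empty of_nat_0 order_refl)
  then show ?thesis by (simp add: lst_def image_image)
qed

lemma lst_0 [simp]: "lst f 0 = []"
  by (simp add: lst_def)

lemma lst_Suc: "0 \<le> k \<Longrightarrow> lst f (k + 1) = lst f k @ [f k]"
  by (simp add: lst_def nat_add_distrib)

lemma lst_upd [simp]: "k \<le> j \<Longrightarrow> lst (f(j := x)) k = lst f k"
  by (auto simp: lst_def)

fun islist :: "(int \<Rightarrow> int) \<Rightarrow> int \<Rightarrow> int list \<Rightarrow> bool" where
  "islist nx k [] \<longleftrightarrow> k = -1"
| "islist nx k (x # xs) \<longleftrightarrow> k = x \<and> islist nx (nx x) xs"

lemma islist_upd: "x \<notin> set xs \<Longrightarrow> islist (f(x := y)) k xs \<longleftrightarrow> islist f k xs"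
  by (induction xs arbitrary: k) auto

text \<open>Array 16 holds the heads of the buckets and array 17 the successors. The list is read
  from its end because insertion at the head of a bucket reverses the order; so the sort is stable,
  which the two-pass ordering in \<open>CLASSORD\<close> relies on.\<close>

definition SORT :: "nat \<Rightarrow> nat \<Rightarrow> nat \<Rightarrow> nat \<Rightarrow> com" where
  "SORT L l K R =
    (For 30 R (Sto 16 (V 30) (N (-1))) ;;
     For 30 l (33 ::= A L (V l .- N 1 .- V 30) ;; Sto 17 (V 33) (A 16 (A K (V 33))) ;;
               Sto 16 (A K (V 33)) (V 33)) ;;
     31 ::= N 0 ;;
     For 30 R (33 ::= A 16 (V 30) ;;
       Loop (Lt (N (-1)) (V 33)) (Sto L (V 31) (V 33) ;; 31 ::= V 31 .+ N 1 ;; 33 ::= A 17 (V 33))))"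

lemma mod_SORT [simp]: "modv (SORT L l K R) = {30, 31, 33}" "moda (SORT L l K R) = {L, 16, 17}"
  by (auto simp: SORT_def)

lemma mset_concat_filter:
  fixes f :: "'a \<Rightarrow> nat"
  assumes "\<forall>x\<in>set xs. f x < n"
  shows "mset (concat (map (\<lambda>v. filter (\<lambda>x. f x = v) xs) [0..<n])) = mset xs"
  using assms
proof (induction n arbitrary: xs)
  case (Suc n)
  let ?ys = "filter (\<lambda>x. f x < n) xs"
  have e: "filter (\<lambda>x. f x = v) ?ys = filter (\<lambda>x. f x = v) xs" if "v < n" for v
    using that by (auto intro!: filter_cong)
  have "map (\<lambda>v. filter (\<lambda>x. f x = v) xs) [0..<n] = map (\<lambda>v. filter (\<lambda>x. f x = v) ?ys) [0..<n]"
    using e by (intro map_cong) auto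
  moreover have "mset (concat (map (\<lambda>v. filter (\<lambda>x. f x = v) ?ys) [0..<n])) = mset ?ys"
    by (rule Suc.IH) simp
  ultimately have "mset (concat (map (\<lambda>v. filter (\<lambda>x. f x = v) xs) [0..<n])) = mset ?ys"
    by (simp only:)
  then have "mset (concat (map (\<lambda>v. filter (\<lambda>x. f x = v) xs) [0..<Suc n])) =
      mset ?ys + mset (filter (\<lambda>x. f x = n) xs)"
    by simp
  also have "filter (\<lambda>x. f x = n) xs = filter (\<lambda>x. \<not> f x < n) xs"
    using Suc.prems by (intro filter_cong) auto
  finally show ?case by (metis mset_filter multiset_partition)
qed simp

lemma filter_concat_buckets:
  fixes f :: "'a \<Rightarrow> nat"
  assumes "k < n"
  shows "filter (\<lambda>x. f x = k) (concat (map (\<lambda>v. filter (\<lambda>x. f x = v) xs) [0..<n])) =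
    filter (\<lambda>x. f x = k) xs"
  using assms
proof (induction n)
  case (Suc n)
  show ?case
  proof (cases "k = n")
    case True
    have "filter (\<lambda>x. f x = k) (concat (map (\<lambda>v. filter (\<lambda>x. f x = v) xs) [0..<n])) = []"
      using True by (auto simp: filter_empty_conv)
    then show ?thesis using True by simp
  next
    case False
    have "filter (\<lambda>x. f x = k) (filter (\<lambda>x. f x = n) xs) = []"
      using False by (auto simp: filter_empty_conv)
    then show ?thesis using Suc False by simp
  qed
qed simp

lemma concat_buckets_sort_key:
  fixes f :: "'a \<Rightarrow> nat"
  assumes "\<forall>x\<in>set xs. f x < n"
  shows "concat (map (\<lambda>v. filter (\<lambda>x. f x = v) xs) [0..<n]) = sort_key f xs"
proof (rule properties_for_sort_key[symmetric])
  show "mset (concat (map (\<lambda>v. filter (\<lambda>x. f x = v) xs) [0..<n])) = mset xs"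
    by (rule mset_concat_filter[OF assms])
  fix k assume "k \<in> set (concat (map (\<lambda>v. filter (\<lambda>x. f x = v) xs) [0..<n]))"
  then have "f k < n" using assms by auto
  then show "filter (\<lambda>x. f k = f x) (concat (map (\<lambda>v. filter (\<lambda>x. f x = v) xs) [0..<n])) =
    filter (\<lambda>x. f k = f x) xs"
    using filter_concat_buckets[of "f k" n f xs] unfolding eq_commute[of "f k"] by blast
next
  show "sorted (map f (concat (map (\<lambda>v. filter (\<lambda>x. f x = v) xs) [0..<n])))"
  proof (induction n)
    case (Suc n)
    have "sorted (map f (filter (\<lambda>x. f x = n) xs))"
      using sorted_replicate by (induction xs) auto
    then show ?case using Suc by (auto simp: sorted_append)
  qed simp
qed

lemma sort_key_int:
  fixes f :: "'a \<Rightarrow> int"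
  assumes "\<forall>x\<in>set xs. 0 \<le> f x \<and> f x < n"
  shows "concat (map (\<lambda>v. filter (\<lambda>x. f x = int v) xs) [0..<nat n]) = sort_key f xs"
proof -
  have "sort_key (nat \<circ> f) xs = sort_key f xs"
  proof (rule properties_for_sort_key)
    fix k assume "k \<in> set (sort_key f xs)"
    then have k: "0 \<le> f k" using assms by auto
    have "filter (\<lambda>x. (nat \<circ> f) k = (nat \<circ> f) x) (sort_key f xs) =
        filter (\<lambda>x. f x = f k) (sort_key f xs)"
      using k assms by (intro filter_cong) auto
    also have "\<dots> = filter (\<lambda>x. f x = f k) xs" by (rule sort_key_stable)
    also have "\<dots> = filter (\<lambda>x. (nat \<circ> f) k = (nat \<circ> f) x) xs"
      using k assms by (intro filter_cong) auto
    finally show "filter (\<lambda>x. (nat \<circ> f) k = (nat \<circ> f) x) (sort_key f xs) =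
      filter (\<lambda>x. (nat \<circ> f) k = (nat \<circ> f) x) xs" .
  next
    have "sorted (map nat (map f (sort_key f xs)))"
      using sorted_sort_key[of f xs] by (auto simp: sorted_iff_nth_mono intro!: nat_mono)
    then show "sorted (map (nat \<circ> f) (sort_key f xs))" by simp
  qed simp
  moreover have "concat (map (\<lambda>v. filter (\<lambda>x. (nat \<circ> f) x = v) xs) [0..<nat n]) =
      sort_key (nat \<circ> f) xs"
    using assms by (intro concat_buckets_sort_key) auto
  moreover have "map (\<lambda>v. filter (\<lambda>x. (nat \<circ> f) x = v) xs) [0..<nat n] =
      map (\<lambda>v. filter (\<lambda>x. f x = int v) xs) [0..<nat n]"
    using assms by (intro map_cong filter_cong) auto
  ultimately show ?thesis by (simp only:)
qed

context ram
begin

lemma wp_SORT: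
  assumes L: "L < 50" "L \<noteq> 16" "L \<noteq> 17" and K: "K < 50" "K \<noteq> L" "K \<noteq> 16" "K \<noteq> 17"
    and l: "l < 30" "R < 30" and b: "0 \<le> vr s l" "vr s l \<le> sz" "0 \<le> vr s R" "vr s R \<le> sz"
    and xs: "xs = lst (ar s L) (vr s l)" "distinct xs"
      "\<forall>x\<in>set xs. 0 \<le> x \<and> x < sz \<and> 0 \<le> ar s K x \<and> ar s K x < vr s R"
    and Q: "\<And>t. lst (ar t L) (vr s l) = sort_key (ar s K) xs \<Longrightarrow>
      int (tk t) = int (tk s) + 2 * (vr s l + vr s R) \<Longrightarrow> frame (SORT L l K R) s t \<Longrightarrow> Q t"
  shows "wp (SORT L l K R) Q s"
proof -
  define key where "key = ar s K"
  define len where "len = vr s l"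
  define r where "r = vr s R"
  define bk where "bk = (\<lambda>v. filter (\<lambda>x. key x = int v) xs)"
  have lxs: "length xs = nat len" using xs by (simp add: len_def)
  have fl: "\<forall>x. vr x = vr s \<longrightarrow> vr x l = len" by (simp add: len_def)
  have srt: "concat (map bk [0..<nat r]) = sort_key key xs"
    unfolding bk_def using xs by (intro sort_key_int) (auto simp: key_def r_def)
  \<comment> \<open>This bounds the writing position inside a bucket: stores stay in range, and the
    measure \<open>len - vr x 31\<close> of the inner loop decreases.\<close>
  have bkl: "length (concat (map bk [0..<k])) + length (bk k) \<le> nat len" if "k < nat r" for k
  proof -
    have "[0..<nat r] = [0..<k] @ k # [Suc k..<nat r]"
      using that by (metis append_Cons append_Nil upt_conv_Cons le0 less_imp_le upt_add_eq_append le_add_diff_inverse)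
    then have "length (concat (map bk [0..<k])) + length (bk k) \<le> length (concat (map bk [0..<nat r]))"
      by simp
    then show ?thesis unfolding srt by (simp add: lxs)
  qed
  have m1: "wp (SORT L l K R) (\<lambda>t. lst (ar t L) len = sort_key key xs \<and>
      int (tk t) = int (tk s) + 2 * (len + r)) s"
    unfolding SORT_def wp_simps(4)
  proof (rule wp_For[where P = "\<lambda>k t. (\<forall>v. 0 \<le> v \<and> v < k \<longrightarrow> ar t 16 v = -1) \<and>
        int (tk t) = int (tk s) + k"], goal_cases)
    case (2 k t)
    then show ?case using b by (auto simp: wp_simps intro!: fits_small)
  next
    case (3 t)
    note ht = 3
    have fr1: "vr t l = len" "vr t R = r" "ar t L = ar s L" "ar t K = key"
      using frameD[OF 3(3)] L K l by (auto simp: len_def r_def key_def)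
    show ?case
    proof (rule wp_For[where P = "\<lambda>k u. (\<forall>v. 0 \<le> v \<and> v < r \<longrightarrow> islist (ar u 17) (ar u 16 v)
          (filter (\<lambda>x. key x = v) (drop (nat (len - k)) xs))) \<and> int (tk u) = int (tk s) + r + k"], goal_cases)
      case 1
      then show ?case using ht lxs by (auto simp: r_def)
    next
      case (2 k u)
      have fr: "vr u l = len" "vr u R = r" "ar u L = ar s L" "ar u K = key"
        using frameD[OF 2(5)] fr1 L K l by auto
      have k: "0 \<le> k" "k < len" "vr u 30 = k" using 2 fr1 by auto
      define j where "j = nat (len - 1 - k)"
      have jl: "j < length xs" "nat (len - k) = Suc j" "int j = len - 1 - k"
        using k lxs by (auto simp: j_def)
      define x where "x = xs ! j"
      have dr: "drop j xs = x # drop (nat (len - k)) xs"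
        unfolding jl(2) x_def using jl(1) by (simp add: Cons_nth_drop_Suc)
      have x: "ar s L (len - 1 - k) = x" using jl k by (simp add: x_def xs(1) len_def lxs)
      have xin: "0 \<le> x" "x < sz" "0 \<le> key x" "key x < r"
        using xs(3) jl(1) unfolding x_def key_def r_def by auto
      have xd: "x \<notin> set (drop (nat (len - k)) xs)"
        using xs(2) dr by (metis distinct.simps(2) distinct_drop)
      have dk: "drop (nat (len - (k + 1))) xs = x # drop (nat (len - k)) xs"
        using dr by (simp add: j_def algebra_simps)
      have xf: "x \<notin> set (filter P (drop (nat (len - k)) xs))" for P using xd by auto
      show ?case
        using k b xin fr 2(3) L K l
        unfolding dk
        by (auto simp: wp_simps len_def[symmetric] r_def[symmetric] x
            islist_upd[OF xf] intro!: fits_small)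
    next
      case (3 u)
      have fr: "vr u l = len" "vr u R = r"
        using frameD[OF 3(3)] fr1 L K l by auto
      have h: "\<forall>v. 0 \<le> v \<and> v < r \<longrightarrow> islist (ar u 17) (ar u 16 v) (filter (\<lambda>x. key x = v) xs)"
        "int (tk u) = int (tk s) + r + len" using 3(1) fr1 by auto
      let ?u = "u\<lparr>vr := (vr u)(31 := 0)\<rparr>"
      have "wp (For 30 R (33 ::= A 16 (V 30) ;;
       Loop (Lt (N (-1)) (V 33)) (Sto L (V 31) (V 33) ;; 31 ::= V 31 .+ N 1 ;; 33 ::= A 17 (V 33))))
        (\<lambda>t. lst (ar t L) len = sort_key key xs \<and> int (tk t) = int (tk s) + 2 * (len + r)) ?u"
      proof (rule wp_For[where P = "\<lambda>k v. lst (ar v L) (vr v 31) = concat (map bk [0..<nat k]) \<and>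
          0 \<le> vr v 31 \<and> int (tk v) = int (tk u) + k + vr v 31"], goal_cases)
        case (2 k v)
        have fr': "ar v 17 = ar u 17" "ar v 16 = ar u 16"
          using frameD[OF 2(5)] L by auto
        have k: "0 \<le> k" "k < r" "vr v 30 = k" "nat k < nat r" using 2 fr l by auto
        let ?v = "v\<lparr>tk := tk v + 1, vr := (vr v)(33 := ar u 16 k)\<rparr>"
        have "wp (Loop (Lt (N (-1)) (V 33)) (Sto L (V 31) (V 33) ;; 31 ::= V 31 .+ N 1 ;; 33 ::= A 17 (V 33)))
          (\<lambda>t'. lst (ar t' L) (vr t' 31) = concat (map bk [0..<nat (k + 1)]) \<and>
             0 \<le> vr t' 31 \<and> int (tk t') = int (tk u) + (k + 1) + vr t' 31) ?v"
        \<comment> \<open>\<open>ys\<close> is the part of the bucket that has been written back,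
          \<open>zs\<close> the part that still hangs on the linked list.\<close>
        proof (rule wp_Loop[where I = "\<lambda>x. \<exists>ys zs. bk (nat k) = ys @ zs \<and>
              islist (ar u 17) (vr x 33) zs \<and> lst (ar x L) (vr x 31) = concat (map bk [0..<nat k]) @ ys \<and>
              0 \<le> vr x 31 \<and> int (tk x) = int (tk u) + (k + 1) + vr x 31"
              and m = "\<lambda>x. nat (len - vr x 31)"], goal_cases)
          case 1
          have "islist (ar u 17) (ar u 16 k) (bk (nat k))" using h(1) k by (simp add: bk_def)
          then show ?case using 2(3) by (intro exI[of _ "[]"] exI[of _ "bk (nat k)"]) auto
        next
          case (2 x)
          then show ?case by (auto intro!: fits_small) (use sz_pos in linarith)
        next
          case (3 x)
          then obtain ys zs where z: "bk (nat k) = ys @ zs" "islist (ar u 17) (vr x 33) zs"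
            "lst (ar x L) (vr x 31) = concat (map bk [0..<nat k]) @ ys"
            "0 \<le> vr x 31" "int (tk x) = int (tk u) + (k + 1) + vr x 31" by auto
          have a17: "ar x 17 = ar u 17" using frameD(2)[OF 3(2), of 17] L fr' by auto
          from z(2) 3(3) obtain y zs' where y: "zs = y # zs'" "vr x 33 = y" "islist (ar u 17) (ar u 17 y) zs'"
            by (cases zs) auto
          have "y \<in> set (bk (nat k))" using z y by simp
          then have yin: "0 \<le> y" "y < sz" using xs(3) unfolding bk_def by auto
          have "length (lst (ar x L) (vr x 31)) + length zs \<le> nat len"
            using z bkl[OF k(4)] by simp
          then have lt: "vr x 31 < len" using y by simp
          have l1: "lst ((ar x L)(vr x 31 := y)) (vr x 31 + 1) = lst (ar x L) (vr x 31) @ [y]"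
            using z(4) by (simp add: lst_Suc)
          show ?case using z y yin lt a17 L b len_def
            apply (simp add: wp_simps l1)
            apply (intro conjI fits_small exI[of _ "ys @ [y]"] exI[of _ zs'])
            using sz_pos by auto
        next
          case (4 x)
          then obtain ys zs where z: "bk (nat k) = ys @ zs" "islist (ar u 17) (vr x 33) zs"
            "lst (ar x L) (vr x 31) = concat (map bk [0..<nat k]) @ ys"
            "0 \<le> vr x 31" "int (tk x) = int (tk u) + (k + 1) + vr x 31" by auto
          have "zs = []"
          proof (cases zs)
            case (Cons y zs')
            then have "y \<in> set (bk (nat k))" "vr x 33 = y" using z by auto
            then have "0 \<le> y" using xs(3) unfolding bk_def by auto
            then show ?thesis using 4(3) \<open>vr x 33 = y\<close> by simp
          qed
          moreover have "nat (k + 1) = Suc (nat k)" using k by simp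
          ultimately show ?case using z by auto
        qed
        then show ?case using k fr' b r_def by (simp add: wp_simps)
      next
        case (3 v)
        then have "lst (ar v L) (vr v 31) = sort_key key xs" "int (tk v) = int (tk u) + r + vr v 31"
          "0 \<le> vr v 31"
          using fr l srt by auto
        moreover from this have "nat (vr v 31) = nat len" by (metis length_lst length_sort lxs)
        ultimately have "vr v 31 = len" using b len_def by auto
        then show ?case using \<open>lst (ar v L) (vr v 31) = _\<close> \<open>int (tk v) = _\<close> h by simp
      qed (use fr l b in \<open>auto simp: len_def r_def\<close>)
      then show ?case using fits_id by (simp add: wp_simps)
    qed (use fr1 l b in \<open>auto simp: len_def r_def\<close>)
  qed (use l b in auto)
  show ?thesis using m1 by (rule wp_conseq) (use Q len_def r_def key_def in auto)
qed

end

section \<open>Copying, scaling, and ordering by multiplicity\<close>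

definition COPY :: "nat \<Rightarrow> nat \<Rightarrow> nat \<Rightarrow> nat \<Rightarrow> com" where
  "COPY D S off l = For 30 l (Sto D (V 30) (A S (V off .+ V 30)))"

lemma mod_COPY [simp]: "modv (COPY D S off l) = {30}" "moda (COPY D S off l) = {D}"
  by (auto simp: COPY_def)

definition SCALE :: "nat \<Rightarrow> nat \<Rightarrow> nat \<Rightarrow> com" where
  "SCALE L l c = For 30 l (33 ::= A L (V 30) ;; Sto 5 (V 33) ((A 5 (V 33) .* V c) .mod V 4))"

lemma mod_SCALE [simp]: "modv (SCALE L l c) = {30, 33}" "moda (SCALE L l c) = {5}"
  by (auto simp: SCALE_def)

text \<open>The key in array 19 is an upper bound minus the multiplicity, which turns decreasing
  multiplicity into increasing order. The preceding sort by value, with stability, keeps equal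
  values together among classes of equal size. Array 19 is kept because class sizes are read from it
  later.\<close>

definition CLASSORD :: "nat \<Rightarrow> nat \<Rightarrow> com" where
  "CLASSORD L l =
    (SORT L l 5 4 ;;
     For 30 4 (Sto 18 (V 30) (N 0)) ;;
     For 30 l (33 ::= A 5 (A L (V 30)) ;; Sto 18 (V 33) (A 18 (V 33) .+ N 1)) ;;
     For 30 l (33 ::= A L (V 30) ;; Sto 19 (V 33) (V 10 .- A 18 (A 5 (V 33)))) ;;
     SORT L l 19 10 ;;
     17 ::= V 10 .- A 19 (A L (N 0)))"

lemma mod_CLASSORD [simp]:
  "modv (CLASSORD L l) = {17, 30, 31, 33}" "moda (CLASSORD L l) = {L, 16, 17, 18, 19}"
  by (auto simp: CLASSORD_def)

section \<open>Multiplicities and the order by class size\<close>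

definition cnt :: "('a \<Rightarrow> int) \<Rightarrow> 'a list \<Rightarrow> int \<Rightarrow> nat" where
  "cnt f xs v = length (filter (\<lambda>x. f x = v) xs)"

lemma cnt_mset: "mset xs = mset ys \<Longrightarrow> cnt f xs v = cnt f ys v"
  unfolding cnt_def by (metis mset_filter size_mset)

lemma cnt_le: "cnt f xs v \<le> length xs"
  by (simp add: cnt_def)

lemma cnt_pos: "x \<in> set xs \<Longrightarrow> 0 < cnt f xs (f x)"
  by (auto simp: cnt_def filter_empty_conv)

lemma cnt_card: "cnt f xs v = card {i. i < length xs \<and> f (xs ! i) = v}"
  by (simp add: cnt_def length_filter_conv_card)

definition classord :: "('a \<Rightarrow> int) \<Rightarrow> 'a list \<Rightarrow> bool" where
  "classord f ys \<longleftrightarrow>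
    (\<forall>i j. i < j \<longrightarrow> j < length ys \<longrightarrow> cnt f ys (f (ys ! j)) \<le> cnt f ys (f (ys ! i))) \<and>
    (\<forall>i j k. i < j \<longrightarrow> j < k \<longrightarrow> k < length ys \<longrightarrow> f (ys ! i) = f (ys ! k) \<longrightarrow> f (ys ! j) = f (ys ! i))"

lemma convex_nat_set:
  fixes J :: "nat set"
  assumes "finite J" "i \<in> J" "\<forall>j\<in>J. i \<le> j" "\<And>j k. k \<in> J \<Longrightarrow> i < j \<Longrightarrow> j < k \<Longrightarrow> j \<in> J"
  shows "J = {i..<i + card J}"
proof -
  define M where "M = Max J"
  have M: "M \<in> J" "\<forall>j\<in>J. j \<le> M"     using Max_in[of J] Max_ge[of J] assms(1,2) unfolding M_def by blast+
  have "J = {i..M}"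
  proof
    show "{i..M} \<subseteq> J"
    proof
      fix j assume "j \<in> {i..M}"
      then show "j \<in> J" using assms(2) assms(4)[of M j] M(1) by (cases "j = i"; cases "j = M") auto
    qed
  qed (use assms M in auto)
  moreover from this have "card J = M + 1 - i" by simp
  moreover have "i \<le> M" using M assms(2) by blast
  ultimately show ?thesis by auto
qed

text \<open>Contiguity of the classes makes a class an interval. From a position where a class
  begins, adding its multiplicity leads to the next such position.\<close>

lemma classord_block:
  assumes "classord f ys" "i < length ys" "i = 0 \<or> f (ys ! (i - 1)) \<noteq> f (ys ! i)"
  shows "{j. j < length ys \<and> f (ys ! j) = f (ys ! i)} = {i..<i + cnt f ys (f (ys ! i))}"
  unfolding cnt_card
proof (rule convex_nat_set)
  show "\<forall>j\<in>{j. j < length ys \<and> f (ys ! j) = f (ys ! i)}. i \<le> j"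
  proof (intro ballI)
    fix j assume j: "j \<in> {j. j < length ys \<and> f (ys ! j) = f (ys ! i)}"
    show "i \<le> j"
    proof (rule ccontr)
      assume "\<not> i \<le> j"
      then have "j < i" by simp
      then have ne: "f (ys ! (i - 1)) \<noteq> f (ys ! i)" using assms by auto
      then have "j < i - 1" "i - 1 < i" using j \<open>j < i\<close> by (cases "j = i - 1"; auto)+
      then show False using assms(1,2) j ne unfolding classord_def by auto
    qed
  qed
next
  fix j k assume h: "k \<in> {j. j < length ys \<and> f (ys ! j) = f (ys ! i)}" "i < j" "j < k"
  then have "f (ys ! j) = f (ys ! i)"
    using assms(1) unfolding classord_def by auto
  then show "j \<in> {j. j < length ys \<and> f (ys ! j) = f (ys ! i)}" using h by auto
qed (use assms in auto)

lemma sort_key_cong: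
  fixes f g :: "'a \<Rightarrow> int"
  assumes "\<forall>x\<in>set xs. f x = g x"
  shows "sort_key f xs = sort_key g xs"
proof (rule properties_for_sort_key)
  fix k assume k: "k \<in> set (sort_key g xs)"
  have "filter (\<lambda>x. f k = f x) (sort_key g xs) = filter (\<lambda>x. g x = g k) (sort_key g xs)"
    using assms k by (intro filter_cong) auto
  also have "\<dots> = filter (\<lambda>x. g x = g k) xs" by (rule sort_key_stable)
  also have "\<dots> = filter (\<lambda>x. f k = f x) xs" using assms k by (intro filter_cong) auto
  finally show "filter (\<lambda>x. f k = f x) (sort_key g xs) = filter (\<lambda>x. f k = f x) xs" .
next
  have "map f (sort_key g xs) = map g (sort_key g xs)" using assms by auto
  then show "sorted (map f (sort_key g xs))" using sorted_sort_key[of g xs] by (simp only:)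
qed simp

lemma sorted_wrt_filter_iff:
  "sorted_wrt R (filter P xs) \<longleftrightarrow> sorted_wrt (\<lambda>x y. P x \<longrightarrow> P y \<longrightarrow> R x y) xs"
  by (induction xs) auto

text \<open>Stability of the outer sort: restricted to one value of \<open>g\<close>, the list is a
  filtered copy of the inner list, which is sorted by \<open>f\<close>.\<close>

lemma stable_lex:
  fixes f g :: "'a \<Rightarrow> int"
  assumes "ys = sort_key g (sort_key f xs)" "i < j" "j < length ys" "g (ys ! i) = g (ys ! j)"
  shows "f (ys ! i) \<le> f (ys ! j)"
proof -
  have "filter (\<lambda>x. g x = g (ys ! i)) ys = filter (\<lambda>x. g x = g (ys ! i)) (sort_key f xs)"
    unfolding assms(1) by (rule sort_key_stable)
  also have "sorted_wrt (\<lambda>x y. f x \<le> f y) \<dots>"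
    using sorted_sort_key[of f xs] by (auto simp: sorted_map intro: sorted_wrt_filter)
  finally show ?thesis using assms unfolding sorted_wrt_filter_iff
    by (auto simp: sorted_wrt_iff_nth_less)
qed

text \<open>For contiguity, let the values at \<open>i\<close> and \<open>k\<close> agree and
  \<open>j\<close> lie between. Their keys agree, so the key at \<open>j\<close> is squeezed between
  them; on equal keys the inner order by \<open>f\<close> then squeezes the value at
  \<open>j\<close> as well.\<close>

lemma classord_sort:
  assumes "ys = sort_key (\<lambda>x. c - int (cnt f xs (f x))) (sort_key f xs)"
  shows "classord f ys"
proof -
  have ms: "mset ys = mset xs" using assms by simp
  let ?g = "\<lambda>x. c - int (cnt f xs (f x))"
  have so: "?g (ys ! i) \<le> ?g (ys ! j)" if "i \<le> j" "j < length ys" for i j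
  proof -
    have "sorted (map ?g ys)" unfolding assms by (rule sorted_sort_key)
    from sorted_nth_mono[OF this, of i j] that show ?thesis by simp
  qed
  show ?thesis unfolding classord_def cnt_mset[OF ms]
  proof (intro conjI allI impI)
    fix i j assume "i < j" "j < length ys"
    then show "cnt f xs (f (ys ! j)) \<le> cnt f xs (f (ys ! i))" using so[of i j] by simp
  next
    fix i j k assume h: "i < j" "j < k" "k < length ys" "f (ys ! i) = f (ys ! k)"
    have "?g (ys ! i) = ?g (ys ! j)" "?g (ys ! j) = ?g (ys ! k)"
      using so[of i j] so[of j k] h by auto
    then have "f (ys ! i) \<le> f (ys ! j)" "f (ys ! j) \<le> f (ys ! k)"
      using stable_lex[OF assms, of i j] stable_lex[OF assms, of j k] h by auto
    then show "f (ys ! j) = f (ys ! i)" using h by simp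
  qed
qed

context ram
begin

lemma fits_1 [simp]: "fits 1" "fits 0" "fits (-1)" "fits (-2)" "fits 2"
  using sz_pos by (auto intro!: fits_small)

lemma wp_COPY:
  assumes "D < 50" "S < 50" "D \<noteq> S" "off < 30" "l < 30"
    "0 \<le> vr s off" "0 \<le> vr s l" "vr s off + vr s l \<le> sz"
    and Q: "\<And>t. (\<forall>i. 0 \<le> i \<and> i < vr s l \<longrightarrow> ar t D i = ar s S (vr s off + i)) \<Longrightarrow>
      int (tk t) = int (tk s) + vr s l \<Longrightarrow> frame (COPY D S off l) s t \<Longrightarrow> Q t"
  shows "wp (COPY D S off l) Q s"
  unfolding COPY_def
proof (rule wp_For[where P = "\<lambda>k t. (\<forall>i. 0 \<le> i \<and> i < k \<longrightarrow> ar t D i = ar s S (vr s off + i)) \<and>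
    int (tk t) = int (tk s) + k"], goal_cases)
  case (2 k t)
  have "vr t off = vr s off" "ar t S = ar s S" using frameD[OF 2(5)] assms by auto
  then show ?case using 2 assms by (auto simp: wp_simps intro!: fits_small)
next
  case (3 t)
  then show ?case using Q by (auto simp: COPY_def)
qed (use assms in auto)

text \<open>The scaling is done in place, so an index listed twice would be multiplied twice; hence
  \<open>distinct xs\<close>.\<close>

lemma wp_SCALE:
  assumes "L < 50" "L \<noteq> 5" "l < 30" "c < 30" "0 \<le> vr s l" "vr s l \<le> sz"
    "xs = lst (ar s L) (vr s l)" "distinct xs" "0 < vr s 4" "vr s 4 \<le> sz" "0 \<le> vr s c" "vr s c \<le> vr s 4"
    "\<forall>x\<in>set xs. 0 \<le> x \<and> x < sz \<and> 0 \<le> ar s 5 x \<and> ar s 5 x < vr s 4"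
    and Q: "\<And>t. ar t 5 = (\<lambda>x. if x \<in> set xs then ar s 5 x * vr s c mod vr s 4 else ar s 5 x) \<Longrightarrow>
      int (tk t) = int (tk s) + vr s l \<Longrightarrow> frame (SCALE L l c) s t \<Longrightarrow> Q t"
  shows "wp (SCALE L l c) Q s"
  unfolding SCALE_def
proof (rule wp_For[where P = "\<lambda>k t. ar t 5 = (\<lambda>x. if x \<in> set (take (nat k) xs)
      then ar s 5 x * vr s c mod vr s 4 else ar s 5 x) \<and> int (tk t) = int (tk s) + k"], goal_cases)
  case (2 k t)
  have fr: "vr t c = vr s c" "vr t 4 = vr s 4" "ar t L = ar s L" using frameD[OF 2(5)] assms by auto
  define x where "x = ar s L k"
  have xk: "nat k < length xs" "xs ! nat k = x" using 2 assms by (auto simp: x_def)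
  then have x: "0 \<le> x" "x < sz" "0 \<le> ar s 5 x" "ar s 5 x < vr s 4"
    using assms(13) nth_mem by metis+
  have tk': "take (nat (k + 1)) xs = take (nat k) xs @ [x]"
    using xk 2 by (simp add: nat_add_distrib take_Suc_conv_app_nth)
  have nx: "x \<notin> set (take (nat k) xs)"
    using distinct_take[OF \<open>distinct xs\<close>, of "nat (k + 1)"] unfolding tk' by simp
  have "fits (ar s 5 x * vr s c)"
    using x assms by (intro fits_prod) auto
  moreover have "fits (ar s 5 x * vr s c mod vr s 4)"
    using pos_mod_bound[of "vr s 4" "ar s 5 x * vr s c"] pos_mod_sign[of "vr s 4" "ar s 5 x * vr s c"]
    using assms(9,10) by (intro fits_small) linarith
  ultimately
  show ?case using 2(1-4) assms(1-6,9,10) x fr nx unfolding tk'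
    by (auto simp: wp_simps x_def[symmetric] fun_eq_iff)
next
  case (3 t)
  then show ?case using Q assms by (auto simp: SCALE_def)
qed (use assms in auto)

lemma wp_CLASSORD:
  assumes L: "L < 50" "L \<notin> {5, 16, 17, 18, 19}" and l: "l < 30" "l \<noteq> 17"
    and b: "1 \<le> vr s l" "vr s l \<le> vr s 10" "vr s 10 \<le> sz" "0 < vr s 4" "vr s 4 \<le> vr s 10"
    and xs: "xs = lst (ar s L) (vr s l)" "distinct xs"
      "\<forall>x\<in>set xs. 0 \<le> x \<and> x < sz \<and> 0 \<le> ar s 5 x \<and> ar s 5 x < vr s 4"
    and Q: "\<And>t ys. ys = lst (ar t L) (vr s l) \<Longrightarrow> mset ys = mset xs \<Longrightarrow> classord (ar s 5) ys \<Longrightarrow>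
      \<forall>x\<in>set xs. ar t 19 x = vr s 10 - int (cnt (ar s 5) xs (ar s 5 x)) \<Longrightarrow>
      vr t 17 = int (cnt (ar s 5) xs (ar s 5 (ys ! 0))) \<Longrightarrow>
      int (tk t) \<le> int (tk s) + 11 * vr s 10 \<Longrightarrow> frame (CLASSORD L l) s t \<Longrightarrow> Q t"
  shows "wp (CLASSORD L l) Q s"
proof -
  define f where "f = ar s 5"
  define p where "p = vr s 4"
  define n where "n = vr s l"
  define c where "c = vr s 10"
  note b' = b[folded p_def n_def c_def]
  define zs where "zs = sort_key f xs"
  define g where "g = (\<lambda>x. c - int (cnt f xs (f x)))"
  have zm: "mset zs = mset xs" "set zs = set xs" "distinct zs" "length zs = nat n"
    using xs by (auto simp: zs_def n_def)
  have zx: "0 \<le> x \<and> x < sz \<and> 0 \<le> f x \<and> f x < p" if "x \<in> set zs" for x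
    using xs(3) zm that by (auto simp: f_def p_def)
  have cl: "1 \<le> int (cnt f xs (f x)) \<and> int (cnt f xs (f x)) \<le> c" if "x \<in> set zs" for x
    using cnt_pos[of x xs f] that zm cnt_le[of f xs "f x"] b' xs by (auto simp: n_def)
  have "wp (CLASSORD L l) (\<lambda>t. lst (ar t L) n = sort_key g zs \<and> (\<forall>x\<in>set xs. ar t 19 x = g x) \<and>
      vr t 17 = c - g (lst (ar t L) n ! 0) \<and> int (tk t) = int (tk s) + 4 * n + 3 * p + 2 * n + 2 * c) s"
    unfolding CLASSORD_def wp_simps(4)
  proof (rule wp_SORT[where xs = xs])
    fix t assume t: "lst (ar t L) (vr s l) = sort_key (ar s 5) xs"
      "int (tk t) = int (tk s) + 2 * (vr s l + vr s 4)" "frame (SORT L l 5 4) s t"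
    have ft: "vr t l = n" "vr t 4 = p" "vr t 10 = c" "ar t 5 = f" "lst (ar t L) n = zs"
      "int (tk t) = int (tk s) + 2 * (n + p)"
      using frameD[OF t(3)] t(1,2) L l by (auto simp: n_def p_def c_def f_def zs_def)
    have el: "ar t L k \<in> set zs" "ar t L k = zs ! nat k" if "0 \<le> k" "k < n" for k
      using that unfolding ft(5)[symmetric] by (auto simp: set_lst)
    show "wp (For 30 4 (Sto 18 (V 30) (N 0))) (wp (For 30 l (33 ::= A 5 (A L (V 30)) ;; Sto 18 (V 33) (A 18 (V 33) .+ N 1)))
      (wp (For 30 l (33 ::= A L (V 30) ;; Sto 19 (V 33) (V 10 .- A 18 (A 5 (V 33))))) (wp (SORT L l 19 10)
       (wp (17 ::= V 10 .- A 19 (A L (N 0))) (\<lambda>t. lst (ar t L) n = sort_key g zs \<and> (\<forall>x\<in>set xs. ar t 19 x = g x) \<and>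
      vr t 17 = c - g (lst (ar t L) n ! 0) \<and> int (tk t) = int (tk s) + 4 * n + 3 * p + 2 * n + 2 * c))))) t"
    proof (rule wp_For[where P = "\<lambda>k u. (\<forall>v. 0 \<le> v \<and> v < k \<longrightarrow> ar u 18 v = 0) \<and> int (tk u) = int (tk t) + k"], goal_cases)
      case (2 k u)
      then show ?case using ft b' by (auto simp: wp_simps)
    next
      case (3 u)
      have fu: "vr u l = n" "vr u 4 = p" "vr u 10 = c" "ar u 5 = f" "ar u L = ar t L"
        using frameD[OF 3(3)] ft L l by auto
      have u0: "\<forall>v. 0 \<le> v \<and> v < p \<longrightarrow> ar u 18 v = 0" "int (tk u) = int (tk t) + p" using 3 ft by auto
      show ?case
      proof (rule wp_For[where P = "\<lambda>k v. (\<forall>y. 0 \<le> y \<and> y < p \<longrightarrow> ar v 18 y = int (cnt f (take (nat k) zs) y)) \<and>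
          int (tk v) = int (tk u) + k"], goal_cases)
        case 1 then show ?case using u0 by (simp add: cnt_def)
      next
        case (2 k v)
        have fv: "vr v l = n" "vr v 4 = p" "vr v 10 = c" "ar v 5 = f" "ar v L = ar t L"
          using frameD[OF 2(5)] fu L l by auto
        have k: "0 \<le> k" "k < n" "vr v 30 = k" using 2 fu by auto
        define x where "x = ar t L k"
        have x: "x \<in> set zs" "x = zs ! nat k" using el k by (auto simp: x_def)
        have ta: "take (nat (k + 1)) zs = take (nat k) zs @ [x]"
          using x k zm by (simp add: nat_add_distrib take_Suc_conv_app_nth)
        have "fits (int (cnt f (take (nat k) zs) (f x)) + 1)"
          using cnt_le[of f "take (nat k) zs" "f x"] k b' by (intro fits_small) (auto simp: zm)
        then show ?case using k fv zx[OF x(1)] 2(3) b' L unfolding ta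
          by (auto simp: wp_simps x_def[symmetric] cnt_def)
      next
        case (3 v)
        have fv: "vr v l = n" "vr v 4 = p" "vr v 10 = c" "ar v 5 = f" "ar v L = ar t L"
          using frameD[OF 3(3)] fu L l by auto
        have v0: "\<forall>y. 0 \<le> y \<and> y < p \<longrightarrow> ar v 18 y = int (cnt f xs y)" "int (tk v) = int (tk u) + n"
          using 3 fu zm cnt_mset[OF zm(1)] by auto
        show ?case
        proof (rule wp_For[where P = "\<lambda>k x. (\<forall>y\<in>set (take (nat k) zs). ar x 19 y = g y) \<and>
          int (tk x) = int (tk v) + k"], goal_cases)
          case (2 k z)
          have fz: "vr z l = n" "vr z 4 = p" "vr z 10 = c" "ar z 5 = f" "ar z L = ar t L" "ar z 18 = ar v 18"
            using frameD[OF 2(5)] fv L l by auto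
          have k: "0 \<le> k" "k < n" "vr z 30 = k" using 2 fv by auto
          define x where "x = ar t L k"
          have x: "x \<in> set zs" "x = zs ! nat k" using el k by (auto simp: x_def)
          have ta: "take (nat (k + 1)) zs = take (nat k) zs @ [x]"
            using x k zm by (simp add: nat_add_distrib take_Suc_conv_app_nth)
          have "fits (c - int (cnt f xs (f x)))" using cl[OF x(1)] b' by (intro fits_small) auto
          then show ?case using k fz zx[OF x(1)] 2(3) b' L v0 unfolding ta
            by (auto simp: wp_simps x_def[symmetric] g_def)
        next
          case (3 z)
          have fz: "vr z l = n" "vr z 4 = p" "vr z 10 = c" "ar z 5 = f" "ar z L = ar t L"
            using frameD[OF 3(3)] fv L l by auto
          have gz: "\<forall>x\<in>set zs. ar z 19 x = g x" and "int (tk z) = int (tk v) + n"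
            using 3 fv zm by auto
          then have tz: "int (tk z) = int (tk s) + 2 * (n + p) + p + 2 * n"
            using v0 u0 ft by simp
          have sk: "sort_key (ar z 19) zs = sort_key g zs"
            using gz by (intro sort_key_cong) auto 
          show ?case
          proof (rule wp_SORT[where xs = zs])
            fix y assume y: "lst (ar y L) (vr z l) = sort_key (ar z 19) zs"
              "int (tk y) = int (tk z) + 2 * (vr z l + vr z 10)" "frame (SORT L l 19 10) z y"
            have fy: "vr y 10 = c" "ar y 19 = ar z 19" "lst (ar y L) n = sort_key g zs"
              using frameD[OF y(3)] fz y(1) sk L l by auto
            have "ar y L 0 = lst (ar y L) n ! 0" using b' by simp
            also have "\<dots> \<in> set zs" using b' zm unfolding fy(3)
              by (metis length_sort nth_mem set_sort zero_less_nat_eq zero_less_one order_less_le_trans)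
            finally have y0: "ar y L 0 \<in> set zs" .
            have "ar y L 0 = lst (ar y L) n ! 0" using b' by simp
            moreover have "fits (c - g (ar y L 0))" using cl[OF y0] b' unfolding g_def by (intro fits_small) auto
            ultimately show "wp (17 ::= V 10 .- A 19 (A L (N 0))) (\<lambda>t. lst (ar t L) n = sort_key g zs \<and>
               (\<forall>x\<in>set xs. ar t 19 x = g x) \<and> vr t 17 = c - g (lst (ar t L) n ! 0) \<and>
               int (tk t) = int (tk s) + 4 * n + 3 * p + 2 * n + 2 * c) y"
              using fy gz y0 zx[OF y0] y(2) tz fz zm L sz_pos by (simp add: wp_simps)
          next
            show "\<forall>x\<in>set zs. 0 \<le> x \<and> x < sz \<and> 0 \<le> ar z 19 x \<and> ar z 19 x < vr z 10"
              using zx gz fz cl unfolding g_def by (smt (verit))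
          qed (use fz ft L l b' zm in auto)
        qed (use fv l b' v0 in auto)
      qed (use fu l b' in auto)
    qed (use ft l b' in auto)
  qed (use L l b xs in auto)
  then show ?thesis
  proof (rule wp_conseq, goal_cases)
    case (1 t)
    let ?ys = "lst (ar t L) n"
    have ys: "?ys = sort_key g (sort_key f xs)" using 1(1) zs_def by simp
    have m: "mset ?ys = mset xs" unfolding ys by simp
    have "classord f ?ys" using ys unfolding g_def by (rule classord_sort)
    moreover have "11 * c \<ge> 4 * n + 3 * p + 2 * n + 2 * c" using b' by simp
    ultimately show ?case
      using 1 m by (intro Q[of ?ys]) (auto simp: n_def f_def g_def c_def)
  qed
qed

end

section \<open>Selection forests\<close>

text \<open>
  Nodes \<open>0, \<dots>, nl - 1\<close> are leaves, and the inner nodes \<open>nl, nl + 1, \<dots>\<close> are created bottom up. An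
  inner node \<open>k\<close> carries a bit, which it passes on to \<open>c1 k\<close> and, complemented, to \<open>c0 k\<close>. Hence
  a linear functional of the leaf bits becomes an affine functional of the bits of the roots, in
  which \<open>k\<close> has the coefficient of \<open>c1 k\<close> minus that of \<open>c0 k\<close>.
\<close>

fun push :: "(int \<Rightarrow> int) \<Rightarrow> (int \<Rightarrow> int) \<Rightarrow> int \<Rightarrow> nat \<Rightarrow> (int \<Rightarrow> int) \<Rightarrow> int \<Rightarrow> int" where
  "push c0 c1 nl 0 b = b"
| "push c0 c1 nl (Suc j) b =
    push c0 c1 nl j (b(c1 (nl + int j) := b (nl + int j), c0 (nl + int j) := 1 - b (nl + int j)))"

text \<open>The number of leaves is odd, so one leaf \<open>LF\<close> stays without a partner; it
  is selected always. Roots outside \<open>R\<close> have been given up and keep the bit 0.\<close>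

definition bits :: "int \<Rightarrow> int set \<Rightarrow> int \<Rightarrow> (int \<Rightarrow> int) \<Rightarrow> bool" where
  "bits LF R n b \<longleftrightarrow> (\<forall>x\<in>{0..<n}. b x \<in> {0, 1}) \<and> b LF = 1 \<and> (\<forall>x\<in>{0..<n}. x \<notin> R \<longrightarrow> x \<noteq> LF \<longrightarrow> b x = 0)"

text \<open>For \<open>q = 0\<close> the congruence is an equality; this instance counts the
  selected leaves, whereas \<open>q = p\<close> concerns their sum.\<close>

definition lrep :: "int \<Rightarrow> (int \<Rightarrow> int) \<Rightarrow> (int \<Rightarrow> int) \<Rightarrow> int \<Rightarrow> nat \<Rightarrow> (int \<Rightarrow> int) \<Rightarrow> int \<Rightarrow>
    int set \<Rightarrow> int \<Rightarrow> (int \<Rightarrow> int) \<Rightarrow> bool" where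
  "lrep q c0 c1 nl j X LF R base val \<longleftrightarrow> (\<forall>b. bits LF R (nl + int j) b \<longrightarrow>
     (\<forall>x\<in>{0..<nl}. push c0 c1 nl j b x \<in> {0, 1}) \<and>
     [(\<Sum>x\<in>{0..<nl}. push c0 c1 nl j b x * X x) = base + (\<Sum>x\<in>R. b x * val x)] (mod q))"

lemma push_cong:
  assumes "\<And>x. nl \<le> x \<Longrightarrow> x < nl + int j \<Longrightarrow> c0 x = c0' x \<and> c1 x = c1' x"
  shows "push c0 c1 nl j b = push c0' c1' nl j b"
  using assms by (induction j arbitrary: b) auto

lemma bits_mono:
  "bits LF R n b \<Longrightarrow> R \<subseteq> R' \<Longrightarrow> bits LF R' n b"
  by (auto simp: bits_def)

text \<open>Giving up a root amounts to fixing its bit at 0.\<close>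

lemma lrep_mono:
  assumes "lrep q c0 c1 nl j X LF R' base val" "R \<subseteq> R'" "R' \<subseteq> {0..<nl + int j}" "LF \<notin> R'"
  shows "lrep q c0 c1 nl j X LF R base val"
  unfolding lrep_def
proof (intro allI impI)
  fix b assume b: "bits LF R (nl + int j) b"
  have "finite R'" using assms(3) finite_subset by blast
  then have "(\<Sum>x\<in>R'. b x * val x) = (\<Sum>x\<in>R. b x * val x)"
    using assms b by (intro sum.mono_neutral_right) (auto simp: bits_def)
  then show "(\<forall>x\<in>{0..<nl}. push c0 c1 nl j b x \<in> {0, 1}) \<and>
      [\<Sum>x\<in>{0..<nl}. push c0 c1 nl j b x * X x = base + (\<Sum>x\<in>R. b x * val x)] (mod q)"
    using assms(1) bits_mono[OF b assms(2)] unfolding lrep_def by auto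
qed

lemma lrep_cong:
  assumes "lrep q c0 c1 nl j X LF R base val"
    "\<And>x. nl \<le> x \<Longrightarrow> x < nl + int j \<Longrightarrow> c0 x = c0' x \<and> c1 x = c1' x"
    "\<And>x. x \<in> R \<Longrightarrow> [val x = val' x] (mod q)" "[base = base'] (mod q)"
  shows "lrep q c0' c1' nl j X LF R base' val'"
  unfolding lrep_def
proof (intro allI impI)
  fix b assume b: "bits LF R (nl + int j) b"
  have e: "push c0' c1' nl j b = push c0 c1 nl j b" by (rule push_cong) (use assms(2) in auto)
  have "[base + (\<Sum>x\<in>R. b x * val x) = base' + (\<Sum>x\<in>R. b x * val' x)] (mod q)"
    using assms(3,4) by (intro cong_add cong_sum cong_mult) auto
  then show "(\<forall>x\<in>{0..<nl}. push c0' c1' nl j b x \<in> {0, 1}) \<and>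
      [\<Sum>x\<in>{0..<nl}. push c0' c1' nl j b x * X x = base' + (\<Sum>x\<in>R. b x * val' x)] (mod q)"
    using assms(1) b unfolding lrep_def e by (auto intro: cong_trans)
qed

lemma lrep_scale:
  assumes "lrep q c0 c1 nl j X LF R base val"
  shows "lrep q c0 c1 nl j (\<lambda>x. u * X x) LF R (u * base) (\<lambda>x. u * val x)"
  unfolding lrep_def
proof (intro allI impI)
  fix b assume b: "bits LF R (nl + int j) b"
  have "[u * (\<Sum>x\<in>{0..<nl}. push c0 c1 nl j b x * X x) = u * (base + (\<Sum>x\<in>R. b x * val x))] (mod q)"
    using assms b unfolding lrep_def by (intro cong_mult) auto
  then show "(\<forall>x\<in>{0..<nl}. push c0 c1 nl j b x \<in> {0, 1}) \<and>
      [\<Sum>x\<in>{0..<nl}. push c0 c1 nl j b x * (u * X x) = u * base + (\<Sum>x\<in>R. b x * (u * val x))] (mod q)"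
    using assms b unfolding lrep_def by (auto simp: sum_distrib_left algebra_simps)
qed

lemma lrep_init:
  assumes "0 \<le> LF" "LF < nl" "R = {0..<nl} - {LF}"
  shows "lrep q c0 c1 nl 0 X LF R (X LF) X"
proof -
  have "(\<Sum>x\<in>{0..<nl}. b x * X x) = X LF + (\<Sum>x\<in>R. b x * X x)" if "b LF = 1" for b
    using that assms by (subst sum.remove[of _ LF]) auto
  then show ?thesis by (auto simp: lrep_def bits_def)
qed

text \<open>A bit \<open>d\<close> at the new root selects \<open>b\<close> if it is 1 and
  \<open>a\<close> if it is 0, which contributes \<open>val a + d * (val b - val a)\<close>. So
  \<open>val a\<close> moves into the constant term and the difference becomes the coefficient of
  the new root.\<close>

lemma lrep_pair:
  assumes r: "lrep q c0 c1 nl j X LF R base val" and n: "n = nl + int j"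
    and R: "R \<subseteq> {0..<n}" "LF \<notin> R" "0 \<le> LF" "LF < n" and ab: "a \<in> R" "b \<in> R" "a \<noteq> b"
    and c: "c0 n = a" "c1 n = b" and v: "val n = val b - val a"
  shows "lrep q c0 c1 nl (Suc j) X LF (insert n (R - {a, b})) (base + val a) val"
  unfolding lrep_def
proof (intro allI impI)
  let ?R = "insert n (R - {a, b})"
  fix d assume d: "bits LF ?R (nl + int (Suc j)) d"
  let ?d = "d(b := d n, a := 1 - d n)"
  have fin: "finite R" using R finite_subset by blast
  have n1: "nl + int (Suc j) = n + 1" using n by simp
  have ge: "0 \<le> n" using R by simp
  note dd = d[unfolded n1 bits_def]
  have dn: "d n \<in> {0, 1}" using dd ge by auto
  have d': "bits LF R (nl + int j) ?d"
    unfolding bits_def n[symmetric]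
  proof (intro conjI ballI impI)
    fix x assume "x \<in> {0..<n}"
    then show "?d x \<in> {0, 1}" using dd dn by auto
  next
    show "?d LF = 1" using dd ab R by auto
  next
    fix x assume "x \<in> {0..<n}" "x \<notin> R" "x \<noteq> LF"
    then show "?d x = 0" using dd ab by auto
  qed
  have "n \<notin> R" using R by auto
  then have "(\<Sum>x\<in>?R. d x * val x) = d n * val n + (\<Sum>x\<in>R - {a, b}. d x * val x)"
    using fin by (subst sum.insert) auto
  moreover have "(\<Sum>x\<in>R. ?d x * val x) = ?d a * val a + (?d b * val b + (\<Sum>x\<in>R - {a} - {b}. ?d x * val x))"
    using fin ab sum.remove[of R a "\<lambda>x. ?d x * val x"] sum.remove[of "R - {a}" b "\<lambda>x. ?d x * val x"]
    by auto
  moreover have "(\<Sum>x\<in>R - {a} - {b}. ?d x * val x) = (\<Sum>x\<in>R - {a, b}. d x * val x)"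
    by (intro sum.cong) auto
  ultimately have "base + (\<Sum>x\<in>R. ?d x * val x) = base + val a + (\<Sum>x\<in>?R. d x * val x)"
    using ab v by (simp add: algebra_simps)
  moreover have "push c0 c1 nl (Suc j) d = push c0 c1 nl j ?d" by (simp add: n[symmetric] c)
  moreover have "(\<forall>x\<in>{0..<nl}. push c0 c1 nl j ?d x \<in> {0, 1}) \<and>
      [\<Sum>x\<in>{0..<nl}. push c0 c1 nl j ?d x * X x = base + (\<Sum>x\<in>R. ?d x * val x)] (mod q)"
    using r d' unfolding lrep_def by blast
  ultimately show "(\<forall>x\<in>{0..<nl}. push c0 c1 nl (Suc j) d x \<in> {0, 1}) \<and>
      [\<Sum>x\<in>{0..<nl}. push c0 c1 nl (Suc j) d x * X x = base + val a + (\<Sum>x\<in>?R. d x * val x)] (mod q)"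
    by (simp only:) blast
qed

lemma lrep_pairs:
  assumes "lrep q c0 c1 nl j X LF R base val"
    and "R \<subseteq> {0..<nl + int j}" "LF \<notin> R" "0 \<le> LF" "LF < nl + int j"
    and "length ls = k" "length rs = k" "distinct (ls @ rs)" "set ls \<union> set rs \<subseteq> R"
    and "\<And>i. i < k \<Longrightarrow> c0 (nl + int j + int i) = ls ! i \<and> c1 (nl + int j + int i) = rs ! i \<and>
        val (nl + int j + int i) = val (rs ! i) - val (ls ! i)"
  shows "lrep q c0 c1 nl (j + k) X LF (R - set ls - set rs \<union> {nl + int j..<nl + int j + int k})
    (base + sum_list (map val ls)) val"
  using assms(6-)
proof (induction k arbitrary: ls rs)
  case 0
  then show ?case using assms(1) by auto
next
  case (Suc k)
  obtain ls' a rs' b where ab: "ls = ls' @ [a]" "rs = rs' @ [b]"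
    using Suc.prems by (metis length_0_conv nat.distinct(1) rev_exhaust)
  then have len: "length ls' = k" "length rs' = k" using Suc.prems by auto
  let ?R = "R - set ls' - set rs' \<union> {nl + int j..<nl + int j + int k}"
  have "lrep q c0 c1 nl (j + k) X LF ?R (base + sum_list (map val ls')) val"
  proof (rule Suc.IH)
    fix i assume "i < k"
    then show "c0 (nl + int j + int i) = ls' ! i \<and> c1 (nl + int j + int i) = rs' ! i \<and>
        val (nl + int j + int i) = val (rs' ! i) - val (ls' ! i)"
      using Suc.prems(5)[of i] ab len by (simp add: nth_append)
  qed (use Suc.prems ab len in auto)
  then have "lrep q c0 c1 nl (Suc (j + k)) X LF (insert (nl + int (j + k)) (?R - {a, b}))
      (base + sum_list (map val ls') + val a) val"
  proof (rule lrep_pair[OF _ refl])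
    show "c0 (nl + int (j + k)) = a" "c1 (nl + int (j + k)) = b"
      "val (nl + int (j + k)) = val b - val a"
      using Suc.prems(5)[of k] ab len nth_append_length[of ls' a "[]"] nth_append_length[of rs' b "[]"]
      by (auto simp: algebra_simps)
  qed (use assms(2-5) Suc.prems ab len in auto)
  moreover have "insert (nl + int (j + k)) (?R - {a, b}) =
      R - set ls - set rs \<union> {nl + int j..<nl + int j + int (Suc k)}"
    using assms(2) Suc.prems ab by auto
  ultimately show ?case using ab by (simp add: algebra_simps)
qed

text \<open>The list is cut into blocks of length \<open>2 * s\<close>, and each entry of the first
  half of a block is joined to the one \<open>s\<close> places further. This keeps the pairs
  disjoint while all of them have the same distance. Pairs whose difference exceeds
  \<open>bd\<close> are rejected.\<close>

definition pairs :: "(int \<Rightarrow> int) \<Rightarrow> int list \<Rightarrow> nat \<Rightarrow> int \<Rightarrow> nat list" where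
  "pairs f xs s bd =
    filter (\<lambda>i. i mod (2 * s) < s \<and> f (xs ! (i + s)) - f (xs ! i) \<le> bd) [0..<length xs - s]"

lemma pairs_bound: "i \<in> set (pairs f xs s bd) \<Longrightarrow> i + s < length xs \<and> i mod (2 * s) < s \<and> 0 < s"
  by (auto simp: pairs_def)

lemma pairs_distinct:
  assumes "distinct xs"
  shows "distinct (map (\<lambda>i. xs ! i) (pairs f xs s bd) @ map (\<lambda>i. xs ! (i + s)) (pairs f xs s bd))"
proof -
  let ?p = "pairs f xs s bd"
  have d: "distinct ?p" by (simp add: pairs_def)
  have ne: "i \<noteq> k + s" if "i \<in> set ?p" "k \<in> set ?p" for i k
  proof
    assume e: "i = k + s"
    have k: "k mod (2 * s) < s" "0 < s" using pairs_bound that by auto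
    \<comment> \<open>A left end is below \<open>s\<close> modulo \<open>2 * s\<close>, and
      therefore a right end is not.\<close>
    have "(k + s) mod (2 * s) = k mod (2 * s) + s"
      using k by (subst mod_add_left_eq[symmetric]) simp
    then show False using pairs_bound[OF that(1)] e by simp
  qed
  show ?thesis
  proof -
    have lt: "i < length xs" "i + s < length xs" if "i \<in> set ?p" for i using pairs_bound[OF that] by auto
    have "distinct (map (\<lambda>i. xs ! i) ?p)" "distinct (map (\<lambda>i. xs ! (i + s)) ?p)"
      using d lt assms by (auto simp: distinct_map inj_on_def nth_eq_iff_index_eq)
    moreover have "xs ! i \<noteq> xs ! (k + s)" if "i \<in> set ?p" "k \<in> set ?p" for i k
      using ne[OF that] lt that assms by (simp add: nth_eq_iff_index_eq)
    ultimately show ?thesis by auto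
  qed
qed

definition PAIR :: "nat \<Rightarrow> nat \<Rightarrow> nat \<Rightarrow> nat \<Rightarrow> com" where
  "PAIR L l G g =
    (g ::= N 0 ;;
     Cond (Lt (V l) (V 19)) (31 ::= N 0) (31 ::= V l .- V 19) ;;
     For 30 31
      (Cond (Lt (V 30 .mod (V 19 .+ V 19)) (V 19))
        (33 ::= A L (V 30) ;; 34 ::= A L (V 30 .+ V 19) ;; 35 ::= A 5 (V 34) .- A 5 (V 33) ;;
         Cond (Lt (V 20) (V 35)) Skip
          (Sto 6 (V 9) (V 33) ;; Sto 7 (V 9) (V 34) ;; Sto 5 (V 9) (V 35) ;;
           8 ::= (V 8 .+ A 5 (V 33)) .mod V 4 ;;
           Sto G (V g) (V 9) ;; g ::= V g .+ N 1 ;; 9 ::= V 9 .+ N 1))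
        Skip))"

lemma mod_PAIR [simp]:
  "modv (PAIR L l G g) = {g, 8, 9, 30, 31, 33, 34, 35}" "moda (PAIR L l G g) = {5, 6, 7, G}"
  by (auto simp: PAIR_def)

context ram
begin

lemma wp_CondT: "bok b s \<Longrightarrow> bev b s \<Longrightarrow> wp c1 Q s \<Longrightarrow> wp (Cond b c1 c2) Q s"
  by (simp add: wp_simps(5))

lemma wp_CondF: "bok b s \<Longrightarrow> \<not> bev b s \<Longrightarrow> wp c2 Q s \<Longrightarrow> wp (Cond b c1 c2) Q s"
  by (simp add: wp_simps(5))

lemma wp_PAIR:
  assumes L: "L < 50" "G < 50" "L \<notin> {5, 6, 7}" "G \<notin> {5, 6, 7}" "L \<noteq> G"
    and l: "l < 30" "g < 30" "l \<notin> {8, 9}" "g \<notin> {4, 8, 9, 19, 20}" "l \<noteq> g"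
    and b: "0 \<le> vr s l" "0 \<le> vr s 9" "vr s 9 + vr s l \<le> sz" "0 < vr s 4" "vr s 4 \<le> sz"
      "0 \<le> vr s 8" "vr s 8 < vr s 4" "vr s 19 = int \<sigma>" "vr s 19 \<le> 10 * sz"
    and xs: "xs = lst (ar s L) (vr s l)"
      "\<forall>x\<in>set xs. 0 \<le> x \<and> x < vr s 9 \<and> 0 \<le> ar s 5 x \<and> ar s 5 x < vr s 4"
    and ps: "ps = pairs (ar s 5) xs \<sigma> (vr s 20)"
    and Q: "\<And>t. vr t 9 = vr s 9 + int (length ps) \<Longrightarrow> vr t g = int (length ps) \<Longrightarrow>
      (\<forall>i<length ps. ar t G (int i) = vr s 9 + int i \<and> ar t 6 (vr s 9 + int i) = xs ! (ps ! i) \<and>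
         ar t 7 (vr s 9 + int i) = xs ! (ps ! i + \<sigma>) \<and>
         ar t 5 (vr s 9 + int i) = ar s 5 (xs ! (ps ! i + \<sigma>)) - ar s 5 (xs ! (ps ! i))) \<Longrightarrow>
      (\<forall>x<vr s 9. ar t 5 x = ar s 5 x \<and> ar t 6 x = ar s 6 x \<and> ar t 7 x = ar s 7 x) \<Longrightarrow>
      [vr t 8 = vr s 8 + sum_list (map (\<lambda>i. ar s 5 (xs ! i)) ps)] (mod vr s 4) \<Longrightarrow>
      0 \<le> vr t 8 \<Longrightarrow> vr t 8 < vr s 4 \<Longrightarrow>
      int (tk t) \<le> int (tk s) + vr s l \<Longrightarrow> frame (PAIR L l G g) s t \<Longrightarrow> Q t"
  shows "wp (PAIR L l G g) Q s"
proof -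
  define n0 where "n0 = vr s 9"
  define f where "f = ar s 5"
  define p where "p = vr s 4"
  define n where "n = vr s l"
  define bd where "bd = vr s 20"
  define pk where "pk = (\<lambda>k. filter (\<lambda>i. i mod (2 * \<sigma>) < \<sigma> \<and> f (xs ! (i + \<sigma>)) - f (xs ! i) \<le> bd) [0..<nat k])"
  define J where "J = (\<lambda>qs (v :: nat \<Rightarrow> int) (a :: nat \<Rightarrow> int \<Rightarrow> int). v 9 = n0 + int (length qs) \<and> v g = int (length qs) \<and>
      (\<forall>i<length qs. a G (int i) = n0 + int i \<and> a 6 (n0 + int i) = xs ! (qs ! i) \<and>
         a 7 (n0 + int i) = xs ! (qs ! i + \<sigma>) \<and>
         a 5 (n0 + int i) = f (xs ! (qs ! i + \<sigma>)) - f (xs ! (qs ! i))) \<and>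
      (\<forall>x<n0. a 5 x = f x \<and> a 6 x = ar s 6 x \<and> a 7 x = ar s 7 x) \<and>
      [v 8 = vr s 8 + sum_list (map (\<lambda>i. f (xs ! i)) qs)] (mod p) \<and>
      0 \<le> v 8 \<and> v 8 < p)"
  note b' = b[folded p_def n_def n0_def]
  define m where "m = (if n < int \<sigma> then 0 else n - int \<sigma>)"
  have lxs: "length xs = nat n" using xs by (simp add: n_def)
  have el: "ar s L k = xs ! nat k" "0 \<le> xs ! nat k \<and> xs ! nat k < n0 \<and> 0 \<le> f (xs ! nat k) \<and> f (xs ! nat k) < p"
    if "0 \<le> k" "k < n" for k
  proof -
    have "nat k < length xs" using that lxs by simp
    then show "0 \<le> xs ! nat k \<and> xs ! nat k < n0 \<and> 0 \<le> f (xs ! nat k) \<and> f (xs ! nat k) < p"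
      using xs(2) nth_mem unfolding f_def p_def n0_def by blast
    show "ar s L k = xs ! nat k" using that by (simp add: xs(1) n_def)
  qed
  have step: "J (qs @ [i]) (v(33 := x, 34 := y, 35 := f y - f x, 8 := (v 8 + f x) mod p,
       g := v g + 1, 9 := v 9 + 1, 30 := k))
     (a(6 := (a 6)(v 9 := x), 7 := (a 7)(v 9 := y), 5 := (a 5)(v 9 := f y - f x),
        G := (a G)(v g := v 9)))"
    if j: "J qs v a" and xy: "x = xs ! i" "y = xs ! (i + \<sigma>)" for qs i v a x y k
  proof -
    have "[(v 8 + f x) mod p = vr s 8 + sum_list (map (\<lambda>i. f (xs ! i)) (qs @ [i]))] (mod p)"
      using j xy unfolding J_def by (auto simp: cong_def mod_simps add.assoc[symmetric])
    moreover have "0 \<le> (v 8 + f x) mod p" "(v 8 + f x) mod p < p" using b' by auto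
    ultimately show ?thesis using j xy L l unfolding J_def
      by (auto simp: nth_append less_Suc_eq)
  qed
  have Jcong: "J qs (v(30 := x)) a \<longleftrightarrow> J qs v a" "J qs (v(31 := x)) a \<longleftrightarrow> J qs v a"
    "J qs (v(33 := x)) a \<longleftrightarrow> J qs v a" "J qs (v(34 := x)) a \<longleftrightarrow> J qs v a"
    "J qs (v(35 := x)) a \<longleftrightarrow> J qs v a" for qs v a x
    using l unfolding J_def by auto
  have main: "wp (For 30 31
      (Cond (Lt (V 30 .mod (V 19 .+ V 19)) (V 19))
        (33 ::= A L (V 30) ;; 34 ::= A L (V 30 .+ V 19) ;; 35 ::= A 5 (V 34) .- A 5 (V 33) ;;
         Cond (Lt (V 20) (V 35)) Skip
          (Sto 6 (V 9) (V 33) ;; Sto 7 (V 9) (V 34) ;; Sto 5 (V 9) (V 35) ;;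
           8 ::= (V 8 .+ A 5 (V 33)) .mod V 4 ;;
           Sto G (V g) (V 9) ;; g ::= V g .+ N 1 ;; 9 ::= V 9 .+ N 1))
        Skip)) (\<lambda>t. J ps (vr t) (ar t) \<and> int (tk t) \<le> int (tk s) + n) (s\<lparr>vr := (vr s)(g := 0, 31 := m)\<rparr>)"
  proof (rule wp_For[where P = "\<lambda>k t. J (pk k) (vr t) (ar t) \<and> int (tk t) = int (tk s) + k"], goal_cases)
    case 1
    then show ?case using l b' by (auto simp: J_def pk_def n0_def f_def)
  next
    case (2 k t)
    have k: "0 \<le> k" "k < m" "vr t 30 = k" using 2 l by auto
    then have k': "k + int \<sigma> < n" "k < n" by (auto simp: m_def split: if_splits)
    have fr: "ar t L = ar s L" "vr t 4 = p" "vr t 19 = int \<sigma>" "vr t 20 = bd"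
      using frameD[OF 2(5)] L l b by (auto simp: p_def bd_def)
    have j: "J (pk k) (vr t) (ar t)" "int (tk t) = int (tk s) + k" using 2(3) by auto
    define x where "x = xs ! nat k"
    define y where "y = xs ! (nat k + \<sigma>)"
    have sg: "nat (k + int \<sigma>) = nat k + \<sigma>" using k by (simp add: nat_add_distrib)
    have x: "ar s L k = x" "0 \<le> x" "x < n0" "0 \<le> f x" "f x < p"
      using el[of k] k k' by (auto simp: x_def)
    have y: "ar s L (k + int \<sigma>) = y" "0 \<le> y" "y < n0" "0 \<le> f y" "f y < p"
      using el[of "k + int \<sigma>"] k k' by (auto simp: y_def sg)
    have "\<forall>z<n0. ar t 5 z = f z" using j(1) unfolding J_def by blast
    then have v5: "ar t 5 x = f x" "ar t 5 y = f y" using x(3) y(3) by blast+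
    have "length (pk k) \<le> length [0..<nat k]" unfolding pk_def by (rule length_filter_le)
    then have lp: "int (length (pk k)) \<le> k" using k by simp
    have tg: "vr t 9 = n0 + int (length (pk k))" "vr t g = int (length (pk k))" "0 \<le> vr t 8" "vr t 8 < p"
      using j(1) unfolding J_def by blast+
    have rng: "vr t 9 < sz" "vr t g < sz" "0 \<le> vr t 9" "0 \<le> vr t g"
      using tg lp k' b' by auto
    have md: "k mod (int \<sigma> + int \<sigma>) = int (nat k mod (2 * \<sigma>))"
    proof -
      have "int \<sigma> + int \<sigma> = int (2 * \<sigma>)" by simp
      then show ?thesis using k zmod_int[of "nat k" "2 * \<sigma>"] by simp
    qed
    have md2: "k mod (2 * int \<sigma>) = int (nat k mod (2 * \<sigma>))" using md unfolding mult_2[of "int \<sigma>"] .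
    have pk1: "pk (k + 1) = pk k @ (if nat k mod (2 * \<sigma>) < \<sigma> \<and> f y - f x \<le> bd then [nat k] else [])"
      using k by (simp add: pk_def nat_add_distrib x_def y_def)
    have fits: "fits (k mod (int \<sigma> + int \<sigma>))" "fits (int \<sigma> + int \<sigma>)" "fits (k + int \<sigma>)" "fits (f y - f x)"
      "fits (vr t 8 + f x)" "fits ((vr t 8 + f x) mod p)" "fits (vr t g + 1)" "fits (vr t 9 + 1)"
    proof -
      have "int (nat k mod (2 * \<sigma>)) \<le> k" using k(1) mod_less_eq_dividend[of "nat k" "2 * \<sigma>"] by linarith
      then have "\<bar>k mod (int \<sigma> + int \<sigma>)\<bar> \<le> 100 * sz" unfolding md using k(1) k' b' by linarith
      then show "fits (k mod (int \<sigma> + int \<sigma>))" by (rule fits_small)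
      show "fits ((vr t 8 + f x) mod p)" using b' pos_mod_bound[of p "vr t 8 + f x"] pos_mod_sign[of p "vr t 8 + f x"]
        by (intro fits_small) linarith
    qed (use k k' b' x y tg rng in \<open>auto intro!: fits_small\<close>)
    show ?case
    proof (cases "nat k mod (2 * \<sigma>) < \<sigma>")
      case False
      then show ?thesis using j k fr(2-) fits(1,2) unfolding pk1
        by (intro wp_CondF) (simp_all add: wp_simps(1) md2 Jcong)
    next
      case True
      show ?thesis
      proof (cases "f y - f x \<le> bd")
        case False
        have "x < sz" "y < sz" "k < sz" "k + int \<sigma> < sz" using x y b' k' by auto
        moreover have "int (nat k mod (2 * \<sigma>)) < int \<sigma>" using True by simp
        ultimately show ?thesis using False j k fr fits(1-4) x(1,2) y(1,2) v5 L(1) unfolding pk1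
          by (intro wp_CondT) (simp_all add: wp_simps(1,2,4) wp_CondT md2 Jcong)
      next
        case B: True
        have e: "int (nat k mod (2 * \<sigma>)) < int \<sigma>" using True by simp
        have ne: "vr t 9 \<noteq> x" "vr t 9 \<noteq> y" using x y tg by auto
        note J1 = step[OF j(1) x_def y_def, of "k + 1"]
        have J2: "pk k @ [nat k] = pk (k + 1)" using pk1 True B by simp
        have "x < sz" "y < sz" "k < sz" "k + int \<sigma> < sz" using x y b' k' by auto
        then show ?thesis using B e j(2) k fr fits l x(1,2) y(1,2) v5 L ne rng J1[unfolded J2]
          by (intro wp_CondT) (simp_all add: wp_simps(1-4) wp_CondF md2)
      qed
    qed
  next
    case (3 t)
    have "pk m = ps" unfolding pk_def ps pairs_def lxs
      by (auto simp: m_def f_def bd_def nat_diff_distrib)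
    then show ?case using 3(1) l b' by (auto simp: m_def split: if_splits)
  qed (use l b' in \<open>auto simp: m_def\<close>)
  have "wp (PAIR L l G g) (\<lambda>t. J ps (vr t) (ar t) \<and> int (tk t) \<le> int (tk s) + n) s"
    unfolding PAIR_def
  proof (cases "n < int \<sigma>")
    case True
    then show "wp (g ::= N 0 ;;
     Cond (Lt (V l) (V 19)) (31 ::= N 0) (31 ::= V l .- V 19) ;;
     For 30 31
      (Cond (Lt (V 30 .mod (V 19 .+ V 19)) (V 19))
        (33 ::= A L (V 30) ;; 34 ::= A L (V 30 .+ V 19) ;; 35 ::= A 5 (V 34) .- A 5 (V 33) ;;
         Cond (Lt (V 20) (V 35)) Skip
          (Sto 6 (V 9) (V 33) ;; Sto 7 (V 9) (V 34) ;; Sto 5 (V 9) (V 35) ;;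
           8 ::= (V 8 .+ A 5 (V 33)) .mod V 4 ;;
           Sto G (V g) (V 9) ;; g ::= V g .+ N 1 ;; 9 ::= V 9 .+ N 1))
        Skip)) (\<lambda>t. J ps (vr t) (ar t) \<and> int (tk t) \<le> int (tk s) + n) s"
      using main l b' by (simp add: wp_simps(2,4,5) n_def m_def)
  next
    case False
    then have "fits (n - int \<sigma>)" using b' by (intro fits_small) auto
    then show "wp (g ::= N 0 ;;
     Cond (Lt (V l) (V 19)) (31 ::= N 0) (31 ::= V l .- V 19) ;;
     For 30 31
      (Cond (Lt (V 30 .mod (V 19 .+ V 19)) (V 19))
        (33 ::= A L (V 30) ;; 34 ::= A L (V 30 .+ V 19) ;; 35 ::= A 5 (V 34) .- A 5 (V 33) ;;
         Cond (Lt (V 20) (V 35)) Skip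
          (Sto 6 (V 9) (V 33) ;; Sto 7 (V 9) (V 34) ;; Sto 5 (V 9) (V 35) ;;
           8 ::= (V 8 .+ A 5 (V 33)) .mod V 4 ;;
           Sto G (V g) (V 9) ;; g ::= V g .+ N 1 ;; 9 ::= V 9 .+ N 1))
        Skip)) (\<lambda>t. J ps (vr t) (ar t) \<and> int (tk t) \<le> int (tk s) + n) s"
      using main l b' False by (simp add: wp_simps(2,4,5) n_def m_def)
  qed
  then show ?thesis
    by (rule wp_conseq) (intro Q; auto simp: J_def n0_def f_def p_def n_def)
qed

end

section \<open>Growing the set of subset sums\<close>

text \<open>Run when the step changes: one pass over the list in array 21 removes the residues
  reached since the last rebuild and collects the frontier for the new step in array 22.\<close>

definition REBUILD :: com where
  "REBUILD = (32 ::= N 0 ;; 38 ::= N 0 ;;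
     For 30 37 (33 ::= A 21 (V 30) ;;
       Cond (Eq (A 20 (V 33)) (N (-2)))
         (Sto 21 (V 32) (V 33) ;; 32 ::= V 32 .+ N 1 ;;
          Cond (Lt (N (-2)) (A 20 ((V 33 .- V 35) .mod V 4))) (Sto 22 (V 38) (V 33) ;; 38 ::= V 38 .+ N 1) Skip)
         Skip) ;;
     37 ::= V 32 ;; 39 ::= V 35)"

definition MARK :: com where
  "MARK = For 30 38 (Sto 20 (A 22 (V 30)) (V 36))"

text \<open>While the step stays the same, only translates of the residues marked last can enter the
  frontier, so the rest of the unreached residues need not be looked at.\<close>

definition ADVANCE :: com where
  "ADVANCE = (32 ::= N 0 ;;
     For 30 38 (33 ::= (A 22 (V 30) .+ V 35) .mod V 4 ;;
       Cond (Eq (A 20 (V 33)) (N (-2))) (Sto 22 (V 32) (V 33) ;; 32 ::= V 32 .+ N 1) Skip) ;;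
     38 ::= V 32)"

text \<open>Array 20 is -2 at unreached residues, -1 at 0, and elsewhere the index of the summand
  that reached the residue first. Variable 39 is the step to which the frontier belongs; its initial
  value -1 is no step and forces a rebuild in the first iteration.\<close>

definition WALK :: com where
  "WALK =
    (For 30 4 (Sto 20 (V 30) (N (-2)) ;; Sto 21 (V 30) (V 30 .+ N 1)) ;;
     Sto 20 (N 0) (N (-1)) ;; 37 ::= V 4 .- N 1 ;; 38 ::= N 0 ;; 39 ::= N (-1) ;;
     For 36 13 (35 ::= A 5 (A 14 (V 36)) ;; Cond (Eq (V 35) (V 39)) Skip REBUILD ;; MARK ;; ADVANCE))"

lemma mod_REBUILD [simp]: "modv REBUILD = {30, 32, 33, 37, 38, 39}" "moda REBUILD = {21, 22}"
  by (auto simp: REBUILD_def)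

lemma mod_MARK [simp]: "modv MARK = {30}" "moda MARK = {20}"
  by (auto simp: MARK_def)

lemma mod_ADVANCE [simp]: "modv ADVANCE = {30, 32, 33, 38}" "moda ADVANCE = {22}"
  by (auto simp: ADVANCE_def)

lemma mod_WALK [simp]: "modv WALK = {30, 32, 33, 35, 36, 37, 38, 39}" "moda WALK = {20, 21, 22}"
  by (auto simp: WALK_def)

text \<open>Filtering in place is sound because the writing position \<open>k\<close> never
  overtakes the reading position \<open>j\<close>: the entries from \<open>j + 1\<close> on are
  still the original ones.\<close>

lemma lst_compact:
  assumes "0 \<le> k" "k \<le> j" "lst f k = ys" "\<forall>i\<ge>j. f i = g i"
  shows "lst (f(k := x)) (k + 1) = ys @ [x]" "\<forall>i\<ge>j + 1. (f(k := x)) i = g i"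
  using assms by (auto simp: lst_Suc)

section \<open>Reached residues, the frontier of a step, and predecessor pointers\<close>

definition unm :: "int \<Rightarrow> (int \<Rightarrow> int) \<Rightarrow> int set" where
  "unm p org = {y \<in> {0..<p}. org y = -2}"

text \<open>If \<open>S\<close> is the set of reached residues, this is the part of
  \<open>S + d\<close> outside \<open>S\<close>: what one more summand \<open>d\<close> adds to the
  subset sums.\<close>

definition front :: "int \<Rightarrow> (int \<Rightarrow> int) \<Rightarrow> int \<Rightarrow> int set" where
  "front p org d = {y \<in> unm p org. org ((y - d) mod p) \<noteq> -2}"

lemma finite_unm [simp]: "finite (unm p org)"
  by (rule finite_subset[of _ "{0..<p}"]) (auto simp: unm_def)

text \<open>The case of Cauchy-Davenport with a two-element summand. If nothing new arose, the set
  of reached residues would contain 0 and be closed under adding \<open>d\<close>; as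
  \<open>d\<close> generates the residues modulo \<open>p\<close>, no residue would be
  unreached.\<close>

lemma front_nonempty:
  assumes p: "prime p" and d: "0 < d" "d < p" and 0: "org 0 \<noteq> -2" and u: "unm p org \<noteq> {}"
  shows "front p org d \<noteq> {}"
proof
  assume e: "front p org d = {}"
  have p0: "0 < p" using p prime_gt_0_int by blast
  have st: "org ((y + d) mod p) \<noteq> -2" if "org y \<noteq> -2" "0 \<le> y" "y < p" for y
  proof
    assume "org ((y + d) mod p) = -2"
    moreover have "((y + d) mod p - d) mod p = y" using that p0 by (simp add: mod_simps)
    ultimately have "(y + d) mod p \<in> front p org d" using that p0 by (simp add: front_def unm_def)
    then show False using e by simp
  qed
  have all: "org (int k * d mod p) \<noteq> -2" for k
  proof (induction k)
    case (Suc k)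
    have "(int k * d mod p + d) mod p = int (Suc k) * d mod p" by (simp add: mod_simps algebra_simps)
    then show ?case using st[OF Suc] p0 by simp
  qed (use 0 in simp)
  obtain y where y: "0 \<le> y" "y < p" "org y = -2" using u by (auto simp: unm_def)
  have "coprime d p" using p d by (metis coprime_commute prime_imp_coprime zdvd_not_zless)
  then obtain x where x: "[d * x = 1] (mod p)" using cong_solve_coprime_int by blast
  define k where "k = nat (x * y mod p)"
  have "[int k * d = y] (mod p)"
  proof -
    have "int k = x * y mod p" using p0 by (simp add: k_def)
    then have "[int k * d = (x * y) * d] (mod p)" by (simp add: cong_def mod_simps)
    also have "(x * y) * d = (d * x) * y" by simp
    also have "[\<dots> = 1 * y] (mod p)" using x by (intro cong_mult) auto
    finally show ?thesis by simp
  qed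
  then have "int k * d mod p = y" using y by (simp add: cong_def)
  then show False using all[of k] y by simp
qed

text \<open>An unreached \<open>y\<close> whose predecessor \<open>y - d\<close> had been reached
  before the marking was itself in the old frontier and is now marked. So the predecessor of a new
  frontier element belongs to \<open>W\<close>.\<close>

lemma front_step:
  assumes "0 < p" "W = front p org d" "0 \<le> i" "org' = (\<lambda>y. if y \<in> W then i else org y)"
  shows "unm p org' = unm p org - W"
    "front p org' d = {y. \<exists>z\<in>W. y = (z + d) mod p} \<inter> unm p org'"
proof -
  show U: "unm p org' = unm p org - W" using assms by (auto simp: unm_def)
  show "front p org' d = {y. \<exists>z\<in>W. y = (z + d) mod p} \<inter> unm p org'"
  proof (intro set_eqI iffI)
    fix y assume y: "y \<in> front p org' d"
    then have yu: "y \<in> unm p org'" "y \<in> unm p org" "y \<notin> W" "org' ((y - d) mod p) \<noteq> -2"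
      using U by (auto simp: front_def)
    then have "org ((y - d) mod p) = -2" using assms(2) by (auto simp: front_def)
    then have "(y - d) mod p \<in> W" using yu(4) assms(4) by (auto split: if_splits)
    moreover have "y = ((y - d) mod p + d) mod p" using yu by (simp add: mod_simps unm_def)
    ultimately show "y \<in> {y. \<exists>z\<in>W. y = (z + d) mod p} \<inter> unm p org'" using yu by blast
  next
    fix y assume "y \<in> {y. \<exists>z\<in>W. y = (z + d) mod p} \<inter> unm p org'"
    then obtain z where z: "z \<in> W" "y = (z + d) mod p" "y \<in> unm p org'" by blast
    have "z \<in> {0..<p}" using z assms(2) by (auto simp: front_def unm_def)
    then have "(y - d) mod p = z" using z by (simp add: mod_simps)
    then show "y \<in> front p org' d" using z assms(3,4) by (auto simp: front_def)
  qed
qed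

text \<open>The array encodes subset sums by pointers: from \<open>y\<close> one goes to
  \<open>y - v (org y)\<close>. The indices strictly decrease on the way, so no summand is used
  twice, and the path can end only at 0.\<close>

definition origin :: "int \<Rightarrow> (int \<Rightarrow> int) \<Rightarrow> int \<Rightarrow> (int \<Rightarrow> int) \<Rightarrow> bool" where
  "origin p v i org \<longleftrightarrow> org 0 = -1 \<and> (\<forall>y. 0 \<le> y \<and> y < p \<longrightarrow> org y = -2 \<or> (org y = -1 \<and> y = 0) \<or>
     (0 \<le> org y \<and> org y < i \<and> -1 \<le> org ((y - v (org y)) mod p) \<and> org ((y - v (org y)) mod p) < org y))"

lemma origin_step:
  assumes "origin p v i org" "0 < p" "0 \<le> i" "W = front p org (v i)"
  shows "origin p v (i + 1) (\<lambda>y. if y \<in> W then i else org y)"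
proof -
  let ?o = "\<lambda>y. if y \<in> W then i else org y"
  have W: "org y = -2" "0 \<le> y" "y < p" "org ((y - v i) mod p) \<noteq> -2" if "y \<in> W" for y
    using that assms(4) by (auto simp: front_def unm_def)
  have org: "org y = -2 \<or> (org y = -1 \<and> y = 0) \<or>
     (0 \<le> org y \<and> org y < i \<and> -1 \<le> org ((y - v (org y)) mod p) \<and> org ((y - v (org y)) mod p) < org y)"
    if "0 \<le> y" "y < p" for y using assms(1) that by (auto simp: origin_def)
  have m: "0 \<le> z mod p" "z mod p < p" for z using assms(2) by auto
  show ?thesis unfolding origin_def
  proof (intro conjI allI impI)
    show "?o 0 = -1" using assms(1) W[of 0] by (auto simp: origin_def)
    fix y assume y: "0 \<le> y \<and> y < p"
    show "?o y = -2 \<or> (?o y = -1 \<and> y = 0) \<or>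
     (0 \<le> ?o y \<and> ?o y < i + 1 \<and> -1 \<le> ?o ((y - v (?o y)) mod p) \<and> ?o ((y - v (?o y)) mod p) < ?o y)"
    proof (cases "y \<in> W")
      case True
      have "org ((y - v i) mod p) \<noteq> -2" using W True by blast
      then have "(y - v i) mod p \<notin> W" using W by blast
      moreover have "-1 \<le> org ((y - v i) mod p) \<and> org ((y - v i) mod p) < i"
        using org[OF m, of "y - v i"] W(4)[OF True] assms(3) by linarith
      ultimately show ?thesis using True assms(3) by auto
    next
      case False
      show ?thesis
      proof (cases "0 \<le> org y")
        case o: True
        then have oo: "org y < i" "-1 \<le> org ((y - v (org y)) mod p)" "org ((y - v (org y)) mod p) < org y"
          using org[of y] y by auto
        then have "(y - v (org y)) mod p \<notin> W" using W(1) by fastforce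
        then show ?thesis using False o oo by auto
      next
        case o: False
        then show ?thesis using org[of y] y False by auto
      qed
    qed
  qed
qed

context ram
begin

lemma fits_mod: "0 < p \<Longrightarrow> p \<le> sz \<Longrightarrow> fits (x mod p)"
  using pos_mod_bound[of p x] pos_mod_sign[of p x] by (intro fits_small) linarith

lemma wp_REBUILD:
  assumes b: "0 < vr s 4" "vr s 4 \<le> sz" "0 \<le> vr s 37" "vr s 37 \<le> vr s 4" "0 \<le> vr s 35" "vr s 35 < vr s 4"
    and ul: "ul = lst (ar s 21) (vr s 37)" "set ul \<subseteq> {0..<vr s 4}"
    and Q: "\<And>t. lst (ar t 21) (vr t 37) = filter (\<lambda>y. ar s 20 y = -2) ul \<Longrightarrow>
      lst (ar t 22) (vr t 38) = filter (\<lambda>y. ar s 20 y = -2 \<and> -2 < ar s 20 ((y - vr s 35) mod vr s 4)) ul \<Longrightarrow>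
      0 \<le> vr t 37 \<Longrightarrow> 0 \<le> vr t 38 \<Longrightarrow> vr t 39 = vr s 35 \<Longrightarrow> vr t 37 \<le> vr s 37 \<Longrightarrow> vr t 38 \<le> vr s 37 \<Longrightarrow>
      int (tk t) = int (tk s) + vr s 37 \<Longrightarrow> frame REBUILD s t \<Longrightarrow> Q t"
  shows "wp REBUILD Q s"
proof -
  define org where "org = ar s 20"
  define p where "p = vr s 4"
  define d where "d = vr s 35"
  define n where "n = vr s 37"
  note b' = b[folded p_def d_def n_def]
  define P where "P = (\<lambda>y. org y = -2)"
  define R where "R = (\<lambda>y. -2 < org ((y - d) mod p))"
  define J where "J = (\<lambda>k (v :: nat \<Rightarrow> int) (a :: nat \<Rightarrow> int \<Rightarrow> int). 0 \<le> v 32 \<and> v 32 \<le> k \<and> 0 \<le> v 38 \<and> v 38 \<le> k \<and>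
      lst (a 21) (v 32) = filter P (take (nat k) ul) \<and> (\<forall>i\<ge>k. a 21 i = ar s 21 i) \<and>
      lst (a 22) (v 38) = filter (\<lambda>y. P y \<and> R y) (take (nat k) ul))"
  let ?s = "s\<lparr>vr := (vr s)(32 := 0, 38 := 0)\<rparr>"
    have "wp (For 30 37 (33 ::= A 21 (V 30) ;;
       Cond (Eq (A 20 (V 33)) (N (-2)))
         (Sto 21 (V 32) (V 33) ;; 32 ::= V 32 .+ N 1 ;;
          Cond (Lt (N (-2)) (A 20 ((V 33 .- V 35) .mod V 4))) (Sto 22 (V 38) (V 33) ;; 38 ::= V 38 .+ N 1) Skip)
         Skip)) (\<lambda>t. J n (vr t) (ar t) \<and> int (tk t) = int (tk s) + n \<and> vr t 35 = d) ?s"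
    proof (rule wp_For[where P = "\<lambda>k t. J k (vr t) (ar t) \<and> int (tk t) = int (tk s) + k"], goal_cases)
      case 1 then show ?case by (simp add: J_def)
    next
      case (2 k t)
      have k: "0 \<le> k" "k < n" "vr t 30 = k" using 2 by (auto simp: n_def)
      have fr: "ar t 20 = org" "vr t 4 = p" "vr t 35 = d"
        using frameD[OF 2(5)] by (auto simp: org_def p_def d_def)
      have j: "0 \<le> vr t 32" "vr t 32 \<le> k" "0 \<le> vr t 38" "vr t 38 \<le> k"
        "lst (ar t 21) (vr t 32) = filter P (take (nat k) ul)" "\<forall>i\<ge>k. ar t 21 i = ar s 21 i"
        "lst (ar t 22) (vr t 38) = filter (\<lambda>y. P y \<and> R y) (take (nat k) ul)"
        using 2(3) unfolding J_def by blast+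
      define x where "x = ar t 21 k"
      have xu: "x = ul ! nat k" "nat k < length ul" using j(6) k by (auto simp: x_def ul n_def)
      then have x: "0 \<le> x" "x < p" using ul(2) nth_mem unfolding p_def by fastforce+
      have ta: "take (nat (k + 1)) ul = take (nat k) ul @ [x]"
        using xu k by (simp add: nat_add_distrib take_Suc_conv_app_nth)
      have ft: "fits (vr t 32 + 1)" "fits (vr t 38 + 1)" "fits (x - d)"
        using j k x b' by (auto intro!: fits_small)
      have ft4: "fits ((x - d) mod p)" using b' by (intro fits_mod) auto
      have "(x - d) mod p < p" using b' by simp
      then have md: "0 \<le> (x - d) mod p" "(x - d) mod p < sz" using b'(1,2) by (simp, linarith)
      note lc1 = lst_compact[OF j(1,2,5,6), of x]
      have lc2: "lst ((ar t 22)(vr t 38 := x)) (vr t 38 + 1) = filter (\<lambda>y. P y \<and> R y) (take (nat k) ul) @ [x]"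
        using j by (simp add: lst_Suc)
      have big: "k < sz" "x < sz" "vr t 32 < sz" "vr t 38 < sz" using k x j b' by auto
      have a2: "\<forall>i\<ge>k + 1. ar t 21 i = ar s 21 i" using j(6) by auto
      show ?case
      proof (cases "P x")
        case False
        then have "org x \<noteq> -2" by (simp add: P_def)
        then show ?thesis using False 2(3) k fr j a2 x big
          by (simp add: wp_simps x_def[symmetric] J_def ta)
      next
        case True
        then have ox: "org x = -2" by (simp add: P_def)
        show ?thesis
        proof (cases "R x")
          case RT: True
          then have "-2 < org ((x - d) mod p)" by (simp add: R_def)
          then show ?thesis using True RT ox 2(3) k fr j x big ft ft4 md lc1 lc2
            by (simp add: wp_simps x_def[symmetric] J_def ta)
        next
          case RF: False
          then have "\<not> -2 < org ((x - d) mod p)" by (simp add: R_def)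
          then show ?thesis using True RF ox 2(3) k fr j x big ft ft4 md lc1
            by (simp add: wp_simps x_def[symmetric] J_def ta)
        qed
      qed
    next
      case (3 t)
      then show ?case using frameD[OF 3(3)] by (auto simp: n_def d_def)
    qed (use b' in \<open>auto simp: n_def\<close>)
  then have "wp REBUILD (\<lambda>t. lst (ar t 21) (vr t 37) = filter P ul \<and> lst (ar t 22) (vr t 38) = filter (\<lambda>y. P y \<and> R y) ul \<and>
      0 \<le> vr t 37 \<and> 0 \<le> vr t 38 \<and> vr t 39 = d \<and> vr t 37 \<le> n \<and> vr t 38 \<le> n \<and> int (tk t) = int (tk s) + n) s"
    unfolding REBUILD_def wp_simps(4)
    apply (subst wp_simps(2), subst wp_simps(2))
    apply simp
    apply (erule wp_conseq)
    using ul by (simp add: wp_simps J_def n_def)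
  then show ?thesis
    by (rule wp_conseq) (rule Q; simp add: P_def R_def org_def p_def d_def n_def)
qed

lemma wp_MARK:
  assumes "0 \<le> vr s 38" "vr s 38 \<le> sz" "\<forall>y\<in>set (lst (ar s 22) (vr s 38)). 0 \<le> y \<and> y < sz"
    and Q: "\<And>t. ar t 20 = (\<lambda>y. if y \<in> set (lst (ar s 22) (vr s 38)) then vr s 36 else ar s 20 y) \<Longrightarrow>
      int (tk t) = int (tk s) + vr s 38 \<Longrightarrow> frame MARK s t \<Longrightarrow> Q t"
  shows "wp MARK Q s"
  unfolding MARK_def
proof (rule wp_For[where P = "\<lambda>k t. ar t 20 = (\<lambda>y. if y \<in> set (lst (ar s 22) k) then vr s 36 else ar s 20 y) \<and>
     int (tk t) = int (tk s) + k"], goal_cases)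
  case (2 k t)
  have fr: "ar t 22 = ar s 22" "vr t 36 = vr s 36" using frameD[OF 2(5)] by auto
  have "ar s 22 k \<in> set (lst (ar s 22) (vr s 38))" using 2 by (auto simp: set_lst)
  then have "0 \<le> ar s 22 k" "ar s 22 k < sz" using assms by auto
  then show ?case using 2(1-4) fr assms by (simp add: wp_simps lst_Suc fun_eq_iff)
next
  case (3 t)
  then show ?case using Q by (simp add: MARK_def)
qed (use assms in auto)

lemma wp_ADVANCE:
  assumes b: "0 < vr s 4" "vr s 4 \<le> sz" "0 \<le> vr s 38" "vr s 38 \<le> vr s 4" "0 \<le> vr s 35" "vr s 35 < vr s 4"
    and wl: "wl = lst (ar s 22) (vr s 38)" "set wl \<subseteq> {0..<vr s 4}"
    and Q: "\<And>t. lst (ar t 22) (vr t 38) = filter (\<lambda>y. ar s 20 y = -2) (map (\<lambda>y. (y + vr s 35) mod vr s 4) wl) \<Longrightarrow>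
      0 \<le> vr t 38 \<Longrightarrow> vr t 38 \<le> vr s 38 \<Longrightarrow>
      int (tk t) = int (tk s) + vr s 38 \<Longrightarrow> frame ADVANCE s t \<Longrightarrow> Q t"
  shows "wp ADVANCE Q s"
proof -
  define org where "org = ar s 20"
  define p where "p = vr s 4"
  define d where "d = vr s 35"
  define n where "n = vr s 38"
  note b' = b[folded p_def d_def n_def]
  define P where "P = (\<lambda>y. org y = -2)"
  define zs where "zs = map (\<lambda>y. (y + d) mod p) wl"
  define J where "J = (\<lambda>k (v :: nat \<Rightarrow> int) (a :: nat \<Rightarrow> int \<Rightarrow> int). 0 \<le> v 32 \<and> v 32 \<le> k \<and>
      lst (a 22) (v 32) = filter P (take (nat k) zs) \<and> (\<forall>i\<ge>k. a 22 i = ar s 22 i))"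
  have "wp (For 30 38 (33 ::= (A 22 (V 30) .+ V 35) .mod V 4 ;;
       Cond (Eq (A 20 (V 33)) (N (-2))) (Sto 22 (V 32) (V 33) ;; 32 ::= V 32 .+ N 1) Skip))
     (\<lambda>t. J n (vr t) (ar t) \<and> int (tk t) = int (tk s) + n) (s\<lparr>vr := (vr s)(32 := 0)\<rparr>)"
  proof (rule wp_For[where P = "\<lambda>k t. J k (vr t) (ar t) \<and> int (tk t) = int (tk s) + k"], goal_cases)
    case 1 then show ?case by (simp add: J_def)
  next
    case (2 k t)
    have k: "0 \<le> k" "k < n" "vr t 30 = k" using 2 by (auto simp: n_def)
    have fr: "ar t 20 = org" "vr t 4 = p" "vr t 35 = d"
      using frameD[OF 2(5)] by (auto simp: org_def p_def d_def)
    have j: "0 \<le> vr t 32" "vr t 32 \<le> k"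
      "lst (ar t 22) (vr t 32) = filter P (take (nat k) zs)" "\<forall>i\<ge>k. ar t 22 i = ar s 22 i"
      using 2(3) unfolding J_def by blast+
    define y where "y = ar t 22 k"
    define x where "x = (y + d) mod p"
    have yu: "y = wl ! nat k" "nat k < length wl" using j(4) k by (auto simp: y_def wl n_def)
    then have y: "0 \<le> y" "y < p" using wl(2) nth_mem unfolding p_def by fastforce+
    have x: "0 \<le> x" "x < p" using b' by (auto simp: x_def)
    have ta: "take (nat (k + 1)) zs = take (nat k) zs @ [x]"
      using yu k by (simp add: nat_add_distrib take_Suc_conv_app_nth zs_def x_def)
    have ft: "fits (vr t 32 + 1)" "fits (y + d)" "fits x"
      using j k x y b' by (auto intro!: fits_small)
    note lc1 = lst_compact[OF j, of x]
    have big: "k < sz" "x < sz" "vr t 32 < sz" using k x j b' by auto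
    have a2: "\<forall>i\<ge>k + 1. ar t 22 i = ar s 22 i" using j(4) by auto
    show ?case
    proof (cases "P x")
      case False
      then have "org x \<noteq> -2" by (simp add: P_def)
      then show ?thesis using False 2(3) k fr j a2 x big ft
        by (simp add: wp_simps y_def[symmetric] x_def[symmetric] J_def ta)
    next
      case True
      then have ox: "org x = -2" by (simp add: P_def)
      then show ?thesis using True 2(3) k fr j x big ft lc1
        by (simp add: wp_simps y_def[symmetric] x_def[symmetric] J_def ta)
    qed
  next
    case (3 t)
    then show ?case by (auto simp: n_def)
  qed (use b' in \<open>auto simp: n_def\<close>)
  then have "wp ADVANCE (\<lambda>t. lst (ar t 22) (vr t 38) = filter P zs \<and> 0 \<le> vr t 38 \<and> vr t 38 \<le> n \<and> int (tk t) = int (tk s) + n) s"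
    unfolding ADVANCE_def wp_simps(4)
    apply (subst wp_simps(2))
    apply simp
    apply (erule wp_conseq)
    using wl by (simp add: wp_simps J_def zs_def n_def)
  then show ?thesis
    by (rule wp_conseq) (rule Q; simp add: P_def zs_def org_def p_def d_def n_def)
qed

text \<open>Amortisation with the potential consisting of twice the number of unreached residues
  plus the length of the list in array 21. Marking and advancing cost 2 for each newly reached
  residue. A rebuild is paid by the old length of the list; the new length, at most
  \<open>p - 1 - i\<close>, is charged to the run of equal values that begins at \<open>i\<close>,
  by \<open>H\<close>.\<close>

lemma wp_WALK:
  fixes Ka :: int
  assumes b: "prime (vr s 4)" "vr s 4 \<le> sz" "0 \<le> vr s 13" "vr s 13 \<le> vr s 4" "0 \<le> Ka"
    and v: "v = (\<lambda>i. ar s 5 (ar s 14 i))"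
      "\<And>i. 0 \<le> i \<Longrightarrow> i < vr s 13 \<Longrightarrow> 0 \<le> ar s 14 i \<and> ar s 14 i < sz \<and> 0 < v i \<and> v i < vr s 4"
    and H: "\<And>i. 0 < i \<Longrightarrow> i < vr s 13 \<Longrightarrow> v i \<noteq> v (i - 1) \<Longrightarrow>
       \<exists>e. i < e \<and> e \<le> vr s 13 \<and> (\<forall>j. i \<le> j \<and> j < e \<longrightarrow> v j = v i) \<and> vr s 4 - 1 - i \<le> Ka * (e - i)"
    and Q: "\<And>t. origin (vr s 4) v (vr s 13) (ar t 20) \<Longrightarrow>
      int (card (unm (vr s 4) (ar t 20))) \<le> max 0 (vr s 4 - 1 - vr s 13) \<Longrightarrow>
      int (tk t) \<le> int (tk s) + 6 * vr s 4 + Ka * vr s 13 \<Longrightarrow> frame WALK s t \<Longrightarrow> Q t"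
  shows "wp WALK Q s"
proof -
  define p where "p = vr s 4"
  define n where "n = vr s 13"
  define T where "T = int (tk s)"
  note b' = b[folded p_def n_def]
  have p0: "0 < p" "1 < p" using b'(1) prime_gt_0_int prime_gt_1_int by auto
  let ?for = "For 36 13 (35 ::= A 5 (A 14 (V 36)) ;; Cond (Eq (V 35) (V 39)) Skip REBUILD ;; MARK ;; ADVANCE)"
  \<comment> \<open>\<open>ce\<close> is the end of the stretch that has been charged. Up to
    \<open>ce\<close> the step does not change, so no rebuild happens there and each index is
    charged at most once.\<close>
  define J where "J = (\<lambda>i (x :: nat \<Rightarrow> int) (a :: nat \<Rightarrow> int \<Rightarrow> int) tt. origin p v i (a 20) \<and>
     int (card (unm p (a 20))) \<le> max 0 (p - 1 - i) \<and>
     (if i = 0 then x 39 = -1 else x 39 = v (i - 1) \<and> set (lst (a 22) (x 38)) = front p (a 20) (x 39) \<and>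
        distinct (lst (a 22) (x 38))) \<and> 0 \<le> x 38 \<and>
     distinct (lst (a 21) (x 37)) \<and> unm p (a 20) \<subseteq> set (lst (a 21) (x 37)) \<and> set (lst (a 21) (x 37)) \<subseteq> {0..<p} \<and>
     0 \<le> x 37 \<and> x 37 \<le> p \<and>
     (\<exists>ce\<ge>i. ce \<le> n \<and> (\<forall>j. i \<le> j \<and> j < ce \<longrightarrow> i \<noteq> 0 \<and> v j = x 39) \<and>
       tt + 2 * int (card (unm p (a 20))) + x 37 \<le> T + (if i = 0 then 4 else 5) * p + i + Ka * ce))"
  have cardle: "int (card X) \<le> p" if "X \<subseteq> {0..<p}" for X
    using card_mono[OF _ that] p0 by simp
  have main: "wp ?for (\<lambda>t. J n (vr t) (ar t) (int (tk t))) t"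
    if t: "J 0 (vr t) (ar t) (int (tk t))" and fr: "vr t 4 = p" "vr t 13 = n" "ar t 5 = ar s 5" "ar t 14 = ar s 14" for t
  proof (rule wp_For[where P = "\<lambda>k u. J k (vr u) (ar u) (int (tk u))"], goal_cases)
    case 1
    then show ?case using t by (simp add: J_def)
  next
    case (2 i u)
    have i: "0 \<le> i" "i < n" "vr u 36 = i" using 2 fr by auto
    have fu: "vr u 4 = p" "vr u 13 = n" "ar u 5 = ar s 5" "ar u 14 = ar s 14"
      using frameD[OF 2(5)] fr by auto
    define org where "org = ar u 20"
    define d where "d = v i"
    have d: "0 < d" "d < p" "0 \<le> ar s 14 i" "ar s 14 i < sz" "ar s 5 (ar s 14 i) = d"
      using v(2)[of i] i by (auto simp: d_def n_def p_def v(1))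
    define ul where "ul = lst (ar u 21) (vr u 37)"
    have j: "origin p v i org" "int (card (unm p org)) \<le> max 0 (p - 1 - i)"
      "i = 0 \<Longrightarrow> vr u 39 = -1" "i \<noteq> 0 \<Longrightarrow> vr u 39 = v (i - 1)"
      "i \<noteq> 0 \<Longrightarrow> set (lst (ar u 22) (vr u 38)) = front p org (vr u 39)"
      "i \<noteq> 0 \<Longrightarrow> distinct (lst (ar u 22) (vr u 38))" "0 \<le> vr u 38"
      "distinct ul" "unm p org \<subseteq> set ul" "set ul \<subseteq> {0..<p}" "0 \<le> vr u 37" "vr u 37 \<le> p"
      using 2(3) by (auto simp: J_def org_def ul_def split: if_splits)
    obtain ce where ce: "i \<le> ce" "ce \<le> n" "\<forall>j. i \<le> j \<and> j < ce \<longrightarrow> i \<noteq> 0 \<and> v j = vr u 39"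
      "int (tk u) + 2 * int (card (unm p org)) + vr u 37 \<le> T + (if i = 0 then 4 else 5) * p + i + Ka * ce"
      using 2(3) unfolding J_def org_def by blast
    define Ready where "Ready = (\<lambda>x :: st. ar x 20 = org \<and> vr x 4 = p \<and> vr x 13 = n \<and> vr x 36 = i \<and> vr x 35 = d \<and> vr x 39 = d \<and>
      ar x 5 = ar s 5 \<and> ar x 14 = ar s 14 \<and>
      set (lst (ar x 22) (vr x 38)) = front p org d \<and> distinct (lst (ar x 22) (vr x 38)) \<and> 0 \<le> vr x 38 \<and>
      distinct (lst (ar x 21) (vr x 37)) \<and> unm p org \<subseteq> set (lst (ar x 21) (vr x 37)) \<and> set (lst (ar x 21) (vr x 37)) \<subseteq> {0..<p} \<and>
      0 \<le> vr x 37 \<and> vr x 37 \<le> p \<and>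
      (\<exists>ce\<ge>i + 1. ce \<le> n \<and> (\<forall>j. i + 1 \<le> j \<and> j < ce \<longrightarrow> v j = d) \<and>
       int (tk x) + 2 * int (card (unm p org)) + vr x 37 \<le> T + 5 * p + (i + 1) + Ka * ce))"
    have after: "wp (MARK ;; ADVANCE) (\<lambda>t'. J (i + 1) (vr (t'\<lparr>vr := (vr t')(36 := i + 1)\<rparr>)) (ar (t'\<lparr>vr := (vr t')(36 := i + 1)\<rparr>)) (int (tk (t'\<lparr>vr := (vr t')(36 := i + 1)\<rparr>)))) x"
      if "Ready x" for x
    proof -
      have x: "ar x 20 = org" "vr x 4 = p" "vr x 36 = i" "vr x 35 = d" "vr x 39 = d"
        "set (lst (ar x 22) (vr x 38)) = front p org d" "distinct (lst (ar x 22) (vr x 38))" "0 \<le> vr x 38"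
        "distinct (lst (ar x 21) (vr x 37))" "unm p org \<subseteq> set (lst (ar x 21) (vr x 37))" "set (lst (ar x 21) (vr x 37)) \<subseteq> {0..<p}"
        "0 \<le> vr x 37" "vr x 37 \<le> p" using that by (simp_all add: Ready_def)
      have "\<exists>ce\<ge>i + 1. ce \<le> n \<and> (\<forall>j. i + 1 \<le> j \<and> j < ce \<longrightarrow> v j = d) \<and>
         int (tk x) + 2 * int (card (unm p org)) + vr x 37 \<le> T + 5 * p + (i + 1) + Ka * ce"
        using that unfolding Ready_def by (elim conjE)
      then obtain ce where ce: "i + 1 \<le> ce" "ce \<le> n" "\<forall>j. i + 1 \<le> j \<and> j < ce \<longrightarrow> v j = d"
       "int (tk x) + 2 * int (card (unm p org)) + vr x 37 \<le> T + 5 * p + (i + 1) + Ka * ce"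
        by blast
      define W where "W = front p org d"
      define wl where "wl = lst (ar x 22) (vr x 38)"
      have Wp: "W \<subseteq> {0..<p}" "W \<subseteq> unm p org" by (auto simp: W_def front_def unm_def)
      have nw: "vr x 38 = int (card W)"
        using distinct_card[OF x(7)] x(6,8) by (simp add: W_def)
      have nwp: "vr x 38 \<le> p" unfolding nw by (rule cardle[OF Wp(1)])
      define org' where "org' = (\<lambda>y. if y \<in> W then i else org y)"
      have fs: "unm p org' = unm p org - W" "front p org' d = {y. \<exists>z\<in>W. y = (z + d) mod p} \<inter> unm p org'"
        using front_step[OF p0(1) W_def i(1) org'_def] by auto
      have cu: "card (unm p org') + card W = card (unm p org)"
      proof -
        have "card W \<le> card (unm p org)" using Wp by (intro card_mono) auto
        then show ?thesis unfolding fs(1) using Wp card_Diff_subset[of W "unm p org"] finite_subset[OF Wp(2)] by simp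
      qed
      show ?thesis unfolding wp_simps(4)
      proof (rule wp_MARK)
        fix y assume y: "ar y 20 = (\<lambda>z. if z \<in> set (lst (ar x 22) (vr x 38)) then vr x 36 else ar x 20 z)"
          "int (tk y) = int (tk x) + vr x 38" "frame MARK x y"
        have y20: "ar y 20 = org'" by (simp only: y(1) x(6) x(3) x(1) org'_def W_def)
        have fy: "vr y 4 = p" "vr y 35 = d" "vr y 38 = vr x 38" "ar y 22 = ar x 22" "vr y 39 = d" "vr y 37 = vr x 37" "ar y 21 = ar x 21"
          using frameD[OF y(3)] x by auto
        show "wp ADVANCE (\<lambda>t'. J (i + 1) (vr (t'\<lparr>vr := (vr t')(36 := i + 1)\<rparr>)) (ar (t'\<lparr>vr := (vr t')(36 := i + 1)\<rparr>)) (int (tk (t'\<lparr>vr := (vr t')(36 := i + 1)\<rparr>)))) y"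
        proof (rule wp_ADVANCE[where wl = wl])
          fix z assume z: "lst (ar z 22) (vr z 38) = filter (\<lambda>q. ar y 20 q = -2) (map (\<lambda>q. (q + vr y 35) mod vr y 4) wl)"
            "0 \<le> vr z 38" "vr z 38 \<le> vr y 38" "int (tk z) = int (tk y) + vr y 38" "frame ADVANCE y z"
          have fz: "ar z 20 = org'" "vr z 39 = d" "vr z 37 = vr x 37" "ar z 21 = ar x 21"
            using frameD[OF z(5)] fy y20 by auto
          have zl: "lst (ar z 22) (vr z 38) = filter (\<lambda>q. org' q = -2) (map (\<lambda>q. (q + d) mod p) wl)"
            using z(1) fy y20 by simp
          have "set (lst (ar z 22) (vr z 38)) = front p org' d"
            unfolding zl fs(2) using x(6) p0 by (auto simp: wl_def W_def[symmetric] unm_def)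
          moreover have "distinct (map (\<lambda>q. (q + d) mod p) wl)"
          proof -
            have "inj_on (\<lambda>q. (q + d) mod p) (set wl)"
            proof (rule inj_onI)
              fix q r assume q: "q \<in> set wl" "r \<in> set wl" "(q + d) mod p = (r + d) mod p"
              then have "((q + d) mod p - d) mod p = ((r + d) mod p - d) mod p" by simp
              then have "q mod p = r mod p" by (simp add: mod_simps)
              moreover have "q \<in> {0..<p}" "r \<in> {0..<p}" using q x(6) Wp(1) by (auto simp: wl_def W_def)
              ultimately show "q = r" by simp
            qed
            then show ?thesis using x(7) by (simp add: distinct_map wl_def)
          qed
          ultimately have w: "set (lst (ar z 22) (vr z 38)) = front p org' d" "distinct (lst (ar z 22) (vr z 38))"
            unfolding zl by auto
          have "origin p v (i + 1) org'" unfolding org'_def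
            using origin_step[OF j(1) p0(1) i(1)] W_def d_def by simp
          moreover have "int (card (unm p org')) \<le> max 0 (p - 1 - (i + 1))"
          proof (cases "unm p org = {}")
            case True
            then show ?thesis using fs(1) by simp
          next
            case False
            have "org 0 \<noteq> -2" using j(1) by (simp add: origin_def)
            then have "W \<noteq> {}" unfolding W_def using front_nonempty[OF b'(1) d(1,2) _ False] by simp
            then have "0 < card W" using finite_subset[OF Wp(2)] by (simp add: card_gt_0_iff)
            then show ?thesis using cu j(2) by linarith
          qed
          moreover have "int (tk z) + 2 * int (card (unm p org')) + vr x 37 \<le> T + 5 * p + (i + 1) + Ka * ce"
            using ce(4) z(4) y(2) fy(3) nw cu by linarith
          moreover have "unm p org' \<subseteq> set (lst (ar x 21) (vr x 37))" using x(10) fs(1) by auto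
          ultimately show "J (i + 1) (vr (z\<lparr>vr := (vr z)(36 := i + 1)\<rparr>)) (ar (z\<lparr>vr := (vr z)(36 := i + 1)\<rparr>)) (int (tk (z\<lparr>vr := (vr z)(36 := i + 1)\<rparr>)))"
            using i(1) fz w x(9,11,12,13) z(2) ce(1-3) d_def unfolding J_def by auto
        next
          show "set wl \<subseteq> {0..<vr y 4}" using x(6) Wp(1) fy by (simp add: wl_def W_def)
          show "wl = lst (ar y 22) (vr y 38)" using fy by (simp add: wl_def)
        qed (use fy b' p0 d nwp x(8) in auto)
      qed (use x nwp b' Wp in \<open>auto simp: W_def\<close>)
    qed
    show ?case unfolding wp_simps(4) wp_simps(2)
    proof (intro conjI)
      let ?x = "u\<lparr>tk := tk u + 1\<rparr>\<lparr>vr := (vr (u\<lparr>tk := tk u + 1\<rparr>))(35 := ev (A 5 (A 14 (V 36))) (u\<lparr>tk := tk u + 1\<rparr>))\<rparr>"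
      have x: "ar ?x = ar u" "vr ?x 35 = d" "vr ?x 39 = vr u 39" "vr ?x 37 = vr u 37" "vr ?x 38 = vr u 38" "vr ?x 36 = i"
        "vr ?x 4 = p" "vr ?x 13 = n" "int (tk ?x) = int (tk u) + 1"
        using fu d i by simp_all
      show "wp (Cond (Eq (V 35) (V 39)) Skip REBUILD)
        (wp MARK (wp ADVANCE (\<lambda>t'. J (i + 1) (vr (t'\<lparr>vr := (vr t')(36 := i + 1)\<rparr>)) (ar (t'\<lparr>vr := (vr t')(36 := i + 1)\<rparr>)) (int (tk (t'\<lparr>vr := (vr t')(36 := i + 1)\<rparr>)))))) ?x"
      proof (cases "vr u 39 = d")
        case True
        then have i0: "i \<noteq> 0" using j(3) d by auto
        have "\<exists>ce'\<ge>i + 1. ce' \<le> n \<and> (\<forall>j. i + 1 \<le> j \<and> j < ce' \<longrightarrow> v j = d) \<and>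
          int (tk u) + 1 + 2 * int (card (unm p org)) + vr u 37 \<le> T + 5 * p + (i + 1) + Ka * ce'"
        proof (cases "ce = i")
          case False
          then show ?thesis using ce i0 True by (intro exI[of _ ce]) auto
        next
          \<comment> \<open>The charged stretch may end before the class does; then it is prolonged
            by one index.\<close>
          case ci: True
          have "Ka * i \<le> Ka * (i + 1)" using b'(5) by (intro mult_left_mono) auto
          then show ?thesis using ce i0 True i(2) ci by (intro exI[of _ "i + 1"]) auto
        qed
        then have "Ready ?x" unfolding Ready_def
          using x fu i0 True j(5-) by (simp add: org_def ul_def)
        then show ?thesis using after[of ?x] True x by (intro wp_CondT) (simp_all add: wp_simps(1,4))
      next
        case False
        show ?thesis
        proof (rule wp_CondF)
          show "wp REBUILD (wp MARK (wp ADVANCE (\<lambda>t'. J (i + 1) (vr (t'\<lparr>vr := (vr t')(36 := i + 1)\<rparr>)) (ar (t'\<lparr>vr := (vr t')(36 := i + 1)\<rparr>)) (int (tk (t'\<lparr>vr := (vr t')(36 := i + 1)\<rparr>)))))) ?x"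
          proof (rule wp_REBUILD[where ul = ul])
            fix y assume y: "lst (ar y 21) (vr y 37) = filter (\<lambda>y. ar ?x 20 y = -2) ul"
              "lst (ar y 22) (vr y 38) = filter (\<lambda>y. ar ?x 20 y = -2 \<and> -2 < ar ?x 20 ((y - vr ?x 35) mod vr ?x 4)) ul"
              "0 \<le> vr y 37" "0 \<le> vr y 38" "vr y 39 = vr ?x 35" "vr y 37 \<le> vr ?x 37" "vr y 38 \<le> vr ?x 37"
              "int (tk y) = int (tk ?x) + vr ?x 37" "frame REBUILD ?x y"
            have l1: "lst (ar y 21) (vr y 37) = filter (\<lambda>y. org y = -2) ul"
              and l2: "lst (ar y 22) (vr y 38) = filter (\<lambda>y. org y = -2 \<and> -2 < org ((y - d) mod p)) ul"
              using y(1,2) x unfolding org_def by simp_all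
            have s1: "set (lst (ar y 21) (vr y 37)) = unm p org"
              unfolding l1 using j(9,10) by (auto simp: unm_def)
            have og: "-2 < org z \<longleftrightarrow> org z \<noteq> -2" if "0 \<le> z" "z < p" for z
              using j(1) that unfolding origin_def by force
            have s2: "set (lst (ar y 22) (vr y 38)) = front p org d"
              unfolding l2 front_def using j(9,10) og p0 by (auto simp: unm_def)
            have dd: "distinct (lst (ar y 21) (vr y 37))" "distinct (lst (ar y 22) (vr y 38))"
              unfolding l1 l2 using j(8) by simp_all
            have nu: "vr y 37 = int (card (unm p org))"
              using distinct_card[OF dd(1)] s1 y(3) by simp
            have fy: "ar y 20 = org" "vr y 4 = p" "vr y 13 = n" "vr y 36 = i" "vr y 35 = d" "ar y 5 = ar s 5" "ar y 14 = ar s 14"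
              using frameD[OF y(9)] x fu by (auto simp: org_def)
            have up: "unm p org \<subseteq> {0..<p}" by (auto simp: unm_def)
            have "\<exists>ce'\<ge>i + 1. ce' \<le> n \<and> (\<forall>j. i + 1 \<le> j \<and> j < ce' \<longrightarrow> v j = d) \<and>
              int (tk y) + 2 * int (card (unm p org)) + vr y 37 \<le> T + 5 * p + (i + 1) + Ka * ce'"
            \<comment> \<open>\<open>H\<close> says nothing about the first rebuild; it is paid by
              the passage from \<open>4 * p\<close> to \<open>5 * p\<close>.\<close>
            proof (cases "i = 0")
              case True
              have "vr y 37 \<le> p" unfolding nu by (rule cardle[OF up])
              moreover have "ce = 0"
              proof (rule ccontr)
                assume "ce \<noteq> 0"
                then show False using ce(1) ce(3)[rule_format, of 0] True by auto
              qed
              ultimately show ?thesis using ce(4) True y(8) x i(2) b'(5) by (intro exI[of _ "1"]) auto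
            next
              case i0: False
              then have "v i \<noteq> v (i - 1)" using False j(4) d_def by simp
              then obtain e where e: "i < e" "e \<le> n" "\<forall>j. i \<le> j \<and> j < e \<longrightarrow> v j = v i" "p - 1 - i \<le> Ka * (e - i)"
                using H[of i] i i0 by (auto simp: n_def p_def)
              have "ce = i"
              proof (rule ccontr)
                assume "ce \<noteq> i"
                then have "v i = vr u 39" using ce(1) ce(3)[rule_format, of i] by auto
                then show False using False d_def by simp
              qed
              then have c4: "int (tk u) + 2 * int (card (unm p org)) + vr u 37 \<le> T + 5 * p + i + Ka * i"
                using ce(4) i0 by simp
              have c1: "Ka * e = Ka * i + Ka * (e - i)" by (simp add: algebra_simps)
              have "0 \<le> Ka * (e - i)" using b'(5) e by simp
              then have c2: "vr y 37 \<le> Ka * (e - i)" unfolding nu using j(2) e(4) by linarith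
              have c3: "int (tk y) = int (tk u) + 1 + vr u 37" using y(8) x(4,9) by linarith
              have "int (tk y) + 2 * int (card (unm p org)) + vr y 37 \<le> T + 5 * p + (i + 1) + Ka * e"
                using c1 c2 c3 c4 by linarith
              moreover have "\<forall>j. i + 1 \<le> j \<and> j < e \<longrightarrow> v j = d"
                unfolding d_def by (intro allI impI e(3)[rule_format]) linarith
              moreover have "i + 1 \<le> e" using e(1) by simp
              ultimately show ?thesis using e(2) by blast
            qed
            then have "Ready y" unfolding Ready_def
              using fy s1 s2 dd y(3,4) y(5)[unfolded x(2)] y(6)[unfolded x(4)] j(12) up
              by (intro conjI; (assumption | (simp; fail) | linarith))
            then show "wp MARK (wp ADVANCE (\<lambda>t'. J (i + 1) (vr (t'\<lparr>vr := (vr t')(36 := i + 1)\<rparr>)) (ar (t'\<lparr>vr := (vr t')(36 := i + 1)\<rparr>)) (int (tk (t'\<lparr>vr := (vr t')(36 := i + 1)\<rparr>))))) y"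
              using after[of y] by (simp add: wp_simps(4))
          qed (use x b' p0 j d in \<open>auto simp: ul_def\<close>)
        qed (use False x in auto)
      qed
    qed (use d fu i b' in \<open>auto simp: p_def n_def\<close>)
  next
    case (3 u)
    then show ?case using fr by simp
  qed (use fr b' in auto)
  have "wp WALK (\<lambda>t. J n (vr t) (ar t) (int (tk t))) s"
    unfolding WALK_def wp_simps(4)
  proof (rule wp_For[where P = "\<lambda>k t. (\<forall>y. 0 \<le> y \<and> y < k \<longrightarrow> ar t 20 y = -2 \<and> ar t 21 y = y + 1) \<and> int (tk t) = T + k"], goal_cases)
    case 1 then show ?case by (simp add: T_def)
  next
    case (2 k t)
    then have "fits (k + 1)" using b by (intro fits_small) auto
    then show ?case using 2(1-4) b by (auto simp: wp_simps)
  next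
    case (3 t)
    have t: "\<forall>y. 0 \<le> y \<and> y < p \<longrightarrow> ar t 20 y = -2 \<and> ar t 21 y = y + 1" "int (tk t) = T + p" "vr t 4 = p"
      "vr t 13 = n" "ar t 5 = ar s 5" "ar t 14 = ar s 14"
      using 3(1) frameD[OF 3(3)] by (auto simp: p_def n_def)
    define org where "org = (ar t 20)(0 := -1)"
    have l1: "lst (ar t 21) (p - 1) = map (\<lambda>i. int i + 1) [0..<nat (p - 1)]"
      unfolding lst_def using t(1) p0 by auto
    have s1: "set (lst (ar t 21) (p - 1)) = {1..<p}"
    proof -
      have "(\<lambda>y. ar t 21 y) ` {0..<p - 1} = (\<lambda>y. y + 1) ` {0..<p - 1}" using t(1) by (intro image_cong) auto
      then show ?thesis unfolding set_lst using image_add_atLeastLessThan'[of 1 0 "p - 1"] by (simp add: add.commute)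
    qed
    have d1: "distinct (lst (ar t 21) (p - 1))" unfolding l1 by (simp add: distinct_map inj_on_def)
    have um: "unm p org = {1..<p}" using t(1) p0 by (auto simp: unm_def org_def)
    have cu: "int (card (unm p org)) = p - 1" unfolding um using p0 by simp
    have or: "origin p v 0 org" using t(1) by (auto simp: origin_def org_def)
    have "J 0 ((vr t)(37 := p - 1, 38 := 0, 39 := -1)) ((ar t)(20 := org)) (int (tk t))"
      unfolding J_def using or cu s1 d1 um p0 t(2) b' by (auto intro!: exI[of _ 0])
    then have "wp ?for (\<lambda>t. J n (vr t) (ar t) (int (tk t))) (t\<lparr>ar := (ar t)(20 := org), vr := (vr t)(37 := p - 1, 38 := 0, 39 := -1)\<rparr>)"
      by (intro main) (use t in simp_all)
    moreover have "fits (p - 1)" using b' p0 by (intro fits_small) auto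
    ultimately show ?case using t(3) sz_pos by (simp add: wp_simps(2,3,4) org_def)
  qed (use b' p0 in \<open>auto simp: p_def\<close>)
  then show ?thesis
  proof (rule wp_conseq, goal_cases)
    case (1 t)
    have h: "origin p v n (ar t 20)" "int (card (unm p (ar t 20))) \<le> max 0 (p - 1 - n)" "0 \<le> vr t 37"
      using 1(1) unfolding J_def by blast+
    obtain ce where ce: "ce \<le> n" "ce \<ge> n"
      "int (tk t) + 2 * int (card (unm p (ar t 20))) + vr t 37 \<le> T + (if n = 0 then 4 else 5) * p + n + Ka * ce"
      using 1(1) unfolding J_def by blast
    then have "int (tk t) \<le> T + 6 * p + Ka * n" using h(3) b' p0 by (auto split: if_splits)
    then show ?case using h 1(2) by (intro Q) (simp_all add: p_def n_def T_def)
  qed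
qed

end

section \<open>Differences in a sorted list at a fixed distance\<close>

lemma shift_telescope:
  fixes g :: "nat \<Rightarrow> int"
  shows "(\<Sum>i<n. g (i + s) - g i) = (\<Sum>i<s. g (n + i)) - (\<Sum>i<s. g i)"
proof (induction n)
  case (Suc n)
  have "(\<Sum>i<s. g (Suc n + i)) + g n = (\<Sum>i<Suc s. g (n + i))"
    by (subst sum.lessThan_Suc_shift) simp
  also have "\<dots> = (\<Sum>i<s. g (n + i)) + g (n + s)" by simp
  finally show ?case using Suc by simp
qed simp

lemma shift_sum_le:
  fixes g :: "nat \<Rightarrow> int"
  assumes "\<And>i. i < n + s \<Longrightarrow> 0 \<le> g i \<and> g i \<le> Y" "0 \<le> Y"
  shows "(\<Sum>i<n. g (i + s) - g i) \<le> int s * Y"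
proof -
  have "(\<Sum>i<s. g (n + i)) \<le> (\<Sum>i<s. Y)" using assms by (intro sum_mono) auto
  moreover have "0 \<le> (\<Sum>i<s. g i)" using assms by (intro sum_nonneg) auto
  ultimately show ?thesis unfolding shift_telescope by simp
qed

text \<open>Markov's inequality: each counted difference contributes at least \<open>bd + 1\<close>
  to a sum of nonnegative terms that telescopes to at most \<open>s * Y\<close>.\<close>

lemma shift_big_count:
  fixes g :: "nat \<Rightarrow> int"
  assumes "\<And>i. i < n + s \<Longrightarrow> 0 \<le> g i \<and> g i \<le> Y" "0 \<le> Y"
    "\<And>i j. i \<le> j \<Longrightarrow> j < n + s \<Longrightarrow> g i \<le> g j"
  shows "int (card {i. i < n \<and> bd < g (i + s) - g i}) * (bd + 1) \<le> int s * Y"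
proof -
  let ?I = "{i. i < n \<and> bd < g (i + s) - g i}"
  have "int (card ?I) * (bd + 1) = (\<Sum>i\<in>?I. bd + 1)" by simp
  also have "\<dots> \<le> (\<Sum>i\<in>?I. g (i + s) - g i)" by (intro sum_mono) auto
  also have "\<dots> \<le> (\<Sum>i<n. g (i + s) - g i)" using assms(3) by (intro sum_mono2) auto
  also have "\<dots> \<le> int s * Y" by (rule shift_sum_le) (use assms in auto)
  finally show ?thesis .
qed

text \<open>Every complete block of length \<open>2 * s\<close> contributes \<open>s\<close>
  admissible indices, and fewer than \<open>2 * s\<close> positions lie outside complete
  blocks.\<close>

lemma half_block_count:
  fixes N s :: nat
  assumes "0 < s"
  shows "int N - 2 * int s \<le> 2 * int (card {i. i < N - s \<and> i mod (2 * s) < s})"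
proof -
  define a where "a = N div (2 * s)"
  let ?f = "\<lambda>(b, c). 2 * s * b + c"
  have N: "N < 2 * s * a + 2 * s" "2 * s * a \<le> N"
    using assms unfolding a_def by (metis add.commute dividend_less_div_times mult.commute nat_0_less_mult_iff zero_less_numeral) simp
  have sub: "?f ` ({..<a} \<times> {..<s}) \<subseteq> {i. i < N - s \<and> i mod (2 * s) < s}"
  proof
    fix i assume "i \<in> ?f ` ({..<a} \<times> {..<s})"
    then obtain b c where i: "i = 2 * s * b + c" "b < a" "c < s" by auto
    have "2 * s * b + 2 * s \<le> 2 * s * a" using i(2) by (metis Suc_leI add.commute mult_Suc_right mult_le_mono2)
    then have "i < N - s" using i N by linarith
    moreover have "i mod (2 * s) = c" using i assms by simp
    ultimately show "i \<in> {i. i < N - s \<and> i mod (2 * s) < s}" using i by simp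
  qed
  have inj: "inj_on ?f ({..<a} \<times> {..<s})"
  proof (rule inj_onI, clarify)
    fix b c b' c' assume h: "c < s" "c' < s" "2 * s * b + c = 2 * s * b' + c'"
    have "(c + 2 * s * b) div (2 * s) = b" "(c' + 2 * s * b') div (2 * s) = b'"
      using h by (subst div_mult_self2; simp)+
    then have "b = b'" using h(3) by (simp add: add.commute)
    then show "b = b' \<and> c = c'" using h by auto
  qed
  have "card (?f ` ({..<a} \<times> {..<s})) = a * s" using card_image[OF inj] by simp
  then have "a * s \<le> card {i. i < N - s \<and> i mod (2 * s) < s}"
    using card_mono[OF _ sub] by simp
  moreover have "2 * s * a = 2 * (a * s)" by simp
  ultimately show ?thesis using N(1) by linarith
qed

text \<open>Pigeonhole: if the difference were below \<open>j\<close>, the \<open>s + 1\<close>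
  entries from \<open>i\<close> to \<open>i + s\<close> would take at most \<open>j\<close> values,
  each at most \<open>\<mu>\<close> times, and so number at most \<open>s\<close>.\<close>

lemma shift_diff_ge:
  assumes "sorted (map f xs)" "\<And>v. cnt f xs v \<le> \<mu>" "j * \<mu> \<le> s" "i + s < length xs"
  shows "int j \<le> f (xs ! (i + s)) - f (xs ! i)"
proof (rule ccontr)
  assume a: "\<not> int j \<le> f (xs ! (i + s)) - f (xs ! i)"
  have mono: "f (xs ! a) \<le> f (xs ! b)" if "a \<le> b" "b < length xs" for a b
    using sorted_nth_mono[OF assms(1), of a b] that by simp
  let ?V = "{f (xs ! i)..f (xs ! (i + s))}"
  have "{i..i + s} \<subseteq> (\<Union>v\<in>?V. {k. k < length xs \<and> f (xs ! k) = v})"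
    using mono assms(4) by auto
  then have "card {i..i + s} \<le> card (\<Union>v\<in>?V. {k. k < length xs \<and> f (xs ! k) = v})"
    by (intro card_mono) auto
  also have "\<dots> \<le> (\<Sum>v\<in>?V. card {k. k < length xs \<and> f (xs ! k) = v})"
    by (intro card_UN_le) simp
  also have "\<dots> \<le> (\<Sum>v\<in>?V. \<mu>)" using assms(2) unfolding cnt_card by (intro sum_mono) auto
  also have "\<dots> = card ?V * \<mu>" by simp
  also have "\<dots> \<le> j * \<mu>"
    using a by (intro mult_right_mono) auto
  finally show False using assms(3) by simp
qed

text \<open>About half of the positions are admissible as left ends; from these the rejected pairs
  are subtracted.\<close>

lemma pairs_length_ge:
  assumes "0 < s" "bc = card {i. i < length xs - s \<and> bd < f (xs ! (i + s)) - f (xs ! i)}"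
  shows "int (length xs) - 2 * int s - 2 * int bc \<le> 2 * int (length (pairs f xs s bd))"
proof -
  let ?C = "{i. i < length xs - s \<and> i mod (2 * s) < s}"
  let ?B = "{i. i < length xs - s \<and> bd < f (xs ! (i + s)) - f (xs ! i)}"
  have sp: "set (pairs f xs s bd) = {i. i < length xs - s \<and> i mod (2 * s) < s \<and> f (xs ! (i + s)) - f (xs ! i) \<le> bd}"
    unfolding pairs_def set_filter set_upt by simp
  have "?C \<subseteq> set (pairs f xs s bd) \<union> ?B"
  proof
    fix i assume i: "i \<in> ?C"
    show "i \<in> set (pairs f xs s bd) \<union> ?B"
      unfolding sp using i by (cases "f (xs ! (i + s)) - f (xs ! i) \<le> bd") auto
  qed
  then have "card ?C \<le> card (set (pairs f xs s bd) \<union> ?B)" by (intro card_mono) auto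
  also have "\<dots> \<le> card (set (pairs f xs s bd)) + card ?B" by (rule card_Un_le)
  also have "card (set (pairs f xs s bd)) = length (pairs f xs s bd)"
    by (intro distinct_card) (simp add: pairs_def)
  finally show ?thesis using half_block_count[OF assms(1), of "length xs"] assms(2) by linarith
qed

definition pairs_sum :: "(int \<Rightarrow> int) \<Rightarrow> int list \<Rightarrow> nat \<Rightarrow> int \<Rightarrow> int" where
  "pairs_sum f xs s bd = sum_list (map (\<lambda>i. f (xs ! (i + s)) - f (xs ! i)) (pairs f xs s bd))"

lemma pairs_sum_ge:
  assumes "sorted (map f xs)" "\<And>v. cnt f xs v \<le> \<mu>" "j * \<mu> \<le> s" "0 < s"
    "bc = card {i. i < length xs - s \<and> bd < f (xs ! (i + s)) - f (xs ! i)}"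
  shows "int j * (int (length xs) - 2 * int s - 2 * int bc) \<le> 2 * pairs_sum f xs s bd"
proof -
  let ?p = "pairs f xs s bd"
  have "sum_list (map (\<lambda>i. int j) ?p) \<le> pairs_sum f xs s bd"
    unfolding pairs_sum_def using pairs_bound[of _ f xs s bd] shift_diff_ge[OF assms(1-3)]
    by (intro sum_list_mono) auto
  then have "int (length ?p) * int j \<le> pairs_sum f xs s bd" by (simp add: sum_list_triv)
  moreover have "int j * (int (length xs) - 2 * int s - 2 * int bc) \<le> int j * (2 * int (length ?p))"
    using pairs_length_ge[OF assms(4,5)] by (intro mult_left_mono) auto
  ultimately show ?thesis by (simp add: mult.commute)
qed

lemma pairs_sum_le:
  assumes "sorted (map f xs)" "\<And>x. x \<in> set xs \<Longrightarrow> 0 \<le> f x \<and> f x \<le> Y" "0 \<le> Y"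
  shows "pairs_sum f xs s bd \<le> int s * Y"
proof (cases "s \<le> length xs")
  case True
  let ?g = "\<lambda>i. f (xs ! i)"
  have mono: "?g a \<le> ?g b" if "a \<le> b" "b < length xs" for a b
    using sorted_nth_mono[OF assms(1), of a b] that by simp
  have "pairs_sum f xs s bd = (\<Sum>i\<in>set (pairs f xs s bd). ?g (i + s) - ?g i)"
    unfolding pairs_sum_def by (intro sum_list_distinct_conv_sum_set) (simp add: pairs_def)
  also have "\<dots> \<le> (\<Sum>i<length xs - s. ?g (i + s) - ?g i)"
    using mono by (intro sum_mono2) (auto simp: pairs_def)
  also have "\<dots> \<le> int s * Y"
    by (rule shift_sum_le) (use assms True nth_mem in auto)
  finally show ?thesis .
next
  case False
  then show ?thesis using assms(3) by (simp add: pairs_sum_def pairs_def)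
qed

lemma big_count:
  assumes "sorted (map f xs)" "\<And>x. x \<in> set xs \<Longrightarrow> 0 \<le> f x \<and> f x \<le> Y" "0 \<le> Y"
  shows "int (card {i. i < length xs - s \<and> bd < f (xs ! (i + s)) - f (xs ! i)}) * (bd + 1) \<le> int s * Y"
proof (cases "s \<le> length xs")
  case True
  then show ?thesis
    using assms(2) nth_mem sorted_nth_mono[OF assms(1)]
    by (intro shift_big_count[where g = "\<lambda>i. f (xs ! i)"]) (use assms(3) in auto)
next
  case False
  then show ?thesis using assms(3) by simp
qed

text \<open>
  Here only the total of the values is bounded: pairs with a value above the threshold \<open>Y\<close> are few
  by the total \<open>Z\<close>, and the other ones lie in an initial segment with values at most \<open>Y\<close>.
\<close>

lemma big_count_sum:
  assumes "sorted (map f xs)" "\<And>x. x \<in> set xs \<Longrightarrow> 0 \<le> f x" "0 \<le> Y" "0 \<le> bd"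
    "sum_list (map f xs) \<le> Z"
    "bc = card {i. i < length xs - s \<and> bd < f (xs ! (i + s)) - f (xs ! i)}"
  shows "\<exists>B1 B2. int bc \<le> B1 + B2 \<and> B1 * (bd + 1) \<le> int s * Y \<and> B2 * Y \<le> Z \<and> 0 \<le> B1 \<and> 0 \<le> B2"
proof -
  let ?g = "\<lambda>i. f (xs ! i)"
  have mono: "?g a \<le> ?g b" if "a \<le> b" "b < length xs" for a b
    using sorted_nth_mono[OF assms(1), of a b] that by simp
  define ys where "ys = filter (\<lambda>x. f x \<le> Y) xs"
  define zs where "zs = filter (\<lambda>x. Y < f x) xs"
  have zs: "int (length zs) * Y \<le> Z"
  proof -
    have "int (length zs) * Y \<le> sum_list (map f zs)"
      unfolding zs_def by (induction xs) (auto simp: algebra_simps)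
    also have "\<dots> \<le> sum_list (map f xs)" using assms(2) unfolding zs_def
      by (induction xs) (auto intro!: add_increasing)
    finally show ?thesis using assms(5) by simp
  qed
  define n where "n = card {k. k < length xs \<and> ?g k \<le> Y}"
  have init: "{k. k < length xs \<and> ?g k \<le> Y} = {..<n}"
  proof -
    let ?J = "{k. k < length xs \<and> ?g k \<le> Y}"
    show ?thesis
    proof (cases "?J = {}")
      case False
      then obtain k where "k \<in> ?J" by blast
      then have 0: "0 \<in> ?J" using mono[of 0 k] by auto
      have "?J = {0..<0 + card ?J}"
      proof (rule convex_nat_set)
        fix j k assume "k \<in> ?J" "0 < j" "j < k"
        then show "j \<in> ?J" using mono[of j k] by auto
      qed (use 0 in auto)
      then show ?thesis unfolding n_def by (simp add: lessThan_atLeast0)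
    next
      case True
      then have "n = 0" unfolding n_def by (simp only: card.empty)
      then show ?thesis using True by simp
    qed
  qed
  have nle: "n \<le> length xs"
  proof -
    have "n \<le> card {..<length xs}" unfolding n_def by (intro card_mono) auto
    then show ?thesis by simp
  qed
  let ?B1 = "{i. i < n - s \<and> bd < ?g (i + s) - ?g i}"
  have "int (card ?B1) * (bd + 1) \<le> int s * Y"
  proof (cases "s \<le> n")
    case True
    have "0 \<le> ?g i \<and> ?g i \<le> Y" if "i < n - s + s" for i
    proof -
      have "i \<in> {k. k < length xs \<and> ?g k \<le> Y}" unfolding init using that True by simp
      then show ?thesis using assms(2) nth_mem by auto
    qed
    moreover have "?g i \<le> ?g j" if "i \<le> j" "j < n - s + s" for i j
      by (rule mono) (use that nle True in linarith)+
    ultimately show ?thesis using assms(3) by (intro shift_big_count) blast+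
  next
    case False
    then show ?thesis using assms(3) by simp
  qed
  moreover have "int bc \<le> int (card ?B1) + int (length zs)"
  proof -
    have "{i. i < length xs - s \<and> bd < ?g (i + s) - ?g i} \<subseteq> ?B1 \<union> (\<lambda>k. k - s) ` {k. k < length xs \<and> Y < ?g k}"
    proof
      fix i assume i: "i \<in> {i. i < length xs - s \<and> bd < ?g (i + s) - ?g i}"
      have il: "i + s < length xs" using i by auto
      show "i \<in> ?B1 \<union> (\<lambda>k. k - s) ` {k. k < length xs \<and> Y < ?g k}"
      proof (cases "?g (i + s) \<le> Y")
        case True
        then have "i + s \<in> {k. k < length xs \<and> ?g k \<le> Y}" using il by simp
        then have "i + s < n" unfolding init by simp
        then have "i \<in> ?B1" using i by simp
        then show ?thesis by blast
      next
        case False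
        then have "i + s \<in> {k. k < length xs \<and> Y < ?g k}" using il by simp
        then have "(i + s) - s \<in> (\<lambda>k. k - s) ` {k. k < length xs \<and> Y < ?g k}" by (rule imageI)
        then show ?thesis by simp
      qed
    qed
    then have "bc \<le> card (?B1 \<union> (\<lambda>k. k - s) ` {k. k < length xs \<and> Y < ?g k})"
      unfolding assms(6) by (intro card_mono) auto
    also have "\<dots> \<le> card ?B1 + card ((\<lambda>k. k - s) ` {k. k < length xs \<and> Y < ?g k})" by (rule card_Un_le)
    also have "card ((\<lambda>k. k - s) ` {k. k < length xs \<and> Y < ?g k}) \<le> card {k. k < length xs \<and> Y < ?g k}"
      by (intro card_image_le) simp
    also have "\<dots> = length zs" by (simp add: zs_def length_filter_conv_card)
    finally show ?thesis by simp
  qed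
  ultimately show ?thesis using zs
    by (intro exI[of _ "int (card ?B1)"] exI[of _ "int (length zs)"]) auto
qed

section \<open>Reading off a selection\<close>

text \<open>The target is \<open>- V 8\<close>, which cancels the constant term. Variable 42 records
  the deficit, the distance from the target down to the first reached residue.\<close>

definition SEEK :: com where
  "SEEK = (For 30 9 (Sto 8 (V 30) (N 0)) ;; Sto 8 (V 24) (N 1) ;;
     33 ::= (N 0 .- V 8) .mod V 4 ;; 42 ::= N 0 ;;
     Loop (Eq (A 20 (V 33)) (N (-2))) (42 ::= V 42 .+ N 1 ;; 33 ::= (V 33 .- N 1) .mod V 4))"

text \<open>The first \<open>V 18\<close> summands of the walk are units. Where the walk uses one,
  it is not selected but added to the deficit, so that the units can be distributed anew
  afterwards.\<close>

definition BACKTRACK :: com where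
  "BACKTRACK = Loop (Lt (N (-1)) (A 20 (V 33)))
     (34 ::= A 20 (V 33) ;; 35 ::= A 14 (V 34) ;;
      Cond (Lt (V 34) (V 18)) (42 ::= V 42 .+ N 1) (Sto 8 (V 35) (N 1)) ;;
      33 ::= (V 33 .- A 5 (V 35)) .mod V 4)"

definition GREEDY :: com where
  "GREEDY = For 30 15 (35 ::= A 15 (V 30) ;;
     Cond (Lt (V 18) (V 42)) (Sto 8 (V 35) (N 1) ;; 42 ::= V 42 .- A 5 (V 35)) Skip)"

definition UNITS :: com where
  "UNITS = For 30 18 (Cond (Lt (V 30) (V 42)) (Sto 8 (A 14 (V 30)) (N 1)) Skip)"

text \<open>Children have smaller numbers than their parent; going from the newest node to the
  oldest, every inner node has received its bit before it passes it on.\<close>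

definition DOWN :: com where
  "DOWN = (41 ::= V 9 .- V 10 ;;
     For 30 41 (33 ::= V 9 .- N 1 .- V 30 ;; 34 ::= A 8 (V 33) ;;
       Sto 8 (A 7 (V 33)) (V 34) ;; Sto 8 (A 6 (V 33)) (N 1 .- V 34)))"

lemma mod_final [simp]:
  "modv SEEK = {30, 33, 42}" "moda SEEK = {8}"
  "modv BACKTRACK = {33, 34, 35, 42}" "moda BACKTRACK = {8}"
  "modv GREEDY = {30, 35, 42}" "moda GREEDY = {8}"
  "modv UNITS = {30}" "moda UNITS = {8}"
  "modv DOWN = {30, 33, 34, 41}" "moda DOWN = {8}"
  by (auto simp: SEEK_def BACKTRACK_def GREEDY_def UNITS_def DOWN_def)

context ram
begin

text \<open>All residues passed are unreached. Since 0 is reached, they are fewer than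
  \<open>p\<close>, hence consecutive ones are pairwise distinct modulo \<open>p\<close>, and the
  deficit is at most the number of unreached residues.\<close>

lemma wp_SEEK:
  assumes b: "1 < vr s 4" "vr s 4 \<le> sz" "0 \<le> vr s 9" "vr s 9 \<le> sz" "0 \<le> vr s 24" "vr s 24 < sz"
      "0 \<le> vr s 8" "vr s 8 < vr s 4" "ar s 20 0 \<noteq> -2"
    and Q: "\<And>t. (\<forall>x. 0 \<le> x \<and> x < vr s 9 \<longrightarrow> ar t 8 x = (if x = vr s 24 then 1 else 0)) \<Longrightarrow>
      0 \<le> vr t 42 \<Longrightarrow> vr t 42 \<le> int (card (unm (vr s 4) (ar s 20))) \<Longrightarrow>
      vr t 33 = (- vr s 8 - vr t 42) mod vr s 4 \<Longrightarrow> ar s 20 (vr t 33) \<noteq> -2 \<Longrightarrow>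
      int (tk t) \<le> int (tk s) + vr s 9 + vr s 4 \<Longrightarrow> frame SEEK s t \<Longrightarrow> Q t"
  shows "wp SEEK Q s"
proof -
  define p where "p = vr s 4"
  define c where "c = vr s 8"
  define org where "org = ar s 20"
  note b' = b[folded p_def c_def org_def]
  have p0: "0 < p" using b' by simp
  define QQ where "QQ = (\<lambda>t :: st. (\<forall>x. 0 \<le> x \<and> x < vr s 9 \<longrightarrow> ar t 8 x = (if x = vr s 24 then 1 else 0)) \<and>
      0 \<le> vr t 42 \<and> vr t 42 \<le> int (card (unm p org)) \<and>
      vr t 33 = (- c - vr t 42) mod p \<and> org (vr t 33) \<noteq> -2 \<and>
      int (tk t) \<le> int (tk s) + vr s 9 + p)"
  have cu: "card (unm p org) < nat p"
  proof -
    have "unm p org \<subseteq> {1..<p}" using b'(9) by (auto simp: unm_def) (metis b'(9) le_less zless_imp_add1_zle add.left_neutral)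
    then have "card (unm p org) \<le> card {1..<p}" by (intro card_mono) auto
    then show ?thesis using b' by simp
  qed
  have lp: "wp (Loop (Eq (A 20 (V 33)) (N (-2))) (42 ::= V 42 .+ N 1 ;; 33 ::= (V 33 .- N 1) .mod V 4)) QQ t"
    if t: "\<forall>x. 0 \<le> x \<and> x < vr s 9 \<longrightarrow> ar t 8 x = (if x = vr s 24 then 1 else 0)" "vr t 42 = 0" "vr t 33 = (- c) mod p"
      "int (tk t) = int (tk s) + vr s 9" "ar t 20 = org" "vr t 4 = p" for t
  proof (rule wp_Loop[where I = "\<lambda>u. 0 \<le> vr u 42 \<and> vr u 42 \<le> int (card (unm p org)) \<and>
      vr u 33 = (- c - vr u 42) mod p \<and> (\<forall>e. 0 \<le> e \<and> e < vr u 42 \<longrightarrow> (- c - e) mod p \<in> unm p org) \<and>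
      int (tk u) = int (tk s) + vr s 9 + vr u 42" and m = "\<lambda>u. nat (p - vr u 42)"], goal_cases)
    case 1
    then show ?case using t by auto
  next
    case (2 u)
    have "ar u 20 = org" using frameD[OF 2(2)] t by auto
    moreover have "0 \<le> vr u 33" "vr u 33 < p" using 2 p0 by auto
    ultimately show ?case using b' by auto
  next
    case (3 u)
    have fr: "ar u 20 = org" "vr u 4 = p" using frameD[OF 3(2)] t by auto
    define e where "e = vr u 42"
    have h: "0 \<le> e" "e \<le> int (card (unm p org))" "vr u 33 = (- c - e) mod p"
      "\<forall>e'. 0 \<le> e' \<and> e' < e \<longrightarrow> (- c - e') mod p \<in> unm p org" "int (tk u) = int (tk s) + vr s 9 + e"
      using 3(1) by (auto simp: e_def)
    have y: "0 \<le> vr u 33" "vr u 33 < p" using h p0 by auto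
    have all: "(- c - e') mod p \<in> unm p org" if "0 \<le> e'" "e' < e + 1" for e'
    proof (cases "e' = e")
      case True
      then show ?thesis using 3(3) fr h(3) y by (simp add: unm_def)
    next
      case False
      then show ?thesis using h(4) that by auto
    qed
    have ep: "e < p" using h(2) cu p0 by simp
    have inj: "inj_on (\<lambda>e'. (- c - e') mod p) {0..<e + 1}"
    proof (rule inj_onI)
      fix x y assume "x \<in> {0..<e + 1}" "y \<in> {0..<e + 1}" "(- c - x) mod p = (- c - y) mod p"
      then have "p dvd (- c - x) - (- c - y)" "\<bar>y - x\<bar> < p" using ep by (auto simp: mod_eq_dvd_iff)
      then have "p dvd y - x" by simp
      then show "x = y" using dvd_imp_le_int[of "y - x" p] \<open>\<bar>y - x\<bar> < p\<close> p0 by linarith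
    qed
    have "card ((\<lambda>e'. (- c - e') mod p) ` {0..<e + 1}) \<le> card (unm p org)"
      using all by (intro card_mono) auto
    then have le: "e + 1 \<le> int (card (unm p org))" using card_image[OF inj] h(1) by simp
    have "(vr u 33 - 1) mod p = (- c - (e + 1)) mod p" unfolding h(3) by (simp add: mod_simps algebra_simps)
    moreover have "fits (e + 1)" "fits (vr u 33 - 1)" using h(1) ep b' y by (auto intro!: fits_small)
    moreover have "fits ((vr u 33 - 1) mod p)" using b' by (intro fits_mod) auto
    ultimately show ?case using h(1,5) le ep fr all by (simp add: wp_simps e_def[symmetric])
  next
    case (4 u)
    have fr: "ar u 20 = org" "ar u 8 = ar t 8" using frameD[OF 4(2)] t by auto
    have "vr u 42 \<le> p" using 4(1) cu p0 by (elim conjE) linarith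
    then show ?case using 4 fr t unfolding QQ_def by auto
  qed
  have "wp SEEK QQ s" unfolding SEEK_def wp_simps(4)
  proof (rule wp_For[where P = "\<lambda>k t. (\<forall>x. 0 \<le> x \<and> x < k \<longrightarrow> ar t 8 x = 0) \<and> int (tk t) = int (tk s) + k"], goal_cases)
    case (2 k t)
    then show ?case using b by (auto simp: wp_simps)
  next
    case (3 t)
    have fr: "vr t 24 = vr s 24" "vr t 8 = c" "vr t 4 = p" "ar t 20 = org" "vr t 9 = vr s 9"
      using frameD[OF 3(3)] by (auto simp: c_def p_def org_def)
    have "fits (- c)" using b' by (intro fits_small) auto
    moreover have "fits (- c mod p)" using b' by (intro fits_mod) auto
    moreover have "wp (Loop (Eq (A 20 (V 33)) (N (-2))) (42 ::= V 42 .+ N 1 ;; 33 ::= (V 33 .- N 1) .mod V 4)) QQ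
      (t\<lparr>ar := (ar t)(8 := (ar t 8)(vr s 24 := 1)), vr := (vr t)(33 := - c mod p, 42 := 0)\<rparr>)"
      by (rule lp) (use 3(1) fr in auto)
    ultimately show ?case using fr b' by (simp add: wp_simps(2,3,4))
  qed (use b in auto)
  then show ?thesis
    by (rule wp_conseq) (unfold QQ_def p_def c_def org_def, elim conjE, rule Q, assumption+)
qed

lemma wp_BACKTRACK:
  assumes b: "1 < vr s 4" "vr s 4 \<le> sz" "0 \<le> vr s 18" "vr s 18 \<le> vr s 13" "vr s 13 \<le> sz"
      "0 \<le> vr s 33" "vr s 33 < vr s 4" "ar s 20 (vr s 33) \<noteq> -2" "0 \<le> vr s 42" "vr s 42 \<le> sz"
    and v: "v = (\<lambda>i. ar s 5 (ar s 14 i))" "origin (vr s 4) v (vr s 13) (ar s 20)"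
      "\<And>i. 0 \<le> i \<Longrightarrow> i < vr s 13 \<Longrightarrow> 0 \<le> ar s 14 i \<and> ar s 14 i < sz \<and> 0 \<le> v i \<and> v i < vr s 4"
    and Q: "\<And>t I. I \<subseteq> {0..<vr s 13} \<Longrightarrow> [vr s 33 = (\<Sum>i\<in>I. v i)] (mod vr s 4) \<Longrightarrow>
      vr t 42 = vr s 42 + int (card (I \<inter> {0..<vr s 18})) \<Longrightarrow>
      ar t 8 = (\<lambda>x. if x \<in> ar s 14 ` (I \<inter> {vr s 18..}) then 1 else ar s 8 x) \<Longrightarrow>
      int (tk t) \<le> int (tk s) + vr s 13 \<Longrightarrow> frame BACKTRACK s t \<Longrightarrow> Q t"
  shows "wp BACKTRACK Q s"
proof -
  define p where "p = vr s 4"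
  define n where "n = vr s 13"
  define L0 where "L0 = vr s 18"
  define org where "org = ar s 20"
  define y0 where "y0 = vr s 33"
  note b' = b[folded p_def n_def L0_def org_def y0_def]
  have org: "org y = -2 \<or> (org y = -1 \<and> y = 0) \<or>
     (0 \<le> org y \<and> org y < n \<and> -1 \<le> org ((y - v (org y)) mod p) \<and> org ((y - v (org y)) mod p) < org y)"
    if "0 \<le> y" "y < p" for y using v(2) that by (auto simp: origin_def p_def n_def org_def)
  \<comment> \<open>All indices collected so far exceed \<open>org y\<close>, so the index read next
    is new and \<open>I\<close> remains a set of distinct summands.\<close>
  define Inv where "Inv = (\<lambda>y x a tt. \<exists>I. I \<subseteq> {0..<n} \<and> (\<forall>i\<in>I. org y < i) \<and>
      [y0 = y + (\<Sum>i\<in>I. v i)] (mod p) \<and> 0 \<le> y \<and> y < p \<and> org y \<noteq> -2 \<and>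
      x = vr s 42 + int (card (I \<inter> {0..<L0})) \<and>
      a = (\<lambda>x. if x \<in> ar s 14 ` (I \<inter> {L0..}) then 1 else ar s 8 x) \<and>
      tt = int (tk s) + int (card I))"
  have "wp BACKTRACK (\<lambda>t. \<exists>I. I \<subseteq> {0..<n} \<and> [y0 = (\<Sum>i\<in>I. v i)] (mod p) \<and>
      vr t 42 = vr s 42 + int (card (I \<inter> {0..<L0})) \<and>
      ar t 8 = (\<lambda>x. if x \<in> ar s 14 ` (I \<inter> {L0..}) then 1 else ar s 8 x) \<and>
      int (tk t) \<le> int (tk s) + n) s"
    unfolding BACKTRACK_def
  proof (rule wp_Loop[where I = "\<lambda>t. Inv (vr t 33) (vr t 42) (ar t 8) (int (tk t))"
      and m = "\<lambda>t. nat (org (vr t 33) + 1)"], goal_cases)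
    case 1
    show ?case unfolding Inv_def using b' by (intro exI[of _ "{}"]) (simp add: y0_def)
  next
    case (2 t)
    have "ar t 20 = org" using frameD[OF 2(2)] by (auto simp: org_def)
    moreover have "0 \<le> vr t 33" "vr t 33 < p" using 2(1) unfolding Inv_def by auto
    ultimately show ?case using b' by auto
  next
    case (3 t)
    from 3(1) obtain I where I: "I \<subseteq> {0..<n}" "\<forall>i\<in>I. org (vr t 33) < i"
      "[y0 = vr t 33 + (\<Sum>i\<in>I. v i)] (mod p)" "0 \<le> vr t 33" "vr t 33 < p" "org (vr t 33) \<noteq> -2"
      "vr t 42 = vr s 42 + int (card (I \<inter> {0..<L0}))"
      "ar t 8 = (\<lambda>x. if x \<in> ar s 14 ` (I \<inter> {L0..}) then 1 else ar s 8 x)"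
      "int (tk t) = int (tk s) + int (card I)" unfolding Inv_def by blast
    have fr: "ar t 20 = org" "ar t 14 = ar s 14" "ar t 5 = ar s 5" "vr t 4 = p" "vr t 18 = L0"
      using frameD[OF 3(2)] by (auto simp: org_def p_def L0_def)
    define y where "y = vr t 33"
    define i where "i = org y"
    have i: "0 \<le> i" "i < n" "-1 \<le> org ((y - v i) mod p)" "org ((y - v i) mod p) < i"
      using org[of y] I(4-6) 3(3) fr by (auto simp: y_def i_def)
    have vi: "0 \<le> ar s 14 i" "ar s 14 i < sz" "0 \<le> v i" "v i < p" "ar s 5 (ar s 14 i) = v i"
      using v(3)[of i] i by (auto simp: n_def p_def v(1))
    have fin: "finite I" using I(1) finite_subset by blast
    have iI: "i \<notin> I" using I(2) by (auto simp: i_def y_def)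
    have fits: "fits (vr t 42 + 1)" "fits (y - v i)" "fits ((y - v i) mod p)"
    proof -
      have "card (I \<inter> {0..<L0}) \<le> card {0..<n}" using I(1) by (intro card_mono) auto
      then show "fits (vr t 42 + 1)" using I(7) b' by (intro fits_small) auto
      show "fits (y - v i)" using I(4,5) vi b' by (intro fits_small) (auto simp: y_def)
      show "fits ((y - v i) mod p)" using b' by (intro fits_mod) auto
    qed
    let ?I = "insert i I"
    have s1: "?I \<subseteq> {0..<n}" using I i by auto
    have s2: "\<forall>k\<in>?I. org ((y - v i) mod p) < k" using I(2) i by (auto simp: y_def[symmetric] i_def)
    have s3: "[y0 = (y - v i) mod p + (\<Sum>k\<in>?I. v k)] (mod p)"
      using I(3) fin iI by (simp add: cong_def mod_simps y_def)
    have pm: "0 \<le> (y - v i) mod p" "(y - v i) mod p < p" using b'(1) by auto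
    have s4: "int (tk t) + 1 = int (tk s) + int (card ?I)" using I(9) fin iI by simp
    show ?case
    proof (cases "i < L0")
      case True
      have e1: "?I \<inter> {0..<L0} = insert i (I \<inter> {0..<L0})" "?I \<inter> {L0..} = I \<inter> {L0..}" using True i by auto
      have "Inv ((y - v i) mod p) (vr t 42 + 1) (ar t 8) (int (tk t) + 1)"
        unfolding Inv_def
        using I(7,8) fin iI s1 s2 s3 s4 i(3) pm by (intro exI[of _ ?I]) (simp add: e1)
      then show ?thesis
        using True fr I(4,5) i vi fits b'
        by (simp add: wp_simps y_def[symmetric] i_def[symmetric] add.commute)
    next
      case False
      have e1: "?I \<inter> {L0..} = insert i (I \<inter> {L0..})" "?I \<inter> {0..<L0} = I \<inter> {0..<L0}" using False i by auto
      have e2: "(ar t 8)(ar s 14 i := 1) = (\<lambda>x. if x \<in> ar s 14 ` (?I \<inter> {L0..}) then 1 else ar s 8 x)"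
        unfolding I(8) e1 by auto
      have "Inv ((y - v i) mod p) (vr t 42) ((ar t 8)(ar s 14 i := 1)) (int (tk t) + 1)"
        unfolding Inv_def
        using I(7) e2 fin iI s1 s2 s3 s4 i(3) pm by (intro exI[of _ ?I]) (simp add: e1)
      then show ?thesis
        using False fr I(4,5) i vi fits b'
        by (simp add: wp_simps y_def[symmetric] i_def[symmetric] add.commute)
    qed
  next
    case (4 t)
    from 4(1) obtain I where I: "I \<subseteq> {0..<n}"
      "[y0 = vr t 33 + (\<Sum>i\<in>I. v i)] (mod p)" "0 \<le> vr t 33" "vr t 33 < p" "org (vr t 33) \<noteq> -2"
      "vr t 42 = vr s 42 + int (card (I \<inter> {0..<L0}))"
      "ar t 8 = (\<lambda>x. if x \<in> ar s 14 ` (I \<inter> {L0..}) then 1 else ar s 8 x)"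
      "int (tk t) = int (tk s) + int (card I)" unfolding Inv_def by blast
    have "ar t 20 = org" using frameD[OF 4(2)] by (auto simp: org_def)
    then have "vr t 33 = 0" using 4(3) org[OF I(3,4)] I(5) by auto
    moreover have "card I \<le> card {0..<n}" using I(1) by (intro card_mono) auto
    then have "int (card I) \<le> n" using b' by simp
    ultimately show ?case using I by (intro exI[of _ I]) auto
  qed
  then show ?thesis
    by (rule wp_conseq) (auto simp: p_def n_def L0_def y0_def intro: Q)
qed

text \<open>An item is taken only while the rest exceeds \<open>vr s 18\<close>; as items are at
  most \<open>vr s 18 + 1\<close>, the rest stays nonnegative. The rest is also bounded by
  \<open>vr s 18\<close> plus the total of the items to come: taking an item lowers both sides
  equally, and an item is skipped only if the rest is at most \<open>vr s 18\<close> already. At the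
  end the units can fill it.\<close>

lemma wp_GREEDY:
  assumes b: "0 \<le> vr s 15" "vr s 15 \<le> sz" "0 \<le> vr s 18" "vr s 18 \<le> sz" "0 \<le> vr s 42" "vr s 42 \<le> 10 * sz"
    and g: "\<And>i. 0 \<le> i \<Longrightarrow> i < vr s 15 \<Longrightarrow> 0 \<le> ar s 15 i \<and> ar s 15 i < sz \<and>
        0 \<le> ar s 5 (ar s 15 i) \<and> ar s 5 (ar s 15 i) \<le> vr s 18 + 1"
      "vr s 42 \<le> vr s 18 + (\<Sum>i\<in>{0..<vr s 15}. ar s 5 (ar s 15 i))"
    and Q: "\<And>t I. I \<subseteq> {0..<vr s 15} \<Longrightarrow> vr s 42 = vr t 42 + (\<Sum>i\<in>I. ar s 5 (ar s 15 i)) \<Longrightarrow>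
      0 \<le> vr t 42 \<Longrightarrow> vr t 42 \<le> vr s 18 \<Longrightarrow>
      ar t 8 = (\<lambda>x. if x \<in> ar s 15 ` I then 1 else ar s 8 x) \<Longrightarrow>
      int (tk t) = int (tk s) + vr s 15 \<Longrightarrow> frame GREEDY s t \<Longrightarrow> Q t"
  shows "wp GREEDY Q s"
proof -
  define n where "n = vr s 15"
  define L0 where "L0 = vr s 18"
  define d where "d = (\<lambda>i. ar s 5 (ar s 15 i))"
  note b' = b[folded n_def L0_def]
  define Inv where "Inv = (\<lambda>k x a. \<exists>I. I \<subseteq> {0..<k} \<and> vr s 42 = x + (\<Sum>i\<in>I. d i) \<and>
      0 \<le> x \<and> x \<le> vr s 42 \<and> x \<le> L0 + (\<Sum>i\<in>{k..<n}. d i) \<and>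
      a = (\<lambda>x. if x \<in> ar s 15 ` I then 1 else ar s 8 x))"
  have "wp GREEDY (\<lambda>t. \<exists>I. I \<subseteq> {0..<n} \<and> vr s 42 = vr t 42 + (\<Sum>i\<in>I. d i) \<and>
      0 \<le> vr t 42 \<and> vr t 42 \<le> L0 \<and>
      ar t 8 = (\<lambda>x. if x \<in> ar s 15 ` I then 1 else ar s 8 x) \<and> int (tk t) = int (tk s) + n) s"
    unfolding GREEDY_def
  proof (rule wp_For[where P = "\<lambda>k t. Inv k (vr t 42) (ar t 8) \<and> int (tk t) = int (tk s) + k"], goal_cases)
    case 1
    then show ?case unfolding Inv_def using b' g by (auto intro!: exI[of _ "{}"] simp: d_def n_def L0_def)
  next
    case (2 k t)
    from 2(3) obtain I where I: "I \<subseteq> {0..<k}" "vr s 42 = vr t 42 + (\<Sum>i\<in>I. d i)"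
      "0 \<le> vr t 42" "vr t 42 \<le> vr s 42" "vr t 42 \<le> L0 + (\<Sum>i\<in>{k..<n}. d i)"
      "ar t 8 = (\<lambda>x. if x \<in> ar s 15 ` I then 1 else ar s 8 x)" "int (tk t) = int (tk s) + k" unfolding Inv_def by blast
    have k: "0 \<le> k" "k < n" "vr t 30 = k" using 2 by (auto simp: n_def)
    have fr: "ar t 15 = ar s 15" "ar t 5 = ar s 5" "vr t 18 = L0"
      using frameD[OF 2(5)] by (auto simp: L0_def)
    have dk: "0 \<le> d k" "d k \<le> L0 + 1" "0 \<le> ar s 15 k" "ar s 15 k < sz" "ar s 5 (ar s 15 k) = d k"
      using g(1)[of k] k by (auto simp: d_def n_def L0_def)
    have sk: "(\<Sum>i\<in>{k..<n}. d i) = d k + (\<Sum>i\<in>{k + 1..<n}. d i)"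
    proof -
      have "{k..<n} = insert k {k + 1..<n}" using k by auto
      then show ?thesis by simp
    qed
    have fin: "finite I" using I(1) finite_subset by blast
    have kI: "k \<notin> I" using I(1) by auto
    have r0: "0 \<le> (\<Sum>i\<in>{k + 1..<n}. d i)" using g(1) k by (intro sum_nonneg) (auto simp: d_def n_def)
    show ?case
    proof (cases "L0 < vr t 42")
      case True
      let ?I = "insert k I"
      have e: "(ar t 8)(ar s 15 k := 1) = (\<lambda>x. if x \<in> ar s 15 ` ?I then 1 else ar s 8 x)"
        unfolding I(6) by auto
      have "?I \<subseteq> {0..<k + 1}" using I(1) k by auto
      moreover have "vr s 42 = vr t 42 - d k + (\<Sum>i\<in>?I. d i)" using I(2) fin kI by simp
      ultimately have "Inv (k + 1) (vr t 42 - d k) ((ar t 8)(ar s 15 k := 1))"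
        unfolding Inv_def e using I(3-5) sk True dk by (intro exI[of _ ?I]) simp
      moreover have "fits (vr t 42 - d k)" using I(3,4) True dk b' by (intro fits_small) auto
      ultimately show ?thesis using True k fr dk I(7) b' by (simp add: wp_simps)
    next
      case False
      have "I \<subseteq> {0..<k + 1}" using I(1) by auto
      then have "Inv (k + 1) (vr t 42) (ar t 8)"
        unfolding Inv_def using I(2-6) r0 False by (intro exI[of _ I]) simp
      then show ?thesis using False k fr dk I(7) b' by (simp add: wp_simps)
    qed
  next
    case (3 t)
    then show ?case unfolding Inv_def by (auto simp: n_def)
  qed (use b' in \<open>auto simp: n_def\<close>)
  then show ?thesis
    by (rule wp_conseq) (auto simp: n_def L0_def d_def intro: Q)
qed

lemma wp_UNITS:
  assumes b: "0 \<le> vr s 18" "vr s 18 \<le> sz" "0 \<le> vr s 42" "vr s 42 \<le> vr s 18"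
    and g: "\<And>i. 0 \<le> i \<Longrightarrow> i < vr s 18 \<Longrightarrow> 0 \<le> ar s 14 i \<and> ar s 14 i < sz"
    and Q: "\<And>t. ar t 8 = (\<lambda>x. if x \<in> ar s 14 ` {0..<vr s 42} then 1 else ar s 8 x) \<Longrightarrow>
      int (tk t) = int (tk s) + vr s 18 \<Longrightarrow> frame UNITS s t \<Longrightarrow> Q t"
  shows "wp UNITS Q s"
  unfolding UNITS_def
proof (rule wp_For[where P = "\<lambda>k t. ar t 8 = (\<lambda>x. if x \<in> ar s 14 ` {0..<min k (vr s 42)} then 1 else ar s 8 x) \<and>
    int (tk t) = int (tk s) + k"], goal_cases)
  case 1
  then show ?case using b by simp
next
  case (2 k t)
  have fr: "ar t 14 = ar s 14" "vr t 42 = vr s 42" using frameD[OF 2(5)] by auto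
  show ?case
  proof (cases "k < vr s 42")
    case True
    then have "{0..<min (k + 1) (vr s 42)} = insert k {0..<min k (vr s 42)}" using 2(1) by auto
    then have "(ar t 8)(ar s 14 k := 1) = (\<lambda>x. if x \<in> ar s 14 ` {0..<min (k + 1) (vr s 42)} then 1 else ar s 8 x)"
      using 2(3) by (auto simp: fun_eq_iff)
    then show ?thesis using True 2 fr g[of k] b by (intro wp_CondT) (simp_all add: wp_simps)
  next
    case False
    then have "min (k + 1) (vr s 42) = min k (vr s 42)" by simp
    then show ?thesis using False 2 fr b by (intro wp_CondF) (simp_all add: wp_simps)
  qed
next
  case (3 t)
  then show ?case using Q b by (simp add: UNITS_def min_def)
qed (use b in auto)

lemma wp_DOWN:
  assumes b: "0 \<le> vr s 10" "vr s 10 + int j = vr s 9" "vr s 9 \<le> sz"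
    and c: "\<And>x. vr s 10 \<le> x \<Longrightarrow> x < vr s 9 \<Longrightarrow> 0 \<le> ar s 6 x \<and> ar s 6 x < sz \<and> 0 \<le> ar s 7 x \<and> ar s 7 x < sz \<and>
        ar s 6 x < x \<and> ar s 7 x < x"
    and bit: "\<And>x. 0 \<le> x \<Longrightarrow> x < vr s 9 \<Longrightarrow> ar s 8 x \<in> {0, 1}"
    and Q: "\<And>t. ar t 8 = push (ar s 6) (ar s 7) (vr s 10) j (ar s 8) \<Longrightarrow>
      int (tk t) = int (tk s) + int j \<Longrightarrow> frame DOWN s t \<Longrightarrow> Q t"
  shows "wp DOWN Q s"
proof -
  define n where "n = vr s 9"
  define nl where "nl = vr s 10"
  let ?push = "push (ar s 6) (ar s 7) nl"
  note b' = b[folded n_def nl_def]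
  have "wp (For 30 41 (33 ::= V 9 .- N 1 .- V 30 ;; 34 ::= A 8 (V 33) ;;
       Sto 8 (A 7 (V 33)) (V 34) ;; Sto 8 (A 6 (V 33)) (N 1 .- V 34)))
     (\<lambda>t. ar t 8 = ?push j (ar s 8) \<and> int (tk t) = int (tk s) + int j) (s\<lparr>vr := (vr s)(41 := int j)\<rparr>)"
  proof (rule wp_For[where P = "\<lambda>k t. ?push (nat (int j - k)) (ar t 8) = ?push j (ar s 8) \<and>
      (\<forall>x. 0 \<le> x \<and> x < n \<longrightarrow> ar t 8 x \<in> {0, 1}) \<and> int (tk t) = int (tk s) + k"], goal_cases)
    case 1
    then show ?case using bit by (simp add: n_def)
  next
    case (2 k t)
    have fr: "ar t 6 = ar s 6" "ar t 7 = ar s 7" "vr t 9 = n" using frameD[OF 2(5)] by (auto simp: n_def)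
    have k: "0 \<le> k" "k < int j" "vr t 30 = k" using 2 by auto
    define x where "x = n - 1 - k"
    have x: "nl \<le> x" "x < n" "0 \<le> x" "x < sz" using k b' by (auto simp: x_def)
    have cx: "0 \<le> ar s 6 x" "ar s 6 x < sz" "0 \<le> ar s 7 x" "ar s 7 x < sz" "ar s 6 x < x" "ar s 7 x < x"
      using c[of x] x by (auto simp: n_def nl_def)
    obtain i where i: "nat (int j - k) = Suc i" "nat (int j - (k + 1)) = i" "nl + int i = x"
      using k b' by (intro that[of "nat (int j - k - 1)"]) (auto simp: x_def)
    let ?b = "(ar t 8)(ar s 7 x := ar t 8 x, ar s 6 x := 1 - ar t 8 x)"
    have p1: "?push i ?b = ?push j (ar s 8)" using 2(3) i by simp
    have bx: "ar t 8 x \<in> {0, 1}" using 2(3) x by blast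
    have p2: "\<forall>y. 0 \<le> y \<and> y < n \<longrightarrow> ?b y \<in> {0, 1}" using 2(3) bx by auto
    have "fits (1 - ar t 8 x)" using bx by auto
    moreover have "fits (n - 1)" "fits (n - 1 - k)" using k b' by (auto intro!: fits_small)
    ultimately show ?case using 2(3) fr k x cx p1 p2 i(2)
      by (simp add: wp_simps x_def[symmetric])
  next
    case (3 t)
    then show ?case by simp
  qed (use b' in auto)
  moreover have "n - nl = int j" "fits (int j)" using b' by (auto intro!: fits_small)
  ultimately have "wp DOWN (\<lambda>t. ar t 8 = ?push j (ar s 8) \<and> int (tk t) = int (tk s) + int j) s"
    unfolding DOWN_def wp_simps(4)
    by (subst wp_simps(2)) (simp add: n_def nl_def)
  then show ?thesis
    by (rule wp_conseq) (rule Q; simp add: nl_def)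
qed

end

definition FINAL :: com where
  "FINAL = (SEEK ;; BACKTRACK ;; GREEDY ;; UNITS ;; DOWN)"

lemma mod_FINAL [simp]: "modv FINAL = {30, 33, 34, 35, 41, 42}" "moda FINAL = {8}"
  by (auto simp: FINAL_def)

text \<open>
  The second functional counts the selected leaves: a leaf has weight 1, and the two leaves below a
  node that pairs them contribute exactly one selected leaf, so inner nodes have weight 0.

  Variable 4 is \<open>p\<close>, 8 the constant term of the first functional, 9 and 10 are the numbers of nodes
  and of leaves, and 24 is a leaf that is always selected. Array 5 holds the values of the nodes,
  arrays 6 and 7 their two children, and array 8 the bits.
\<close>

definition forest :: "int \<Rightarrow> (int \<Rightarrow> int) \<Rightarrow> int \<Rightarrow> int set \<Rightarrow> int \<Rightarrow> (nat \<Rightarrow> int) \<Rightarrow> (nat \<Rightarrow> int \<Rightarrow> int) \<Rightarrow> bool" where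
  "forest p X LF R ct v a \<longleftrightarrow>
    v 4 = p \<and> v 10 = 2 * p - 1 \<and> v 10 \<le> v 9 \<and> v 24 = LF \<and> 0 \<le> LF \<and> LF < v 10 \<and> LF \<notin> R \<and> R \<subseteq> {0..<v 9} \<and>
    0 \<le> v 8 \<and> v 8 < p \<and>
    (\<forall>x. v 10 \<le> x \<and> x < v 9 \<longrightarrow> 0 \<le> a 6 x \<and> a 6 x < x \<and> 0 \<le> a 7 x \<and> a 7 x < x) \<and>
    (\<forall>x\<in>R. 0 \<le> a 5 x \<and> a 5 x < p) \<and>
    (\<exists>U. coprime U p \<and> lrep p (a 6) (a 7) (v 10) (nat (v 9 - v 10)) (\<lambda>x. U * X x) LF R (v 8) (a 5)) \<and>
    lrep 0 (a 6) (a 7) (v 10) (nat (v 9 - v 10)) (\<lambda>_. 1) LF R ct (\<lambda>x. if x < v 10 then 1 else 0)"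

lemma forest_cong:
  assumes "forest p X LF R ct v a" "R' \<subseteq> R"
    "v' 4 = v 4" "v' 8 = v 8" "v' 9 = v 9" "v' 10 = v 10" "v' 24 = v 24" "a' 5 = a 5" "a' 6 = a 6" "a' 7 = a 7"
  shows "forest p X LF R' ct v' a'"
proof -
  have r: "R \<subseteq> {0..<v 10 + int (nat (v 9 - v 10))}" "LF \<notin> R" using assms(1) by (auto simp: forest_def)
  obtain U where "coprime U p" "lrep p (a 6) (a 7) (v 10) (nat (v 9 - v 10)) (\<lambda>x. U * X x) LF R (v 8) (a 5)"
    using assms(1) by (auto simp: forest_def)
  then have "\<exists>U. coprime U p \<and> lrep p (a 6) (a 7) (v 10) (nat (v 9 - v 10)) (\<lambda>x. U * X x) LF R' (v 8) (a 5)"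
    using lrep_mono[OF _ assms(2) r] by blast
  moreover have "lrep 0 (a 6) (a 7) (v 10) (nat (v 9 - v 10)) (\<lambda>_. 1) LF R' ct (\<lambda>x. if x < v 10 then 1 else 0)"
    using lrep_mono[OF _ assms(2) r] assms(1) by (auto simp: forest_def)
  ultimately show ?thesis
    using assms(1,2) unfolding forest_def assms(3-) by blast
qed

lemma distinct_lst: "distinct (lst f n) \<longleftrightarrow> inj_on f {0..<n}"
proof (cases "0 \<le> n")
  case True
  have e: "{0..<n} = int ` {0..<nat n}" using True by (simp add: image_int_atLeastLessThan)
  show ?thesis unfolding e lst_def by (auto simp: distinct_map inj_on_def)
qed (simp add: lst_def)

lemma sum_select:
  fixes f :: "int \<Rightarrow> int"
  assumes "inj_on f {0..<n}" "I \<subseteq> {0..<n}" "\<And>i. i \<in> {0..<n} \<Longrightarrow> b (f i) = (if i \<in> I then 1 else 0 :: int)"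
  shows "(\<Sum>x\<in>f ` {0..<n}. b x * w x) = (\<Sum>i\<in>I. w (f i))"
proof -
  have "(\<Sum>x\<in>f ` {0..<n}. b x * w x) = (\<Sum>i\<in>{0..<n}. b (f i) * w (f i))"
    using sum.reindex[OF assms(1)] by simp
  also have "\<dots> = (\<Sum>i\<in>{0..<n}. if i \<in> I then w (f i) else 0)"
    using assms(3) by (intro sum.cong) auto
  also have "\<dots> = (\<Sum>i\<in>{0..<n} \<inter> I. w (f i))" by (simp add: sum.inter_restrict)
  also have "{0..<n} \<inter> I = I" using assms(2) by auto
  finally show ?thesis .
qed

context ram
begin

lemma wp_FINAL:
  assumes F: "forest p X LF R p (vr s) (ar s)" and p: "prime p" "p \<le> sz"
    and b: "vr s 9 \<le> sz" "0 \<le> vr s 18" "vr s 18 \<le> vr s 13" "vr s 13 \<le> sz" "0 \<le> vr s 15" "vr s 15 \<le> sz"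
    and d: "distinct (lst (ar s 14) (vr s 13) @ lst (ar s 15) (vr s 15))"
      "set (lst (ar s 14) (vr s 13)) \<subseteq> R" "set (lst (ar s 15) (vr s 15)) \<subseteq> R"
    and ge: "\<And>x. x \<in> R \<Longrightarrow> 2 * p - 1 \<le> x"
    and v: "v = (\<lambda>i. ar s 5 (ar s 14 i))" "origin p v (vr s 13) (ar s 20)"
      "\<And>i. 0 \<le> i \<Longrightarrow> i < vr s 18 \<Longrightarrow> v i = 1"
    and g: "\<And>i. 0 \<le> i \<Longrightarrow> i < vr s 15 \<Longrightarrow> ar s 5 (ar s 15 i) \<le> vr s 18 + 1"
      "int (card (unm p (ar s 20))) \<le> (\<Sum>i\<in>{0..<vr s 15}. ar s 5 (ar s 15 i))"
    and Q: "\<And>t. (\<forall>x\<in>{0..<2 * p - 1}. ar t 8 x \<in> {0, 1}) \<Longrightarrow> (\<Sum>x\<in>{0..<2 * p - 1}. ar t 8 x) = p \<Longrightarrow>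
      [(\<Sum>x\<in>{0..<2 * p - 1}. ar t 8 x * X x) = 0] (mod p) \<Longrightarrow>
      int (tk t) \<le> int (tk s) + 2 * vr s 9 + p + 2 * vr s 13 + vr s 15 \<Longrightarrow> frame FINAL s t \<Longrightarrow> Q t"
  shows "wp FINAL Q s"
proof -
  define nn where "nn = vr s 9"
  define nl where "nl = vr s 10"
  define c where "c = vr s 8"
  define nq where "nq = vr s 13"
  define ng where "ng = vr s 15"
  define L0 where "L0 = vr s 18"
  define qf where "qf = ar s 14"
  define gf where "gf = ar s 15"
  define val where "val = ar s 5"
  define org where "org = ar s 20"
  define j where "j = nat (nn - nl)"
  define R' where "R' = qf ` {0..<nq} \<union> gf ` {0..<ng}"
  note b' = b[folded nn_def nq_def ng_def L0_def]
  have p1: "1 < p" using p prime_gt_1_int by blast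
  have R'R: "R' \<subseteq> R" using d(2,3) unfolding R'_def set_lst qf_def gf_def nq_def ng_def by blast
  have F': "forest p X LF R' p (vr s) (ar s)" by (rule forest_cong[OF F R'R]) auto
  have f1: "vr s 4 = p" "nl = 2 * p - 1" "nl \<le> nn" "vr s 24 = LF" "0 \<le> LF" "LF < nl" "LF \<notin> R'" "R' \<subseteq> {0..<nn}" "0 \<le> c" "c < p"
    using F' by (auto simp: forest_def nl_def nn_def c_def)
  have f2: "0 \<le> ar s 6 x \<and> ar s 6 x < x \<and> 0 \<le> ar s 7 x \<and> ar s 7 x < x \<and> ar s 6 x < sz \<and> ar s 7 x < sz"
    if "nl \<le> x" "x < nn" for x
  proof -
    have "0 \<le> ar s 6 x \<and> ar s 6 x < x \<and> 0 \<le> ar s 7 x \<and> ar s 7 x < x"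
      using F' that by (auto simp: forest_def nl_def nn_def)
    then show ?thesis using that b'(1) by linarith
  qed
  have f3: "0 \<le> val x \<and> val x < p" if "x \<in> R'" for x
    using F' that by (auto simp: forest_def val_def)
  obtain U where U: "coprime U p" "lrep p (ar s 6) (ar s 7) nl j (\<lambda>x. U * X x) LF R' c val"
    using F' by (auto simp: forest_def nl_def j_def nn_def c_def val_def)
  have f4: "lrep 0 (ar s 6) (ar s 7) nl j (\<lambda>_. 1) LF R' p (\<lambda>x. if x < nl then 1 else 0)"
    using F' by (auto simp: forest_def nl_def j_def nn_def)
  have ij: "inj_on qf {0..<nq}" "inj_on gf {0..<ng}" "qf ` {0..<nq} \<inter> gf ` {0..<ng} = {}"
    using d(1) unfolding distinct_append distinct_lst set_lst qf_def gf_def nq_def ng_def by auto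
  have qr: "0 \<le> qf i \<and> qf i < nn \<and> qf i < sz \<and> qf i \<noteq> LF \<and> 0 \<le> val (qf i) \<and> val (qf i) < p" if "0 \<le> i" "i < nq" for i
  proof -
    have "qf i \<in> R'" using that by (auto simp: R'_def)
    then show ?thesis using f1(7,8) f3 b'(1) by fastforce
  qed
  have gr: "0 \<le> gf i \<and> gf i < nn \<and> gf i < sz \<and> gf i \<noteq> LF \<and> 0 \<le> val (gf i) \<and> val (gf i) < p" if "0 \<le> i" "i < ng" for i
  proof -
    have "gf i \<in> R'" using that by (auto simp: R'_def)
    then show ?thesis using f1(7,8) f3 b'(1) by fastforce
  qed
  have cu: "int (card (unm p org)) \<le> p"
  proof -
    have "card (unm p org) \<le> card {0..<p}" by (intro card_mono) (auto simp: unm_def)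
    then show ?thesis using p1 by simp
  qed
  have "wp FINAL (\<lambda>t. (\<forall>x\<in>{0..<nl}. ar t 8 x \<in> {0, 1}) \<and> (\<Sum>x\<in>{0..<nl}. ar t 8 x) = p \<and>
      [(\<Sum>x\<in>{0..<nl}. ar t 8 x * X x) = 0] (mod p) \<and>
      int (tk t) \<le> int (tk s) + 2 * nn + p + 2 * nq + ng) s"
    unfolding FINAL_def wp_simps(4)
  proof (rule wp_SEEK)
    fix s1 assume s1: "\<forall>x. 0 \<le> x \<and> x < vr s 9 \<longrightarrow> ar s1 8 x = (if x = vr s 24 then 1 else 0)"
      "0 \<le> vr s1 42" "vr s1 42 \<le> int (card (unm (vr s 4) (ar s 20)))"
      "vr s1 33 = (- vr s 8 - vr s1 42) mod vr s 4" "ar s 20 (vr s1 33) \<noteq> -2"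
      "int (tk s1) \<le> int (tk s) + vr s 9 + vr s 4" "frame SEEK s s1"
    define e where "e = vr s1 42"
    have g1: "vr s1 4 = p" "vr s1 18 = L0" "vr s1 13 = nq" "vr s1 15 = ng" "ar s1 20 = org" "ar s1 5 = val" "ar s1 14 = qf"
       "ar s1 15 = gf" "ar s1 6 = ar s 6" "ar s1 7 = ar s 7" "vr s1 9 = nn" "vr s1 10 = nl"
      using frameD[OF s1(7)] f1 by (auto simp: L0_def nq_def ng_def org_def val_def qf_def gf_def nn_def nl_def)
    have e: "0 \<le> e" "e \<le> int (card (unm p org))" "vr s1 33 = (- c - e) mod p"
      using s1(2-4) f1 by (auto simp: e_def org_def c_def)
    show "wp BACKTRACK (wp GREEDY (wp UNITS (wp DOWN (\<lambda>t. (\<forall>x\<in>{0..<nl}. ar t 8 x \<in> {0, 1}) \<and> (\<Sum>x\<in>{0..<nl}. ar t 8 x) = p \<and>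
      [(\<Sum>x\<in>{0..<nl}. ar t 8 x * X x) = 0] (mod p) \<and>
      int (tk t) \<le> int (tk s) + 2 * nn + p + 2 * nq + ng)))) s1"
    proof (rule wp_BACKTRACK[where v = v])
      fix s2 I assume s2: "I \<subseteq> {0..<vr s1 13}" "[vr s1 33 = (\<Sum>i\<in>I. v i)] (mod vr s1 4)"
        "vr s2 42 = vr s1 42 + int (card (I \<inter> {0..<vr s1 18}))"
        "ar s2 8 = (\<lambda>x. if x \<in> ar s1 14 ` (I \<inter> {vr s1 18..}) then 1 else ar s1 8 x)"
        "int (tk s2) \<le> int (tk s1) + vr s1 13" "frame BACKTRACK s1 s2"
      define x0 where "x0 = int (card (I \<inter> {0..<L0}))"
      have g2: "vr s2 18 = L0" "vr s2 15 = ng" "ar s2 5 = val" "ar s2 14 = qf"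
       "ar s2 15 = gf" "ar s2 6 = ar s 6" "ar s2 7 = ar s 7" "vr s2 9 = nn" "vr s2 10 = nl" "vr s2 42 = e + x0"
        using frameD[OF s2(6)] g1 s2(3) by (auto simp: x0_def e_def)
      have Isub: "I \<subseteq> {0..<nq}" using s2(1) g1 by simp
      have x0: "0 \<le> x0" "x0 \<le> L0"
      proof -
        have "card (I \<inter> {0..<L0}) \<le> card {0..<L0}" by (intro card_mono) auto
        then show "0 \<le> x0" "x0 \<le> L0" using b' by (auto simp: x0_def)
      qed
      have sI: "(\<Sum>i\<in>I. v i) = x0 + (\<Sum>i\<in>I \<inter> {L0..}. v i)"
      proof -
        have fin: "finite I" using Isub finite_subset by blast
        have "I = (I \<inter> {0..<L0}) \<union> (I \<inter> {L0..})" using Isub by auto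
        then have "(\<Sum>i\<in>I. v i) = (\<Sum>i\<in>I \<inter> {0..<L0}. v i) + (\<Sum>i\<in>I \<inter> {L0..}. v i)"
          using fin by (subst sum.union_disjoint[symmetric]) auto
        moreover have "(\<Sum>i\<in>I \<inter> {0..<L0}. v i) = (\<Sum>i\<in>I \<inter> {0..<L0}. 1)"
          using v(3) by (intro sum.cong) (auto simp: L0_def)
        ultimately show ?thesis by (simp add: x0_def)
      qed
      show "wp GREEDY (wp UNITS (wp DOWN (\<lambda>t. (\<forall>x\<in>{0..<nl}. ar t 8 x \<in> {0, 1}) \<and> (\<Sum>x\<in>{0..<nl}. ar t 8 x) = p \<and>
        [(\<Sum>x\<in>{0..<nl}. ar t 8 x * X x) = 0] (mod p) \<and>
        int (tk t) \<le> int (tk s) + 2 * nn + p + 2 * nq + ng))) s2"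
      proof (rule wp_GREEDY)
        fix s3 G assume s3: "G \<subseteq> {0..<vr s2 15}" "vr s2 42 = vr s3 42 + (\<Sum>i\<in>G. ar s2 5 (ar s2 15 i))"
          "0 \<le> vr s3 42" "vr s3 42 \<le> vr s2 18" "ar s3 8 = (\<lambda>x. if x \<in> ar s2 15 ` G then 1 else ar s2 8 x)"
          "int (tk s3) = int (tk s2) + vr s2 15" "frame GREEDY s2 s3"
        define y where "y = vr s3 42"
        have g3: "vr s3 18 = L0" "ar s3 14 = qf" "ar s3 6 = ar s 6" "ar s3 7 = ar s 7" "vr s3 9 = nn" "vr s3 10 = nl"
          using frameD[OF s3(7)] g2 by auto
        have y: "0 \<le> y" "y \<le> L0" "e + x0 = y + (\<Sum>i\<in>G. val (gf i))" "G \<subseteq> {0..<ng}"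
          using s3(1-4) g2 by (auto simp: y_def)
        show "wp UNITS (wp DOWN (\<lambda>t. (\<forall>x\<in>{0..<nl}. ar t 8 x \<in> {0, 1}) \<and> (\<Sum>x\<in>{0..<nl}. ar t 8 x) = p \<and>
          [(\<Sum>x\<in>{0..<nl}. ar t 8 x * X x) = 0] (mod p) \<and>
          int (tk t) \<le> int (tk s) + 2 * nn + p + 2 * nq + ng)) s3"
        proof (rule wp_UNITS)
          fix s4 assume s4: "ar s4 8 = (\<lambda>x. if x \<in> ar s3 14 ` {0..<vr s3 42} then 1 else ar s3 8 x)"
            "int (tk s4) = int (tk s3) + vr s3 18" "frame UNITS s3 s4"
          have g4: "ar s4 6 = ar s 6" "ar s4 7 = ar s 7" "vr s4 9 = nn" "vr s4 10 = nl"
            using frameD[OF s4(3)] g3 by auto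
          define b where "b = ar s4 8"
          let ?IQ = "(I \<inter> {L0..}) \<union> {0..<y}"
          have bx: "b x = (if x \<in> qf ` ?IQ \<or> x \<in> gf ` G \<or> x = LF then 1 else 0)" if "0 \<le> x" "x < nn" for x
            unfolding b_def s4(1) s3(5) s2(4) using s1(1) that f1(4) g1 g2 g3 by (auto simp: y_def nn_def)
          have IQ: "?IQ \<subseteq> {0..<nq}" using Isub y b' by auto
          have inR: "qf ` ?IQ \<subseteq> R'" "gf ` G \<subseteq> R'" using IQ y(4) by (auto simp: R'_def)
          have bits: "bits LF R' nn b" unfolding bits_def
            using bx inR f1(3-8) by auto
          have bq: "b (qf i) = (if i \<in> ?IQ then 1 else 0)" if "i \<in> {0..<nq}" for i
          proof -
            have "qf i \<notin> gf ` G" using ij(3) y(4) that by blast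
            moreover have "qf i \<in> qf ` ?IQ \<longleftrightarrow> i \<in> ?IQ" using ij(1) IQ that by (meson inj_on_image_mem_iff)
            ultimately show ?thesis using bx[of "qf i"] qr[of i] that by auto
          qed
          have bg: "b (gf i) = (if i \<in> G then 1 else 0)" if "i \<in> {0..<ng}" for i
          proof -
            have "gf i \<notin> qf ` ?IQ" using ij(3) IQ that by blast
            moreover have "gf i \<in> gf ` G \<longleftrightarrow> i \<in> G" using ij(2) y(4) that by (meson inj_on_image_mem_iff)
            ultimately show ?thesis using bx[of "gf i"] gr[of i] that by auto
          qed
          \<comment> \<open>The greedy items together with \<open>y\<close> units account for the
            deficit \<open>e\<close> and the \<open>x0\<close> units of the walk. So the selected
            values have the sum \<open>e + (\<Sum>i\<in>I. v i)\<close>, which is congruent to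
            \<open>- c\<close>.\<close>
          have "(\<Sum>x\<in>R'. b x * val x) = (\<Sum>x\<in>qf ` {0..<nq}. b x * val x) + (\<Sum>x\<in>gf ` {0..<ng}. b x * val x)"
            unfolding R'_def using ij(3) by (intro sum.union_disjoint) auto
          also have "\<dots> = (\<Sum>i\<in>?IQ. val (qf i)) + (\<Sum>i\<in>G. val (gf i))"
            using sum_select[OF ij(1) IQ bq] sum_select[OF ij(2) y(4) bg] by simp
          also have "(\<Sum>i\<in>?IQ. val (qf i)) = (\<Sum>i\<in>I \<inter> {L0..}. v i) + (\<Sum>i\<in>{0..<y}. v i)"
            using y Isub finite_subset[OF Isub]
            by (subst sum.union_disjoint) (auto simp: v(1) val_def qf_def)
          also have "(\<Sum>i\<in>{0..<y}. v i) = (\<Sum>i\<in>{0..<y}. 1)" using v(3) y by (intro sum.cong) (auto simp: L0_def)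
          also have "\<dots> = y" using y by simp
          finally have sumR: "(\<Sum>x\<in>R'. b x * val x) = e + (\<Sum>i\<in>I. v i)" using y(3) sI by linarith
          have jn: "nl + int j = nn" using f1 by (simp add: j_def)
          have "[c + (\<Sum>x\<in>R'. b x * val x) = 0] (mod p)"
          proof -
            have "[(\<Sum>i\<in>I. v i) = - c - e] (mod p)"
              using s2(2) g1 e(3) by (simp add: cong_def)
            then have "[c + (e + (\<Sum>i\<in>I. v i)) = c + (e + (- c - e))] (mod p)"
              by (intro cong_add cong_refl)
            then show ?thesis unfolding sumR by simp
          qed
          moreover have push: "\<forall>x\<in>{0..<nl}. push (ar s 6) (ar s 7) nl j b x \<in> {0, 1}"
            "[\<Sum>x\<in>{0..<nl}. push (ar s 6) (ar s 7) nl j b x * (U * X x) = c + (\<Sum>x\<in>R'. b x * val x)] (mod p)"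
            using U(2) bits unfolding lrep_def jn by blast+
          ultimately have "[\<Sum>x\<in>{0..<nl}. push (ar s 6) (ar s 7) nl j b x * (U * X x) = 0] (mod p)"
            using cong_trans by blast
          moreover have "(\<Sum>x\<in>{0..<nl}. push (ar s 6) (ar s 7) nl j b x * (U * X x)) =
              U * (\<Sum>x\<in>{0..<nl}. push (ar s 6) (ar s 7) nl j b x * X x)"
            by (simp add: sum_distrib_left mult.left_commute)
          ultimately have "p dvd U * (\<Sum>x\<in>{0..<nl}. push (ar s 6) (ar s 7) nl j b x * X x)"
            by (simp add: cong_0_iff)
          then have z: "[(\<Sum>x\<in>{0..<nl}. push (ar s 6) (ar s 7) nl j b x * X x) = 0] (mod p)"
            using U(1) by (simp add: cong_0_iff coprime_dvd_mult_right_iff coprime_commute)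
          \<comment> \<open>All roots in \<open>R'\<close> are inner nodes of weight 0, so every
            choice of bits selects exactly \<open>p\<close> leaves.\<close>
          have "(\<Sum>x\<in>{0..<nl}. push (ar s 6) (ar s 7) nl j b x * 1) = p + (\<Sum>x\<in>R'. b x * (if x < nl then 1 else 0))"
            using f4 bits unfolding lrep_def jn by (simp add: cong_def)
          moreover have "(\<Sum>x\<in>R'. b x * (if x < nl then 1 else 0)) = 0"
          proof (rule sum.neutral, intro ballI)
            fix x assume "x \<in> R'"
            then show "b x * (if x < nl then 1 else 0) = 0" using ge[of x] R'R f1(2) by auto
          qed
          ultimately have cnt: "(\<Sum>x\<in>{0..<nl}. push (ar s 6) (ar s 7) nl j b x) = p" by simp
          show "wp DOWN (\<lambda>t. (\<forall>x\<in>{0..<nl}. ar t 8 x \<in> {0, 1}) \<and> (\<Sum>x\<in>{0..<nl}. ar t 8 x) = p \<and>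
            [(\<Sum>x\<in>{0..<nl}. ar t 8 x * X x) = 0] (mod p) \<and>
            int (tk t) \<le> int (tk s) + 2 * nn + p + 2 * nq + ng) s4"
          proof (rule wp_DOWN[where j = j])
            fix t assume t: "ar t 8 = push (ar s4 6) (ar s4 7) (vr s4 10) j (ar s4 8)" "int (tk t) = int (tk s4) + int j"
            have e8: "ar t 8 = push (ar s 6) (ar s 7) nl j b" using t(1) g4 by (simp add: b_def)
            have "int (tk t) \<le> int (tk s) + 2 * nn + p + 2 * nq + ng"
              using t(2) s4(2) s3(6) s2(5) s1(6) g1(3) g2(2) g3(1) b'(2,3) f1(1) jn f1(5,6)
              unfolding nn_def by linarith
            then show "(\<forall>x\<in>{0..<nl}. ar t 8 x \<in> {0, 1}) \<and> (\<Sum>x\<in>{0..<nl}. ar t 8 x) = p \<and>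
              [(\<Sum>x\<in>{0..<nl}. ar t 8 x * X x) = 0] (mod p) \<and>
              int (tk t) \<le> int (tk s) + 2 * nn + p + 2 * nq + ng"
              unfolding e8 using push(1) z cnt by blast
          qed (use g4 f2 f1 b' jn bits in \<open>auto simp: b_def bits_def\<close>)
        qed (use g3 y qr b' in \<open>auto simp: y_def\<close>)
      qed (use g2 x0 e gr g cu b' p p1 in \<open>auto simp: ng_def L0_def val_def gf_def org_def\<close>)
    qed (use g1 p1 p b' e qr s1(5) v f1 cu in \<open>auto simp: org_def val_def qf_def nq_def e_def[symmetric]\<close>)
  qed (use f1 p1 p b' v(2) in \<open>auto simp: nn_def c_def origin_def\<close>)
  then show ?thesis
    by (rule wp_conseq) (rule Q; simp add: f1(2)[symmetric] nn_def nq_def ng_def)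
qed

end

lemma origin_cong:
  assumes "origin p v n org" "\<And>i. 0 \<le> i \<Longrightarrow> i < n \<Longrightarrow> v i = v' i"
  shows "origin p v' n org"
  unfolding origin_def
proof (intro conjI allI impI)
  show "org 0 = -1" using assms(1) by (simp add: origin_def)
  fix y assume y: "0 \<le> y \<and> y < p"
  then have "org y = -2 \<or> (org y = -1 \<and> y = 0) \<or>
     (0 \<le> org y \<and> org y < n \<and> -1 \<le> org ((y - v (org y)) mod p) \<and> org ((y - v (org y)) mod p) < org y)"
    using assms(1) unfolding origin_def by blast
  then show "org y = -2 \<or> (org y = -1 \<and> y = 0) \<or>
     (0 \<le> org y \<and> org y < n \<and> -1 \<le> org ((y - v' (org y)) mod p) \<and> org ((y - v' (org y)) mod p) < org y)"
    using assms(2)[of "org y"] by auto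
qed

text \<open>Multiplying all root values and the constant term by a unit multiplies the functional of
  the leaves by it, which does not change where it vanishes modulo \<open>p\<close>. The quantified
  factor \<open>U\<close> in \<open>forest\<close> absorbs the unit.\<close>

lemma forest_scale:
  assumes F: "forest p X LF R ct v a" and c: "coprime c p" "0 < p"
    and v: "v' 4 = v 4" "v' 9 = v 9" "v' 10 = v 10" "v' 24 = v 24" "v' 8 = v 8 * c mod p"
    and a: "a' 6 = a 6" "a' 7 = a 7" "\<And>x. x \<in> R' \<Longrightarrow> a' 5 x = a 5 x * c mod p" and R: "R' \<subseteq> R"
  shows "forest p X LF R' ct v' a'"
proof -
  have F': "forest p X LF R' ct v a" by (rule forest_cong[OF F R]) auto
  obtain U where U: "coprime U p" "lrep p (a 6) (a 7) (v 10) (nat (v 9 - v 10)) (\<lambda>x. U * X x) LF R' (v 8) (a 5)"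
    using F' by (auto simp: forest_def)
  have "lrep p (a 6) (a 7) (v 10) (nat (v 9 - v 10)) (\<lambda>x. c * (U * X x)) LF R' (v' 8) (a' 5)"
    by (rule lrep_cong[OF lrep_scale[OF U(2), of c]])
      (use a v in \<open>auto simp: cong_def mod_simps mult.commute\<close>)
  then have "\<exists>U. coprime U p \<and> lrep p (a 6) (a 7) (v 10) (nat (v 9 - v 10)) (\<lambda>x. U * X x) LF R' (v' 8) (a' 5)"
    using U(1) c by (intro exI[of _ "c * U"]) (simp add: mult.assoc)
  moreover have "\<forall>x\<in>R'. 0 \<le> a' 5 x \<and> a' 5 x < p" using a(3) c(2) by simp
  moreover have "0 \<le> v' 8" "v' 8 < p" using v(5) c(2) by simp_all
  ultimately show ?thesis using F' unfolding forest_def v(1-4) a(1,2) by blast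
qed

text \<open>A pair of leaves always contains exactly one selected leaf, so it raises the count
  \<open>ct\<close> by 1; a pair of inner nodes does not affect it. As the list is sorted,
  differences of residues lie in the range from 0 to \<open>p - 1\<close> and need no reduction.
  Entries of \<open>xs\<close> left without a partner are given up.\<close>

lemma forest_pairs:
  assumes F: "forest p X LF R ct v a" and xs: "set xs \<subseteq> R" "distinct xs" "sorted (map (a 5) xs)"
    and ps: "ps = pairs (a 5) xs \<sigma> bd"
    and leaf: "(\<forall>x\<in>set xs. x < v 10) \<and> w = 1 \<or> (\<forall>x\<in>set xs. v 10 \<le> x) \<and> w = 0"
    and v: "v' 4 = v 4" "v' 10 = v 10" "v' 24 = v 24" "v' 9 = v 9 + int (length ps)"
      "[v' 8 = v 8 + sum_list (map (\<lambda>i. a 5 (xs ! i)) ps)] (mod p)" "0 \<le> v' 8" "v' 8 < p"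
    and a1: "\<And>i. i < length ps \<Longrightarrow> a' 6 (v 9 + int i) = xs ! (ps ! i) \<and> a' 7 (v 9 + int i) = xs ! (ps ! i + \<sigma>) \<and>
         a' 5 (v 9 + int i) = a 5 (xs ! (ps ! i + \<sigma>)) - a 5 (xs ! (ps ! i))"
    and a2: "\<And>x. x < v 9 \<Longrightarrow> a' 5 x = a 5 x \<and> a' 6 x = a 6 x \<and> a' 7 x = a 7 x"
  shows "forest p X LF (R - set xs \<union> {v 9..<v 9 + int (length ps)}) (ct + w * int (length ps)) v' a'"
proof -
  define k where "k = length ps"
  define j where "j = nat (v 9 - v 10)"
  define ls where "ls = map (\<lambda>i. xs ! i) ps"
  define rs where "rs = map (\<lambda>i. xs ! (i + \<sigma>)) ps"
  have f: "v 4 = p" "v 10 = 2 * p - 1" "v 10 \<le> v 9" "v 24 = LF" "0 \<le> LF" "LF < v 10" "LF \<notin> R" "R \<subseteq> {0..<v 9}"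
    using F by (auto simp: forest_def)
  have jn: "v 10 + int j = v 9" using f by (simp add: j_def)
  have pb: "i + \<sigma> < length xs" "i < length xs" if "i \<in> set ps" for i
    using pairs_bound[of i "a 5" xs \<sigma> bd] that ps by auto
  have len: "length ls = k" "length rs = k" by (auto simp: ls_def rs_def k_def)
  have dis: "distinct (ls @ rs)" using pairs_distinct[OF xs(2)] ps by (simp add: ls_def rs_def)
  have sub: "set ls \<union> set rs \<subseteq> set xs" using pb by (auto simp: ls_def rs_def)
  let ?R1 = "R - set ls - set rs \<union> {v 9..<v 9 + int k}"
  let ?R = "R - set xs \<union> {v 9..<v 9 + int k}"
  have RR: "?R \<subseteq> ?R1" using sub by auto
  have R1: "?R1 \<subseteq> {0..<v 10 + int (j + k)}" "LF \<notin> ?R1" using f jn by auto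
  have nth: "ls ! i = xs ! (ps ! i)" "rs ! i = xs ! (ps ! i + \<sigma>)" "ps ! i \<in> set ps" if "i < k" for i
    using that by (auto simp: ls_def rs_def k_def)
  have vx: "a' 5 x = a 5 x" if "x \<in> R" for x using a2 that f(8) by auto
  obtain U where U: "coprime U p" "lrep p (a 6) (a 7) (v 10) j (\<lambda>x. U * X x) LF R (v 8) (a 5)"
    using F by (auto simp: forest_def j_def)
  have "lrep p (a' 6) (a' 7) (v 10) j (\<lambda>x. U * X x) LF R (v 8) (a' 5)"
    by (rule lrep_cong[OF U(2)]) (use a2 vx jn in auto)
  then have "lrep p (a' 6) (a' 7) (v 10) (j + k) (\<lambda>x. U * X x) LF ?R1 (v 8 + sum_list (map (a' 5) ls)) (a' 5)"
    unfolding jn[symmetric]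
  proof (rule lrep_pairs)
    fix i assume i: "i < k"
    have "xs ! (ps ! i) \<in> R" "xs ! (ps ! i + \<sigma>) \<in> R"
      using pb[OF nth(3)[OF i]] xs(1) by (meson nth_mem subsetD)+
    then show "a' 6 (v 10 + int j + int i) = ls ! i \<and> a' 7 (v 10 + int j + int i) = rs ! i \<and>
        a' 5 (v 10 + int j + int i) = a' 5 (rs ! i) - a' 5 (ls ! i)"
      using a1[of i] i nth vx unfolding jn by (simp add: k_def)
  qed (use f jn len dis sub xs in auto)
  moreover have "map (a' 5) ls = map (\<lambda>i. a 5 (xs ! i)) ps"
    unfolding ls_def using pb xs(1) vx by (auto simp: subset_iff)
  ultimately have l1: "lrep p (a' 6) (a' 7) (v 10) (j + k) (\<lambda>x. U * X x) LF ?R1 (v' 8) (a' 5)"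
    using v(5) by (elim lrep_cong) (auto simp: cong_sym)
  have l1: "lrep p (a' 6) (a' 7) (v 10) (j + k) (\<lambda>x. U * X x) LF ?R (v' 8) (a' 5)"
    by (rule lrep_mono[OF l1 RR R1])
  let ?wt = "\<lambda>x. if x < v 10 then 1 else 0 :: int"
  have "lrep 0 (a 6) (a 7) (v 10) j (\<lambda>_. 1) LF R ct ?wt"
    using F by (auto simp: forest_def j_def)
  then have "lrep 0 (a' 6) (a' 7) (v 10) j (\<lambda>_. 1) LF R ct ?wt"
    by (rule lrep_cong) (use a2 jn in auto)
  then have "lrep 0 (a' 6) (a' 7) (v 10) (j + k) (\<lambda>_. 1) LF ?R1 (ct + sum_list (map ?wt ls)) ?wt"
    unfolding jn[symmetric]
  proof (rule lrep_pairs)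
    fix i assume i: "i < k"
    have "xs ! (ps ! i) \<in> set xs" "xs ! (ps ! i + \<sigma>) \<in> set xs"
      using pb[OF nth(3)[OF i]] by auto
    then show "a' 6 (v 10 + int j + int i) = ls ! i \<and> a' 7 (v 10 + int j + int i) = rs ! i \<and>
        ?wt (v 10 + int j + int i) = ?wt (rs ! i) - ?wt (ls ! i)"
      using a1[of i] i nth leaf f(3) unfolding jn by (auto simp: k_def)
  qed (use f jn len dis sub xs in auto)
  moreover have "map ?wt ls = map (\<lambda>_. w) ls"
  proof (rule map_cong[OF refl])
    fix x assume "x \<in> set ls"
    then have "x \<in> set xs" using sub by blast
    then show "?wt x = w" using leaf by auto
  qed
  moreover have "sum_list (map (\<lambda>_. w) ls) = w * int k" using len by (simp add: sum_list_triv)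
  ultimately have "lrep 0 (a' 6) (a' 7) (v 10) (j + k) (\<lambda>_. 1) LF ?R1 (ct + w * int k) ?wt" by simp
  then have l2: "lrep 0 (a' 6) (a' 7) (v 10) (j + k) (\<lambda>_. 1) LF ?R (ct + w * int k) ?wt"
    by (rule lrep_mono[OF _ RR R1])
  have jk: "nat (v' 9 - v 10) = j + k" using v f by (simp add: j_def k_def nat_add_distrib)
  have ch: "0 \<le> a' 6 x \<and> a' 6 x < x \<and> 0 \<le> a' 7 x \<and> a' 7 x < x" if "v 10 \<le> x" "x < v 9 + int k" for x
  proof (cases "x < v 9")
    case True
    then show ?thesis using a2 F that by (auto simp: forest_def)
  next
    case False
    define i where "i = nat (x - v 9)"
    have i: "i < k" "x = v 9 + int i" using False that by (auto simp: i_def)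
    have "xs ! (ps ! i) \<in> R" "xs ! (ps ! i + \<sigma>) \<in> R"
      using pb[OF nth(3)[OF i(1)]] xs(1) by (meson nth_mem subsetD)+
    then show ?thesis using a1[of i] i f(8) by (auto simp: k_def)
  qed
  have vr: "0 \<le> a' 5 x \<and> a' 5 x < p" if "x \<in> ?R" for x
  proof (cases "x < v 9")
    case True
    then have "x \<in> R" using that by auto
    then show ?thesis using vx F by (auto simp: forest_def)
  next
    case False
    then have xk: "x < v 9 + int k" using that f(8) by auto
    define i where "i = nat (x - v 9)"
    have i: "i < k" "x = v 9 + int i" using False xk by (auto simp: i_def)
    note pi = pb[OF nth(3)[OF i(1)]]
    have "xs ! (ps ! i) \<in> R" "xs ! (ps ! i + \<sigma>) \<in> R" using pi xs(1) by (meson nth_mem subsetD)+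
    then have "0 \<le> a 5 (xs ! (ps ! i))" "a 5 (xs ! (ps ! i + \<sigma>)) < p" using F by (auto simp: forest_def)
    moreover have "a 5 (xs ! (ps ! i)) \<le> a 5 (xs ! (ps ! i + \<sigma>))"
      using sorted_nth_mono[OF xs(3), of "ps ! i" "ps ! i + \<sigma>"] pi by simp
    ultimately show ?thesis using a1[of i] i by (auto simp: k_def)
  qed
  have "LF \<notin> ?R" "?R \<subseteq> {0..<v' 9}" using f v by (auto simp: k_def)
  then show ?thesis unfolding forest_def k_def[symmetric] jk v(2)
    using f v(1,3,4,6,7) ch vr l1 l2 U(1) by (auto simp: k_def)
qed

definition SOLVE :: com where
  "SOLVE = (WALK ;; SORT 13 14 5 4 ;; 20 ::= V 18 .+ N 1 ;; PAIR 13 14 15 15 ;; FINAL)"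

lemma mod_SOLVE [simp]:
  "modv SOLVE = {8, 9, 15, 20} \<union> {30, 31, 32, 33, 34, 35, 36, 37, 38, 39, 41, 42}"
  "moda SOLVE = {5, 6, 7, 8, 13, 15, 16, 17, 20, 21, 22}"
  by (auto simp: SOLVE_def)

context ram
begin

text \<open>The residues are split into \<open>qs\<close>, which feed the walk, and
  \<open>ts\<close>, which are paired for the greedy choice. Two numerical conditions govern the
  split: \<open>H\<close> makes the walk run in linear time, and \<open>E\<close> lets the
  differences of \<open>ts\<close> make up for the residues that the walk leaves unreached.\<close>

lemma wp_SOLVE:
  fixes Ka :: int
  assumes F: "forest p X LF R p (vr s) (ar s)" and p: "prime p" "0 \<le> Ka"
    and b: "vr s 9 + p \<le> sz" "0 \<le> vr s 18" "vr s 18 \<le> vr s 13" "vr s 13 \<le> p" "0 \<le> vr s 14" "vr s 14 \<le> p"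
      "vr s 19 = int \<sigma>" "vr s 19 \<le> 10 * sz"
    and qs: "qs = lst (ar s 14) (vr s 13)" and ts: "ts = lst (ar s 13) (vr s 14)"
    and d: "distinct (qs @ ts)" "set qs \<subseteq> R" "set ts \<subseteq> R" "\<And>x. x \<in> R \<Longrightarrow> 2 * p - 1 \<le> x"
      "\<And>x. x \<in> set qs \<Longrightarrow> 0 < ar s 5 x"
    and v: "v = (\<lambda>i. ar s 5 (ar s 14 i))" "\<And>i. 0 \<le> i \<Longrightarrow> i < vr s 18 \<Longrightarrow> v i = 1"
    and H: "\<And>i. 0 < i \<Longrightarrow> i < vr s 13 \<Longrightarrow> v i \<noteq> v (i - 1) \<Longrightarrow>
       \<exists>e. i < e \<and> e \<le> vr s 13 \<and> (\<forall>j. i \<le> j \<and> j < e \<longrightarrow> v j = v i) \<and> p - 1 - i \<le> Ka * (e - i)"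
    and E: "max 0 (p - 1 - vr s 13) \<le> pairs_sum (ar s 5) (sort_key (ar s 5) ts) \<sigma> (vr s 18 + 1)"
    and Q: "\<And>t. (\<forall>x\<in>{0..<2 * p - 1}. ar t 8 x \<in> {0, 1}) \<Longrightarrow> (\<Sum>x\<in>{0..<2 * p - 1}. ar t 8 x) = p \<Longrightarrow>
      [(\<Sum>x\<in>{0..<2 * p - 1}. ar t 8 x * X x) = 0] (mod p) \<Longrightarrow>
      int (tk t) \<le> int (tk s) + 20 * p + Ka * p + 2 * vr s 9 \<Longrightarrow> frame SOLVE s t \<Longrightarrow> Q t"
  shows "wp SOLVE Q s"
proof -
  define nq where "nq = vr s 13"
  define nt where "nt = vr s 14"
  define L0 where "L0 = vr s 18"
  define n9 where "n9 = vr s 9"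
  define f where "f = ar s 5"
  define zs where "zs = sort_key f ts"
  note b' = b[folded nq_def nt_def L0_def n9_def]
  have p1: "1 < p" using p prime_gt_1_int by blast
  have f0: "vr s 4 = p" "R \<subseteq> {0..<n9}" "vr s 10 \<le> n9" "vr s 10 = 2 * p - 1" "0 \<le> vr s 8" "vr s 8 < p"
    using F by (auto simp: forest_def n9_def)
  have fR: "0 \<le> f x \<and> f x < p" if "x \<in> R" for x using F that by (auto simp: forest_def f_def)
  have szb: "p \<le> sz" "n9 \<le> sz" using b' f0 p1 by auto
  have qi: "ar s 14 i \<in> set qs" if "0 \<le> i" "i < nq" for i
    using that by (auto simp: qs set_lst nq_def)
  have qv: "0 \<le> ar s 14 i \<and> ar s 14 i < sz \<and> 0 < v i \<and> v i < p" if "0 \<le> i" "i < nq" for i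
  proof -
    have "ar s 14 i \<in> R" using qi[OF that] d(2) by blast
    moreover from this have "0 \<le> ar s 14 i \<and> ar s 14 i < n9" using f0(2) by auto
    ultimately show ?thesis using d(5)[OF qi[OF that]] fR szb by (auto simp: v(1) f_def)
  qed
  have zm: "mset zs = mset ts" "set zs = set ts" "distinct zs" "length zs = nat nt" "sorted (map f zs)"
    using d(1) by (auto simp: zs_def ts nt_def)
  let ?P = "\<lambda>t. (\<forall>x\<in>{0..<2 * p - 1}. ar t 8 x \<in> {0, 1}) \<and> (\<Sum>x\<in>{0..<2 * p - 1}. ar t 8 x) = p \<and>
      [(\<Sum>x\<in>{0..<2 * p - 1}. ar t 8 x * X x) = 0] (mod p) \<and>
      int (tk t) \<le> int (tk s) + 20 * p + Ka * p + 2 * n9"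
  have "wp SOLVE ?P s" unfolding SOLVE_def wp_simps(4)
  proof (rule wp_WALK[where v = v and Ka = Ka])
    fix s1 assume s1: "origin (vr s 4) v (vr s 13) (ar s1 20)"
      "int (card (unm (vr s 4) (ar s1 20))) \<le> max 0 (vr s 4 - 1 - vr s 13)"
      "int (tk s1) \<le> int (tk s) + 6 * vr s 4 + Ka * vr s 13" "frame WALK s s1"
    have g1: "vr s1 4 = p" "vr s1 8 = vr s 8" "vr s1 9 = n9" "vr s1 10 = vr s 10" "vr s1 13 = nq" "vr s1 14 = nt" "vr s1 18 = L0"
      "vr s1 19 = int \<sigma>" "vr s1 24 = vr s 24"
      "ar s1 5 = f" "ar s1 6 = ar s 6" "ar s1 7 = ar s 7" "ar s1 13 = ar s 13" "ar s1 14 = ar s 14"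
      using frameD[OF s1(4)] f0 b by (auto simp: n9_def nq_def nt_def L0_def f_def)
    have F1: "forest p X LF R p (vr s1) (ar s1)"
      by (rule forest_cong[OF F]) (use g1 f0 in \<open>auto simp: n9_def f_def\<close>)
    show "wp (SORT 13 14 5 4) (wp (20 ::= V 18 .+ N 1) (wp (PAIR 13 14 15 15) (wp FINAL ?P))) s1"
    proof (rule wp_SORT[where xs = ts])
      fix s2 assume s2: "lst (ar s2 13) (vr s1 14) = sort_key (ar s1 5) ts"
        "int (tk s2) = int (tk s1) + 2 * (vr s1 14 + vr s1 4)" "frame (SORT 13 14 5 4) s1 s2"
      let ?s2 = "s2\<lparr>vr := (vr s2)(20 := L0 + 1)\<rparr>"
      have g2: "vr ?s2 4 = p" "vr ?s2 8 = vr s 8" "vr ?s2 9 = n9" "vr ?s2 10 = vr s 10" "vr ?s2 13 = nq" "vr ?s2 14 = nt" "vr ?s2 18 = L0"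
        "vr ?s2 19 = int \<sigma>" "vr ?s2 24 = vr s 24" "vr ?s2 20 = L0 + 1"
        "ar ?s2 5 = f" "ar ?s2 6 = ar s 6" "ar ?s2 7 = ar s 7" "ar ?s2 14 = ar s 14" "ar ?s2 20 = ar s1 20"
        "lst (ar ?s2 13) nt = zs" "vr s2 18 = L0"
        using frameD[OF s2(3)] g1 s2(1) by (auto simp: zs_def)
      have F2: "forest p X LF R p (vr ?s2) (ar ?s2)"
        by (rule forest_cong[OF F]) (use g2 f0 in \<open>auto simp: n9_def f_def\<close>)
      define ps where "ps = pairs f zs \<sigma> (L0 + 1)"
      have "length ps \<le> length [0..<length zs - \<sigma>]"
        unfolding ps_def pairs_def by (rule length_filter_le)
      then have pl: "length ps \<le> length zs" by simp
      have pb: "i + \<sigma> < length zs" "i < length zs" "f (zs ! (i + \<sigma>)) - f (zs ! i) \<le> L0 + 1" if "i \<in> set ps" for i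
        using that by (auto simp: ps_def pairs_def)
      have "wp (PAIR 13 14 15 15) (wp FINAL ?P) ?s2"
      proof (rule wp_PAIR[where xs = zs and ps = ps and \<sigma> = \<sigma>])
        fix s3 assume s3: "vr s3 9 = vr ?s2 9 + int (length ps)" "vr s3 15 = int (length ps)"
          "\<forall>i<length ps. ar s3 15 (int i) = vr ?s2 9 + int i \<and> ar s3 6 (vr ?s2 9 + int i) = zs ! (ps ! i) \<and>
             ar s3 7 (vr ?s2 9 + int i) = zs ! (ps ! i + \<sigma>) \<and>
             ar s3 5 (vr ?s2 9 + int i) = ar ?s2 5 (zs ! (ps ! i + \<sigma>)) - ar ?s2 5 (zs ! (ps ! i))"
          "\<forall>x<vr ?s2 9. ar s3 5 x = ar ?s2 5 x \<and> ar s3 6 x = ar ?s2 6 x \<and> ar s3 7 x = ar ?s2 7 x"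
          "[vr s3 8 = vr ?s2 8 + sum_list (map (\<lambda>i. ar ?s2 5 (zs ! i)) ps)] (mod vr ?s2 4)"
          "0 \<le> vr s3 8" "vr s3 8 < vr ?s2 4" "int (tk s3) \<le> int (tk ?s2) + vr ?s2 14" "frame (PAIR 13 14 15 15) ?s2 s3"
        define k where "k = length ps"
        have g3: "vr s3 4 = p" "vr s3 10 = vr s 10" "vr s3 13 = nq" "vr s3 18 = L0" "vr s3 24 = vr s 24" "ar s3 14 = ar s 14" "ar s3 20 = ar s1 20"
          using frameD[OF s3(9)] g2 by auto
        have h1: "vr s3 9 = n9 + int k" "vr s3 15 = int k" using s3(1,2) g2 by (auto simp: k_def)
        have h2: "ar s3 15 (int i) = n9 + int i \<and> ar s3 6 (n9 + int i) = zs ! (ps ! i) \<and>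
             ar s3 7 (n9 + int i) = zs ! (ps ! i + \<sigma>) \<and> ar s3 5 (n9 + int i) = f (zs ! (ps ! i + \<sigma>)) - f (zs ! (ps ! i))"
          if "i < k" for i using s3(3) that g2 by (auto simp: k_def)
        have h3: "ar s3 5 x = f x \<and> ar s3 6 x = ar s 6 x \<and> ar s3 7 x = ar s 7 x" if "x < n9" for x
          using s3(4) that g2 by auto
        define R3 where "R3 = R - set zs \<union> {n9..<n9 + int k}"
        have "forest p X LF (R - set zs \<union> {vr ?s2 9..<vr ?s2 9 + int (length ps)}) (p + 0 * int (length ps)) (vr s3) (ar s3)"
        proof (rule forest_pairs[OF F2])
          show "ps = pairs (ar ?s2 5) zs \<sigma> (L0 + 1)" using g2 by (simp add: ps_def)
        qed (use zm d g2 g3 s3 h2 f0 in \<open>auto simp: k_def\<close>)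
        then have F3: "forest p X LF R3 p (vr s3) (ar s3)" using g2 by (simp add: R3_def k_def)
        have gs: "set (lst (ar s3 15) (int k)) = {n9..<n9 + int k}"
        proof -
          have "(ar s3 15) ` {0..<int k} = (\<lambda>x. n9 + x) ` {0..<int k}"
          proof (rule image_cong[OF refl])
            fix x assume "x \<in> {0..<int k}"
            then show "ar s3 15 x = n9 + x" using h2[of "nat x"] by auto
          qed
          then show ?thesis unfolding set_lst by (simp add: add.commute)
        qed
        have gd: "distinct (lst (ar s3 15) (int k))"
        proof (subst distinct_lst, rule inj_onI)
          fix x y assume "x \<in> {0..<int k}" "y \<in> {0..<int k}" "ar s3 15 x = ar s3 15 y"
          then show "x = y" using h2[of "nat x"] h2[of "nat y"] by auto
        qed
        have qn: "x < n9" if "x \<in> set qs" for x using that d(2) f0(2) by auto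
        have qs3: "lst (ar s3 14) (vr s3 13) = qs" using g3 by (simp add: qs nq_def)
        have v3: "v i = ar s3 5 (ar s3 14 i)" if "0 \<le> i" "i < nq" for i
          using h3 qn[OF qi[OF that]] g3 by (simp add: v(1) f_def)
        have sE: "(\<Sum>i\<in>{0..<vr s3 15}. ar s3 5 (ar s3 15 i)) = pairs_sum f zs \<sigma> (L0 + 1)"
        proof -
          have "(\<Sum>i\<in>{0..<vr s3 15}. ar s3 5 (ar s3 15 i)) = (\<Sum>i\<in>int ` {0..<k}. ar s3 5 (ar s3 15 i))"
            unfolding h1(2) by (simp add: image_int_atLeastLessThan)
          also have "\<dots> = (\<Sum>i\<in>{0..<k}. ar s3 5 (ar s3 15 (int i)))" by (simp add: sum.reindex)
          also have "\<dots> = (\<Sum>i\<in>{0..<k}. (\<lambda>i. f (zs ! (i + \<sigma>)) - f (zs ! i)) (ps ! i))"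
            using h2 by (intro sum.cong) auto
          also have "\<dots> = pairs_sum f zs \<sigma> (L0 + 1)"
            unfolding pairs_sum_def ps_def[symmetric] k_def sum_list_sum_nth by simp
          finally show ?thesis .
        qed
        have org3: "origin p (\<lambda>i. ar s3 5 (ar s3 14 i)) (vr s3 13) (ar s3 20)"
          using origin_cong[OF s1(1) v3] g3 f0 unfolding nq_def[symmetric] by simp
        show "wp FINAL ?P s3"
        proof (rule wp_FINAL[OF F3 p(1) szb(1)])
          show "distinct (lst (ar s3 14) (vr s3 13) @ lst (ar s3 15) (vr s3 15))"
            using d(1) gd gs qn qs3 h1 by fastforce
          show "set (lst (ar s3 14) (vr s3 13)) \<subseteq> R3" using qs3 d zm by (auto simp: R3_def)
          show "set (lst (ar s3 15) (vr s3 15)) \<subseteq> R3" using gs h1 by (auto simp: R3_def)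
          show "2 * p - 1 \<le> x" if "x \<in> R3" for x using that d(4) f0 by (auto simp: R3_def)
          show "origin p (\<lambda>i. ar s3 5 (ar s3 14 i)) (vr s3 13) (ar s3 20)" by (rule org3)
          show "ar s3 5 (ar s3 14 i) = 1" if "0 \<le> i" "i < vr s3 18" for i
            using v3[of i] v(2)[of i] that g3 b' by (simp add: L0_def)
          show "ar s3 5 (ar s3 15 i) \<le> vr s3 18 + 1" if "0 \<le> i" "i < vr s3 15" for i
          proof -
            have i: "nat i < k" "int (nat i) = i" using that h1 by auto
            then have "ps ! nat i \<in> set ps" by (simp add: k_def)
            then show ?thesis using h2[OF i(1)] pb(3) g3 i(2) by simp
          qed
          show "int (card (unm p (ar s3 20))) \<le> (\<Sum>i\<in>{0..<vr s3 15}. ar s3 5 (ar s3 15 i))"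
            unfolding sE g3(7) f_def zs_def L0_def by (rule order_trans[OF s1(2)[unfolded f0(1)] E])
        next
          fix t assume t: "\<forall>x\<in>{0..<2 * p - 1}. ar t 8 x \<in> {0, 1}" "(\<Sum>x\<in>{0..<2 * p - 1}. ar t 8 x) = p"
            "[(\<Sum>x\<in>{0..<2 * p - 1}. ar t 8 x * X x) = 0] (mod p)"
            "int (tk t) \<le> int (tk s3) + 2 * vr s3 9 + p + 2 * vr s3 13 + vr s3 15"
          have kb: "int k \<le> nt" using pl zm(4) b'(5) by (simp add: k_def)
          have "Ka * nq \<le> Ka * p" using p(2) b' by (intro mult_left_mono) auto
          moreover have "int (tk s1) \<le> int (tk s) + 6 * p + Ka * nq" using s1(3) f0 by (simp add: nq_def)
          moreover have "int (tk s2) = int (tk s1) + 2 * (nt + p)" using s2(2) g1 by simp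
          moreover have "int (tk s3) \<le> int (tk s2) + nt" using s3(8) g2 by simp
          ultimately have "int (tk t) \<le> int (tk s) + 20 * p + Ka * p + 2 * n9"
            using t(4) kb h1 g3 b'(4,6) by simp
          then show "?P t" using t by blast
        qed (use h1 g3 b' szb pl zm in \<open>auto simp: k_def\<close>)
      qed (use g2 zm d szb b' p1 f0 fR ps_def in \<open>auto simp: nt_def\<close>)
      moreover have "fits (L0 + 1)" using b' szb p1 by (intro fits_small) auto
      ultimately show "wp (20 ::= V 18 .+ N 1) (wp (PAIR 13 14 15 15) (wp FINAL ?P)) s2"
        using g2 by (subst wp_simps(2)) simp
    next
      show "\<forall>x\<in>set ts. 0 \<le> x \<and> x < sz \<and> 0 \<le> ar s1 5 x \<and> ar s1 5 x < vr s1 4"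
        using d(3) f0(2) fR g1 szb by fastforce
    qed (use g1 b' szb p1 d ts in \<open>auto simp: nt_def\<close>)
  next
    show "0 \<le> ar s 14 i \<and> ar s 14 i < sz \<and> 0 < v i \<and> v i < vr s 4" if "0 \<le> i" "i < vr s 13" for i
      using qv[of i] that f0 by (simp add: nq_def)
    show "\<exists>e. i < e \<and> e \<le> vr s 13 \<and> (\<forall>j. i \<le> j \<and> j < e \<longrightarrow> v j = v i) \<and> vr s 4 - 1 - i \<le> Ka * (e - i)"
      if "0 < i" "i < vr s 13" "v i \<noteq> v (i - 1)" for i using H[OF that] f0 by simp
  qed (use p f0 szb b' v in \<open>auto simp: nq_def\<close>)
  then show ?thesis
    by (rule wp_conseq) (unfold n9_def, elim conjE, rule Q, assumption+)
qed

end

section \<open>Reducing the prime case to subset sums of nonzero residues\<close>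

definition PREP :: com where
  "PREP = (10 ::= V 4 .+ V 4 .- N 1 ;;
     For 30 10 (Sto 5 (V 30) (A 1 (V 7 .+ V 30) .mod V 4) ;; Sto 9 (V 30) (V 30)) ;;
     9 ::= V 10 ;; CLASSORD 9 10)"

definition TRIV :: com where
  "TRIV = (For 30 10 (Sto 8 (V 30) (N 0)) ;; For 30 4 (Sto 8 (A 9 (V 30)) (N 1)))"

text \<open>The largest leaf becomes the one that is always selected. The other
  \<open>2 * p - 2\<close> are paired at distance \<open>p - 1\<close>, with a bound that rejects no
  pair. Then all differences are divided by the most frequent one; its multiplicity is kept in
  variable 16.\<close>

definition DBLOCK :: com where
  "DBLOCK = (SORT 9 10 5 4 ;; 12 ::= V 10 .- N 1 ;; 24 ::= A 9 (V 12) ;; 8 ::= A 5 (V 24) ;;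
     19 ::= V 4 .- N 1 ;; 20 ::= V 4 ;; PAIR 9 12 10 11 ;; CLASSORD 10 11 ;; 16 ::= V 17 ;;
     21 ::= B ModInv (A 5 (A 10 (N 0))) (V 4) ;; SCALE 10 11 21 ;; 8 ::= (V 8 .* V 21) .mod V 4)"

lemma mod_DBLOCK [simp]:
  "modv PREP = {9, 10, 17, 30, 31, 33}" "moda PREP = {5, 9, 16, 17, 18, 19}"
  "modv TRIV = {30}" "moda TRIV = {8}"
  "modv DBLOCK = {8, 9, 11, 12, 16, 17, 19, 20, 21, 24, 30, 31, 33, 34, 35}"
  "moda DBLOCK = {5, 6, 7, 9, 10, 16, 17, 18, 19}"
  by (auto simp: PREP_def TRIV_def DBLOCK_def)

section \<open>Class orders under scaling by a unit\<close>

lemma classord_max: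
  assumes "classord f ys" "ys \<noteq> []"
  shows "cnt f ys v \<le> cnt f ys (f (ys ! 0))"
proof (cases "v \<in> f ` set ys")
  case True
  then obtain j where j: "j < length ys" "v = f (ys ! j)" by (auto simp: in_set_conv_nth)
  then show ?thesis using assms(1) unfolding classord_def by (cases "j = 0") auto
next
  case False
  then have "cnt f ys v = 0" by (auto simp: cnt_def filter_empty_conv)
  then show ?thesis by simp
qed

lemma cnt_scale:
  assumes "\<And>x y. x \<in> set ds \<Longrightarrow> y \<in> set ds \<Longrightarrow> g x = g y \<longleftrightarrow> f x = f y" "x \<in> set ds"
  shows "cnt g ds (g x) = cnt f ds (f x)"
  unfolding cnt_def using assms by (intro arg_cong[where f = length] filter_cong) auto

text \<open>The order by class size depends only on the partition into classes, which scaling by a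
  unit preserves.\<close>

lemma classord_scale:
  assumes "\<And>x y. x \<in> set ds \<Longrightarrow> y \<in> set ds \<Longrightarrow> g x = g y \<longleftrightarrow> f x = f y" "classord f ds"
  shows "classord g ds"
proof -
  have n: "ds ! i \<in> set ds" if "i < length ds" for i using that by simp
  have cs: "cnt g ds (g x) = cnt f ds (f x)" if "x \<in> set ds" for x
    using cnt_scale[of ds g f x] assms(1) that by blast
  show ?thesis unfolding classord_def
  proof (intro conjI allI impI)
    fix i j assume h: "i < j" "j < length ds"
    then show "cnt g ds (g (ds ! j)) \<le> cnt g ds (g (ds ! i))"
      using assms(2) cs n unfolding classord_def by simp
  next
    fix i j k assume h: "i < j" "j < k" "k < length ds" "g (ds ! i) = g (ds ! k)"
    then have "f (ds ! i) = f (ds ! k)" using assms(1) n by simp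
    then have "f (ds ! j) = f (ds ! i)" using assms(2) h unfolding classord_def by blast
    then show "g (ds ! j) = g (ds ! i)" using assms(1)[of "ds ! j" "ds ! i"] n h by simp
  qed
qed

lemma mult_mod_inj:
  fixes c p :: int
  assumes "coprime c p" "0 \<le> x" "x < p" "0 \<le> y" "y < p"
  shows "x * c mod p = y * c mod p \<longleftrightarrow> x = y"
proof
  assume "x * c mod p = y * c mod p"
  then have "[x * c = y * c] (mod p)" by (simp add: cong_def)
  then have "[x = y] (mod p)" using assms(1) by (simp add: cong_mult_rcancel coprime_commute)
  then show "x = y" using assms by (simp add: cong_def)
qed simp

lemma mult_mod_pos:
  fixes c p :: int
  assumes "coprime c p" "0 < x" "x < p"
  shows "0 < x * c mod p" "x * c mod p < p"
proof -
  have "x * c mod p \<noteq> 0" using mult_mod_inj[OF assms(1), of x 0] assms by auto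
  then show "0 < x * c mod p" using assms by (simp add: order_less_le)
  show "x * c mod p < p" using assms by simp
qed

lemma prime_coprime_less:
  fixes p x :: int
  assumes "prime p" "0 < x" "x < p"
  shows "coprime x p"
  using assms by (metis coprime_commute prime_imp_coprime zdvd_not_zless)

definition dstate :: "int \<Rightarrow> (int \<Rightarrow> int) \<Rightarrow> int \<Rightarrow> int list \<Rightarrow> (nat \<Rightarrow> int) \<Rightarrow> (nat \<Rightarrow> int \<Rightarrow> int) \<Rightarrow> bool" where
  "dstate p X LF ds v a \<longleftrightarrow> ds = lst (a 10) (p - 1) \<and> forest p X LF (set ds) p v a \<and> distinct ds \<and>
     v 11 = p - 1 \<and> v 9 = 3 * p - 2 \<and> (\<forall>x\<in>set ds. 2 * p - 1 \<le> x \<and> 0 < a 5 x) \<and> classord (a 5) ds \<and>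
     (\<forall>x\<in>set ds. a 19 x = 2 * p - 1 - int (cnt (a 5) ds (a 5 x))) \<and>
     v 16 = int (cnt (a 5) ds 1) \<and> a 5 (ds ! 0) = 1"

context ram
begin

lemma wp_PREP:
  assumes p: "1 < vr s 4" "8 * vr s 4 \<le> sz" "0 \<le> vr s 7" "vr s 7 + 2 * vr s 4 \<le> sz"
    and X: "X = (\<lambda>x. ar s 1 (vr s 7 + x) mod vr s 4)"
    and Q: "\<And>t ys. ys = lst (ar t 9) (2 * vr s 4 - 1) \<Longrightarrow> mset ys = mset (map int [0..<nat (2 * vr s 4 - 1)]) \<Longrightarrow>
      (\<forall>x. 0 \<le> x \<and> x < 2 * vr s 4 - 1 \<longrightarrow> ar t 5 x = X x) \<Longrightarrow> classord X ys \<Longrightarrow>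
      vr t 17 = int (cnt X ys (X (ys ! 0))) \<Longrightarrow> vr t 10 = 2 * vr s 4 - 1 \<Longrightarrow> vr t 9 = 2 * vr s 4 - 1 \<Longrightarrow>
      int (tk t) \<le> int (tk s) + 24 * vr s 4 \<Longrightarrow> frame PREP s t \<Longrightarrow> Q t"
  shows "wp PREP Q s"
proof -
  define p where "p = vr s 4"
  define nl where "nl = 2 * p - 1"
  note p' = p[folded p_def]
  let ?ls = "map int [0..<nat nl]"
  have "wp PREP (\<lambda>t. \<exists>ys. ys = lst (ar t 9) nl \<and> mset ys = mset ?ls \<and>
      (\<forall>x. 0 \<le> x \<and> x < nl \<longrightarrow> ar t 5 x = X x) \<and> classord X ys \<and>
      vr t 17 = int (cnt X ys (X (ys ! 0))) \<and> vr t 10 = nl \<and> vr t 9 = nl \<and>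
      int (tk t) \<le> int (tk s) + 24 * p) s"
  proof -
    let ?s = "s\<lparr>vr := (vr s)(10 := nl)\<rparr>"
    let ?P = "\<lambda>t. \<exists>ys. ys = lst (ar t 9) nl \<and> mset ys = mset ?ls \<and>
      (\<forall>x. 0 \<le> x \<and> x < nl \<longrightarrow> ar t 5 x = X x) \<and> classord X ys \<and>
      vr t 17 = int (cnt X ys (X (ys ! 0))) \<and> vr t 10 = nl \<and> vr t 9 = nl \<and>
      int (tk t) \<le> int (tk s) + 24 * p"
    have "wp (For 30 10 (Sto 5 (V 30) (A 1 (V 7 .+ V 30) .mod V 4) ;; Sto 9 (V 30) (V 30)))
       (wp (9 ::= V 10) (wp (CLASSORD 9 10) ?P)) ?s"
    proof (rule wp_For[where P = "\<lambda>k t. (\<forall>x. 0 \<le> x \<and> x < k \<longrightarrow> ar t 5 x = X x \<and> ar t 9 x = x) \<and>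
        int (tk t) = int (tk s) + k"], goal_cases)
      case (2 k t)
      have fr: "ar t 1 = ar s 1" "vr t 7 = vr s 7" "vr t 4 = p" using frameD[OF 2(5)] by (auto simp: p_def)
      have k: "0 \<le> k" "k < nl" "vr t 30 = k" using 2 by auto
      have kn: "vr s 7 + k < sz" "k < sz" using k p' by (auto simp: nl_def)
      have "fits (vr s 7 + k)" using kn k p' by (intro fits_small) auto
      moreover have "fits (ar s 1 (vr s 7 + k) mod p)" using p' by (intro fits_mod) auto
      moreover have "X k = ar s 1 (vr s 7 + k) mod p" by (simp add: X p_def)
      ultimately show ?case using 2(3) k fr kn p' by (auto simp: wp_simps)
    next
      case (3 t)
      have t: "\<forall>x. 0 \<le> x \<and> x < nl \<longrightarrow> ar t 5 x = X x \<and> ar t 9 x = x" "int (tk t) = int (tk s) + nl" using 3 by auto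
      have fr: "vr t 4 = p" "vr t 10 = nl" using frameD[OF 3(3)] by (auto simp: p_def)
      let ?t = "t\<lparr>vr := (vr t)(9 := nl)\<rparr>"
      have l9: "lst (ar ?t 9) nl = ?ls" unfolding lst_def using t(1) by auto
      have Xr: "0 \<le> X x \<and> X x < p" for x using p' by (simp add: X p_def)
      have e5: "ar t 5 x = X x" if "x \<in> set ?ls" for x using that t(1) by auto
      have "wp (CLASSORD 9 10) ?P ?t"
      proof (rule wp_CLASSORD[where xs = ?ls])
        show "\<forall>x\<in>set ?ls. 0 \<le> x \<and> x < sz \<and> 0 \<le> ar ?t 5 x \<and> ar ?t 5 x < vr ?t 4"
        proof
          fix x assume x: "x \<in> set ?ls"
          then have "0 \<le> x" "x < nl" by auto
          then show "0 \<le> x \<and> x < sz \<and> 0 \<le> ar ?t 5 x \<and> ar ?t 5 x < vr ?t 4"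
            using e5[OF x] Xr[of x] fr p' by (auto simp: nl_def)
        qed
        fix u ys assume u: "ys = lst (ar u 9) (vr ?t 10)" "mset ys = mset ?ls" "classord (ar ?t 5) ys"
          "vr u 17 = int (cnt (ar ?t 5) ?ls (ar ?t 5 (ys ! 0)))" "int (tk u) \<le> int (tk ?t) + 11 * vr ?t 10"
          "frame (CLASSORD 9 10) ?t u"
        have sy: "set ys = set ?ls" using u(2) by (metis set_mset_mset)
        have ne: "ys \<noteq> []"
        proof
          assume "ys = []"
          then have "set ?ls = {}" using sy by simp
          then show False using p' by (simp add: nl_def)
        qed
        have eq: "(X x = X y) = (ar t 5 x = ar t 5 y)" if "x \<in> set ys" "y \<in> set ys" for x y using e5 that sy by simp
        have c: "classord X ys" by (rule classord_scale[OF eq]) (use u(3) in auto)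
        have y0: "ys ! 0 \<in> set ys" using ne by simp
        have "cnt (ar t 5) ?ls (ar t 5 (ys ! 0)) = cnt (ar t 5) ys (ar t 5 (ys ! 0))"
          using cnt_mset[OF u(2)] by simp
        also have "\<dots> = cnt X ys (X (ys ! 0))" by (rule cnt_scale[symmetric, OF eq y0])
        finally have "vr u 17 = int (cnt X ys (X (ys ! 0)))" using u(4) by simp
        moreover have "ar u 5 = ar t 5" "vr u 10 = nl" "vr u 9 = nl" using frameD[OF u(6)] fr by auto
        moreover have "int (tk u) \<le> int (tk s) + 24 * p" using u(5) t(2) fr p' by (simp add: nl_def)
        ultimately show "?P u" using u(1,2) c t(1) fr by auto
      qed (use fr p' l9 in \<open>auto simp: nl_def distinct_map\<close>)
      then show ?case using fr by (simp add: wp_simps(2))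
    qed (use p' in \<open>auto simp: nl_def p_def\<close>)
    moreover have "fits (p + p)" "fits (p + p - 1)" using p' by (auto intro!: fits_small)
    moreover have "p + p - 1 = nl" by (simp add: nl_def)
    ultimately show ?thesis unfolding PREP_def wp_simps(4)
      by (subst wp_simps(2)) (simp add: p_def)
  qed
  then show ?thesis
    by (rule wp_conseq) (unfold nl_def p_def, elim exE conjE, rule Q, assumption+)
qed

lemma wp_TRIV:
  assumes p: "1 < p" "8 * p \<le> sz" "vr s 4 = p" "vr s 10 = 2 * p - 1"
    and ys: "ys = lst (ar s 9) (2 * p - 1)" "mset ys = mset (map int [0..<nat (2 * p - 1)])" "classord X ys"
      "p \<le> int (cnt X ys (X (ys ! 0)))"
    and Q: "\<And>t. (\<forall>x\<in>{0..<2 * p - 1}. ar t 8 x \<in> {0, 1}) \<Longrightarrow> (\<Sum>x\<in>{0..<2 * p - 1}. ar t 8 x) = p \<Longrightarrow>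
      [(\<Sum>x\<in>{0..<2 * p - 1}. ar t 8 x * X x) = 0] (mod p) \<Longrightarrow>
      int (tk t) \<le> int (tk s) + 3 * p \<Longrightarrow> frame TRIV s t \<Longrightarrow> Q t"
  shows "wp TRIV Q s"
proof -
  define nl where "nl = 2 * p - 1"
  have sy: "set ys = {0..<nl}"
  proof -
    have "set ys = set (map int [0..<nat nl])" using ys(2) unfolding nl_def by (metis set_mset_mset)
    also have "\<dots> = {0..<nl}" using p by (simp add: image_int_atLeastLessThan nl_def)
    finally show ?thesis .
  qed
  have dy: "distinct ys"
  proof -
    have "distinct (map int [0..<nat (2 * p - 1)])" by (simp add: distinct_map)
    then show ?thesis using ys(2) by (metis mset_eq_imp_distinct_iff)
  qed
  have inj: "inj_on (ar s 9) {0..<nl}" using dy ys(1) distinct_lst by (simp add: nl_def)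
  have im: "(ar s 9) ` {0..<nl} = {0..<nl}" using sy ys(1) set_lst by (simp add: nl_def)
  have same: "X (ar s 9 i) = X (ys ! 0)" if "0 \<le> i" "i < p" for i
  proof -
    have "length ys = nat nl" using ys(1) by (simp add: nl_def)
    then have "{j. j < length ys \<and> X (ys ! j) = X (ys ! 0)} = {0..<0 + cnt X ys (X (ys ! 0))}"
      using classord_block[OF ys(3), of 0] p by (auto simp: nl_def)
    moreover have "nat i \<in> {0..<0 + cnt X ys (X (ys ! 0))}" using that ys(4) by auto
    ultimately have "nat i < length ys" "X (ys ! nat i) = X (ys ! 0)" by blast+
    then show ?thesis using that ys(1) by simp
  qed
  have "wp TRIV (\<lambda>t. (\<forall>x\<in>{0..<nl}. ar t 8 x = (if x \<in> ar s 9 ` {0..<p} then 1 else 0)) \<and>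
     int (tk t) = int (tk s) + nl + p) s"
    unfolding TRIV_def wp_simps(4)
  proof (rule wp_For[where P = "\<lambda>k t. (\<forall>x. 0 \<le> x \<and> x < k \<longrightarrow> ar t 8 x = 0) \<and> int (tk t) = int (tk s) + k"], goal_cases)
    case (2 k t)
    then show ?case using p by (auto simp: wp_simps)
  next
    case (3 t)
    have fr: "vr t 4 = p" "ar t 9 = ar s 9" using frameD[OF 3(3)] p by auto
    show ?case
    proof (rule wp_For[where P = "\<lambda>k u. (\<forall>x\<in>{0..<nl}. ar u 8 x = (if x \<in> ar s 9 ` {0..<k} then 1 else 0)) \<and>
        int (tk u) = int (tk s) + nl + k"], goal_cases)
      case 1 then show ?case using 3 p by (auto simp: nl_def)
    next
      case (2 k u)
      have fu: "ar u 9 = ar s 9" using frameD[OF 2(5)] fr by auto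
      have k: "0 \<le> k" "k < p" "vr u 30 = k" using 2 fr by auto
      have "ar s 9 k \<in> {0..<nl}" using im k by (auto simp: nl_def)
      then have "0 \<le> ar s 9 k" "ar s 9 k < sz" using p by (auto simp: nl_def)
      moreover have "{0..<k + 1} = insert k {0..<k}" using k by auto
      ultimately show ?case using 2(3) k fu p by (auto simp: wp_simps)
    next
      case (3 u)
      then show ?case using fr by simp
    qed (use fr p in auto)
  qed (use p in auto)
  then show ?thesis
  proof (rule wp_conseq, goal_cases)
    case (1 t)
    have b: "ar t 8 x = (if x \<in> ar s 9 ` {0..<p} then 1 else 0)" if "x \<in> {0..<nl}" for x using 1(1) that by blast
    have sub: "{0..<p} \<subseteq> {0..<nl}" using p by (auto simp: nl_def)
    have bi: "ar t 8 (ar s 9 i) = (if i \<in> {0..<p} then 1 else 0)" if "i \<in> {0..<nl}" for i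
    proof -
      have "ar s 9 i \<in> ar s 9 ` {0..<p} \<longleftrightarrow> i \<in> {0..<p}" using inj sub that by (meson inj_on_image_mem_iff)
      moreover have "ar s 9 i \<in> {0..<nl}" using im that by blast
      ultimately show ?thesis using b by simp
    qed
    have sum: "(\<Sum>x\<in>{0..<nl}. ar t 8 x * w x) = (\<Sum>i\<in>{0..<p}. w (ar s 9 i))" for w
      using sum_select[OF inj sub bi, of w] im by simp
    have "(\<Sum>x\<in>{0..<nl}. ar t 8 x) = p" using sum[of "\<lambda>_. 1"] p by simp
    moreover have "(\<Sum>x\<in>{0..<nl}. ar t 8 x * X x) = p * X (ys ! 0)"
      unfolding sum using same p by (simp add: sum.cong[of _ _ _ "\<lambda>_. X (ys ! 0)"])
    then have "[(\<Sum>x\<in>{0..<nl}. ar t 8 x * X x) = 0] (mod p)" by (simp add: cong_0_iff)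
    ultimately show ?case using b 1 by (intro Q) (auto simp: nl_def)
  qed
qed

lemma wp_DBLOCK:
  assumes p: "prime p" "8 * p \<le> sz" "vr s 4 = p" "vr s 10 = 2 * p - 1" "vr s 9 = 2 * p - 1"
    and ys: "ys = lst (ar s 9) (2 * p - 1)" "mset ys = mset (map int [0..<nat (2 * p - 1)])" "classord X ys"
      "int (cnt X ys (X (ys ! 0))) < p"
    and X: "\<forall>x. 0 \<le> x \<and> x < 2 * p - 1 \<longrightarrow> ar s 5 x = X x" "\<And>x. 0 \<le> X x \<and> X x < p"
    and Q: "\<And>t LF ds. dstate p X LF ds (vr t) (ar t) \<Longrightarrow>
      int (tk t) \<le> int (tk s) + 33 * p \<Longrightarrow> frame DBLOCK s t \<Longrightarrow> Q t"
  shows "wp DBLOCK Q s"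
proof -
  define nl where "nl = 2 * p - 1"
  define f where "f = ar s 5"
  have p1: "1 < p" using p prime_gt_1_int by blast
  have ly: "length ys = nat nl" using ys(1) by (simp add: nl_def)
  have sy: "set ys = {0..<nl}"
  proof -
    have "set ys = set (map int [0..<nat nl])" using ys(2) unfolding nl_def by (metis set_mset_mset)
    also have "\<dots> = {0..<nl}" using p1 by (simp add: image_int_atLeastLessThan nl_def)
    finally show ?thesis .
  qed
  have dy: "distinct ys"
  proof -
    have "distinct (map int [0..<nat (2 * p - 1)])" by (simp add: distinct_map)
    then show ?thesis using ys(2) by (metis mset_eq_imp_distinct_iff)
  qed
  have fX: "f x = X x" if "x \<in> {0..<nl}" for x using X(1) that by (auto simp: f_def nl_def)
  have fr0: "0 \<le> f x \<and> f x < p" if "x \<in> {0..<nl}" for x using fX[OF that] X(2)[of x] by simp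
  have cf: "cnt f ys v \<le> nat (p - 1)" for v
  proof -
    have eq: "(f x = f y) = (X x = X y)" if "x \<in> set ys" "y \<in> set ys" for x y using fX that sy by simp
    have ne: "ys \<noteq> []" using ly p1 by (auto simp: nl_def)
    have "cnt f ys v \<le> cnt f ys (f (ys ! 0))"
      by (rule classord_max[OF classord_scale[OF eq ys(3)] ne])
    also have "\<dots> = cnt X ys (X (ys ! 0))" by (rule cnt_scale[OF eq]) (use ne in auto)
    finally show ?thesis using ys(4) by simp
  qed
  define zs where "zs = sort_key f ys"
  have zm: "mset zs = mset ys" "set zs = {0..<nl}" "distinct zs" "length zs = nat nl" "sorted (map f zs)"
    using dy sy ly by (auto simp: zs_def)
  define LF where "LF = zs ! nat (nl - 1)"
  have nl1: "nat nl = Suc (nat (nl - 1))" using p1 by (simp add: nl_def nat_diff_distrib)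
  define xs where "xs = take (nat (nl - 1)) zs"
  have zx: "zs = xs @ [LF]"
    using zm(4) nl1 by (simp add: xs_def LF_def take_Suc_conv_app_nth[symmetric])
  have lx: "length xs = nat (2 * p - 2)" using zm(4) by (simp add: xs_def nl_def)
  have xd: "distinct xs" "LF \<notin> set xs" "set xs = {0..<nl} - {LF}" "LF \<in> {0..<nl}" "sorted (map f xs)"
    using zm(2,3,5) unfolding zx by (auto simp: sorted_append)
  have cx: "cnt f xs v \<le> nat (p - 1)" for v
  proof -
    have "cnt f xs v \<le> cnt f zs v" unfolding zx by (simp add: cnt_def)
    then show ?thesis using cf[of v] cnt_mset[OF zm(1), of f v] by simp
  qed
  define ps where "ps = pairs f xs (nat (p - 1)) p"
  \<comment> \<open>The list of length \<open>2 * (p - 1)\<close> is a single block, so every entry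
    of its first half is a left end.\<close>
  have pse: "ps = [0..<nat (p - 1)]"
  proof -
    have l: "length xs - nat (p - 1) = nat (p - 1)" using lx p1 by (simp add: nat_diff_distrib)
    have "f (xs ! (i + nat (p - 1))) - f (xs ! i) \<le> p" if "i < nat (p - 1)" for i
    proof -
      have "i + nat (p - 1) < length xs" "i < length xs" using that lx by auto
      then have "xs ! (i + nat (p - 1)) \<in> {0..<nl}" "xs ! i \<in> {0..<nl}" using xd(3) nth_mem by blast+
      then show ?thesis using fr0[of "xs ! (i + nat (p - 1))"] fr0[of "xs ! i"] by linarith
    qed
    then show ?thesis unfolding ps_def pairs_def l by (intro filter_True) auto
  qed
  \<comment> \<open>No residue occurs \<open>p\<close> times, otherwise \<open>TRIV\<close> applies;
    so entries at distance \<open>p - 1\<close> differ.\<close>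
  have pos: "1 \<le> f (xs ! (i + nat (p - 1))) - f (xs ! i)" if "i < nat (p - 1)" for i
    using shift_diff_ge[OF xd(5) cx, of 1 "nat (p - 1)" i] that lx by simp
  let ?P = "\<lambda>t. (\<exists>LF ds. dstate p X LF ds (vr t) (ar t)) \<and> int (tk t) \<le> int (tk s) + 33 * p"
  have "wp DBLOCK ?P s" unfolding DBLOCK_def wp_simps(4)
  proof (rule wp_SORT[where xs = ys])
    fix s1 assume s1: "lst (ar s1 9) (vr s 10) = sort_key (ar s 5) ys"
      "int (tk s1) = int (tk s) + 2 * (vr s 10 + vr s 4)" "frame (SORT 9 10 5 4) s s1"
    have l1: "lst (ar s1 9) nl = zs" using s1(1) p by (simp add: zs_def f_def nl_def)
    have g1: "vr s1 4 = p" "vr s1 10 = nl" "vr s1 9 = nl" "ar s1 5 = f" using frameD[OF s1(3)] p by (auto simp: nl_def f_def)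
    have LF9: "ar s1 9 (nl - 1) = LF" using l1 p1 unfolding LF_def l1[symmetric] by (simp add: nl_def)
    have x9: "lst (ar s1 9) (nl - 1) = xs"
    proof -
      have "lst (ar s1 9) nl = lst (ar s1 9) (nl - 1) @ [ar s1 9 (nl - 1)]"
        using lst_Suc[of "nl - 1" "ar s1 9"] p1 by (simp add: nl_def)
      then show ?thesis using l1 zx by simp
    qed
    let ?s2 = "s1\<lparr>vr := (vr s1)(12 := nl - 1, 24 := LF, 8 := f LF, 19 := p - 1, 20 := p)\<rparr>"
    have F2: "forest p X LF (set xs) 1 (vr ?s2) (ar ?s2)"
    proof -
      have "lrep p (ar ?s2 6) (ar ?s2 7) nl 0 (\<lambda>x. 1 * X x) LF (set xs) (f LF) f"
        using lrep_init[of LF nl "set xs" p "ar s1 6" "ar s1 7" X] xd fX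
        by (intro lrep_cong[OF lrep_init[of LF nl "set xs"]]) (auto simp: cong_def)
      then have "\<exists>U. coprime U p \<and> lrep p (ar ?s2 6) (ar ?s2 7) nl 0 (\<lambda>x. U * X x) LF (set xs) (f LF) f"
        by (intro exI[of _ 1]) simp
      moreover have "lrep 0 (ar ?s2 6) (ar ?s2 7) nl 0 (\<lambda>_. 1) LF (set xs) 1 (\<lambda>x. if x < nl then 1 else 0)"
        using xd by (intro lrep_cong[OF lrep_init[of LF nl "set xs" 0 _ _ "\<lambda>_. 1"]]) (auto simp: cong_def)
      ultimately show ?thesis unfolding forest_def using g1 xd fr0 by (auto simp: nl_def)
    qed
    have "wp (PAIR 9 12 10 11) (wp (CLASSORD 10 11) (wp (16 ::= V 17) (wp (21 ::= B ModInv (A 5 (A 10 (N 0))) (V 4))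
       (wp (SCALE 10 11 21) (wp (8 ::= (V 8 .* V 21) .mod V 4) ?P))))) ?s2"
    proof (rule wp_PAIR[where xs = xs and ps = ps and \<sigma> = "nat (p - 1)"])
      show "\<forall>x\<in>set xs. 0 \<le> x \<and> x < vr ?s2 9 \<and> 0 \<le> ar ?s2 5 x \<and> ar ?s2 5 x < vr ?s2 4"
        using xd(3) fr0 g1 by auto
      fix s3 assume s3: "vr s3 9 = vr ?s2 9 + int (length ps)" "vr s3 11 = int (length ps)"
        "\<forall>i<length ps. ar s3 10 (int i) = vr ?s2 9 + int i \<and> ar s3 6 (vr ?s2 9 + int i) = xs ! (ps ! i) \<and>
           ar s3 7 (vr ?s2 9 + int i) = xs ! (ps ! i + nat (p - 1)) \<and>
           ar s3 5 (vr ?s2 9 + int i) = ar ?s2 5 (xs ! (ps ! i + nat (p - 1))) - ar ?s2 5 (xs ! (ps ! i))"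
        "\<forall>x<vr ?s2 9. ar s3 5 x = ar ?s2 5 x \<and> ar s3 6 x = ar ?s2 6 x \<and> ar s3 7 x = ar ?s2 7 x"
        "[vr s3 8 = vr ?s2 8 + sum_list (map (\<lambda>i. ar ?s2 5 (xs ! i)) ps)] (mod vr ?s2 4)"
        "0 \<le> vr s3 8" "vr s3 8 < vr ?s2 4" "int (tk s3) \<le> int (tk ?s2) + vr ?s2 12" "frame (PAIR 9 12 10 11) ?s2 s3"
      have lp: "length ps = nat (p - 1)" using pse by simp
      have g3: "vr s3 4 = p" "vr s3 10 = nl" "vr s3 24 = LF" "vr s3 9 = 3 * p - 2" "vr s3 11 = p - 1"
        using frameD[OF s3(9)] g1 s3(1,2) lp p1 by (auto simp: nl_def)
      define R where "R = {nl..<nl + (p - 1)}"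
      have "forest p X LF (set xs - set xs \<union> {vr ?s2 9..<vr ?s2 9 + int (length ps)}) (1 + 1 * int (length ps)) (vr s3) (ar s3)"
      proof (rule forest_pairs[OF F2])
        show "ps = pairs (ar ?s2 5) xs (nat (p - 1)) p" using g1 by (simp add: ps_def)
        show "(\<forall>x\<in>set xs. x < vr ?s2 10) \<and> (1::int) = 1 \<or> (\<forall>x\<in>set xs. vr ?s2 10 \<le> x) \<and> (1::int) = 0"
          using xd(3) g1 by auto
      qed (use xd g1 g3 s3 in auto)
      then have F3: "forest p X LF R p (vr s3) (ar s3)" using lp p1 g1 by (simp add: R_def)
      have d10: "ar s3 10 i = nl + i" "0 < ar s3 5 (nl + i)" if "0 \<le> i" "i < p - 1" for i
        using s3(3)[rule_format, of "nat i"] that lp g1 pos[of "nat i"] pse by auto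
      define qs where "qs = lst (ar s3 10) (p - 1)"
      have sa: "set qs = R"
      proof -
        have "(ar s3 10) ` {0..<p - 1} = (\<lambda>x. nl + x) ` {0..<p - 1}"
          using d10 by (intro image_cong) auto
        then show ?thesis unfolding qs_def set_lst R_def by (simp add: add.commute)
      qed
      have da: "distinct qs" unfolding qs_def distinct_lst using d10 by (auto simp: inj_on_def)
      have Rp: "0 < ar s3 5 x" "nl \<le> x" "0 \<le> x" "x < 3 * p - 2" if "x \<in> R" for x
        using d10(2)[of "x - nl"] that p1 by (auto simp: R_def nl_def)
      have R5: "0 \<le> ar s3 5 x \<and> ar s3 5 x < p" if "x \<in> R" for x using F3 that by (auto simp: forest_def)
      show "wp (CLASSORD 10 11) (wp (16 ::= V 17) (wp (21 ::= B ModInv (A 5 (A 10 (N 0))) (V 4))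
         (wp (SCALE 10 11 21) (wp (8 ::= (V 8 .* V 21) .mod V 4) ?P)))) s3"
      proof (rule wp_CLASSORD[where xs = qs])
        show "\<forall>x\<in>set qs. 0 \<le> x \<and> x < sz \<and> 0 \<le> ar s3 5 x \<and> ar s3 5 x < vr s3 4"
        proof
          fix x assume "x \<in> set qs"
          then have x: "x \<in> R" using sa by simp
          show "0 \<le> x \<and> x < sz \<and> 0 \<le> ar s3 5 x \<and> ar s3 5 x < vr s3 4"
            using Rp(3,4)[OF x] R5[OF x] g3(1) p(2) p1 by linarith
        qed
        fix s4 ds assume s4: "ds = lst (ar s4 10) (vr s3 11)" "mset ds = mset qs" "classord (ar s3 5) ds"
          "\<forall>x\<in>set qs. ar s4 19 x = vr s3 10 - int (cnt (ar s3 5) qs (ar s3 5 x))"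
          "vr s4 17 = int (cnt (ar s3 5) qs (ar s3 5 (ds ! 0)))"
          "int (tk s4) \<le> int (tk s3) + 11 * vr s3 10" "frame (CLASSORD 10 11) s3 s4"
        define h where "h = ar s3 5"
        have sd: "set ds = R" "distinct ds" "length ds = nat (p - 1)"
          using s4(1,2) sa da g3 mset_eq_imp_distinct_iff[OF s4(2)] by (auto dest: mset_eq_setD)
        have g4: "vr s4 4 = p" "vr s4 10 = nl" "vr s4 24 = LF" "vr s4 9 = 3 * p - 2" "vr s4 11 = p - 1" "vr s4 8 = vr s3 8"
          "ar s4 5 = h" "ar s4 6 = ar s3 6" "ar s4 7 = ar s3 7"
          using frameD[OF s4(7)] g3 by (auto simp: h_def)
        have d0: "ar s4 10 0 = ds ! 0" "ds ! 0 \<in> R"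
          using s4(1) g3 p1 sd(1,3) nth_mem[of 0 ds] by auto
        define x0 where "x0 = h (ds ! 0)"
        have x0: "0 < x0" "x0 < p" using Rp(1)[OF d0(2)] R5[OF d0(2)] by (auto simp: x0_def h_def)
        have co: "coprime x0 p" using prime_coprime_less[OF p(1) x0] .
        define c where "c = modular_inverse p x0"
        have c: "coprime c p" "0 \<le> c" "c < p" "x0 * c mod p = 1"
          using co p1 cong_modular_inverse1[OF co] modular_inverse_int_nonneg[of p x0] modular_inverse_int_less[of p x0]
          by (auto simp: c_def cong_def)
        define h' where "h' = (\<lambda>x. if x \<in> set ds then h x * c mod p else h x)"
        have eq: "(h' x = h' y) = (h x = h y)" if "x \<in> set ds" "y \<in> set ds" for x y
          using that R5 mult_mod_inj[OF c(1), of "h x" "h y"] sd(1) by (auto simp: h'_def h_def)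
        let ?s5 = "s4\<lparr>vr := (vr s4)(16 := vr s4 17, 21 := c)\<rparr>"
        have "wp (SCALE 10 11 21) (wp (8 ::= (V 8 .* V 21) .mod V 4) ?P) ?s5"
        proof (rule wp_SCALE[where xs = ds])
          show "\<forall>x\<in>set ds. 0 \<le> x \<and> x < sz \<and> 0 \<le> ar ?s5 5 x \<and> ar ?s5 5 x < vr ?s5 4"
          proof
            fix x assume "x \<in> set ds"
            then have x: "x \<in> R" using sd(1) by simp
            have "ar ?s5 5 x = ar s3 5 x" "vr ?s5 4 = p" using g4 by (simp_all add: h_def)
            then show "0 \<le> x \<and> x < sz \<and> 0 \<le> ar ?s5 5 x \<and> ar ?s5 5 x < vr ?s5 4"
              using Rp(3,4)[OF x] R5[OF x] p(2) p1 by linarith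
          qed
          fix s6 assume s6: "ar s6 5 = (\<lambda>x. if x \<in> set ds then ar ?s5 5 x * vr ?s5 21 mod vr ?s5 4 else ar ?s5 5 x)"
            "int (tk s6) = int (tk ?s5) + vr ?s5 11" "frame (SCALE 10 11 21) ?s5 s6"
          have g6: "vr s6 4 = p" "vr s6 10 = nl" "vr s6 24 = LF" "vr s6 9 = 3 * p - 2" "vr s6 11 = p - 1" "vr s6 8 = vr s3 8"
            "vr s6 21 = c" "ar s6 5 = h'" "ar s6 6 = ar s3 6" "ar s6 7 = ar s3 7" "ar s6 10 = ar s4 10" "ar s6 19 = ar s4 19" "vr s6 16 = vr s4 17"
            using frameD[OF s6(3)] g4 s6(1) by (auto simp: h'_def)
          let ?v = "(vr s6)(8 := vr s3 8 * c mod p)"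
          have "forest p X LF (set ds) p ?v (ar s6)"
            by (rule forest_scale[OF F3 c(1)]) (use g6 g3 p1 sd in \<open>auto simp: h'_def h_def\<close>)
          moreover have "classord h' ds" by (rule classord_scale[OF eq]) (use s4(3) h_def in auto)
          \<comment> \<open>Array 19 was filled before the scaling; it remains correct because the
            class sizes do not change.\<close>
          moreover have ch: "cnt h' ds (h' x) = cnt h qs (h x)" if "x \<in> set ds" for x
          proof -
            have "cnt h' ds (h' x) = cnt h ds (h x)" by (rule cnt_scale) (use eq that in auto)
            then show ?thesis using cnt_mset[OF s4(2), of h "h x"] by simp
          qed
          moreover have "h' (ds ! 0) = 1" using d0(2) sd(1) c(4) by (simp add: h'_def x0_def)
          moreover have "0 < h' x" if "x \<in> set ds" for x
            using mult_mod_pos(1)[OF c(1), of "h x"] Rp(1)[of x] R5[of x] that sd(1) by (simp add: h'_def h_def)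
          moreover have "vr s4 17 = int (cnt h' ds 1)"
            using ch[of "ds ! 0"] d0(2) sd(1) \<open>h' (ds ! 0) = 1\<close> s4(5) by (simp add: h_def)
          ultimately have "dstate p X LF ds ?v (ar s6)"
            unfolding dstate_def using s4(1,4) g6 g3 sd sa Rp(2) by (auto simp: h_def nl_def)
          moreover have "int (tk s6) \<le> int (tk s) + 33 * p"
            using s6(2) g4 s4(6) g3 s3(8) s1(2) p p1 by (simp add: nl_def)
          moreover have "fits (vr s3 8 * c)" using s3(6,7) g1 c p by (intro fits_prod) auto
          moreover have "fits (vr s3 8 * c mod p)" using p1 p by (intro fits_mod) auto
          ultimately show "wp (8 ::= (V 8 .* V 21) .mod V 4) ?P s6"
            using g6 by (subst wp_simps(2)) auto
        qed (use g4 c p p1 s4(1) g3 sd in auto)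
        moreover have "fits c" using c p by (intro fits_small) auto
        moreover have "ds ! 0 < sz" "0 \<le> ds ! 0" using Rp[OF d0(2)] p p1 by auto
        ultimately show "wp (16 ::= V 17) (wp (21 ::= B ModInv (A 5 (A 10 (N 0))) (V 4))
         (wp (SCALE 10 11 21) (wp (8 ::= (V 8 .* V 21) .mod V 4) ?P))) s4"
          using g4 d0(1) sz_pos unfolding wp_simps(2) by (simp add: x0_def[symmetric] c_def[symmetric])
      qed (use g3 p p1 da qs_def in \<open>auto simp: nl_def\<close>)
    qed (use g1 x9 p p1 xd fr0 ps_def in \<open>auto simp: nl_def\<close>)
    moreover have "fits (nl - 1)" "fits (p - 1)" using p p1 by (auto intro!: fits_small simp: nl_def)
    moreover have "0 \<le> nl - 1" "nl - 1 < sz" "0 \<le> LF" "LF < sz" using xd(4) p p1 by (auto simp: nl_def)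
    ultimately show "wp (12 ::= V 10 .- N 1) (wp (24 ::= A 9 (V 12)) (wp (8 ::= A 5 (V 24)) (wp (19 ::= V 4 .- N 1) (wp (20 ::= V 4)
       (wp (PAIR 9 12 10 11) (wp (CLASSORD 10 11) (wp (16 ::= V 17) (wp (21 ::= B ModInv (A 5 (A 10 (N 0))) (V 4))
       (wp (SCALE 10 11 21) (wp (8 ::= (V 8 .* V 21) .mod V 4) ?P)))))))))) s1"
      using g1 LF9 unfolding wp_simps(2) by simp
  next
    show "\<forall>x\<in>set ys. 0 \<le> x \<and> x < sz \<and> 0 \<le> ar s 5 x \<and> ar s 5 x < vr s 4"
      using sy fr0 p p1 by (auto simp: f_def nl_def)
  qed (use p p1 ys dy in auto)
  then show ?thesis
    by (rule wp_conseq) (elim exE conjE, rule Q, assumption+)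
qed

end

section \<open>A large class of equal residues\<close>

text \<open>
  If the most frequent residue, scaled to 1, occurs at least \<open>p / 10000000\<close> times, classes are
  processed in the order of decreasing size as long as their size is at least a constant fraction of
  the number of unprocessed residues. Then every remaining class is small, and the differences of
  the remaining residues at distance \<open>4 * \<mu>\<close> in sorted order are on average large enough to fill
  the gaps of the set of subset sums.
\<close>

definition ready :: "int \<Rightarrow> (int \<Rightarrow> int) \<Rightarrow> int \<Rightarrow> (nat \<Rightarrow> int) \<Rightarrow> (nat \<Rightarrow> int \<Rightarrow> int) \<Rightarrow> bool" where
  "ready p X Ka v a \<longleftrightarrow> (\<exists>LF R \<sigma>. forest p X LF R p v a \<and>
    0 \<le> v 18 \<and> v 18 \<le> v 13 \<and> v 13 \<le> p \<and> 0 \<le> v 14 \<and> v 14 \<le> p \<and> v 19 = int \<sigma> \<and>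
    distinct (lst (a 14) (v 13) @ lst (a 13) (v 14)) \<and>
    set (lst (a 14) (v 13)) \<subseteq> R \<and> set (lst (a 13) (v 14)) \<subseteq> R \<and> (\<forall>x\<in>R. 2 * p - 1 \<le> x) \<and>
    (\<forall>x\<in>set (lst (a 14) (v 13)). 0 < a 5 x) \<and>
    (\<forall>i. 0 \<le> i \<and> i < v 18 \<longrightarrow> a 5 (a 14 i) = 1) \<and>
    (\<forall>i. 0 < i \<and> i < v 13 \<and> a 5 (a 14 i) \<noteq> a 5 (a 14 (i - 1)) \<longrightarrow>
       (\<exists>e. i < e \<and> e \<le> v 13 \<and> (\<forall>j. i \<le> j \<and> j < e \<longrightarrow> a 5 (a 14 j) = a 5 (a 14 i)) \<and>
         p - 1 - i \<le> Ka * (e - i))) \<and>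
    max 0 (p - 1 - v 13) \<le> pairs_sum (a 5) (sort_key (a 5) (lst (a 13) (v 14))) \<sigma> (v 18 + 1))"

lemma lst_copy:
  assumes "\<forall>i. 0 \<le> i \<and> i < l \<longrightarrow> g i = f (off + i)" "0 \<le> off" "0 \<le> l" "off + l \<le> n"
  shows "lst g l = take (nat l) (drop (nat off) (lst f n))"
proof (rule nth_equalityI)
  show len: "length (lst g l) = length (take (nat l) (drop (nat off) (lst f n)))" using assms by simp
  fix i assume "i < length (lst g l)"
  then have i: "i < nat l" by simp
  then have "nat off + i < nat n" using assms by linarith
  then show "lst g l ! i = take (nat l) (drop (nat off) (lst f n)) ! i"
    using assms i by simp
qed

section \<open>Lower bounds for the total of the differences in the three cases\<close>

lemma cnt_append: "cnt f (xs @ ys) v = cnt f xs v + cnt f ys v"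
  by (simp add: cnt_def)

lemma cnt_drop: "cnt f (drop k xs) v \<le> cnt f xs v"
  using cnt_append[of f "take k xs" "drop k xs" v] by simp

lemma cnt_take: "cnt f (take k xs) v \<le> cnt f xs v"
  using cnt_append[of f "take k xs" "drop k xs" v] by simp

text \<open>At distance \<open>4 * \<mu>\<close> every difference is at least 4, so the total is at
  least twice the length minus \<open>16 * \<mu>\<close> and 4 for each rejected pair. By
  \<open>p \<le> 10000000 * m\<close> at most \<open>40000000 * \<mu>\<close> pairs are rejected.
  The loss is at most \<open>160000016 * \<mu>\<close>, which explains this constant: the loss stays
  below the length, and half of the main term survives.\<close>

lemma pairs_sum_large_class:
  fixes p m :: int
  assumes s: "sorted (map f zs)" "\<And>v. cnt f zs v \<le> \<mu>" "\<And>x. x \<in> set zs \<Longrightarrow> 0 \<le> f x \<and> f x \<le> p" "0 < \<mu>"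
    and k: "160000016 * int \<mu> < int (length zs)" "p \<le> 10000000 * m" "0 < m" "0 \<le> p"
  shows "int (length zs) \<le> pairs_sum f zs (4 * \<mu>) (m + 1)"
proof -
  define bc where "bc = card {i. i < length zs - 4 * \<mu> \<and> m + 1 < f (zs ! (i + 4 * \<mu>)) - f (zs ! i)}"
  have 1: "4 * (int (length zs) - 2 * int (4 * \<mu>) - 2 * int bc) \<le> 2 * pairs_sum f zs (4 * \<mu>) (m + 1)"
    using pairs_sum_ge[OF s(1,2), of 4 "4 * \<mu>" bc "m + 1"] s(4) bc_def by simp
  have "int bc * (m + 1 + 1) \<le> int (4 * \<mu>) * p"
    unfolding bc_def by (rule big_count[OF s(1,3) k(4)])
  also have "\<dots> \<le> int (4 * \<mu>) * (10000000 * m)" using k by (intro mult_left_mono) auto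
  finally have "int bc * (m + 1 + 1) \<le> (40000000 * int \<mu>) * m" by simp
  moreover have "int bc * m \<le> int bc * (m + 1 + 1)" by (intro mult_left_mono) auto
  ultimately have "int bc * m \<le> (40000000 * int \<mu>) * m" by linarith
  then have 2: "int bc \<le> 40000000 * int \<mu>" using k(3) by simp
  define S where "S = pairs_sum f zs (4 * \<mu>) (m + 1)"
  have "4 * (int (length zs) - 8 * int \<mu> - 2 * int bc) \<le> 2 * S" using 1 by (simp add: S_def)
  then have "4 * int (length zs) - 32 * int \<mu> - 8 * int bc \<le> 2 * S" by simp
  then have "4 * int (length zs) - 32 * int \<mu> - 320000000 * int \<mu> \<le> 2 * S" using 2 by linarith
  then have "4 * int (length zs) - 320000032 * int \<mu> \<le> 2 * S" by simp
  moreover have "320000032 * int \<mu> < 2 * int (length zs)" using k(1) by simp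
  ultimately have "2 * int (length zs) < 2 * S" by linarith
  then show ?thesis by (simp add: S_def)
qed

text \<open>Differences at distance \<open>8 * m\<close> are at least 8, and at most
  \<open>p / 20\<close> pairs are rejected by the bound \<open>160 * m + 1\<close>. With about
  \<open>p / 2\<close> values the total is thus about \<open>4 * (p / 2 - p / 10)\<close>, that is
  \<open>1.6 * p\<close>, up to a multiple of \<open>m\<close>. The 160 is 20 times the 8 of the
  distance.\<close>

lemma pairs_sum_small_classes:
  fixes p m :: int
  assumes s: "sorted (map f zs)" "\<And>v. int (cnt f zs v) \<le> m" "\<And>x. x \<in> set zs \<Longrightarrow> 0 \<le> f x \<and> f x \<le> p"
    and k: "p - 1 - m \<le> 2 * int (length zs)" "10000000 * m < p" "0 < m"
  shows "p - 1 \<le> pairs_sum f zs (nat (8 * m)) (160 * m + 1)"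
proof -
  define bc where "bc = card {i. i < length zs - nat (8 * m) \<and> 160 * m + 1 < f (zs ! (i + nat (8 * m))) - f (zs ! i)}"
  have c: "cnt f zs v \<le> nat m" for v using s(2)[of v] by simp
  have 1: "8 * (int (length zs) - 2 * int (nat (8 * m)) - 2 * int bc) \<le> 2 * pairs_sum f zs (nat (8 * m)) (160 * m + 1)"
    using pairs_sum_ge[OF s(1) c, of 8 "nat (8 * m)" bc "160 * m + 1"] k bc_def by (simp add: nat_mult_distrib)
  have "int bc * (160 * m + 1 + 1) \<le> int (nat (8 * m)) * p"
    unfolding bc_def by (rule big_count[OF s(1,3)]) (use k in auto)
  moreover have "int bc * (160 * m) \<le> int bc * (160 * m + 1 + 1)" by (intro mult_left_mono) auto
  moreover have "int (nat (8 * m)) = 8 * m" using k by simp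
  ultimately have "int bc * (160 * m) \<le> (8 * m) * p" by (metis order_trans)
  moreover have "(20 * int bc) * (8 * m) = int bc * (160 * m)" "p * (8 * m) = (8 * m) * p" by simp_all
  ultimately have "(20 * int bc) * (8 * m) \<le> p * (8 * m)" by linarith
  then have 2: "20 * int bc \<le> p" using k by simp
  define S where "S = pairs_sum f zs (nat (8 * m)) (160 * m + 1)"
  have "8 * (int (length zs) - 16 * m - 2 * int bc) \<le> 2 * S" using 1 k by (simp add: S_def)
  then have "8 * int (length zs) - 128 * m - 16 * int bc \<le> 2 * S" by simp
  then have "40 * int (length zs) - 640 * m - 4 * p \<le> 10 * S" using 2 by linarith
  moreover have "20 * p - 20 - 20 * m \<le> 40 * int (length zs)" using k(1) by simp
  ultimately have "16 * p - 20 - 660 * m \<le> 10 * S" by linarith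
  moreover have "660 * m < p" using k by linarith
  ultimately have "15 * p - 20 < 10 * S" by linarith
  then have "p - 1 \<le> S" using k by linarith
  then show ?thesis by (simp add: S_def)
qed

text \<open>Differences at distance \<open>3200 * m\<close> are at least 20. With the threshold
  \<open>50 * m\<close> in \<open>big_count_sum\<close>, at most \<open>160000 * m + p / 50\<close>
  pairs are rejected. With about \<open>p / 4\<close> values the total is about
  \<open>10 * (p / 4 - p / 25)\<close>, that is \<open>2.1 * p\<close>, minus roughly
  \<open>3264000 * m\<close>; the bound \<open>10000000 * m < p\<close> makes the last term less
  than \<open>0.4 * p\<close>.\<close>

lemma pairs_sum_small_differences:
  fixes p m :: int
  assumes s: "sorted (map f zs)" "\<And>v. int (cnt f zs v) \<le> 160 * m" "\<And>x. x \<in> set zs \<Longrightarrow> 0 \<le> f x"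
      "sum_list (map f zs) \<le> m * p"
    and k: "p - 2 - 5 * m \<le> 4 * int (length zs)" "10000000 * m < p" "0 < m"
  shows "p - 1 \<le> pairs_sum f zs (nat (20 * (160 * m))) (m + 1)"
proof -
  let ?s = "nat (20 * (160 * m))"
  define bc where "bc = card {i. i < length zs - ?s \<and> m + 1 < f (zs ! (i + ?s)) - f (zs ! i)}"
  have c: "cnt f zs v \<le> nat (160 * m)" for v using s(2)[of v] by simp
  have 1: "20 * (int (length zs) - 2 * int ?s - 2 * int bc) \<le> 2 * pairs_sum f zs ?s (m + 1)"
    using pairs_sum_ge[OF s(1) c, of 20 ?s bc "m + 1"] k bc_def by (simp add: nat_mult_distrib)
  have si: "int ?s = 3200 * m" using k by simp
  obtain b1 b2 where b: "int bc \<le> b1 + b2" "b1 * (m + 1 + 1) \<le> int ?s * (50 * m)" "b2 * (50 * m) \<le> m * p" "0 \<le> b1"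
    using big_count_sum[OF s(1,3), of "50 * m" "m + 1" "m * p" bc ?s] s(4) k bc_def by auto
  have "b1 * m \<le> b1 * (m + 1 + 1)" using b(4) by (intro mult_left_mono) auto
  then have "b1 * m \<le> (160000 * m) * m" using b(2) si by simp
  then have b1: "b1 \<le> 160000 * m" using k by simp
  have "(50 * b2) * m \<le> p * m" using b(3) by (simp add: mult_ac)
  then have b2: "50 * b2 \<le> p" using k by simp
  define S where "S = pairs_sum f zs ?s (m + 1)"
  have "20 * (int (length zs) - 6400 * m - 2 * int bc) \<le> 2 * S" using 1 si by (simp add: S_def)
  then have 1: "20 * int (length zs) - 128000 * m - 40 * int bc \<le> 2 * S" by simp
  have 2: "5 * p - 10 - 25 * m \<le> 20 * int (length zs)" using k(1) by simp
  have 3: "200 * int bc \<le> 32000000 * m + 4 * p" using b(1) b1 b2 by linarith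
  have "25 * p - 50 - 125 * m - 640000 * m - 200 * int bc \<le> 10 * S" using 1 2 by linarith
  then have "21 * p - 50 - 125 * m - 640000 * m - 32000000 * m \<le> 10 * S" using 3 by linarith
  then have "21 * p - 50 - 32640125 * m \<le> 10 * S" by simp
  moreover have "4 * (10000000 * m) < 4 * p" using k(2) by simp
  then have "32640125 * m < 4 * p" using k(3) by linarith
  ultimately have "17 * p - 50 < 10 * S" by linarith
  then have "p - 1 \<le> S" using k by linarith
  then show ?thesis by (simp add: S_def)
qed

text \<open>Whole classes join the walk until one is smaller than the number of remaining residues
  divided by 160000016. The constant serves twice: as long as the test fails, the class pays for its
  rebuild; once it succeeds, the premise of \<open>pairs_sum_large_class\<close> holds for the
  rest.\<close>

definition REG1 :: com where
  "REG1 = (13 ::= N 0 ;; 23 ::= N 1 ;;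
     Loop (Lt (N 0) (V 23))
      (Cond (Lt (V 13) (V 11))
        (33 ::= V 10 .- A 19 (A 10 (V 13)) ;;
         Cond (Lt (N 160000016 .* V 33) (V 11 .- V 13)) (23 ::= N 0) (13 ::= V 13 .+ V 33))
        (23 ::= N 0)) ;;
     18 ::= V 16 ;; 14 ::= V 11 .- V 13 ;;
     Cond (Lt (V 13) (V 11)) (19 ::= N 4 .* (V 10 .- A 19 (A 10 (V 13)))) (19 ::= N 0) ;;
     25 ::= N 0 ;; COPY 14 10 25 13 ;; COPY 13 10 13 14)"

lemma mod_REG1 [simp]: "modv REG1 = {13, 14, 18, 19, 23, 25, 30, 33}" "moda REG1 = {13, 14}"
  by (auto simp: REG1_def)

context ram
begin

lemma wp_ready_SOLVE:
  assumes "ready p X Ka (vr s) (ar s)" "prime p" "0 \<le> Ka" "vr s 9 + p \<le> sz" "vr s 19 \<le> 10 * sz"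
    and "\<And>t. (\<forall>x\<in>{0..<2 * p - 1}. ar t 8 x \<in> {0, 1}) \<Longrightarrow> (\<Sum>x\<in>{0..<2 * p - 1}. ar t 8 x) = p \<Longrightarrow>
      [(\<Sum>x\<in>{0..<2 * p - 1}. ar t 8 x * X x) = 0] (mod p) \<Longrightarrow>
      int (tk t) \<le> int (tk s) + 20 * p + Ka * p + 2 * vr s 9 \<Longrightarrow> frame SOLVE s t \<Longrightarrow> Q t"
  shows "wp SOLVE Q s"
proof -
  obtain LF R \<sigma> where h: "forest p X LF R p (vr s) (ar s)"
    "0 \<le> vr s 18" "vr s 18 \<le> vr s 13" "vr s 13 \<le> p" "0 \<le> vr s 14" "vr s 14 \<le> p" "vr s 19 = int \<sigma>"
    "distinct (lst (ar s 14) (vr s 13) @ lst (ar s 13) (vr s 14))"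
    "set (lst (ar s 14) (vr s 13)) \<subseteq> R" "set (lst (ar s 13) (vr s 14)) \<subseteq> R" "\<forall>x\<in>R. 2 * p - 1 \<le> x"
    "\<forall>x\<in>set (lst (ar s 14) (vr s 13)). 0 < ar s 5 x"
    "\<forall>i. 0 \<le> i \<and> i < vr s 18 \<longrightarrow> ar s 5 (ar s 14 i) = 1"
    "\<forall>i. 0 < i \<and> i < vr s 13 \<and> ar s 5 (ar s 14 i) \<noteq> ar s 5 (ar s 14 (i - 1)) \<longrightarrow>
       (\<exists>e. i < e \<and> e \<le> vr s 13 \<and> (\<forall>j. i \<le> j \<and> j < e \<longrightarrow> ar s 5 (ar s 14 j) = ar s 5 (ar s 14 i)) \<and>
         p - 1 - i \<le> Ka * (e - i))"
    "max 0 (p - 1 - vr s 13) \<le> pairs_sum (ar s 5) (sort_key (ar s 5) (lst (ar s 13) (vr s 14))) \<sigma> (vr s 18 + 1)"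
    using assms(1) unfolding ready_def by blast
  show ?thesis
    by (rule wp_SOLVE[OF h(1) assms(2-4) h(2-7) assms(5) refl refl h(8-10) _ _ refl _ _ h(15) assms(6)])
      (use h(11-14) in blast)+
qed

lemma wp_REG1:
  assumes D: "dstate p X LF ds (vr s) (ar s)" and p: "prime p" "8 * p \<le> sz" and m: "p \<le> 10000000 * vr s 16"
    and Q: "\<And>t. ready p X 160000016 (vr t) (ar t) \<Longrightarrow> vr t 19 \<le> 10 * sz \<Longrightarrow>
      int (tk t) \<le> int (tk s) + 3 * p \<Longrightarrow> frame REG1 s t \<Longrightarrow> Q t"
  shows "wp REG1 Q s"
proof -
  define val where "val = ar s 5"
  define n where "n = p - 1"
  define m where "m = vr s 16"
  define mu where "mu = (\<lambda>i. int (cnt val ds (val (ds ! nat i))))"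
  have p1: "1 < p" using p prime_gt_1_int by blast
  have d: "ds = lst (ar s 10) n" "forest p X LF (set ds) p (vr s) (ar s)" "distinct ds" "vr s 11 = n" "vr s 9 = 3 * p - 2"
    "\<forall>x\<in>set ds. 2 * p - 1 \<le> x \<and> 0 < val x" "classord val ds"
    "\<forall>x\<in>set ds. ar s 19 x = 2 * p - 1 - int (cnt val ds (val x))" "m = int (cnt val ds 1)" "val (ds ! 0) = 1"
    using D unfolding dstate_def val_def n_def m_def by blast+
  have f0: "vr s 4 = p" "vr s 10 = 2 * p - 1" "set ds \<subseteq> {0..<3 * p - 2}" "\<And>x. x \<in> set ds \<Longrightarrow> 0 \<le> val x \<and> val x < p"
    using d(2,5) by (auto simp: forest_def val_def)
  have ln: "length ds = nat n" using d(1) by simp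
  have nn: "0 < n" using p1 by (simp add: n_def)
  have dsi: "ds ! nat i \<in> set ds" "ar s 10 i = ds ! nat i" if "0 \<le> i" "i < n" for i
  proof -
    have i: "nat i < length ds" using that ln by simp
    then show "ds ! nat i \<in> set ds" by simp
    show "ar s 10 i = ds ! nat i" using that i unfolding d(1) by simp
  qed
  have mu1: "1 \<le> mu i" "mu i \<le> n" if "0 \<le> i" "i < n" for i
    using cnt_pos[OF dsi(1)[OF that], of val] cnt_le[of val ds "val (ds ! nat i)"] ln nn by (auto simp: mu_def)
  have mu0: "mu 0 = m" using d(9,10) by (simp add: mu_def)
  have ar19: "2 * p - 1 - ar s 19 (ar s 10 i) = mu i" if "0 \<le> i" "i < n" for i
    using dsi[OF that] d(8) by (simp add: mu_def)
  \<comment> \<open>Positions where a class begins, and the end of the list.\<close>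
  define bnd where "bnd = (\<lambda>i. i = 0 \<or> i = n \<or> val (ds ! nat (i - 1)) \<noteq> val (ds ! nat i))"
  have block: "i + mu i \<le> n" "\<And>j. i \<le> j \<Longrightarrow> j < i + mu i \<Longrightarrow> val (ds ! nat j) = val (ds ! nat i)"
    "\<And>j. 0 \<le> j \<Longrightarrow> j < n \<Longrightarrow> val (ds ! nat j) = val (ds ! nat i) \<Longrightarrow> i \<le> j \<and> j < i + mu i"
    if i: "0 \<le> i" "i < n" "bnd i" for i
  proof -
    have ni: "nat (i - 1) = nat i - 1" using i by simp
    have B: "{j. j < length ds \<and> val (ds ! j) = val (ds ! nat i)} = {nat i..<nat i + cnt val ds (val (ds ! nat i))}"
      using i ln by (intro classord_block[OF d(7)]) (auto simp: bnd_def ni)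
    have c: "0 < cnt val ds (val (ds ! nat i))" using mu1[OF i(1,2)] by (simp add: mu_def)
    have "nat i + cnt val ds (val (ds ! nat i)) - 1 \<in> {nat i..<nat i + cnt val ds (val (ds ! nat i))}" using c by auto
    then have "nat i + cnt val ds (val (ds ! nat i)) - 1 < length ds" using B by blast
    then show "i + mu i \<le> n" using c ln i by (simp add: mu_def)
    show "val (ds ! nat j) = val (ds ! nat i)" if "i \<le> j" "j < i + mu i" for j
    proof -
      have "nat j \<in> {nat i..<nat i + cnt val ds (val (ds ! nat i))}" using that i(1) by (auto simp: mu_def)
      then show ?thesis using B by blast
    qed
    show "i \<le> j \<and> j < i + mu i" if "0 \<le> j" "j < n" "val (ds ! nat j) = val (ds ! nat i)" for j
    proof -
      have "nat j \<in> {j. j < length ds \<and> val (ds ! j) = val (ds ! nat i)}" using that ln by auto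
      then have "nat j \<in> {nat i..<nat i + cnt val ds (val (ds ! nat i))}" using B by blast
      then show ?thesis using that i(1) by (auto simp: mu_def)
    qed
  qed
  \<comment> \<open>The premise \<open>H\<close> of the walk for the prefix of length
    \<open>i\<close>; the witness for a new class is its end.\<close>
  define Hyp where "Hyp = (\<lambda>i. \<forall>k. 0 < k \<and> k < i \<and> val (ds ! nat k) \<noteq> val (ds ! nat (k - 1)) \<longrightarrow>
     (\<exists>e. k < e \<and> e \<le> i \<and> (\<forall>j. k \<le> j \<and> j < e \<longrightarrow> val (ds ! nat j) = val (ds ! nat k)) \<and> p - 1 - k \<le> 160000016 * (e - k)))"
  define J where "J = (\<lambda>i g tt. 0 \<le> i \<and> i \<le> n \<and> bnd i \<and> Hyp i \<and> (g = 0 \<or> g = 1) \<and> (i = 0 \<and> g = 1 \<or> m \<le> i) \<and>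
     (g = 0 \<longrightarrow> i = n \<or> 160000016 * mu i < n - i) \<and> tt \<le> int (tk s) + i + (1 - g))"
  let ?rest = "wp (18 ::= V 16) (wp (14 ::= V 11 .- V 13) (wp
     (Cond (Lt (V 13) (V 11)) (19 ::= N 4 .* (V 10 .- A 19 (A 10 (V 13)))) (19 ::= N 0)) (wp
     (25 ::= N 0) (wp (COPY 14 10 25 13) (wp (COPY 13 10 13 14) (\<lambda>t. ready p X 160000016 (vr t) (ar t) \<and> vr t 19 \<le> 10 * sz \<and>
      int (tk t) \<le> int (tk s) + 3 * p))))))"
  have rest: "?rest t" if t: "J (vr t 13) 0 (int (tk t))" and fr: "vr t 11 = n" "vr t 10 = 2 * p - 1" "vr t 16 = m" "vr t 4 = p"
     "vr t 8 = vr s 8" "vr t 9 = vr s 9" "vr t 24 = vr s 24" "ar t = ar s" for t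
  proof -
    define q where "q = vr t 13"
    have q: "0 \<le> q" "q \<le> n" "Hyp q" "m \<le> q" "q = n \<or> 160000016 * mu q < n - q" "bnd q" "int (tk t) \<le> int (tk s) + q + 1"
      using t by (auto simp: J_def q_def)
    define sh where "sh = (if q < n then 4 * mu q else 0)"
    have sh: "0 \<le> sh" "sh \<le> 4 * n" using mu1[of q] q nn by (auto simp: sh_def)
    let ?t = "t\<lparr>vr := (vr t)(18 := m, 14 := n - q, 19 := sh, 25 := 0)\<rparr>"
    have "wp (COPY 14 10 25 13) (wp (COPY 13 10 13 14) (\<lambda>t. ready p X 160000016 (vr t) (ar t) \<and> vr t 19 \<le> 10 * sz \<and>
      int (tk t) \<le> int (tk s) + 3 * p)) ?t"
    proof (rule wp_COPY)
      fix t1 assume t1: "\<forall>i. 0 \<le> i \<and> i < vr ?t 13 \<longrightarrow> ar t1 14 i = ar ?t 10 (vr ?t 25 + i)"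
        "int (tk t1) = int (tk ?t) + vr ?t 13" "frame (COPY 14 10 25 13) ?t t1"
      have g1: "vr t1 13 = q" "vr t1 14 = n - q" "ar t1 10 = ar s 10" "\<forall>i. 0 \<le> i \<and> i < q \<longrightarrow> ar t1 14 i = ar s 10 i"
        "vr t1 18 = m" "vr t1 19 = sh" "ar t1 5 = val" "ar t1 6 = ar s 6" "ar t1 7 = ar s 7"
        "vr t1 4 = p" "vr t1 8 = vr s 8" "vr t1 9 = vr s 9" "vr t1 10 = 2 * p - 1" "vr t1 24 = vr s 24"
        using frameD[OF t1(3)] t1(1) fr by (auto simp: q_def val_def)
      show "wp (COPY 13 10 13 14) (\<lambda>t. ready p X 160000016 (vr t) (ar t) \<and> vr t 19 \<le> 10 * sz \<and>
        int (tk t) \<le> int (tk s) + 3 * p) t1"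
      proof (rule wp_COPY)
        fix t2 assume t2: "\<forall>i. 0 \<le> i \<and> i < vr t1 14 \<longrightarrow> ar t2 13 i = ar t1 10 (vr t1 13 + i)"
          "int (tk t2) = int (tk t1) + vr t1 14" "frame (COPY 13 10 13 14) t1 t2"
        have g2: "vr t2 13 = q" "vr t2 14 = n - q" "\<forall>i. 0 \<le> i \<and> i < q \<longrightarrow> ar t2 14 i = ar s 10 (0 + i)"
          "\<forall>i. 0 \<le> i \<and> i < n - q \<longrightarrow> ar t2 13 i = ar s 10 (q + i)"
          "vr t2 18 = m" "vr t2 19 = sh" "ar t2 5 = val" "ar t2 6 = ar s 6" "ar t2 7 = ar s 7"
          "vr t2 4 = p" "vr t2 8 = vr s 8" "vr t2 9 = vr s 9" "vr t2 10 = 2 * p - 1" "vr t2 24 = vr s 24"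
          using frameD[OF t2(3)] t2(1) g1 by auto
        have lQ: "lst (ar t2 14) q = take (nat q) ds"
          using lst_copy[OF g2(3), of n] q d(1) by simp
        have lT: "lst (ar t2 13) (n - q) = drop (nat q) ds"
          using lst_copy[OF g2(4), of n] q d(1) ln by (simp add: nat_diff_distrib)
        have F2: "forest p X LF (set ds) p (vr t2) (ar t2)"
          by (rule forest_cong[OF d(2)]) (use g2 f0 in \<open>auto simp: val_def\<close>)
        have dist: "distinct (take (nat q) ds @ drop (nat q) ds)" using d(3) by simp
        have q14: "ar t2 5 (ar t2 14 i) = val (ds ! nat i)" if "0 \<le> i" "i < q" for i
          using g2(3,7) dsi(2)[of i] that q by simp
        have ones: "val (ds ! nat i) = 1" if "0 \<le> i" "i < m" for i
          using block(2)[of 0 i] that mu0 nn d(10) by (simp add: bnd_def)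
        have EE: "max 0 (p - 1 - q) \<le> pairs_sum val (sort_key val (drop (nat q) ds)) (nat sh) (m + 1)"
        proof (cases "q < n")
          case False
          then have "drop (nat q) ds = []" using q ln by simp
          then show ?thesis using False q by (simp add: pairs_sum_def pairs_def n_def)
        next
          case True
          define zs where "zs = sort_key val (drop (nat q) ds)"
          have lz: "int (length zs) = n - q" using q ln by (simp add: zs_def nat_diff_distrib)
          \<comment> \<open>Classes come in the order of decreasing size, so the class at
            \<open>q\<close> bounds all later ones.\<close>
          have cz: "cnt val zs v \<le> nat (mu q)" for v
          proof (cases "v \<in> val ` set zs")
            case True
            then obtain x where x: "x \<in> set (drop (nat q) ds)" "v = val x" by (auto simp: zs_def)
            then obtain j where "j < length ds - nat q" "drop (nat q) ds ! j = x" by (auto simp: in_set_conv_nth)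
            then have j: "nat q + j < length ds" "v = val (ds ! (nat q + j))" using x(2) by auto
            have "cnt val zs v = cnt val (drop (nat q) ds) v" by (rule cnt_mset) (simp add: zs_def)
            also have "\<dots> \<le> cnt val ds v" by (rule cnt_drop)
            also have "\<dots> \<le> cnt val ds (val (ds ! nat q))"
            proof (cases "j = 0")
              case False
              then show ?thesis using d(7) j unfolding classord_def by simp
            qed (use j in simp)
            finally show ?thesis by (simp add: mu_def)
          next
            case False
            then have "cnt val zs v = 0" by (auto simp: cnt_def filter_empty_conv)
            then show ?thesis by simp
          qed
          have "int (length zs) \<le> pairs_sum val zs (4 * nat (mu q)) (m + 1)"
          proof (rule pairs_sum_large_class[OF _ cz])
            show "sorted (map val zs)" by (simp add: zs_def)
            show "0 \<le> val x \<and> val x \<le> p" if "x \<in> set zs" for x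
              using that f0(4)[of x] by (auto simp: zs_def dest!: in_set_dropD)
          qed (use mu1[of q] q True lz m mu1[of 0] mu0 nn p1 in \<open>auto simp: m_def\<close>)
          moreover have "nat sh = 4 * nat (mu q)" using True mu1[of q] q by (simp add: sh_def nat_mult_distrib)
          ultimately show ?thesis using lz True by (simp add: zs_def n_def)
        qed
        have HH: "\<forall>i. 0 < i \<and> i < q \<and> ar t2 5 (ar t2 14 i) \<noteq> ar t2 5 (ar t2 14 (i - 1)) \<longrightarrow>
          (\<exists>e. i < e \<and> e \<le> q \<and> (\<forall>j. i \<le> j \<and> j < e \<longrightarrow> ar t2 5 (ar t2 14 j) = ar t2 5 (ar t2 14 i)) \<and>
           p - 1 - i \<le> 160000016 * (e - i))"
        proof (intro allI impI)
          fix i assume i: "0 < i \<and> i < q \<and> ar t2 5 (ar t2 14 i) \<noteq> ar t2 5 (ar t2 14 (i - 1))"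
          then have "val (ds ! nat i) \<noteq> val (ds ! nat (i - 1))" using q14[of i] q14[of "i - 1"] by simp
          then obtain e where e: "i < e" "e \<le> q" "\<forall>j. i \<le> j \<and> j < e \<longrightarrow> val (ds ! nat j) = val (ds ! nat i)"
            "p - 1 - i \<le> 160000016 * (e - i)" using q(3) i unfolding Hyp_def by blast
          have "ar t2 5 (ar t2 14 j) = ar t2 5 (ar t2 14 i)" if "i \<le> j" "j < e" for j
            using e(3)[rule_format, of j] q14[of j] q14[of i] that i e(2) by simp
          then show "\<exists>e. i < e \<and> e \<le> q \<and> (\<forall>j. i \<le> j \<and> j < e \<longrightarrow> ar t2 5 (ar t2 14 j) = ar t2 5 (ar t2 14 i)) \<and>
            p - 1 - i \<le> 160000016 * (e - i)" using e by blast
        qed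
        have "ready p X 160000016 (vr t2) (ar t2)"
          unfolding ready_def g2(1,2,5,6) lQ lT
        proof (intro exI[of _ LF] exI[of _ "set ds"] exI[of _ "nat sh"] conjI)
          show "\<forall>i. 0 \<le> i \<and> i < m \<longrightarrow> ar t2 5 (ar t2 14 i) = 1" using q14 ones q(4) by simp
          show "max 0 (p - 1 - q) \<le> pairs_sum (ar t2 5) (sort_key (ar t2 5) (drop (nat q) ds)) (nat sh) (m + 1)"
            using EE g2(7) by simp
          show "\<forall>x\<in>set (take (nat q) ds). 0 < ar t2 5 x" using d(6) g2(7) by (auto dest!: in_set_takeD)
          show "0 \<le> m" by (simp add: d(9))
        qed (use F2 dist HH d(6) q sh p1 in \<open>auto simp: n_def dest!: in_set_takeD in_set_dropD\<close>)
        moreover have "int (tk t2) \<le> int (tk s) + 3 * p" using t2(2) t1(2) g1 q fr by (simp add: n_def q_def)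
        moreover have "sh \<le> 10 * sz" using sh p by (simp add: n_def)
        ultimately show "ready p X 160000016 (vr t2) (ar t2) \<and> vr t2 19 \<le> 10 * sz \<and> int (tk t2) \<le> int (tk s) + 3 * p"
          using g2(6) by simp
      qed (use g1 q p p1 in \<open>auto simp: n_def\<close>)
    qed (use q p p1 in \<open>auto simp: n_def q_def\<close>)
    moreover have "fits (n - q)" "fits 4" using q p p1 by (auto intro!: fits_small simp: n_def)
    ultimately show ?thesis
    proof (cases "q < n")
      case True
      have x: "0 \<le> ar s 10 q" "ar s 10 q < sz" "q < sz" using dsi[of q] q True f0(3) p p1 by (auto simp: n_def)
      have "fits (2 * p - 1 - ar s 19 (ar s 10 q))" "fits (4 * (2 * p - 1 - ar s 19 (ar s 10 q)))"
        unfolding ar19[OF q(1) True] using mu1[OF q(1) True] p p1 by (auto intro!: fits_small simp: n_def)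
      then show ?thesis
        using \<open>wp (COPY 14 10 25 13) _ ?t\<close> \<open>fits (n - q)\<close> \<open>fits 4\<close> True x q fr ar19[OF q(1) True]
        unfolding wp_simps(2) by (simp add: wp_simps(2,5) q_def[symmetric] sh_def)
    next
      case False
      then show ?thesis
        using \<open>wp (COPY 14 10 25 13) _ ?t\<close> \<open>fits (n - q)\<close> q fr
        unfolding wp_simps(2) by (simp add: wp_simps(2,5) q_def[symmetric] sh_def)
    qed
  qed
  have "wp REG1 (\<lambda>t. ready p X 160000016 (vr t) (ar t) \<and> vr t 19 \<le> 10 * sz \<and> int (tk t) \<le> int (tk s) + 3 * p) s"
  proof -
    have "wp (Loop (Lt (N 0) (V 23))
      (Cond (Lt (V 13) (V 11))
        (33 ::= V 10 .- A 19 (A 10 (V 13)) ;;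
         Cond (Lt (N 160000016 .* V 33) (V 11 .- V 13)) (23 ::= N 0) (13 ::= V 13 .+ V 33))
        (23 ::= N 0))) ?rest (s\<lparr>vr := (vr s)(13 := 0, 23 := 1)\<rparr>)"
    proof (rule wp_Loop[where I = "\<lambda>t. J (vr t 13) (vr t 23) (int (tk t))" and m = "\<lambda>t. nat (2 * (n - vr t 13) + vr t 23)"], goal_cases)
      case 1
      then show ?case using nn by (simp add: J_def bnd_def Hyp_def)
    next
      case (2 t)
      then show ?case by simp
    next
      case (3 t)
      have fr: "vr t 11 = n" "vr t 10 = 2 * p - 1" "ar t = ar s"
        using frameD[OF 3(2)] d f0 by auto
      define q where "q = vr t 13"
      have q: "0 \<le> q" "q \<le> n" "bnd q" "Hyp q" "q = 0 \<or> m \<le> q" "int (tk t) \<le> int (tk s) + q" "vr t 23 = 1"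
        using 3(1,3) by (auto simp: J_def q_def)
      show ?case
      proof (cases "q < n")
        case False
        then have "q = n" using q(2) by simp
        moreover from this have "m \<le> q" using q(5) nn by auto
        ultimately have "J q 0 (int (tk t) + 1)" using q(1,2,3,4,6) by (simp add: J_def)
        then show ?thesis using False fr q by (intro wp_CondF) (simp_all add: wp_simps q_def[symmetric] add.commute)
      next
        case True
        have x: "0 \<le> ar s 10 q" "ar s 10 q < sz" "q < sz" using dsi[of q] q True f0(3) p p1 by (auto simp: n_def)
        note mq = mu1[OF q(1) True] ar19[OF q(1) True]
        have ft: "fits (2 * p - 1 - ar s 19 (ar s 10 q))" "fits (160000016 * mu q)" "fits (n - q)" "fits (q + mu q)" "fits 160000016"
        proof -
          show "fits (160000016 * mu q)" using mq p p1 by (intro fits_mid) (auto simp: n_def)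
          show "fits 160000016" using sz_pos by (intro fits_mid) auto
        qed (use mq q p p1 True in \<open>auto intro!: fits_small simp: n_def\<close>)
        show ?thesis
        proof (cases "160000016 * mu q < n - q")
          case c: True
          \<comment> \<open>The class of 1 has at least \<open>p / 10000000\<close> members and
            never stops the loop, so all \<open>m\<close> units are part of the walk, as
            \<open>ready\<close> requires.\<close>
          have "q \<noteq> 0"
          proof
            assume "q = 0"
            then have "160000016 * m < n" using c mu0 by simp
            then show False using m p1 nn by (simp add: m_def n_def)
          qed
          then have "m \<le> q" using q(5) by simp
          then have "J q 0 (int (tk t) + 1)" using q(1-4,6) c by (simp add: J_def)
          then show ?thesis using True c fr q x mq ft
            by (intro wp_CondT) (simp_all add: wp_simps q_def[symmetric] add.commute)
        next
          case c: False
          have bq: "bnd (q + mu q)"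
          proof (cases "q + mu q = n")
            case ne: False
            have a: "val (ds ! nat (q + mu q - 1)) = val (ds ! nat q)"
              using block(2)[OF q(1) True q(3), of "q + mu q - 1"] mq(1) by simp
            have "val (ds ! nat (q + mu q)) \<noteq> val (ds ! nat q)"
            proof
              assume "val (ds ! nat (q + mu q)) = val (ds ! nat q)"
              then show False
                using block(3)[OF q(1) True q(3), of "q + mu q"] block(1)[OF q(1) True q(3)] ne mq(1) q(1) by linarith
            qed
            then show ?thesis using a by (simp add: bnd_def)
          qed (simp add: bnd_def)
          have hq: "Hyp (q + mu q)" unfolding Hyp_def
          proof (intro allI impI)
            fix k assume k: "0 < k \<and> k < q + mu q \<and> val (ds ! nat k) \<noteq> val (ds ! nat (k - 1))"
            show "\<exists>e. k < e \<and> e \<le> q + mu q \<and> (\<forall>j. k \<le> j \<and> j < e \<longrightarrow> val (ds ! nat j) = val (ds ! nat k)) \<and> p - 1 - k \<le> 160000016 * (e - k)"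
            proof (cases "k < q")
              case True
              then obtain e where "k < e" "e \<le> q" "\<forall>j. k \<le> j \<and> j < e \<longrightarrow> val (ds ! nat j) = val (ds ! nat k)" "p - 1 - k \<le> 160000016 * (e - k)"
                using q(4) k unfolding Hyp_def by blast
              moreover from this have "e \<le> q + mu q" using mq(1) by linarith
              ultimately show ?thesis by blast
            next
              case ge: False
              have "k = q"
              proof (rule ccontr)
                assume "k \<noteq> q"
                then show False using block(2)[OF q(1) True q(3), of k] block(2)[OF q(1) True q(3), of "k - 1"] k ge by auto
              qed
              moreover have "\<forall>j. q \<le> j \<and> j < q + mu q \<longrightarrow> val (ds ! nat j) = val (ds ! nat q)"
                using block(2)[OF q(1) True q(3)] by blast
              moreover have "q < q + mu q" "q + mu q \<le> q + mu q" "p - 1 - q \<le> 160000016 * (q + mu q - q)"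
                using c mq(1) by (simp_all add: n_def)
              ultimately show ?thesis by blast
            qed
          qed
          have "m \<le> q + mu q" using q(5) mu0 mq by auto
          then have "J (q + mu q) 1 (int (tk t) + 1)"
            using q(1,6) bq hq block(1)[OF q(1) True q(3)] mq(1) by (simp add: J_def)
          then show ?thesis using True c fr q x mq ft
            by (intro wp_CondT) (simp_all add: wp_simps q_def[symmetric] add.commute)
        qed
      qed
    next
      case (4 t)
      have fr: "vr t 11 = n" "vr t 10 = 2 * p - 1" "vr t 16 = m" "vr t 4 = p"
        "vr t 8 = vr s 8" "vr t 9 = vr s 9" "vr t 24 = vr s 24" "ar t = ar s"
        using frameD[OF 4(2)] d f0 by (auto simp: m_def)
      have "vr t 23 = 0" using 4 by (auto simp: J_def)
      then show ?case using rest[OF _ fr] 4(1) by simp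
    qed
    then show ?thesis unfolding REG1_def wp_simps(4) wp_simps(2) by simp
  qed
  then show ?thesis
    by (rule wp_conseq) (elim conjE, rule Q, assumption+)
qed

end

section \<open>Only small classes of equal residues\<close>

text \<open>
  If all classes are small, half of the residues are paired at distance \<open>m\<close> in sorted order, which
  yields differences of average size \<open>O(m)\<close>. Either one of these differences is frequent, and then
  it is scaled to 1 and serves together with the other half of the residues; or the differences
  are diverse, and then their own differences are combined with the class of 1.
\<close>

definition R2A :: com where
  "R2A = (SORT 10 11 5 4 ;; 22 ::= (V 11 .- V 16) .div N 2 ;; COPY 12 10 16 22 ;;
     25 ::= V 16 .+ V 22 ;; 26 ::= V 11 .- V 25 ;; 19 ::= V 16 ;; 20 ::= V 4 ;;
     PAIR 12 22 11 12 ;; CLASSORD 11 12 ;; 23 ::= N 160 .* V 16)"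

definition CASEA :: com where
  "CASEA = (COPY 13 10 25 26 ;; 14 ::= V 26 ;; 21 ::= B ModInv (A 5 (A 11 (N 0))) (V 4) ;;
     SCALE 13 14 21 ;; 27 ::= N 0 ;; COPY 14 11 27 23 ;; 13 ::= V 23 ;; SCALE 14 13 21 ;;
     8 ::= (V 8 .* V 21) .mod V 4 ;; 18 ::= V 23 ;; 19 ::= N 8 .* V 16)"

definition CASEB :: com where
  "CASEB = (27 ::= N 0 ;; COPY 14 10 27 16 ;; 13 ::= V 16 ;; 18 ::= V 16 ;;
     COPY 13 11 27 12 ;; 14 ::= V 12 ;; 19 ::= N 20 .* V 23)"

lemma mod_REG2 [simp]:
  "modv R2A = {8, 9, 12, 17, 19, 20, 22, 23, 25, 26, 30, 31, 33, 34, 35}"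
  "moda R2A = {5, 6, 7, 10, 11, 12, 16, 17, 18, 19}"
  "modv CASEA = {8, 13, 14, 18, 19, 21, 27, 30, 33}" "moda CASEA = {5, 13, 14}"
  "modv CASEB = {13, 14, 18, 19, 27, 30}" "moda CASEB = {13, 14}"
  by (auto simp: R2A_def CASEA_def CASEB_def)

text \<open>Layout of \<open>zs\<close>: first \<open>m\<close> units, then a half that has been
  paired into \<open>fl\<close>, and from position \<open>v 25\<close> on a rest that is still
  available. The forest keeps the units, the rest and \<open>fl\<close> as roots.\<close>

definition mid :: "int \<Rightarrow> (int \<Rightarrow> int) \<Rightarrow> int \<Rightarrow> int \<Rightarrow> int list \<Rightarrow> int list \<Rightarrow> (nat \<Rightarrow> int) \<Rightarrow> (nat \<Rightarrow> int \<Rightarrow> int) \<Rightarrow> bool" where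
  "mid p X LF m zs fl v a \<longleftrightarrow> zs = lst (a 10) (p - 1) \<and> distinct zs \<and>
    (\<forall>x\<in>set zs. 2 * p - 1 \<le> x \<and> x < 3 * p - 2 \<and> 0 < a 5 x \<and> a 5 x < p) \<and>
    (\<forall>v. int (cnt (a 5) zs v) \<le> m) \<and> (\<forall>i. 0 \<le> i \<and> i < m \<longrightarrow> a 5 (zs ! nat i) = 1) \<and>
    v 4 = p \<and> v 16 = m \<and> v 25 = m + (p - 1 - m) div 2 \<and> v 26 = p - 1 - v 25 \<and> v 23 = 160 * m \<and>
    fl = lst (a 11) (v 12) \<and> 0 \<le> v 12 \<and> v 12 \<le> p - 1 - m \<and> distinct fl \<and>
    (\<forall>x\<in>set fl. 3 * p - 2 \<le> x \<and> 0 < a 5 x \<and> a 5 x < p) \<and> v 9 = 3 * p - 2 + v 12 \<and> classord (a 5) fl \<and>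
    v 17 = int (cnt (a 5) fl (a 5 (fl ! 0))) \<and> sum_list (map (a 5) fl) \<le> m * p \<and> p - 2 - 5 * m \<le> 4 * v 12 \<and>
    forest p X LF (set zs - set (take (nat ((p - 1 - m) div 2)) (drop (nat m) zs)) \<union> set fl) p v a"

lemma sorted_first_ones:
  assumes "sorted (map f zs)" "\<And>x. x \<in> set zs \<Longrightarrow> (0::int) < f x" "i < cnt f zs 1"
  shows "f (zs ! i) = 1"
proof (rule ccontr)
  assume a: "f (zs ! i) \<noteq> 1"
  have il: "i < length zs" using assms(3) cnt_le[of f zs 1] by simp
  have "{j. j < length zs \<and> f (zs ! j) = 1} \<subseteq> {..<i}"
  proof
    fix j assume j: "j \<in> {j. j < length zs \<and> f (zs ! j) = 1}"
    show "j \<in> {..<i}"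
    proof (rule ccontr)
      assume "j \<notin> {..<i}"
      then have "f (zs ! i) \<le> f (zs ! j)" using sorted_nth_mono[OF assms(1), of i j] j il by simp
      moreover have "0 < f (zs ! i)" using assms(2) il by simp
      ultimately show False using a j by simp
    qed
  qed
  then have "cnt f zs 1 \<le> card {..<i}" unfolding cnt_card by (intro card_mono) auto
  then show False using assms(3) by simp
qed

context ram
begin

text \<open>No residue occurs more than \<open>m\<close> times, so differences at distance
  \<open>m\<close> are positive. Their total telescopes to at most \<open>m * p\<close>, so that
  they are of order \<open>m\<close> on average, since their number is a constant fraction of
  \<open>p\<close>.\<close>

lemma wp_R2A:
  assumes D: "dstate p X LF ds (vr s) (ar s)" and p: "prime p" "8 * p \<le> sz" and small: "10000000 * vr s 16 < p"
    and Q: "\<And>t zs fl. mid p X LF (vr s 16) zs fl (vr t) (ar t) \<Longrightarrow> 0 < vr s 16 \<Longrightarrow>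
      int (tk t) \<le> int (tk s) + 28 * p \<Longrightarrow> frame R2A s t \<Longrightarrow> Q t"
  shows "wp R2A Q s"
proof -
  define val where "val = ar s 5"
  define n where "n = p - 1"
  define m where "m = vr s 16"
  define h where "h = (n - m) div 2"
  have p1: "1 < p" using p prime_gt_1_int by blast
  have d: "ds = lst (ar s 10) n" "forest p X LF (set ds) p (vr s) (ar s)" "distinct ds" "vr s 11 = n" "vr s 9 = 3 * p - 2"
    "\<forall>x\<in>set ds. 2 * p - 1 \<le> x \<and> 0 < val x" "classord val ds" "m = int (cnt val ds 1)" "val (ds ! 0) = 1"
    using D unfolding dstate_def val_def n_def m_def by blast+
  have f0: "vr s 4 = p" "vr s 10 = 2 * p - 1" "set ds \<subseteq> {0..<3 * p - 2}" "\<And>x. x \<in> set ds \<Longrightarrow> 0 \<le> val x \<and> val x < p"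
    "0 \<le> vr s 8" "vr s 8 < p"
    using d(2,5) by (auto simp: forest_def val_def)
  have ln: "length ds = nat n" using d(1) by simp
  have nn: "0 < n" using p1 by (simp add: n_def)
  have ne: "ds \<noteq> []" using ln nn by auto
  have m0: "0 < m" using cnt_pos[of "ds ! 0" ds val] ne d(8,9) by simp
  have sm: "10000000 * m < p" using small by (simp add: m_def)
  have cm: "int (cnt val ds v) \<le> m" for v using classord_max[OF d(7) ne, of v] d(8,9) by simp
  define zs where "zs = sort_key val ds"
  have z: "mset zs = mset ds" "set zs = set ds" "distinct zs" "length zs = nat n" "sorted (map val zs)"
    using d(3) ln by (auto simp: zs_def)
  have cz: "int (cnt val zs v) \<le> m" for v using cm[of v] cnt_mset[OF z(1), of val v] by simp
  have zo: "val (zs ! nat i) = 1" if "0 \<le> i" "i < m" for i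
    by (rule sorted_first_ones[OF z(5)]) (use that d(6,8) z cnt_mset[OF z(1), of val 1] in auto)
  have hb: "0 \<le> h" "m + h \<le> n" "2 * h \<le> n - m" "n - m - 1 \<le> 2 * h" "2 * m \<le> h" using sm m0 by (auto simp: h_def n_def)
  define xs where "xs = take (nat h) (drop (nat m) zs)"
  have x: "set xs \<subseteq> set zs" "distinct xs" "length xs = nat h" "sorted (map val xs)"
  proof -
    show "set xs \<subseteq> set zs" unfolding xs_def by (meson set_drop_subset set_take_subset subset_trans)
    show "distinct xs" using z(3) by (simp add: xs_def)
    show "length xs = nat h" using z(4) hb m0 by (simp add: xs_def)
    show "sorted (map val xs)" unfolding xs_def take_map[symmetric] drop_map[symmetric]
      using z(5) by (intro sorted_wrt_take sorted_wrt_drop)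
  qed
  have cx: "cnt val xs v \<le> nat m" for v
    using cnt_take[of val "nat h" "drop (nat m) zs" v] cnt_drop[of val "nat m" zs v] cz[of v] by (simp add: xs_def)
  have zr: "2 * p - 1 \<le> x \<and> x < 3 * p - 2 \<and> 0 < val x \<and> val x < p" if "x \<in> set zs" for x
    using that z(2) d(6) f0(3,4) by fastforce
  define ps where "ps = pairs val xs (nat m) p"
  have diff: "1 \<le> val (xs ! (i + nat m)) - val (xs ! i)" "val (xs ! (i + nat m)) - val (xs ! i) < p" if "i + nat m < length xs" for i
  proof -
    show "1 \<le> val (xs ! (i + nat m)) - val (xs ! i)"
      using shift_diff_ge[OF x(4) cx, of 1 "nat m" i] that by simp
    have "xs ! (i + nat m) \<in> set zs" "xs ! i \<in> set zs" using that x(1) by (meson add_lessD1 nth_mem subsetD)+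
    then show "val (xs ! (i + nat m)) - val (xs ! i) < p"
      using zr[of "xs ! (i + nat m)"] zr[of "xs ! i"] by linarith
  qed
  have pb: "i + nat m < length xs" if "i \<in> set ps" for i using pairs_bound that ps_def by blast
  \<comment> \<open>The bound \<open>p\<close> rejects no pair, so there are at least
    \<open>h / 2 - m\<close> of them. With \<open>p - 2 - m \<le> 2 * h\<close> this becomes the
    bound \<open>p - 2 - 5 * m \<le> 4 * v 12\<close> in \<open>mid\<close>.\<close>
  have lps: "h - 2 * m \<le> 2 * int (length ps)" "int (length ps) \<le> h"
  proof -
    have "{i. i < length xs - nat m \<and> p < val (xs ! (i + nat m)) - val (xs ! i)} = {}"
    proof (rule equals0I)
      fix i assume "i \<in> {i. i < length xs - nat m \<and> p < val (xs ! (i + nat m)) - val (xs ! i)}"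
      then have "i + nat m < length xs" "p < val (xs ! (i + nat m)) - val (xs ! i)" by auto
      then show False using diff(2)[of i] by linarith
    qed
    then have "0 = card {i. i < length xs - nat m \<and> p < val (xs ! (i + nat m)) - val (xs ! i)}"
      by (simp only: card.empty)
    from pairs_length_ge[OF _ this] show "h - 2 * m \<le> 2 * int (length ps)"
      using m0 x(3) hb by (simp add: ps_def)
    have "length ps \<le> length [0..<length xs - nat m]" unfolding ps_def pairs_def by (rule length_filter_le)
    then show "int (length ps) \<le> h" using x(3) hb by simp
  qed
  \<comment> \<open>This total is the hypothesis under which
    \<open>pairs_sum_small_differences\<close> can afford the small bound
    \<open>m + 1\<close>.\<close>
  have ssum: "pairs_sum val xs (nat m) p \<le> m * p"
  proof -
    have "0 \<le> val x \<and> val x \<le> p" if "x \<in> set xs" for x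
    proof -
      have "x \<in> set zs" using that x(1) by blast
      then show ?thesis using zr by fastforce
    qed
    then show ?thesis using pairs_sum_le[OF x(4), of p "nat m" p] p1 m0 by simp
  qed
  let ?P = "\<lambda>t. (\<exists>zs fl. mid p X LF m zs fl (vr t) (ar t)) \<and> int (tk t) \<le> int (tk s) + 28 * p"
  have "wp R2A ?P s" unfolding R2A_def wp_simps(4)
  proof (rule wp_SORT[where xs = ds])
    fix s1 assume s1: "lst (ar s1 10) (vr s 11) = sort_key (ar s 5) ds"
      "int (tk s1) = int (tk s) + 2 * (vr s 11 + vr s 4)" "frame (SORT 10 11 5 4) s s1"
    have g1: "vr s1 11 = n" "vr s1 16 = m" "vr s1 4 = p" "vr s1 8 = vr s 8" "vr s1 9 = 3 * p - 2" "vr s1 10 = 2 * p - 1" "vr s1 24 = vr s 24"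
      "ar s1 5 = val" "ar s1 6 = ar s 6" "ar s1 7 = ar s 7" "lst (ar s1 10) n = zs"
      using frameD[OF s1(3)] s1(1) d f0 by (auto simp: m_def val_def zs_def)
    let ?s1 = "s1\<lparr>vr := (vr s1)(22 := h)\<rparr>"
    have "wp (COPY 12 10 16 22) (wp (25 ::= V 16 .+ V 22) (wp (26 ::= V 11 .- V 25) (wp (19 ::= V 16) (wp (20 ::= V 4)
     (wp (PAIR 12 22 11 12) (wp (CLASSORD 11 12) (wp (23 ::= N 160 .* V 16) ?P))))))) ?s1"
    proof (rule wp_COPY)
      fix s2 assume s2: "\<forall>i. 0 \<le> i \<and> i < vr ?s1 22 \<longrightarrow> ar s2 12 i = ar ?s1 10 (vr ?s1 16 + i)"
        "int (tk s2) = int (tk ?s1) + vr ?s1 22" "frame (COPY 12 10 16 22) ?s1 s2"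
      have g2: "vr s2 11 = n" "vr s2 16 = m" "vr s2 4 = p" "vr s2 8 = vr s 8" "vr s2 9 = 3 * p - 2" "vr s2 10 = 2 * p - 1" "vr s2 24 = vr s 24"
        "vr s2 22 = h" "ar s2 5 = val" "ar s2 6 = ar s 6" "ar s2 7 = ar s 7" "ar s2 10 = ar s1 10"
        "\<forall>i. 0 \<le> i \<and> i < h \<longrightarrow> ar s2 12 i = ar s1 10 (m + i)"
        using frameD[OF s2(3)] s2(1) g1 by auto
      have l12: "lst (ar s2 12) h = xs"
        using lst_copy[OF g2(13), of n] hb m0 g1(11) by (simp add: xs_def)
      let ?s3 = "s2\<lparr>vr := (vr s2)(25 := m + h, 26 := n - (m + h), 19 := m, 20 := p)\<rparr>"
      have F3: "forest p X LF (set zs) p (vr ?s3) (ar ?s3)"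
        by (rule forest_cong[OF d(2)]) (use g2 f0 d z in \<open>auto simp: val_def\<close>)
      have "wp (PAIR 12 22 11 12) (wp (CLASSORD 11 12) (wp (23 ::= N 160 .* V 16) ?P)) ?s3"
      proof (rule wp_PAIR[where xs = xs and ps = ps and \<sigma> = "nat m"])
        show "\<forall>x\<in>set xs. 0 \<le> x \<and> x < vr ?s3 9 \<and> 0 \<le> ar ?s3 5 x \<and> ar ?s3 5 x < vr ?s3 4"
        proof
          fix y assume "y \<in> set xs"
          then have "y \<in> set zs" using x(1) by blast
          then show "0 \<le> y \<and> y < vr ?s3 9 \<and> 0 \<le> ar ?s3 5 y \<and> ar ?s3 5 y < vr ?s3 4"
            using zr[of y] g2 p1 by simp
        qed
        fix s4 assume s4: "vr s4 9 = vr ?s3 9 + int (length ps)" "vr s4 12 = int (length ps)"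
          "\<forall>i<length ps. ar s4 11 (int i) = vr ?s3 9 + int i \<and> ar s4 6 (vr ?s3 9 + int i) = xs ! (ps ! i) \<and>
             ar s4 7 (vr ?s3 9 + int i) = xs ! (ps ! i + nat m) \<and>
             ar s4 5 (vr ?s3 9 + int i) = ar ?s3 5 (xs ! (ps ! i + nat m)) - ar ?s3 5 (xs ! (ps ! i))"
          "\<forall>x<vr ?s3 9. ar s4 5 x = ar ?s3 5 x \<and> ar s4 6 x = ar ?s3 6 x \<and> ar s4 7 x = ar ?s3 7 x"
          "[vr s4 8 = vr ?s3 8 + sum_list (map (\<lambda>i. ar ?s3 5 (xs ! i)) ps)] (mod vr ?s3 4)"
          "0 \<le> vr s4 8" "vr s4 8 < vr ?s3 4" "int (tk s4) \<le> int (tk ?s3) + vr ?s3 22" "frame (PAIR 12 22 11 12) ?s3 s4"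
        define k where "k = int (length ps)"
        define n9 where "n9 = 3 * p - 2"
        have g4: "vr s4 4 = p" "vr s4 10 = 2 * p - 1" "vr s4 24 = vr s 24" "vr s4 16 = m" "vr s4 25 = m + h" "vr s4 26 = n - (m + h)"
          "vr s4 9 = n9 + k" "vr s4 12 = k" "ar s4 10 = ar s1 10"
          using frameD[OF s4(9)] g2 s4(1,2) by (auto simp: k_def n9_def)
        have k: "h - 2 * m \<le> 2 * k" "k \<le> h" "1 \<le> k" using lps sm hb m0 by (auto simp: k_def n_def)
        have h4: "ar s4 11 i = n9 + i" "ar s4 5 (n9 + i) = val (xs ! (ps ! nat i + nat m)) - val (xs ! (ps ! nat i))"
          "ps ! nat i \<in> set ps"
          if "0 \<le> i" "i < k" for i
          using s4(3)[rule_format, of "nat i"] that g2 by (auto simp: k_def n9_def)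
        have h5: "0 < ar s4 5 (n9 + i) \<and> ar s4 5 (n9 + i) < p" if "0 \<le> i" "i < k" for i
          using h4(2)[OF that] diff[OF pb[OF h4(3)[OF that]]] by linarith
        define fs where "fs = lst (ar s4 11) k"
        have sfs: "set fs = {n9..<n9 + k}"
        proof -
          have "(ar s4 11) ` {0..<k} = (\<lambda>x. n9 + x) ` {0..<k}" using h4(1) by (intro image_cong) auto
          then show ?thesis unfolding fs_def set_lst by (simp add: add.commute)
        qed
        have dfs: "distinct fs" unfolding fs_def distinct_lst using h4(1) by (auto simp: inj_on_def)
        have fr: "n9 \<le> x \<and> x < n9 + k \<and> 0 < ar s4 5 x \<and> ar s4 5 x < p" if "x \<in> set fs" for x
          using h5[of "x - n9"] that sfs by auto
        have sumf: "sum_list (map (ar s4 5) fs) \<le> m * p"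
        proof -
          have "sum_list (map (ar s4 5) fs) = (\<Sum>i\<in>{0..<nat k}. ar s4 5 (ar s4 11 (int i)))"
            unfolding fs_def lst_def map_map comp_def by (simp add: sum_list_distinct_conv_sum_set)
          also have "\<dots> = (\<Sum>i\<in>{0..<length ps}. (\<lambda>i. val (xs ! (i + nat m)) - val (xs ! i)) (ps ! i))"
            using h4(1,2) by (intro sum.cong) (auto simp: k_def)
          also have "\<dots> = pairs_sum val xs (nat m) p"
            unfolding pairs_sum_def ps_def[symmetric] sum_list_sum_nth by simp
          finally show ?thesis using ssum by simp
        qed
        define R where "R = set zs - set xs \<union> set fs"
        have "forest p X LF (set zs - set xs \<union> {vr ?s3 9..<vr ?s3 9 + int (length ps)}) (p + 0 * int (length ps)) (vr s4) (ar s4)"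
        proof (rule forest_pairs[OF F3])
          show "ps = pairs (ar ?s3 5) xs (nat m) p" using g2 by (simp add: ps_def)
          show "(\<forall>x\<in>set xs. x < vr ?s3 10) \<and> (0::int) = 1 \<or> (\<forall>x\<in>set xs. vr ?s3 10 \<le> x) \<and> (0::int) = 0"
            using x(1) zr g2 by auto
        qed (use x z g2 g4 s4 in auto)
        then have F4: "forest p X LF R p (vr s4) (ar s4)" using g2 sfs by (simp add: R_def k_def n9_def)
        show "wp (CLASSORD 11 12) (wp (23 ::= N 160 .* V 16) ?P) s4"
        proof (rule wp_CLASSORD[where xs = fs])
          show "\<forall>x\<in>set fs. 0 \<le> x \<and> x < sz \<and> 0 \<le> ar s4 5 x \<and> ar s4 5 x < vr s4 4"
          proof
            fix y assume "y \<in> set fs"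
            then show "0 \<le> y \<and> y < sz \<and> 0 \<le> ar s4 5 y \<and> ar s4 5 y < vr s4 4"
              using fr[of y] g4(1) k hb m0 p(2) p1 by (auto simp: n9_def n_def)
          qed
          fix s5 fl assume s5: "fl = lst (ar s5 11) (vr s4 12)" "mset fl = mset fs" "classord (ar s4 5) fl"
            "vr s5 17 = int (cnt (ar s4 5) fs (ar s4 5 (fl ! 0)))" "int (tk s5) \<le> int (tk s4) + 11 * vr s4 10"
            "frame (CLASSORD 11 12) s4 s5"
          have sfl: "set fl = set fs" "distinct fl" using s5(2) dfs mset_eq_imp_distinct_iff[OF s5(2)] by (auto dest: mset_eq_setD)
          have g5: "vr s5 4 = p" "vr s5 10 = 2 * p - 1" "vr s5 24 = vr s 24" "vr s5 16 = m" "vr s5 25 = m + h" "vr s5 26 = n - (m + h)"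
            "vr s5 9 = n9 + k" "vr s5 12 = k" "ar s5 10 = ar s1 10" "ar s5 5 = ar s4 5" "ar s5 6 = ar s4 6" "ar s5 7 = ar s4 7" "vr s5 8 = vr s4 8"
            using frameD[OF s5(6)] g4 by auto
          let ?v = "(vr s5)(23 := 160 * m)"
          have v5: "ar s5 5 y = val y" if "y \<in> set zs" for y
            using s4(4) zr[OF that] g2 g5 by simp
          have "forest p X LF R p ?v (ar s5)"
            by (rule forest_cong[OF F4]) (use g5 g4 in auto)
          moreover have "R = set zs - set (take (nat ((p - 1 - m) div 2)) (drop (nat m) zs)) \<union> set fl"
            using sfl(1) by (simp add: R_def xs_def h_def n_def)
          moreover have "cnt (ar s5 5) zs v = cnt val zs v" for v
            unfolding cnt_def using v5 by (intro arg_cong[where f = length] filter_cong) auto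
          moreover have "ar s5 5 (zs ! nat i) = 1" if "0 \<le> i" "i < m" for i
          proof -
            have "zs ! nat i \<in> set zs" using that hb z(4) by (intro nth_mem) auto
            then show ?thesis using zo[OF that] v5 by simp
          qed
          moreover have "sum_list (map (ar s5 5) fl) = sum_list (map (ar s4 5) fs)"
            unfolding g5(10) using s5(2) by (metis mset_map sum_mset_sum_list)
          moreover have "vr s5 17 = int (cnt (ar s5 5) fl (ar s5 5 (fl ! 0)))"
            using s5(4) cnt_mset[OF s5(2)] g5(10) by simp
          ultimately have "mid p X LF m zs fl ?v (ar s5)"
            unfolding mid_def using z(3) zr cz v5 sumf g5 g1(11) s5(1,3) g4(8) sfl fr k hb(4) hb(1,2) m0
            by (auto simp: n_def n9_def h_def)
          moreover have "int (tk s5) \<le> int (tk s) + 28 * p"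
            using s5(5) g4(2) s4(8) g2(8) s2(2) s1(2) hb m0 d(4) f0(1) p1 by (simp add: n_def)
          moreover have "fits (160 * m)" "fits 160" using sm m0 p p1 by (auto intro!: fits_small)
          ultimately show "wp (23 ::= N 160 .* V 16) ?P s5"
            using g5 by (subst wp_simps(2)) auto
        qed (use g4 k hb m0 p p1 dfs fs_def in \<open>auto simp: n_def\<close>)
      qed (use g2 l12 hb m0 p p1 f0 ps_def in \<open>auto simp: n_def\<close>)
      moreover have "fits (m + h)" "fits (n - (m + h))" using hb m0 p p1 by (auto intro!: fits_small simp: n_def)
      ultimately show "wp (25 ::= V 16 .+ V 22) (wp (26 ::= V 11 .- V 25) (wp (19 ::= V 16) (wp (20 ::= V 4)
       (wp (PAIR 12 22 11 12) (wp (CLASSORD 11 12) (wp (23 ::= N 160 .* V 16) ?P)))))) s2"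
        using g2 unfolding wp_simps(2) by simp
    qed (use g1 hb m0 p p1 in \<open>auto simp: n_def\<close>)
    moreover have "fits (n - m)" "fits h" using hb m0 p p1 by (auto intro!: fits_small simp: n_def)
    ultimately show "wp (22 ::= (V 11 .- V 16) .div N 2) (wp (COPY 12 10 16 22) (wp (25 ::= V 16 .+ V 22) (wp (26 ::= V 11 .- V 25) (wp (19 ::= V 16) (wp (20 ::= V 4)
     (wp (PAIR 12 22 11 12) (wp (CLASSORD 11 12) (wp (23 ::= N 160 .* V 16) ?P)))))))) s1"
      using g1 by (subst wp_simps(2)) (simp add: h_def)
  next
    show "\<forall>x\<in>set ds. 0 \<le> x \<and> x < sz \<and> 0 \<le> ar s 5 x \<and> ar s 5 x < vr s 4"
    proof
      fix y assume "y \<in> set ds"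
      then show "0 \<le> y \<and> y < sz \<and> 0 \<le> ar s 5 y \<and> ar s 5 y < vr s 4"
        using zr[of y] z(2) f0(1) p(2) p1 by (simp add: val_def)
    qed
  qed (use d f0 p p1 in \<open>auto simp: n_def\<close>)
  then show ?thesis
    by (rule wp_conseq) (unfold m_def, elim exE conjE, rule Q, assumption, use m0 m_def in simp, assumption+)
qed

text \<open>The walk consists of the \<open>m\<close> units alone, so its step never changes. No
  difference occurs \<open>160 * m\<close> times, and the differences of the differences have a
  total of at least \<open>p - 1\<close>, enough for any deficit.\<close>

lemma wp_CASEB:
  assumes M: "mid p X LF m zs fl (vr s) (ar s)" and p: "prime p" "8 * p \<le> sz" "10000000 * m < p" "0 < m"
    and lt: "vr s 17 < vr s 23"
    and Q: "\<And>t. ready p X 160000016 (vr t) (ar t) \<Longrightarrow> vr t 19 \<le> 10 * sz \<Longrightarrow>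
      int (tk t) \<le> int (tk s) + 2 * p \<Longrightarrow> frame CASEB s t \<Longrightarrow> Q t"
  shows "wp CASEB Q s"
proof -
  define val where "val = ar s 5"
  define nf where "nf = vr s 12"
  define R where "R = set zs - set (take (nat ((p - 1 - m) div 2)) (drop (nat m) zs)) \<union> set fl"
  have d: "zs = lst (ar s 10) (p - 1)" "distinct zs" "\<forall>x\<in>set zs. 2 * p - 1 \<le> x \<and> x < 3 * p - 2 \<and> 0 < val x \<and> val x < p"
    "\<forall>i. 0 \<le> i \<and> i < m \<longrightarrow> val (zs ! nat i) = 1" "vr s 4 = p" "vr s 16 = m" "vr s 23 = 160 * m"
    "fl = lst (ar s 11) nf" "0 \<le> nf" "nf \<le> p - 1 - m" "distinct fl"
    "\<forall>x\<in>set fl. 3 * p - 2 \<le> x \<and> 0 < val x \<and> val x < p" "vr s 9 = 3 * p - 2 + nf" "classord val fl"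
    "vr s 17 = int (cnt val fl (val (fl ! 0)))" "sum_list (map val fl) \<le> m * p" "p - 2 - 5 * m \<le> 4 * nf"
    "forest p X LF R p (vr s) (ar s)"
    using M unfolding mid_def val_def nf_def R_def by blast+
  have p1: "1 < p" using p prime_gt_1_int by blast
  have mp: "m \<le> p - 1" using p by simp
  have lz: "length zs = nat (p - 1)" "length fl = nat nf" using d(1,8) by auto
  have tk0: "set (take (nat m) zs) \<subseteq> R"
  proof
    fix y assume y: "y \<in> set (take (nat m) zs)"
    have "set (take (nat m) zs) \<inter> set (drop (nat m) zs) = {}" using d(2) by (simp add: set_take_disj_set_drop_if_distinct)
    then have "y \<notin> set (take (nat ((p - 1 - m) div 2)) (drop (nat m) zs))" using y by (meson disjoint_iff in_set_takeD)
    then show "y \<in> R" using y by (auto simp: R_def dest!: in_set_takeD)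
  qed
  let ?P = "\<lambda>t. ready p X 160000016 (vr t) (ar t) \<and> vr t 19 \<le> 10 * sz \<and> int (tk t) \<le> int (tk s) + 2 * p"
  have "wp CASEB ?P s"
  proof -
    let ?s = "s\<lparr>vr := (vr s)(27 := 0)\<rparr>"
    have "wp (COPY 14 10 27 16) (wp (13 ::= V 16) (wp (18 ::= V 16) (wp (COPY 13 11 27 12) (wp (14 ::= V 12) (wp (19 ::= N 20 .* V 23) ?P))))) ?s"
    proof (rule wp_COPY)
      fix s1 assume s1: "\<forall>i. 0 \<le> i \<and> i < vr ?s 16 \<longrightarrow> ar s1 14 i = ar ?s 10 (vr ?s 27 + i)"
        "int (tk s1) = int (tk ?s) + vr ?s 16" "frame (COPY 14 10 27 16) ?s s1"
      have g1: "vr s1 16 = m" "vr s1 27 = 0" "vr s1 12 = nf" "vr s1 23 = 160 * m" "ar s1 11 = ar s 11"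
        "\<forall>i. 0 \<le> i \<and> i < m \<longrightarrow> ar s1 14 i = ar s 10 (0 + i)"
        "vr s1 4 = vr s 4" "vr s1 8 = vr s 8" "vr s1 9 = vr s 9" "vr s1 10 = vr s 10" "vr s1 24 = vr s 24"
        "ar s1 5 = val" "ar s1 6 = ar s 6" "ar s1 7 = ar s 7"
        using frameD[OF s1(3)] s1(1) d by (auto simp: nf_def val_def)
      let ?s1 = "s1\<lparr>vr := (vr s1)(13 := m, 18 := m)\<rparr>"
      have "wp (COPY 13 11 27 12) (wp (14 ::= V 12) (wp (19 ::= N 20 .* V 23) ?P)) ?s1"
      proof (rule wp_COPY)
        fix s2 assume s2: "\<forall>i. 0 \<le> i \<and> i < vr ?s1 12 \<longrightarrow> ar s2 13 i = ar ?s1 11 (vr ?s1 27 + i)"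
          "int (tk s2) = int (tk ?s1) + vr ?s1 12" "frame (COPY 13 11 27 12) ?s1 s2"
        have g2: "vr s2 12 = nf" "vr s2 13 = m" "vr s2 18 = m" "vr s2 23 = 160 * m"
          "\<forall>i. 0 \<le> i \<and> i < m \<longrightarrow> ar s2 14 i = ar s 10 (0 + i)" "\<forall>i. 0 \<le> i \<and> i < nf \<longrightarrow> ar s2 13 i = ar s 11 (0 + i)"
          "vr s2 4 = vr s 4" "vr s2 8 = vr s 8" "vr s2 9 = vr s 9" "vr s2 10 = vr s 10" "vr s2 24 = vr s 24"
          "ar s2 5 = val" "ar s2 6 = ar s 6" "ar s2 7 = ar s 7"
          using frameD[OF s2(3)] s2(1) g1 by auto
        have lQ: "lst (ar s2 14) m = take (nat m) zs" using lst_copy[OF g2(5), of "p - 1"] p mp d(1) by simp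
        have lT: "lst (ar s2 13) nf = fl" using lst_copy[OF g2(6), of nf] d(8,9) by simp
        let ?v = "(vr s2)(14 := nf, 19 := 20 * (160 * m))"
        have F: "forest p X LF R p ?v (ar s2)"
          by (rule forest_cong[OF d(18)]) (use g2 in \<open>auto simp: val_def\<close>)
        have one: "val (ar s2 14 i) = 1" if "0 \<le> i" "i < m" for i
        proof -
          have "ar s2 14 i = zs ! nat i" using g2(5) that mp lz d(1) by simp
          then show ?thesis using d(4) that by simp
        qed
        have ne: "fl \<noteq> []" using lz(2) d(17) p by auto
        have E: "p - 1 \<le> pairs_sum val (sort_key val fl) (nat (20 * (160 * m))) (m + 1)"
        proof (rule pairs_sum_small_differences)
          show "sorted (map val (sort_key val fl))" by simp
          show "int (cnt val (sort_key val fl) v) \<le> 160 * m" for v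
            using classord_max[OF d(14) ne, of v] cnt_mset[of "sort_key val fl" fl val v] d(15,7) lt by simp
          show "sum_list (map val (sort_key val fl)) \<le> m * p"
          proof -
            have "sum_list (map val (sort_key val fl)) = sum_list (map val fl)"
              by (metis mset_map mset_sort sum_mset_sum_list)
            then show ?thesis using d(16) by simp
          qed
        qed (use d(12,17) lz p d(9) in auto)
        have "ready p X 160000016 ?v (ar s2)" unfolding ready_def
        proof (intro exI[of _ LF] exI[of _ R] exI[of _ "nat (20 * (160 * m))"] conjI)
          show "max 0 (p - 1 - ?v 13) \<le> pairs_sum (ar s2 5) (sort_key (ar s2 5) (lst (ar s2 13) (?v 14))) (nat (20 * (160 * m))) (?v 18 + 1)"
            using E lT g2 p by simp
          show "distinct (lst (ar s2 14) (?v 13) @ lst (ar s2 13) (?v 14))"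
          proof -
            have "y \<notin> set fl" if "y \<in> set (take (nat m) zs)" for y using d(3,12) that by (fastforce dest!: in_set_takeD)
            then show ?thesis using lQ lT d(2,11) g2 by auto
          qed
          show "set (lst (ar s2 14) (?v 13)) \<subseteq> R" using lQ tk0 g2 by simp
          show "set (lst (ar s2 13) (?v 14)) \<subseteq> R" using lT g2 by (simp add: R_def)
          show "\<forall>x\<in>R. 2 * p - 1 \<le> x" using d(3,12) p1 unfolding R_def by fastforce
          show "\<forall>x\<in>set (lst (ar s2 14) (?v 13)). 0 < ar s2 5 x" using lQ g2 d(3) by (auto dest!: in_set_takeD)
        qed (use F g2 one d(9,10) p mp in auto)
        moreover have "int (tk s2) \<le> int (tk s) + 2 * p" using s2(2) s1(2) g1 d(6,10) p by simp
        moreover have "20 * (160 * m) \<le> 10 * sz" "fits (20 * (160 * m))" "fits 20" using p p1 by (auto intro!: fits_small)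
        ultimately show "wp (14 ::= V 12) (wp (19 ::= N 20 .* V 23) ?P) s2"
          using g2 unfolding wp_simps(2) by simp
      qed (use g1 d(9,10) p in auto)
      then show "wp (13 ::= V 16) (wp (18 ::= V 16) (wp (COPY 13 11 27 12) (wp (14 ::= V 12) (wp (19 ::= N 20 .* V 23) ?P)))) s1"
        using g1 unfolding wp_simps(2) by simp
    qed (use d p mp in auto)
    then show ?thesis unfolding CASEB_def wp_simps(4) by (subst wp_simps(2)) simp
  qed
  then show ?thesis
    by (rule wp_conseq) (elim conjE, rule Q, assumption+)
qed

text \<open>Some difference occurs at least \<open>160 * m\<close> times. Division by it yields
  \<open>160 * m\<close> units, so the untouched rest of the residues may be paired with differences
  up to \<open>160 * m + 1\<close>; their classes keep their size of at most \<open>m\<close> under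
  the division.\<close>

lemma wp_CASEA:
  assumes M: "mid p X LF m zs fl (vr s) (ar s)" and p: "prime p" "8 * p \<le> sz" "10000000 * m < p" "0 < m"
    and ge: "vr s 23 \<le> vr s 17"
    and Q: "\<And>t. ready p X 160000016 (vr t) (ar t) \<Longrightarrow> vr t 19 \<le> 10 * sz \<Longrightarrow>
      int (tk t) \<le> int (tk s) + 4 * p \<Longrightarrow> frame CASEA s t \<Longrightarrow> Q t"
  shows "wp CASEA Q s"
proof -
  define val where "val = ar s 5"
  define nf where "nf = vr s 12"
  define h where "h = (p - 1 - m) div 2"
  define R where "R = set zs - set (take (nat h) (drop (nat m) zs)) \<union> set fl"
  define f where "f = 160 * m"
  define nt where "nt = p - 1 - (m + h)"
  have d: "zs = lst (ar s 10) (p - 1)" "distinct zs" "\<forall>x\<in>set zs. 2 * p - 1 \<le> x \<and> x < 3 * p - 2 \<and> 0 < val x \<and> val x < p"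
    "\<forall>v. int (cnt val zs v) \<le> m" "vr s 4 = p" "vr s 16 = m" "vr s 23 = f" "vr s 25 = m + h" "vr s 26 = p - 1 - vr s 25"
    "fl = lst (ar s 11) nf" "0 \<le> nf" "nf \<le> p - 1 - m" "distinct fl"
    "\<forall>x\<in>set fl. 3 * p - 2 \<le> x \<and> 0 < val x \<and> val x < p" "vr s 9 = 3 * p - 2 + nf" "classord val fl"
    "vr s 17 = int (cnt val fl (val (fl ! 0)))" "forest p X LF R p (vr s) (ar s)"
    using M unfolding mid_def val_def nf_def R_def h_def f_def by blast+
  have p1: "1 < p" using p prime_gt_1_int by blast
  have v26: "vr s 26 = nt" using d(8,9) by (simp add: nt_def)
  have hb: "0 \<le> h" "m + h \<le> p - 1" "0 \<le> nt" "nt \<le> p" "p - 1 - m \<le> 2 * nt" "0 < f" "f \<le> p" using p by (auto simp: h_def nt_def f_def)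
  have lz: "length zs = nat (p - 1)" "length fl = nat nf" using d(1,10) by auto
  have f8: "0 \<le> vr s 8" "vr s 8 < p" "R \<subseteq> {0..<3 * p - 2 + nf}" using d(15,18) by (auto simp: forest_def)
  have fc: "f \<le> int (cnt val fl (val (fl ! 0)))" using ge d(7,17) by simp
  have fnf: "f \<le> nf" using fc cnt_le[of val fl "val (fl ! 0)"] lz(2) d(11) by simp
  have nf0: "0 < nf" using fnf hb by simp
  have ne: "fl \<noteq> []" using lz(2) nf0 by auto
  define ts where "ts = drop (nat (m + h)) zs"
  define qs where "qs = take (nat f) fl"
  have lt: "length ts = nat nt" "length qs = nat f" using lz hb fnf p by (auto simp: ts_def qs_def nt_def nat_diff_distrib)
  have ti: "x \<in> set zs" if "x \<in> set ts" for x using that unfolding ts_def by (rule in_set_dropD)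
  have qi: "x \<in> set fl" if "x \<in> set qs" for x using that unfolding qs_def by (rule in_set_takeD)
  have dt: "distinct ts" "distinct qs" using d(2,13) by (auto simp: ts_def qs_def)
  have dj: "set ts \<inter> set qs = {}" using ti qi d(3,14) by fastforce
  have qv: "val x = val (fl ! 0)" if xq: "x \<in> set qs" for x
  proof -
    obtain i where i: "i < length qs" "x = qs ! i" using xq by (auto simp: in_set_conv_nth)
    then have "i < cnt val fl (val (fl ! 0))" "x = fl ! i" using lt(2) fc by (auto simp: qs_def)
    moreover have "{j. j < length fl \<and> val (fl ! j) = val (fl ! 0)} = {0..<0 + cnt val fl (val (fl ! 0))}"
      using classord_block[OF d(16), of 0] ne by auto
    ultimately show ?thesis by (metis (mono_tags, lifting) add_0 atLeastLessThan_iff le0 mem_Collect_eq)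
  qed
  have tsR: "set ts \<subseteq> R"
  proof
    fix y assume y: "y \<in> set ts"
    have e: "take (nat (m + h)) zs = take (nat m) zs @ take (nat h) (drop (nat m) zs)"
      using p hb by (simp add: take_add nat_add_distrib)
    have "set (take (nat (m + h)) zs) \<inter> set ts = {}" using d(2) by (simp add: ts_def set_take_disj_set_drop_if_distinct)
    then have "y \<notin> set (take (nat h) (drop (nat m) zs))" using y unfolding e by auto
    then show "y \<in> R" using ti[OF y] by (auto simp: R_def)
  qed
  have qsR: "set qs \<subseteq> R" using qi by (auto simp: R_def)
  define x0 where "x0 = val (fl ! 0)"
  have f0: "fl ! 0 \<in> set fl" using ne by simp
  have x0: "0 < x0" "x0 < p" using d(14) f0 by (auto simp: x0_def)
  have co: "coprime x0 p" using prime_coprime_less[OF p(1) x0] .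
  define c where "c = modular_inverse p x0"
  have c: "coprime c p" "0 \<le> c" "c < p" "x0 * c mod p = 1"
    using co p1 cong_modular_inverse1[OF co] modular_inverse_int_nonneg[of p x0] modular_inverse_int_less[of p x0]
    by (auto simp: c_def cong_def)
  have idr: "0 \<le> x" "x < sz" "0 < val x" "val x < p" if "x \<in> set ts \<union> set qs" for x
  proof -
    have "x \<in> R" using that tsR qsR by blast
    then show "0 \<le> x" "x < sz" using f8(3) d(12) p p1 by auto
    show "0 < val x" "val x < p" using that ti[of x] qi[of x] d(3,14) by auto
  qed
  \<comment> \<open>The two lists are scaled in place one after the other. They are disjoint, so
    every value is multiplied by \<open>c\<close> exactly once.\<close>
  define val1 where "val1 = (\<lambda>x. if x \<in> set ts then val x * c mod p else val x)"
  define val2 where "val2 = (\<lambda>x. if x \<in> set qs then val1 x * c mod p else val1 x)"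
  have v2: "val2 x = val x * c mod p" if "x \<in> set ts \<union> set qs" for x
    using that dj by (auto simp: val2_def val1_def)
  let ?P = "\<lambda>t. ready p X 160000016 (vr t) (ar t) \<and> vr t 19 \<le> 10 * sz \<and> int (tk t) \<le> int (tk s) + 4 * p"
  have "wp CASEA ?P s" unfolding CASEA_def wp_simps(4)
  proof (rule wp_COPY)
    fix s1 assume s1: "\<forall>i. 0 \<le> i \<and> i < vr s 26 \<longrightarrow> ar s1 13 i = ar s 10 (vr s 25 + i)"
      "int (tk s1) = int (tk s) + vr s 26" "frame (COPY 13 10 25 26) s s1"
    have g1: "vr s1 4 = p" "vr s1 8 = vr s 8" "vr s1 9 = vr s 9" "vr s1 10 = vr s 10" "vr s1 24 = vr s 24" "vr s1 16 = m" "vr s1 23 = f"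
      "vr s1 26 = nt" "ar s1 5 = val" "ar s1 6 = ar s 6" "ar s1 7 = ar s 7" "ar s1 11 = ar s 11"
      "\<forall>i. 0 \<le> i \<and> i < nt \<longrightarrow> ar s1 13 i = ar s 10 ((m + h) + i)" "int (tk s1) = int (tk s) + nt"
      using frameD[OF s1(3)] s1(1,2) d(5-8) v26 by (auto simp: val_def)
    have l13: "lst (ar s1 13) nt = ts"
      using lst_copy[OF g1(13), of "p - 1"] hb p lt(1) lz(1) d(1) by (simp add: ts_def nt_def)
    have a11: "ar s 11 0 = fl ! 0" using d(10) nf0 by simp
    let ?s1 = "s1\<lparr>vr := (vr s1)(14 := nt, 21 := c)\<rparr>"
    have "wp (SCALE 13 14 21) (wp (27 ::= N 0) (wp (COPY 14 11 27 23) (wp (13 ::= V 23) (wp (SCALE 14 13 21)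
       (wp (8 ::= (V 8 .* V 21) .mod V 4) (wp (18 ::= V 23) (wp (19 ::= N 8 .* V 16) ?P))))))) ?s1"
    proof (rule wp_SCALE[where xs = ts])
      show "\<forall>x\<in>set ts. 0 \<le> x \<and> x < sz \<and> 0 \<le> ar ?s1 5 x \<and> ar ?s1 5 x < vr ?s1 4"
        using idr g1 by (auto simp: less_imp_le)
      fix s2 assume s2: "ar s2 5 = (\<lambda>x. if x \<in> set ts then ar ?s1 5 x * vr ?s1 21 mod vr ?s1 4 else ar ?s1 5 x)"
        "int (tk s2) = int (tk ?s1) + vr ?s1 14" "frame (SCALE 13 14 21) ?s1 s2"
      have g2: "vr s2 4 = p" "vr s2 8 = vr s 8" "vr s2 9 = vr s 9" "vr s2 10 = vr s 10" "vr s2 24 = vr s 24" "vr s2 16 = m" "vr s2 23 = f"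
        "vr s2 14 = nt" "vr s2 21 = c" "ar s2 5 = val1" "ar s2 6 = ar s 6" "ar s2 7 = ar s 7" "ar s2 11 = ar s 11" "ar s2 13 = ar s1 13"
        using frameD[OF s2(3)] s2(1) g1 by (auto simp: val1_def)
      let ?s2 = "s2\<lparr>vr := (vr s2)(27 := 0)\<rparr>"
      have "wp (COPY 14 11 27 23) (wp (13 ::= V 23) (wp (SCALE 14 13 21)
         (wp (8 ::= (V 8 .* V 21) .mod V 4) (wp (18 ::= V 23) (wp (19 ::= N 8 .* V 16) ?P))))) ?s2"
      proof (rule wp_COPY)
        fix s3 assume s3: "\<forall>i. 0 \<le> i \<and> i < vr ?s2 23 \<longrightarrow> ar s3 14 i = ar ?s2 11 (vr ?s2 27 + i)"
          "int (tk s3) = int (tk ?s2) + vr ?s2 23" "frame (COPY 14 11 27 23) ?s2 s3"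
        have g3: "vr s3 4 = p" "vr s3 8 = vr s 8" "vr s3 9 = vr s 9" "vr s3 10 = vr s 10" "vr s3 24 = vr s 24" "vr s3 16 = m" "vr s3 23 = f"
          "vr s3 14 = nt" "vr s3 21 = c" "ar s3 5 = val1" "ar s3 6 = ar s 6" "ar s3 7 = ar s 7" "ar s3 13 = ar s1 13"
          "\<forall>i. 0 \<le> i \<and> i < f \<longrightarrow> ar s3 14 i = ar s 11 (0 + i)"
          using frameD[OF s3(3)] s3(1) g2 by auto
        have l14: "lst (ar s3 14) f = qs"
          using lst_copy[OF g3(14), of nf] hb fnf d(10) by (simp add: qs_def)
        let ?s3 = "s3\<lparr>vr := (vr s3)(13 := f)\<rparr>"
        have "wp (SCALE 14 13 21) (wp (8 ::= (V 8 .* V 21) .mod V 4) (wp (18 ::= V 23) (wp (19 ::= N 8 .* V 16) ?P))) ?s3"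
        proof (rule wp_SCALE[where xs = qs])
          show "\<forall>x\<in>set qs. 0 \<le> x \<and> x < sz \<and> 0 \<le> ar ?s3 5 x \<and> ar ?s3 5 x < vr ?s3 4"
          proof
            fix x assume x: "x \<in> set qs"
            then have "val1 x = val x" using dj by (auto simp: val1_def)
            then show "0 \<le> x \<and> x < sz \<and> 0 \<le> ar ?s3 5 x \<and> ar ?s3 5 x < vr ?s3 4"
              using idr[of x] x g3 by (simp add: less_imp_le)
          qed
          fix s4 assume s4: "ar s4 5 = (\<lambda>x. if x \<in> set qs then ar ?s3 5 x * vr ?s3 21 mod vr ?s3 4 else ar ?s3 5 x)"
            "int (tk s4) = int (tk ?s3) + vr ?s3 13" "frame (SCALE 14 13 21) ?s3 s4"
          have g4: "vr s4 4 = p" "vr s4 8 = vr s 8" "vr s4 9 = vr s 9" "vr s4 10 = vr s 10" "vr s4 24 = vr s 24" "vr s4 16 = m" "vr s4 23 = f"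
            "vr s4 13 = f" "vr s4 14 = nt" "vr s4 21 = c" "ar s4 5 = val2" "ar s4 6 = ar s 6" "ar s4 7 = ar s 7" "ar s4 13 = ar s1 13" "ar s4 14 = ar s3 14"
            using frameD[OF s4(3)] s4(1) g3 by (auto simp: val2_def)
          let ?v = "(vr s4)(8 := vr s 8 * c mod p, 18 := f, 19 := 8 * m)"
          have F: "forest p X LF (set ts \<union> set qs) p ?v (ar s4)"
            by (rule forest_scale[OF d(18) c(1)]) (use g4 p1 tsR qsR v2 d(5) in \<open>auto simp: val_def\<close>)
          have one: "val2 (ar s4 14 i) = 1" if "0 \<le> i" "i < f" for i
          proof -
            have "ar s4 14 i = qs ! nat i" using that g4(15) unfolding l14[symmetric] by simp
            then have "ar s4 14 i \<in> set qs" using that lt(2) by simp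
            then show ?thesis using v2 qv c(4) by (simp add: x0_def)
          qed
          have E: "p - 1 \<le> pairs_sum val2 (sort_key val2 ts) (nat (8 * m)) (160 * m + 1)"
          proof (rule pairs_sum_small_classes)
            show "sorted (map val2 (sort_key val2 ts))" by simp
            show "int (cnt val2 (sort_key val2 ts) v) \<le> m" for v
            proof (cases "v \<in> val2 ` set ts")
              case True
              then obtain x where x: "x \<in> set ts" "v = val2 x" by blast
              have eq: "(val2 y = val2 z) = (val y = val z)" if "y \<in> set ts" "z \<in> set ts" for y z
                using that v2 mult_mod_inj[OF c(1), of "val y" "val z"] idr[of y] idr[of z] by (simp add: less_imp_le)
              have "cnt val2 (sort_key val2 ts) v = cnt val2 ts (val2 x)" unfolding x(2) by (rule cnt_mset) simp
              also have "\<dots> = cnt val ts (val x)" by (rule cnt_scale) (use eq x in auto)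
              also have "\<dots> \<le> cnt val zs (val x)" unfolding ts_def by (rule cnt_drop)
              finally show ?thesis using d(4)[rule_format, of "val x"] by linarith
            next
              case False
              then have "cnt val2 (sort_key val2 ts) v = 0" by (auto simp: cnt_def filter_empty_conv)
              then show ?thesis using p by simp
            qed
            show "0 \<le> val2 x \<and> val2 x \<le> p" if "x \<in> set (sort_key val2 ts)" for x
            proof -
              have "val2 x = val x * c mod p" using that v2 by simp
              then show ?thesis using p1 by (simp add: less_imp_le)
            qed
          qed (use lt hb p in auto)
          have "ready p X 160000016 ?v (ar s4)" unfolding ready_def
          proof (intro exI[of _ LF] exI[of _ "set ts \<union> set qs"] exI[of _ "nat (8 * m)"] conjI)
            show "max 0 (p - 1 - ?v 13) \<le> pairs_sum (ar s4 5) (sort_key (ar s4 5) (lst (ar s4 13) (?v 14))) (nat (8 * m)) (?v 18 + 1)"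
              using E l13 g4 p hb by (simp add: f_def)
            show "distinct (lst (ar s4 14) (?v 13) @ lst (ar s4 13) (?v 14))"
              using l13 l14 g4 dt dj by auto
            show "set (lst (ar s4 14) (?v 13)) \<subseteq> set ts \<union> set qs" using l14 g4 by simp
            show "set (lst (ar s4 13) (?v 14)) \<subseteq> set ts \<union> set qs" using l13 g4 by simp
            show "\<forall>x\<in>set ts \<union> set qs. 2 * p - 1 \<le> x" using ti qi d(3,14) p1 by fastforce
            show "\<forall>x\<in>set (lst (ar s4 14) (?v 13)). 0 < ar s4 5 x"
              using l14 g4 v2 mult_mod_pos(1)[OF c(1)] idr by auto
          qed (use F g4 one hb p in auto)
          moreover have "int (tk s4) \<le> int (tk s) + 4 * p" using s4(2) s3(2) s2(2) g1 g2 hb by simp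
          moreover have "8 * m \<le> 10 * sz" "fits (8 * m)" "fits 8" using p p1 by (auto intro!: fits_small)
          moreover have "fits (vr s 8 * c)" using f8 c p by (intro fits_prod) auto
          moreover have "fits (vr s 8 * c mod p)" using p1 p by (intro fits_mod) auto
          ultimately show "wp (8 ::= (V 8 .* V 21) .mod V 4) (wp (18 ::= V 23) (wp (19 ::= N 8 .* V 16) ?P)) s4"
            using g4 unfolding wp_simps(2) by simp
        qed (use g3 l14 hb fnf c p p1 dt in auto)
        then show "wp (13 ::= V 23) (wp (SCALE 14 13 21) (wp (8 ::= (V 8 .* V 21) .mod V 4) (wp (18 ::= V 23) (wp (19 ::= N 8 .* V 16) ?P)))) s3"
          using g3 by (subst wp_simps(2)) simp
      qed (use g2 hb fnf p p1 in auto)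
      then show "wp (27 ::= N 0) (wp (COPY 14 11 27 23) (wp (13 ::= V 23) (wp (SCALE 14 13 21)
         (wp (8 ::= (V 8 .* V 21) .mod V 4) (wp (18 ::= V 23) (wp (19 ::= N 8 .* V 16) ?P)))))) s2"
        by (subst wp_simps(2)) simp
    qed (use g1 l13 hb c p p1 dt in auto)
    moreover have "fits c" using c p by (intro fits_small) auto
    moreover have "0 \<le> fl ! 0" "fl ! 0 < sz"
    proof -
      have "fl ! 0 \<in> R" using f0 by (simp add: R_def)
      then show "0 \<le> fl ! 0" "fl ! 0 < sz" using f8(3) d(12) p p1 by auto
    qed
    ultimately show "wp (14 ::= V 26) (wp (21 ::= B ModInv (A 5 (A 11 (N 0))) (V 4)) (wp (SCALE 13 14 21) (wp (27 ::= N 0) (wp (COPY 14 11 27 23) (wp (13 ::= V 23) (wp (SCALE 14 13 21)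
       (wp (8 ::= (V 8 .* V 21) .mod V 4) (wp (18 ::= V 23) (wp (19 ::= N 8 .* V 16) ?P))))))))) s1"
      using g1 a11 sz_pos unfolding wp_simps(2) by (simp add: x0_def[symmetric] c_def[symmetric])
  qed (use d v26 hb p p1 in \<open>auto simp: nt_def\<close>)
  then show ?thesis
    by (rule wp_conseq) (elim conjE, rule Q, assumption+)
qed

end

section \<open>One window\<close>

definition PRIME :: com where
  "PRIME = (PREP ;; Cond (Lt (V 17) (V 4))
     (DBLOCK ;; Cond (Lt (N 10000000 .* V 16) (V 4)) (R2A ;; Cond (Lt (V 17) (V 23)) CASEB CASEA) REG1 ;; SOLVE)
     TRIV)"

lemma mod_PRIME:
  "modv PRIME \<subseteq> {8..42}" "moda PRIME \<subseteq> {5..22}"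
  by (auto simp: PRIME_def)

text \<open>
  The chosen items are concatenated from right to left, and the other items are moved to the right
  end of the window, so that they become the beginning of the next window.
\<close>

definition MERGE :: com where
  "MERGE = (45 ::= N 0 ;; 46 ::= N (-1) ;; 47 ::= N (-1) ;; 48 ::= V 7 .+ V 10 .- N 1 ;;
     For 30 10 (31 ::= V 7 .+ V 10 .- N 1 .- V 30 ;;
       Cond (Eq (A 8 (V 10 .- N 1 .- V 30)) (N 0))
        (Sto 1 (V 48) (A 1 (V 31)) ;; Sto 2 (V 48) (A 2 (V 31)) ;; Sto 3 (V 48) (A 3 (V 31)) ;; 48 ::= V 48 .- N 1)
        (45 ::= (V 45 .+ A 1 (V 31)) .mod V 3 ;; Sto 4 (A 3 (V 31)) (V 46) ;; 46 ::= A 2 (V 31) ;;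
         Cond (Lt (V 47) (N 0)) (47 ::= A 3 (V 31)) Skip)) ;;
     Sto 1 (V 6) (V 45 .div V 4) ;; Sto 2 (V 6) (V 46) ;; Sto 3 (V 6) (V 47))"

lemma mod_MERGE [simp]:
  "modv MERGE = {30, 31, 45, 46, 47, 48}" "moda MERGE = {1, 2, 3, 4}"
  by (auto simp: MERGE_def)

section \<open>Items as linked lists of indices\<close>

lemma islist_append:
  "xs \<noteq> [] \<Longrightarrow> distinct xs \<Longrightarrow> islist nx k xs \<Longrightarrow> islist nx h ys \<Longrightarrow> set xs \<inter> set ys = {} \<Longrightarrow>
    islist (nx(last xs := h)) k (xs @ ys)"
proof (induction xs arbitrary: k)
  case (Cons x xs)
  show ?case
  proof (cases "xs = []")
    case True
    then show ?thesis using Cons.prems islist_upd[of x ys nx h h] by (auto simp: fun_upd_def)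
  next
    case False
    then have "last xs \<in> set xs" by simp
    then have "last xs \<noteq> x" using Cons.prems(2) by auto
    then show ?thesis using Cons False by auto
  qed
qed simp

text \<open>In all uses the product of \<open>g\<close> and \<open>M\<close> is \<open>n\<close>, so
  \<open>val\<close> matters only modulo \<open>M\<close>: the task modulo \<open>n\<close> for
  indices has become one modulo \<open>M\<close> for items.\<close>

definition itm :: "(int \<Rightarrow> int) \<Rightarrow> int \<Rightarrow> (int \<Rightarrow> int) \<Rightarrow> nat \<Rightarrow> int \<Rightarrow> int \<Rightarrow> int \<Rightarrow> int \<Rightarrow> int list \<Rightarrow> bool" where
  "itm inp n nx g M val h l xs \<longleftrightarrow> xs \<noteq> [] \<and> distinct xs \<and> islist nx h xs \<and> l = last xs \<and> length xs = g \<and>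
     set xs \<subseteq> {1..2 * n - 1} \<and> 0 \<le> val \<and> val < M \<and> [sum_list (map inp xs) = int g * val] (mod n)"

lemma itm_upd: "itm inp n nx g M val h l xs \<Longrightarrow> y \<notin> set xs \<Longrightarrow> itm inp n (nx(y := z)) g M val h l xs"
  by (simp add: itm_def islist_upd)

definition coll :: "(int \<Rightarrow> int) \<Rightarrow> int \<Rightarrow> (int \<Rightarrow> nat) \<Rightarrow> (int \<Rightarrow> int) \<Rightarrow> int set \<Rightarrow> (int \<Rightarrow> int list) \<Rightarrow> (nat \<Rightarrow> int \<Rightarrow> int) \<Rightarrow> bool" where
  "coll inp n gz mz D W a \<longleftrightarrow>
    (\<forall>i\<in>D. itm inp n (a 4) (gz i) (mz i) (a 1 i) (a 2 i) (a 3 i) (W i)) \<and>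
    (\<forall>i\<in>D. \<forall>j\<in>D. i \<noteq> j \<longrightarrow> set (W i) \<inter> set (W j) = {})"

context ram
begin

lemma wp_PRIME:
  assumes p: "prime (vr s 4)" "8 * vr s 4 \<le> sz" "0 \<le> vr s 7" "vr s 7 + 2 * vr s 4 \<le> sz"
    and Q: "\<And>t. (\<forall>x\<in>{0..<2 * vr s 4 - 1}. ar t 8 x \<in> {0, 1}) \<Longrightarrow> (\<Sum>x\<in>{0..<2 * vr s 4 - 1}. ar t 8 x) = vr s 4 \<Longrightarrow>
      [(\<Sum>x\<in>{0..<2 * vr s 4 - 1}. ar t 8 x * ar s 1 (vr s 7 + x)) = 0] (mod vr s 4) \<Longrightarrow> vr t 10 = 2 * vr s 4 - 1 \<Longrightarrow>
      int (tk t) \<le> int (tk s) + 160000200 * vr s 4 \<Longrightarrow> frame PRIME s t \<Longrightarrow> Q t"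
  shows "wp PRIME Q s"
proof -
  define p where "p = vr s 4"
  define X where "X = (\<lambda>x. ar s 1 (vr s 7 + x) mod p)"
  note p' = p[folded p_def]
  have p1: "1 < p" using p' prime_gt_1_int by blast
  have Xr: "0 \<le> X x \<and> X x < p" for x using p1 by (simp add: X_def)
  define P where "P = (\<lambda>t :: st. (\<forall>x\<in>{0..<2 * p - 1}. ar t 8 x \<in> {0, 1}) \<and> (\<Sum>x\<in>{0..<2 * p - 1}. ar t 8 x) = p \<and>
      [(\<Sum>x\<in>{0..<2 * p - 1}. ar t 8 x * X x) = 0] (mod p) \<and> vr t 10 = 2 * p - 1 \<and> int (tk t) \<le> int (tk s) + 160000200 * p)"
  have solve: "wp SOLVE P t" if "ready p X 160000016 (vr t) (ar t)" "vr t 19 \<le> 10 * sz" "int (tk t) \<le> int (tk s) + 90 * p"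
    "vr t 9 \<le> 4 * p" "vr t 10 = 2 * p - 1" for t
  proof (rule wp_ready_SOLVE[OF that(1)])
    fix u assume u: "\<forall>x\<in>{0..<2 * p - 1}. ar u 8 x \<in> {0, 1}" "(\<Sum>x\<in>{0..<2 * p - 1}. ar u 8 x) = p"
      "[(\<Sum>x\<in>{0..<2 * p - 1}. ar u 8 x * X x) = 0] (mod p)" "int (tk u) \<le> int (tk t) + 20 * p + 160000016 * p + 2 * vr t 9"
      "frame SOLVE t u"
    have "vr u 10 = 2 * p - 1" using frameD(1)[OF u(5), of 10] that by simp
    moreover have "int (tk u) \<le> int (tk s) + 160000200 * p" using u(4) that p1 by linarith
    ultimately show "P u" using u unfolding P_def by blast
  qed (use that p' p1 in auto)
  have "wp PRIME P s" unfolding PRIME_def wp_simps(4)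
  proof (rule wp_PREP[where X = X])
    fix s1 ys assume s1: "ys = lst (ar s1 9) (2 * vr s 4 - 1)" "mset ys = mset (map int [0..<nat (2 * vr s 4 - 1)])"
      "\<forall>x. 0 \<le> x \<and> x < 2 * vr s 4 - 1 \<longrightarrow> ar s1 5 x = X x" "classord X ys" "vr s1 17 = int (cnt X ys (X (ys ! 0)))"
      "vr s1 10 = 2 * vr s 4 - 1" "vr s1 9 = 2 * vr s 4 - 1" "int (tk s1) \<le> int (tk s) + 24 * vr s 4" "frame PREP s s1"
    note s1' = s1[folded p_def]
    have g1: "vr s1 4 = p" using frameD(1)[OF s1(9), of 4] by (simp add: p_def)
    show "wp (Cond (Lt (V 17) (V 4))
     (DBLOCK ;; Cond (Lt (N 10000000 .* V 16) (V 4)) (R2A ;; Cond (Lt (V 17) (V 23)) CASEB CASEA) REG1 ;; SOLVE) TRIV) P s1"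
    proof (cases "vr s1 17 < p")
      case False
      have "wp TRIV P s1"
      proof (rule wp_TRIV[where p = p and X = X and ys = ys])
        fix t assume t: "\<forall>x\<in>{0..<2 * p - 1}. ar t 8 x \<in> {0, 1}" "(\<Sum>x\<in>{0..<2 * p - 1}. ar t 8 x) = p"
          "[(\<Sum>x\<in>{0..<2 * p - 1}. ar t 8 x * X x) = 0] (mod p)" "int (tk t) \<le> int (tk s1) + 3 * p" "frame TRIV s1 t"
        have "vr t 10 = 2 * p - 1" using frameD(1)[OF t(5), of 10] s1' by simp
        moreover have "int (tk t) \<le> int (tk s) + 160000200 * p" using t(4) s1'(8) p1 by linarith
        ultimately show "P t" using t unfolding P_def by blast
      qed (use p' p1 g1 s1' False in auto)
      then show ?thesis using False g1 by (intro wp_CondF) auto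
    next
      case True
      have "wp (DBLOCK ;; Cond (Lt (N 10000000 .* V 16) (V 4)) (R2A ;; Cond (Lt (V 17) (V 23)) CASEB CASEA) REG1 ;; SOLVE) P s1"
        unfolding wp_simps(4)
      proof (rule wp_DBLOCK[where p = p and X = X and ys = ys])
        fix s2 :: st and LF ds assume s2: "dstate p X LF ds (vr s2) (ar s2)" "int (tk s2) \<le> int (tk s1) + 33 * p"
        have d: "vr s2 9 = 3 * p - 2" "vr s2 4 = p" "vr s2 10 = 2 * p - 1" using s2(1) by (auto simp: dstate_def forest_def)
        have t2: "int (tk s2) \<le> int (tk s) + 57 * p" using s2(2) s1'(8) by linarith
        have "vr s2 16 \<le> p" "0 \<le> vr s2 16"
        proof -
          have "cnt (ar s2 5) ds 1 \<le> nat (p - 1)" using cnt_le[of "ar s2 5" ds 1] s2(1) by (auto simp: dstate_def)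
          then show "vr s2 16 \<le> p" "0 \<le> vr s2 16" using s2(1) p1 by (auto simp: dstate_def)
        qed
        then have ft: "fits (10000000 * vr s2 16)" "fits 10000000" using p' p1 sz_pos by (auto intro!: fits_mid)
        show "wp (Cond (Lt (N 10000000 .* V 16) (V 4)) (R2A ;; Cond (Lt (V 17) (V 23)) CASEB CASEA) REG1) (wp SOLVE P) s2"
        proof (cases "10000000 * vr s2 16 < p")
          case False
          have "wp REG1 (wp SOLVE P) s2"
          proof (rule wp_REG1[OF s2(1) p'(1,2)])
            fix t assume t: "ready p X 160000016 (vr t) (ar t)" "vr t 19 \<le> 10 * sz" "int (tk t) \<le> int (tk s2) + 3 * p" "frame REG1 s2 t"
            have "vr t 9 = vr s2 9" "vr t 10 = vr s2 10" using frameD(1)[OF t(4)] by auto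
            then show "wp SOLVE P t" using t t2 d p1 by (intro solve) auto
          qed (use False in simp)
          then show ?thesis using False d ft by (intro wp_CondF) auto
        next
          case small: True
          have "wp R2A (wp (Cond (Lt (V 17) (V 23)) CASEB CASEA) (wp SOLVE P)) s2"
          proof (rule wp_R2A[OF s2(1) p'(1,2) small])
            fix t zs fl assume t: "mid p X LF (vr s2 16) zs fl (vr t) (ar t)" "0 < vr s2 16" "int (tk t) \<le> int (tk s2) + 28 * p" "frame R2A s2 t"
            have d9: "vr t 9 \<le> 4 * p" "vr t 10 = 2 * p - 1" using t(1,2) by (auto simp: mid_def forest_def)
            show "wp (Cond (Lt (V 17) (V 23)) CASEB CASEA) (wp SOLVE P) t"
            proof (cases "vr t 17 < vr t 23")
              case True
              have "wp CASEB (wp SOLVE P) t"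
              proof (rule wp_CASEB[OF t(1) p'(1,2) small t(2) True])
                fix u assume u: "ready p X 160000016 (vr u) (ar u)" "vr u 19 \<le> 10 * sz" "int (tk u) \<le> int (tk t) + 2 * p" "frame CASEB t u"
                have "vr u 9 = vr t 9" "vr u 10 = vr t 10" using frameD(1)[OF u(4)] by auto
                then show "wp SOLVE P u" using u t(3) t2 d9 p1 by (intro solve) auto
              qed
              then show ?thesis using True by (intro wp_CondT) auto
            next
              case False
              have "wp CASEA (wp SOLVE P) t"
              proof (rule wp_CASEA[OF t(1) p'(1,2) small t(2)])
                fix u assume u: "ready p X 160000016 (vr u) (ar u)" "vr u 19 \<le> 10 * sz" "int (tk u) \<le> int (tk t) + 4 * p" "frame CASEA t u"
                have "vr u 9 = vr t 9" "vr u 10 = vr t 10" using frameD(1)[OF u(4)] by auto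
                then show "wp SOLVE P u" using u t(3) t2 d9 p1 by (intro solve) auto
              qed (use False in simp)
              then show ?thesis using False by (intro wp_CondF) auto
            qed
          qed
          then show ?thesis using small d ft by (intro wp_CondT) (auto simp: wp_simps(4))
        qed
      qed (use True in simp | use p' g1 s1' Xr in auto)+
      then show ?thesis using True g1 by (intro wp_CondT) auto
    qed
  qed (use p' p1 X_def p_def in auto)
  then show ?thesis
  proof (rule wp_conseq, goal_cases)
    case (1 t)
    have "[(\<Sum>x\<in>{0..<2 * p - 1}. ar t 8 x * X x) = (\<Sum>x\<in>{0..<2 * p - 1}. ar t 8 x * ar s 1 (vr s 7 + x))] (mod p)"
      unfolding X_def by (intro cong_sum cong_mult cong_refl) (simp add: cong_def)
    then have "[(\<Sum>x\<in>{0..<2 * p - 1}. ar t 8 x * ar s 1 (vr s 7 + x)) = 0] (mod p)"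
      using 1(1) unfolding P_def by (meson cong_sym cong_trans)
    then show ?case using 1 unfolding P_def p_def by (intro Q) blast+
  qed
qed

text \<open>Of the \<open>2 * p - 1\<close> items in the window \<open>p\<close> are used up and the
  other \<open>p - 1\<close> are moved to its right end. So the next window begins exactly
  \<open>p\<close> places further, at \<open>(r + 1) * p\<close>. The new group is stored at
  position \<open>r\<close>, which is never ahead of the window.\<close>

lemma wp_MERGE:
  fixes g :: nat
  assumes b: "1 < vr s 4" "0 < vr s 3" "2 * vr s 3 \<le> sz" "vr s 4 dvd vr s 3" "int g * vr s 3 = n" "8 * n \<le> sz"
      "0 \<le> vr s 6" "vr s 7 = vr s 6 * vr s 4" "vr s 10 = 2 * vr s 4 - 1" "vr s 7 + vr s 10 \<le> 2 * vr s 3 - 1"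
    and gz: "gz = (\<lambda>i. if i < vr s 6 then g * nat (vr s 4) else g)" "mz = (\<lambda>i. if i < vr s 6 then vr s 3 div vr s 4 else vr s 3)"
    and C: "coll inp n gz mz ({0..<vr s 6} \<union> {vr s 7..<2 * vr s 3 - 1}) W (ar s)"
    and bits: "\<forall>x\<in>{0..<2 * vr s 4 - 1}. ar s 8 x \<in> {0, 1}" "(\<Sum>x\<in>{0..<2 * vr s 4 - 1}. ar s 8 x) = vr s 4"
      "[(\<Sum>x\<in>{0..<2 * vr s 4 - 1}. ar s 8 x * ar s 1 (vr s 7 + x)) = 0] (mod vr s 4)"
    and Q: "\<And>t W'. coll inp n (\<lambda>i. if i < vr s 6 + 1 then g * nat (vr s 4) else g) (\<lambda>i. if i < vr s 6 + 1 then vr s 3 div vr s 4 else vr s 3)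
        ({0..<vr s 6 + 1} \<union> {(vr s 6 + 1) * vr s 4..<2 * vr s 3 - 1}) W' (ar t) \<Longrightarrow>
      int (tk t) = int (tk s) + vr s 10 \<Longrightarrow> frame MERGE s t \<Longrightarrow> Q t"
  shows "wp MERGE Q s"
proof -
  define p where "p = vr s 4"
  define M where "M = vr s 3"
  define r where "r = vr s 6"
  define off where "off = vr s 7"
  define nl where "nl = 2 * p - 1"
  define bit where "bit = ar s 8"
  define V0 where "V0 = ar s 1"
  note b' = b[folded p_def M_def r_def off_def]
  note bits' = bits[folded p_def bit_def V0_def off_def, folded nl_def]
  have n0: "0 < n" "0 < g" "M \<le> n"
  proof -
    show g: "0 < g"
    proof (rule ccontr)
      assume "\<not> 0 < g"
      then have "\<forall>i\<in>{off..<2 * M - 1}. W i \<noteq> [] \<and> length (W i) = 0"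
        using C b' unfolding coll_def itm_def gz off_def[symmetric] r_def[symmetric] M_def[symmetric] by auto
      moreover have "off \<in> {off..<2 * M - 1}" using b' by (auto simp: p_def[symmetric])
      ultimately show False by auto
    qed
    show "0 < n" using b'(2,5) g by (metis of_nat_0_less_iff zero_less_mult_iff)
    have "1 * M \<le> int g * M" using g b'(2) by (intro mult_right_mono) auto
    then show "M \<le> n" using b'(5) by simp
  qed
  have rp: "r \<le> off" "0 \<le> off" using b' mult_left_mono[of 1 p r] by auto
  have nlp: "0 < nl" "vr s 10 = nl" "off + nl \<le> 2 * M - 1" using b' by (auto simp: nl_def)
  define q where "q = M div p"
  have Mq: "M = q * p" "0 < q" using b'(1,2,4) by (auto simp: q_def elim!: dvdE simp: zero_less_mult_iff)
  define nz where "nz = (\<lambda>k. (\<Sum>x\<in>{nl - k..<nl}. 1 - bit x))"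
  define sz' where "sz' = (\<lambda>k. (\<Sum>x\<in>{nl - k..<nl}. bit x * V0 (off + x)))"
  have ins: "{nl - (k + 1)..<nl} = insert (nl - 1 - k) {nl - k..<nl}" if "0 \<le> k" "k < nl" for k using that by auto
  have nz1: "nz (k + 1) = (1 - bit (nl - 1 - k)) + nz k" and sz1: "sz' (k + 1) = bit (nl - 1 - k) * V0 (off + (nl - 1 - k)) + sz' k"
    if "0 \<le> k" "k < nl" for k
    unfolding nz_def sz'_def ins[OF that] by (subst sum.insert; simp)+
  have b01: "0 \<le> 1 - bit x" "1 - bit x \<le> 1" if "x \<in> {nl - k..<nl}" "k \<le> nl" for x k
  proof -
    have "bit x = 0 \<or> bit x = 1" using bits'(1) that by auto
    then show "0 \<le> 1 - bit x" "1 - bit x \<le> 1" by auto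
  qed
  have nzb: "0 \<le> nz k" "nz k \<le> k" if "0 \<le> k" "k \<le> nl" for k
  proof -
    show "0 \<le> nz k" unfolding nz_def using b01 that by (intro sum_nonneg) blast
    have "nz k \<le> (\<Sum>x\<in>{nl - k..<nl}. 1)" unfolding nz_def using b01 that by (intro sum_mono) blast
    then show "nz k \<le> k" using that by simp
  qed
  have nznl: "nz nl = p - 1"
  proof -
    have "nz nl = (\<Sum>x\<in>{0..<nl}. 1) - (\<Sum>x\<in>{0..<nl}. bit x)" unfolding nz_def by (simp add: sum_subtractf)
    then show ?thesis using bits'(2) nlp(1) by (simp add: nl_def)
  qed
  \<comment> \<open>The live positions: finished groups, the part of the window still to be read,
    and everything to the right of the next free slot \<open>w\<close>. The slot is never to the
    left of the reading position, so a move overwrites nothing that is still needed.\<close>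
  define D where "D = (\<lambda>k w. {0..<r} \<union> {off..<off + nl - k} \<union> {w<..<2 * M - 1})"
  define Inv where "Inv = (\<lambda>k (v :: nat \<Rightarrow> int) (a :: nat \<Rightarrow> int \<Rightarrow> int). v 48 = off + nl - 1 - nz k \<and>
     (\<exists>W acc. coll inp n gz mz (D k (v 48)) W a \<and> (\<forall>i\<in>D k (v 48). set (W i) \<inter> set acc = {}) \<and>
       distinct acc \<and> set acc \<subseteq> {1..2 * n - 1} \<and> islist (a 4) (v 46) acc \<and>
       (if acc = [] then v 47 = -1 else v 47 = last acc) \<and> int (length acc) = int g * (k - nz k) \<and>
       0 \<le> v 45 \<and> v 45 < M \<and> [sum_list (map inp acc) = int g * v 45] (mod n) \<and> [v 45 = sz' k] (mod M)) \<and>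
     (\<forall>i. off \<le> i \<and> i < off + nl - k \<longrightarrow> a 1 i = V0 i))"
  have Icong: "Inv k (v(30 := x)) a \<longleftrightarrow> Inv k v a" "Inv k (v(31 := x)) a \<longleftrightarrow> Inv k v a"
    "Inv k (v(31 := x, 48 := y)) a \<longleftrightarrow> Inv k (v(48 := y)) a"
    "Inv k (v(31 := x, 45 := y, 46 := z)) a \<longleftrightarrow> Inv k (v(45 := y, 46 := z)) a"
    "Inv k (v(31 := x, 45 := y, 46 := z, 47 := u)) a \<longleftrightarrow> Inv k (v(45 := y, 46 := z, 47 := u)) a"
    "Inv k (v(45 := y, 46 := z, 47 := v 47)) a \<longleftrightarrow> Inv k (v(45 := y, 46 := z)) a" for k v a x y z u
    unfolding Inv_def by auto
  have step: "wp (31 ::= V 7 .+ V 10 .- N 1 .- V 30 ;;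
       Cond (Eq (A 8 (V 10 .- N 1 .- V 30)) (N 0))
        (Sto 1 (V 48) (A 1 (V 31)) ;; Sto 2 (V 48) (A 2 (V 31)) ;; Sto 3 (V 48) (A 3 (V 31)) ;; 48 ::= V 48 .- N 1)
        (45 ::= (V 45 .+ A 1 (V 31)) .mod V 3 ;; Sto 4 (A 3 (V 31)) (V 46) ;; 46 ::= A 2 (V 31) ;;
         Cond (Lt (V 47) (N 0)) (47 ::= A 3 (V 31)) Skip))
      (\<lambda>t'. Inv (k + 1) (vr t') (ar t') \<and> int (tk t') = int (tk t)) t"
    if k: "0 \<le> k" "k < nl" "vr t 30 = k" and I: "Inv k (vr t) (ar t)"
      and fr: "vr t 7 = off" "vr t 10 = nl" "vr t 3 = M" "ar t 8 = bit" for t k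
  proof -
    define y where "y = off + nl - 1 - k"
    define w where "w = vr t 48"
    define x where "x = nl - 1 - k"
    have xy: "y = off + x" "0 \<le> x" "x < nl" "x < sz" using k nlp rp b' by (auto simp: x_def y_def)
    have yb: "off \<le> y" "y < 2 * M - 1" "0 \<le> y" "y < sz" "y < off + nl" using k nlp rp b' by (auto simp: y_def)
    obtain W acc where W: "w = off + nl - 1 - nz k" "coll inp n gz mz (D k w) W (ar t)" "\<forall>i\<in>D k w. set (W i) \<inter> set acc = {}"
      "distinct acc" "set acc \<subseteq> {1..2 * n - 1}" "islist (ar t 4) (vr t 46) acc" "if acc = [] then vr t 47 = -1 else vr t 47 = last acc"
      "int (length acc) = int g * (k - nz k)" "0 \<le> vr t 45" "vr t 45 < M" "[sum_list (map inp acc) = int g * vr t 45] (mod n)"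
      "[vr t 45 = sz' k] (mod M)" "\<forall>i. off \<le> i \<and> i < off + nl - k \<longrightarrow> ar t 1 i = V0 i"
      using I unfolding Inv_def w_def by blast
    have wb: "y \<le> w" "w < off + nl" "0 \<le> w" "w < sz" using W(1) nzb[of k] k yb rp b' nlp by (auto simp: y_def)
    have yD: "y \<in> D k w" using k nlp by (auto simp: D_def y_def)
    have Dk: "{off..<off + nl - k} = insert y {off..<off + nl - (k + 1)}" using k by (auto simp: y_def)
    have gy: "gz y = g" "mz y = M" using yb rp by (auto simp: gz r_def[symmetric] M_def)
    have it: "itm inp n (ar t 4) g M (ar t 1 y) (ar t 2 y) (ar t 3 y) (W y)"
      using W(2) yD gy unfolding coll_def by metis
    have V0y: "ar t 1 y = V0 y" using W(13) yb k by (auto simp: y_def)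
    have ft: "fits (off + nl)" "fits (off + nl - 1)" "fits (off + nl - 1 - k)" "fits (nl - 1)" "fits (nl - 1 - k)" "fits (w - 1)"
      using k nlp rp b' wb by (auto intro!: fits_small)
    have bx: "bit x \<in> {0, 1}" using bits'(1) xy by auto
    show ?thesis
    proof (cases "bit x = 0")
      case True
      have nk: "nz (k + 1) = nz k + 1" "sz' (k + 1) = sz' k" using nz1[of k] sz1[of k] k True by (auto simp: x_def)
      define a where "a = (ar t)(1 := (ar t 1)(w := ar t 1 y), 2 := (ar t 2)(w := ar t 2 y), 3 := (ar t 3)(w := ar t 3 y))"
      define W1 where "W1 = W(w := W y)"
      have DD: "D (k + 1) (w - 1) \<subseteq> insert w (D k w - {y})"
        unfolding D_def Dk using wb rp k by (auto simp: y_def)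
      have wn: "w = y \<or> w \<notin> D k w" using wb yb rp by (auto simp: D_def y_def)
      have gw: "gz w = g" "mz w = M" using wb yb rp by (auto simp: gz r_def[symmetric] M_def)
      have c1: "coll inp n gz mz (D (k + 1) (w - 1)) W1 a"
        unfolding coll_def
      proof (intro conjI ballI impI)
        fix i assume i: "i \<in> D (k + 1) (w - 1)"
        show "itm inp n (a 4) (gz i) (mz i) (a 1 i) (a 2 i) (a 3 i) (W1 i)"
        proof (cases "i = w")
          case True
          then show ?thesis using it gw by (simp add: a_def W1_def)
        next
          case False
          then have "i \<in> D k w" using i DD by auto
          then show ?thesis using W(2) False unfolding coll_def by (simp add: a_def W1_def)
        qed
      next
        fix i j assume ij: "i \<in> D (k + 1) (w - 1)" "j \<in> D (k + 1) (w - 1)" "i \<noteq> j"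
        have "i = w \<or> i \<in> D k w - {y}" "j = w \<or> j \<in> D k w - {y}" using ij DD by auto
        then show "set (W1 i) \<inter> set (W1 j) = {}"
          using W(2) ij(3) yD unfolding coll_def W1_def by auto
      qed
      have c2: "\<forall>i\<in>D (k + 1) (w - 1). set (W1 i) \<inter> set acc = {}"
      proof
        fix i assume "i \<in> D (k + 1) (w - 1)"
        then have "i = w \<or> i \<in> D k w" using DD by auto
        then show "set (W1 i) \<inter> set acc = {}" using W(3) yD by (auto simp: W1_def)
      qed
      have "Inv (k + 1) ((vr t)(48 := w - 1)) a"
        unfolding Inv_def
      proof (intro conjI exI[of _ W1] exI[of _ acc])
        show "((vr t)(48 := w - 1)) 48 = off + nl - 1 - nz (k + 1)" using W(1) nk by simp
        show "\<forall>i. off \<le> i \<and> i < off + nl - (k + 1) \<longrightarrow> a 1 i = V0 i"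
          using W(13) wb by (auto simp: a_def y_def)
      qed (use c1 c2 W nk in \<open>auto simp: a_def\<close>)
      then show ?thesis unfolding wp_simps(4)
        using True fr k ft yb wb bx xy
        by (simp add: wp_simps w_def[symmetric] y_def[symmetric] x_def[symmetric] Icong a_def)
    next
      case False
      then have b1: "bit x = 1" using bx by auto
      have nk: "nz (k + 1) = nz k" "sz' (k + 1) = V0 y + sz' k" using nz1[of k] sz1[of k] k b1 xy by (auto simp: x_def)
      have i': "W y \<noteq> []" "distinct (W y)" "islist (ar t 4) (ar t 2 y) (W y)" "ar t 3 y = last (W y)" "length (W y) = g"
        "set (W y) \<subseteq> {1..2 * n - 1}" "0 \<le> ar t 1 y" "ar t 1 y < M" "[sum_list (map inp (W y)) = int g * ar t 1 y] (mod n)"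
        using it unfolding itm_def by auto
      define tt where "tt = ar t 3 y"
      have tlin: "tt \<in> set (W y)" using i'(1,4) by (simp add: tt_def)
      then have tlb: "0 \<le> tt" "tt < sz" using i'(6) n0 b'(6) by auto
      define a where "a = (ar t)(4 := (ar t 4)(tt := vr t 46))"
      have disj: "set (W y) \<inter> set acc = {}" using W(3) yD by blast
      have DD: "D (k + 1) w \<subseteq> D k w - {y}"
        unfolding D_def Dk using wb rp yb by (auto simp: y_def)
      have c1: "coll inp n gz mz (D (k + 1) w) W a"
        unfolding coll_def
      proof (intro conjI ballI impI)
        fix i assume i: "i \<in> D (k + 1) w"
        then have iD: "i \<in> D k w" "i \<noteq> y" using DD by auto
        then have "set (W i) \<inter> set (W y) = {}" using W(2) yD unfolding coll_def by blast
        then have "tt \<notin> set (W i)" using tlin by blast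
        then show "itm inp n (a 4) (gz i) (mz i) (a 1 i) (a 2 i) (a 3 i) (W i)"
          using W(2) iD unfolding coll_def by (simp add: a_def itm_upd)
      next
        fix i j assume "i \<in> D (k + 1) w" "j \<in> D (k + 1) w" "i \<noteq> j"
        then show "set (W i) \<inter> set (W j) = {}" using W(2) DD unfolding coll_def by blast
      qed
      let ?acc = "W y @ acc"
      have c2: "\<forall>i\<in>D (k + 1) w. set (W i) \<inter> set ?acc = {}"
      proof
        fix i assume i: "i \<in> D (k + 1) w"
        then have iD: "i \<in> D k w" "i \<noteq> y" using DD by auto
        then have "set (W i) \<inter> set (W y) = {}" using W(2) yD unfolding coll_def by blast
        then show "set (W i) \<inter> set ?acc = {}" using W(3) iD by auto
      qed
      define s45 where "s45 = (vr t 45 + ar t 1 y) mod M"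
      have c3: "islist (a 4) (ar t 2 y) ?acc"
        using islist_append[OF i'(1,2,3) W(6) disj] i'(4) by (simp add: a_def tt_def)
      have c4: "[sum_list (map inp ?acc) = int g * s45] (mod n)"
      proof -
        have "[sum_list (map inp ?acc) = int g * ar t 1 y + int g * vr t 45] (mod n)"
          using cong_add[OF i'(9) W(11)] by simp
        also have "int g * ar t 1 y + int g * vr t 45 = int g * (vr t 45 + ar t 1 y)" by (simp add: algebra_simps)
        \<comment> \<open>Reduction of the sum modulo \<open>M\<close> changes \<open>g\<close>
          times the sum by a multiple of \<open>g * M = n\<close>.\<close>
        also have "[\<dots> = int g * s45] (mod n)"
          unfolding s45_def b'(5)[symmetric] cong_def by (simp only: mult_mod_right mod_mod_trivial)
        finally show ?thesis .
      qed
      have c5: "[s45 = sz' (k + 1)] (mod M)"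
      proof -
        have "[s45 = ar t 1 y + vr t 45] (mod M)" by (simp add: s45_def cong_def add.commute)
        also have "[ar t 1 y + vr t 45 = V0 y + sz' k] (mod M)" using W(12) V0y by (intro cong_add) auto
        finally show ?thesis using nk by simp
      qed
      have c6: "int (length ?acc) = int g * (k + 1 - nz (k + 1))"
        using W(8) i'(5) nk by (simp add: algebra_simps)
      define t47 where "t47 = (if vr t 47 < 0 then tt else vr t 47)"
      have c7: "t47 = last ?acc"
      proof (cases "acc = []")
        case True
        then show ?thesis using W(7) i'(4) by (simp add: t47_def tt_def)
      next
        case False
        then have "vr t 47 = last acc" "last acc \<in> set acc" using W(7) by auto
        then have "0 \<le> vr t 47" using W(5) by fastforce
        then show ?thesis using False \<open>vr t 47 = last acc\<close> by (simp add: t47_def)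
      qed
      have "Inv (k + 1) ((vr t)(45 := s45, 46 := ar t 2 y, 47 := t47)) a"
        unfolding Inv_def
      proof (intro conjI exI[of _ W] exI[of _ ?acc])
        show "((vr t)(45 := s45, 46 := ar t 2 y, 47 := t47)) 48 = off + nl - 1 - nz (k + 1)" using W(1) nk by (simp add: w_def)
        show "\<forall>i. off \<le> i \<and> i < off + nl - (k + 1) \<longrightarrow> a 1 i = V0 i" using W(13) by (auto simp: a_def)
        show "distinct ?acc" using W(4) i'(2) disj by simp
        show "set ?acc \<subseteq> {1..2 * n - 1}" using W(5) i'(6) by simp
        show "if ?acc = [] then ((vr t)(45 := s45, 46 := ar t 2 y, 47 := t47)) 47 = -1
           else ((vr t)(45 := s45, 46 := ar t 2 y, 47 := t47)) 47 = last ?acc" using c7 i'(1) by simp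
        show "0 \<le> ((vr t)(45 := s45, 46 := ar t 2 y, 47 := t47)) 45" "((vr t)(45 := s45, 46 := ar t 2 y, 47 := t47)) 45 < M"
          using b'(2) by (auto simp: s45_def)
      qed (use c1 c2 c3 c4 c5 c6 in \<open>auto simp: w_def[symmetric]\<close>)
      moreover have "fits (vr t 45 + ar t 1 y)" using W(9,10) i'(7,8) b' by (intro fits_small) auto
      moreover have "fits s45" unfolding s45_def using b' by (intro fits_mod) auto
      ultimately show ?thesis unfolding wp_simps(4)
        using False fr k ft yb tlb xy
        by (cases "vr t 47 < 0") (simp_all add: wp_simps y_def[symmetric] x_def[symmetric] Icong a_def tt_def s45_def t47_def)
    qed
  qed
  let ?T = "\<lambda>t. \<exists>W'. coll inp n (\<lambda>i. if i < r + 1 then g * nat p else g) (\<lambda>i. if i < r + 1 then M div p else M)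
        ({0..<r + 1} \<union> {(r + 1) * p..<2 * M - 1}) W' (ar t) \<and> int (tk t) = int (tk s) + nl"
  let ?s = "s\<lparr>vr := (vr s)(45 := 0, 46 := -1, 47 := -1, 48 := off + nl - 1)\<rparr>"
  have "wp (For 30 10 (31 ::= V 7 .+ V 10 .- N 1 .- V 30 ;;
       Cond (Eq (A 8 (V 10 .- N 1 .- V 30)) (N 0))
        (Sto 1 (V 48) (A 1 (V 31)) ;; Sto 2 (V 48) (A 2 (V 31)) ;; Sto 3 (V 48) (A 3 (V 31)) ;; 48 ::= V 48 .- N 1)
        (45 ::= (V 45 .+ A 1 (V 31)) .mod V 3 ;; Sto 4 (A 3 (V 31)) (V 46) ;; 46 ::= A 2 (V 31) ;;
         Cond (Lt (V 47) (N 0)) (47 ::= A 3 (V 31)) Skip)))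
     (wp (Sto 1 (V 6) (V 45 .div V 4)) (wp (Sto 2 (V 6) (V 46)) (wp (Sto 3 (V 6) (V 47)) ?T))) ?s"
  proof (rule wp_For[where P = "\<lambda>k t. Inv k (vr t) (ar t) \<and> int (tk t) = int (tk s) + k"], goal_cases)
    case 1
    have D0: "D 0 (off + nl - 1) = {0..<r} \<union> {off..<2 * M - 1}" using nlp by (auto simp: D_def)
    have "Inv 0 ((vr s)(45 := 0, 46 := -1, 47 := -1, 48 := off + nl - 1, 30 := 0)) (ar s)"
      unfolding Inv_def
    proof (intro conjI exI[of _ W] exI[of _ "[]"])
      show "coll inp n gz mz (D 0 (((vr s)(45 := 0, 46 := -1, 47 := -1, 48 := off + nl - 1, 30 := 0)) 48)) W (ar s)"
        using C by (simp add: D0 r_def[symmetric] off_def[symmetric] M_def[symmetric])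
    qed (use b' in \<open>auto simp: nz_def sz'_def V0_def\<close>)
    then show ?case by (simp add: fun_upd_twist)
  next
    case (2 k t)
    have fr: "vr t 7 = off" "vr t 10 = nl" "vr t 3 = M" "ar t 8 = bit" "vr s 10 = nl"
      using frameD[OF 2(5)] nlp by (auto simp: off_def M_def bit_def)
    let ?t = "t\<lparr>tk := tk t + 1\<rparr>"
    show ?case
      by (rule wp_conseq[OF step[of k ?t]]) (use 2 fr in \<open>auto simp: Icong\<close>)
  next
    case (3 t)
    have fr: "vr t 6 = r" "vr t 4 = p" using frameD[OF 3(3)] by (auto simp: r_def p_def)
    have I: "Inv nl (vr t) (ar t)" "int (tk t) = int (tk s) + nl" using 3(1) nlp by auto
    define w where "w = vr t 48"
    obtain W acc where W: "w = off + nl - 1 - nz nl" "coll inp n gz mz (D nl w) W (ar t)" "\<forall>i\<in>D nl w. set (W i) \<inter> set acc = {}"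
      "distinct acc" "set acc \<subseteq> {1..2 * n - 1}" "islist (ar t 4) (vr t 46) acc" "if acc = [] then vr t 47 = -1 else vr t 47 = last acc"
      "int (length acc) = int g * (nl - nz nl)" "0 \<le> vr t 45" "vr t 45 < M" "[sum_list (map inp acc) = int g * vr t 45] (mod n)"
      "[vr t 45 = sz' nl] (mod M)"
      using I(1) unfolding Inv_def w_def by blast
    have we: "w = off + p - 1" using W(1) nznl by (simp add: nl_def)
    have off1: "(r + 1) * p = off + p" using b'(8) by (simp add: algebra_simps)
    have De: "D nl w = {0..<r} \<union> {off + p..<2 * M - 1}" unfolding D_def we by auto
    have la: "length acc = g * nat p" using W(8) nznl b'(1) by (simp add: nl_def) (metis int_nat_eq less_imp_le of_nat_eq_iff of_nat_mult order_less_trans zero_less_one)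
    have an: "acc \<noteq> []" using la n0 b'(1) by auto
    \<comment> \<open>The selection makes the sum divisible by \<open>p\<close>; the quotient is the
      value of the new group, which has \<open>g * p\<close> indices.\<close>
    have pd: "p dvd vr t 45"
    proof -
      have "p dvd M" using b'(4) .
      then have "[vr t 45 = sz' nl] (mod p)" using W(12) cong_dvd_modulus by blast
      moreover have "[sz' nl = 0] (mod p)" using bits'(3) by (simp add: sz'_def)
      ultimately show ?thesis by (meson cong_0_iff cong_trans)
    qed
    define v where "v = vr t 45 div p"
    have v: "vr t 45 = p * v" "0 \<le> v" "v < q"
    proof -
      show e: "vr t 45 = p * v" using pd by (simp add: v_def)
      show "0 \<le> v" using W(9) b'(1) by (simp add: v_def pos_imp_zdiv_nonneg_iff)
      have "p * v < p * q" using e W(10) Mq(1) by (simp add: mult.commute)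
      then show "v < q" using b'(1) by simp
    qed
    have itn: "itm inp n (ar t 4) (g * nat p) q v (vr t 46) (vr t 47) acc"
      unfolding itm_def using an W(4-7) la v(2,3) W(11) b'(1) unfolding v(1) by (auto simp: mult.assoc)
    define a where "a = (ar t)(1 := (ar t 1)(r := v), 2 := (ar t 2)(r := vr t 46), 3 := (ar t 3)(r := vr t 47))"
    have op: "r < off + p" using rp b'(1) by simp
    have "coll inp n (\<lambda>i. if i < r + 1 then g * nat p else g) (\<lambda>i. if i < r + 1 then M div p else M)
        ({0..<r + 1} \<union> {(r + 1) * p..<2 * M - 1}) (W(r := acc)) a"
      unfolding coll_def off1
    proof (intro conjI ballI impI)
      fix i assume i: "i \<in> {0..<r + 1} \<union> {off + p..<2 * M - 1}"
      show "itm inp n (a 4) (if i < r + 1 then g * nat p else g) (if i < r + 1 then M div p else M) (a 1 i) (a 2 i) (a 3 i) ((W(r := acc)) i)"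
      proof (cases "i = r")
        case True
        then show ?thesis using itn by (simp add: a_def q_def)
      next
        case False
        then have "i \<in> D nl w" using i unfolding De by auto
        then have "itm inp n (ar t 4) (gz i) (mz i) (ar t 1 i) (ar t 2 i) (ar t 3 i) (W i)" using W(2) unfolding coll_def by blast
        moreover have "(i < r + 1) = (i < r)" using False by auto
        ultimately show ?thesis using False by (cases "i < r") (simp_all add: a_def gz r_def[symmetric] p_def[symmetric] M_def[symmetric])
      qed
    next
      fix i j assume ij: "i \<in> {0..<r + 1} \<union> {off + p..<2 * M - 1}" "j \<in> {0..<r + 1} \<union> {off + p..<2 * M - 1}" "i \<noteq> j"
      have pw: "i \<in> D nl w \<Longrightarrow> j \<in> D nl w \<Longrightarrow> i \<noteq> j \<Longrightarrow> set (W i) \<inter> set (W j) = {}" for i j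
        using W(2) unfolding coll_def by blast
      have w3: "i \<in> D nl w \<Longrightarrow> set (W i) \<inter> set acc = {}" for i using W(3) by blast
      have "i = r \<or> i \<in> D nl w" "j = r \<or> j \<in> D nl w" using ij unfolding De by auto
      then show "set ((W(r := acc)) i) \<inter> set ((W(r := acc)) j) = {}"
        using pw[of i j] w3[of i] w3[of j] ij(3) by auto
    qed
    moreover have "0 \<le> r" "r < sz" using b' rp op nlp by (auto simp: nl_def)
    moreover have "fits v"
    proof (rule fits_small)
      have "q * 1 \<le> q * p" using Mq b'(1) by (intro mult_left_mono) auto
      then have "v \<le> M" using v(3) Mq(1) by linarith
      then show "\<bar>v\<bar> \<le> 100 * sz" using v(2) b'(2,3) by linarith
    qed
    ultimately show ?case using fr I(2) b'(1) unfolding wp_simps(3)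
      by (auto simp: v_def[symmetric] a_def fun_upd_twist intro!: exI[of _ "W(r := acc)"])
  qed (use nlp b' rp in \<open>auto simp: nl_def\<close>)
  moreover have "fits (off + nl)" "fits (off + nl - 1)" using nlp rp b' by (auto intro!: fits_small)
  moreover have "vr s 7 = off" "vr s 10 = nl" using nlp by (auto simp: off_def)
  ultimately have "wp MERGE ?T s" unfolding MERGE_def wp_simps(4) wp_simps(2) by simp
  then show ?thesis
    by (rule wp_conseq) (unfold r_def p_def M_def, elim exE conjE, rule Q, assumption, simp add: nlp(2), assumption)
qed

end

section \<open>The whole program\<close>

lemma coll_cong:
  assumes "coll inp n gz mz D W a" "D' \<subseteq> D" "\<And>i. i \<in> D' \<Longrightarrow> gz' i = gz i" "\<And>i. i \<in> D' \<Longrightarrow> mz' i = mz i"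
    "a' 1 = a 1" "a' 2 = a 2" "a' 3 = a 3" "a' 4 = a 4"
  shows "coll inp n gz' mz' D' W a'"
  using assms unfolding coll_def by (simp add: subset_iff)

text \<open>
  Variable 2 is \<open>n\<close>, 3 the product \<open>M\<close> of the prime factors that remain, 4 the current divisor \<open>p\<close>,
  6 the number of the window and 7 its first item. An item is a list of \<open>n div M\<close> indices whose
  values add up to \<open>n div M\<close> times a number below \<open>M\<close>, which is kept in array 1; arrays 2, 3 and 4
  hold the heads, the ends and the successor function of the lists.
\<close>

definition WINDOW :: com where
  "WINDOW = (7 ::= V 6 .* V 4 ;; PRIME ;; MERGE)"

lemma fresh_PRIME [simp]:
  "3 \<notin> modv PRIME" "4 \<notin> modv PRIME" "6 \<notin> modv PRIME" "7 \<notin> modv PRIME"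
  "Suc 0 \<notin> moda PRIME" "2 \<notin> moda PRIME" "3 \<notin> moda PRIME" "4 \<notin> moda PRIME"
  by (auto dest!: subsetD[OF mod_PRIME(1)] subsetD[OF mod_PRIME(2)])

lemma mod_WINDOW: "modv WINDOW \<subseteq> {7..42} \<union> {45..48}" "moda WINDOW \<subseteq> {1..22}"
  using mod_PRIME by (auto simp: WINDOW_def)

lemma fresh_WINDOW [simp]:
  "3 \<notin> modv WINDOW" "4 \<notin> modv WINDOW" "5 \<notin> modv WINDOW" "6 \<notin> modv WINDOW" "44 \<notin> modv WINDOW"
  by (auto dest!: subsetD[OF mod_WINDOW(1)])

definition ROUND :: com where
  "ROUND = (5 ::= V 3 .div V 4 ;; 44 ::= V 5 .+ V 5 .- N 1 ;; For 6 44 WINDOW ;; 3 ::= V 5)"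

lemma mod_ROUND: "modv ROUND \<subseteq> {3} \<union> {5..48}" "moda ROUND \<subseteq> {1..22}"
  using mod_WINDOW by (auto simp: ROUND_def)

lemma fresh_ROUND [simp]: "4 \<notin> modv ROUND"
  by (auto dest!: subsetD[OF mod_ROUND(1)])

definition MAIN :: com where
  "MAIN = Loop (Lt (N 1) (V 3)) (Cond (Eq (V 3 .mod V 4) (N 0)) ROUND (4 ::= V 4 .+ N 1))"

lemma mod_MAIN: "modv MAIN \<subseteq> {3..48}"
  using mod_ROUND by (auto simp: MAIN_def)

lemma fresh_MAIN [simp]: "2 \<notin> modv MAIN"
  by (auto dest!: subsetD[OF mod_MAIN])

definition INIT :: com where
  "INIT = (43 ::= V 2 .+ V 2 .- N 1 ;;
     For 30 43 (Sto 1 (V 30) (A 0 (V 30 .+ N 1) .mod V 2) ;; Sto 2 (V 30) (V 30 .+ N 1) ;;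
       Sto 3 (V 30) (V 30 .+ N 1) ;; Sto 4 (V 30 .+ N 1) (N (-1))) ;;
     3 ::= V 2 ;; 4 ::= N 2)"

text \<open>The result cells lie in array 0, the input; it may be overwritten because the values
  were copied to array 1 at the start.\<close>

definition OUTPUT :: com where
  "OUTPUT = (31 ::= A 2 (N 0) ;; For 30 2 (Sto 0 (V 30 .+ N 1) (V 31) ;; 31 ::= A 4 (V 31)))"

definition EGZ :: com where
  "EGZ = (INIT ;; MAIN ;; OUTPUT)"

context ram
begin

lemma wp_WINDOW:
  fixes g :: nat
  assumes b: "prime (vr s 4)" "0 < vr s 3" "vr s 4 dvd vr s 3" "int g * vr s 3 = n" "0 < n" "8 * n \<le> sz"
      "0 \<le> vr s 6" "vr s 6 < 2 * (vr s 3 div vr s 4) - 1"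
    and C: "coll inp n (\<lambda>i. if i < vr s 6 then g * nat (vr s 4) else g) (\<lambda>i. if i < vr s 6 then vr s 3 div vr s 4 else vr s 3)
        ({0..<vr s 6} \<union> {vr s 6 * vr s 4..<2 * vr s 3 - 1}) W (ar s)"
    and Q: "\<And>t W'. coll inp n (\<lambda>i. if i < vr s 6 + 1 then g * nat (vr s 4) else g) (\<lambda>i. if i < vr s 6 + 1 then vr s 3 div vr s 4 else vr s 3)
        ({0..<vr s 6 + 1} \<union> {(vr s 6 + 1) * vr s 4..<2 * vr s 3 - 1}) W' (ar t) \<Longrightarrow>
      int (tk t) \<le> int (tk s) + 160000202 * vr s 4 \<Longrightarrow> Q t"
  shows "wp WINDOW Q s"
proof -
  define p where "p = vr s 4"
  define M where "M = vr s 3"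
  define r where "r = vr s 6"
  note b' = b[folded p_def M_def r_def]
  note C' = C[folded p_def M_def r_def]
  have p1: "1 < p" using b'(1) prime_gt_1_int by blast
  have Mn: "M \<le> n"
  proof -
    have "0 < g" using b'(4,5) by (cases g) auto
    then have "1 * M \<le> int g * M" using b'(2) by (intro mult_right_mono) auto
    then show ?thesis using b'(4) by simp
  qed
  \<comment> \<open>As \<open>r\<close> is at most \<open>2 * (M div p) - 2\<close>, at least
    \<open>2 * p\<close> positions remain, so the window and its \<open>2 * p - 1\<close> items
    fit.\<close>
  have rp: "0 \<le> r * p" "r * p + 2 * p \<le> 2 * M"
  proof -
    show "0 \<le> r * p" using b'(7) p1 by simp
    have "(r + 2) * p \<le> (2 * (M div p)) * p" using b'(8) p1 by (intro mult_right_mono) auto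
    also have "\<dots> = 2 * M" using b'(3) by simp
    finally show "r * p + 2 * p \<le> 2 * M" by (simp add: algebra_simps)
  qed
  have pM: "p \<le> M" using b'(2,3) by (simp add: zdvd_imp_le)
  let ?s = "s\<lparr>vr := (vr s)(7 := r * p)\<rparr>"
  have "wp PRIME (wp MERGE Q) ?s"
  proof (rule wp_PRIME, goal_cases)
    case (5 t)
    note t = 5[simplified, folded p_def]
    have fr: "vr t 3 = M" "vr t 4 = p" "vr t 6 = r" "vr t 7 = r * p"
      using frameD(1)[OF 5(6)] by (auto simp: p_def M_def r_def)
    have fa: "ar t 1 = ar s 1" "ar t 2 = ar s 2" "ar t 3 = ar s 3" "ar t 4 = ar s 4"
      using frameD(2)[OF 5(6)] by auto
    have Ct: "coll inp n (\<lambda>i. if i < r then g * nat p else g) (\<lambda>i. if i < r then M div p else M) ({0..<r} \<union> {r * p..<2 * M - 1}) W (ar t)"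
      by (rule coll_cong[OF C']) (simp_all only: fa order_refl)
    show ?case
    proof (rule wp_MERGE[where g = g and n = n and inp = inp and W = W and
          gz = "\<lambda>i. if i < r then g * nat p else g" and mz = "\<lambda>i. if i < r then M div p else M"], goal_cases)
      case (17 u W')
      note u = 17[unfolded fr]
      have "int (tk u) \<le> int (tk s) + 160000202 * p" using u(2) t(4,5) by linarith
      then show ?case using u(1) by (intro Q) (simp_all only: p_def M_def r_def)
    qed (use b' p1 rp pM Mn t Ct fr fa in \<open>simp_all cong: if_cong\<close>)
  qed (use b' p1 rp pM Mn in \<open>simp_all add: p_def[symmetric]\<close>)
  moreover have "fits (r * p)" using rp p1 Mn b' by (intro fits_small) linarith
  ultimately show ?thesis unfolding WINDOW_def wp_simps(4) wp_simps(2) by (simp add: p_def r_def)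
qed

lemma wp_ROUND:
  fixes g :: nat
  assumes b: "prime (vr s 4)" "0 < vr s 3" "vr s 4 dvd vr s 3" "int g * vr s 3 = n" "0 < n" "8 * n \<le> sz"
    and C: "coll inp n (\<lambda>_. g) (\<lambda>_. vr s 3) {0..<2 * vr s 3 - 1} W (ar s)"
    and Q: "\<And>t W'. coll inp n (\<lambda>_. g * nat (vr s 4)) (\<lambda>_. vr s 3 div vr s 4) {0..<2 * (vr s 3 div vr s 4) - 1} W' (ar t) \<Longrightarrow>
      vr t 3 = vr s 3 div vr s 4 \<Longrightarrow> int (tk t) \<le> int (tk s) + 320000406 * vr s 3 \<Longrightarrow> frame ROUND s t \<Longrightarrow> Q t"
  shows "wp ROUND Q s"
proof -
  define p where "p = vr s 4"
  define M where "M = vr s 3"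
  define q where "q = M div p"
  note b' = b[folded p_def M_def]
  note C' = C[folded p_def M_def]
  have p1: "1 < p" using b'(1) prime_gt_1_int by blast
  have Mq: "M = q * p" "0 < q" using b'(2,3) p1 by (auto simp: q_def elim!: dvdE simp: zero_less_mult_iff)
  have qM: "q \<le> M" using Mq p1 mult_left_mono[of 1 p q] by simp
  have Mn: "M \<le> n"
  proof -
    have "0 < g" using b'(4,5) by (cases g) auto
    then have "1 * M \<le> int g * M" using b'(2) by (intro mult_right_mono) auto
    then show ?thesis using b'(4) by simp
  qed
  have qs: "0 < q" "8 * q \<le> sz" using Mq(2) qM Mn b'(6) by linarith+
  define Cl where "Cl = (\<lambda>k a. \<exists>W. coll inp n (\<lambda>i. if i < k then g * nat p else g) (\<lambda>i. if i < k then q else M)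
     ({0..<k} \<union> {k * p..<2 * M - 1}) W a)"
  let ?T = "\<lambda>t. (\<exists>W'. coll inp n (\<lambda>_. g * nat p) (\<lambda>_. q) {0..<2 * q - 1} W' (ar t)) \<and> vr t 3 = q \<and> int (tk t) \<le> int (tk s) + 320000406 * M"
  let ?s = "s\<lparr>vr := (vr s)(5 := q, 44 := 2 * q - 1)\<rparr>"
  have "wp (For 6 44 WINDOW) (wp (3 ::= V 5) ?T) ?s"
  proof (rule wp_For[where P = "\<lambda>k t. Cl k (ar t) \<and> int (tk t) \<le> int (tk s) + 160000203 * p * k"], goal_cases)
    case 1
    have "coll inp n (\<lambda>i. if i < 0 then g * nat p else g) (\<lambda>i. if i < 0 then q else M) ({0..<0} \<union> {0 * p..<2 * M - 1}) W (ar s)"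
      by (rule coll_cong[OF C']) auto
    then have "Cl 0 (ar s)" unfolding Cl_def by blast
    then show ?case by simp
  next
    case (2 k t)
    have fr: "vr t 3 = M" "vr t 4 = p" using frameD(1)[OF 2(5)] by (auto simp: p_def M_def)
    have k: "vr t 6 = k" "0 \<le> k" "k < 2 * q - 1" using 2 by auto
    obtain W1 where W1: "coll inp n (\<lambda>i. if i < k then g * nat p else g) (\<lambda>i. if i < k then q else M)
     ({0..<k} \<union> {k * p..<2 * M - 1}) W1 (ar t)" using 2(3) unfolding Cl_def by blast
    let ?t = "t\<lparr>tk := tk t + 1\<rparr>"
    show ?case
    proof (rule wp_WINDOW[where g = g and n = n and inp = inp and W = W1], goal_cases)
      case (10 u W2)
      note u = 10[simplified, unfolded fr k, folded q_def]
      have "Cl (k + 1) (ar u)" unfolding Cl_def using 10(1) by (intro exI[of _ W2]) (simp add: fr k q_def cong: if_cong)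
      moreover have "int (tk u) \<le> int (tk s) + 160000203 * p * (k + 1)"
        using 10(2) 2(3) p1 by (simp add: fr algebra_simps)
      ultimately show ?case by simp
    qed (use b' fr k W1 in \<open>simp_all add: q_def cong: if_cong\<close>)
  next
    case (3 t)
    have fr: "vr t 5 = q" using frameD(1)[OF 3(3)] by auto
    have c: "Cl (2 * q - 1) (ar t)" "int (tk t) \<le> int (tk s) + 160000203 * p * (2 * q - 1)" using 3(1) by auto
    obtain W1 where W1: "coll inp n (\<lambda>i. if i < 2 * q - 1 then g * nat p else g) (\<lambda>i. if i < 2 * q - 1 then q else M)
     ({0..<2 * q - 1} \<union> {(2 * q - 1) * p..<2 * M - 1}) W1 (ar t)" using c(1) unfolding Cl_def by blast
    have "coll inp n (\<lambda>_. g * nat p) (\<lambda>_. q) {0..<2 * q - 1} W1 (ar t)"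
      by (rule coll_cong[OF W1]) auto
    \<comment> \<open>The \<open>2 * q - 1\<close> windows of cost proportional to \<open>p\<close>
      stay below \<open>2 * q * p = 2 * M\<close>.\<close>
    moreover have "160000203 * p * (2 * q - 1) \<le> 320000406 * M"
    proof -
      have "160000203 * p * (2 * q - 1) = 320000406 * (q * p) - 160000203 * p" by (simp add: algebra_simps)
      then show ?thesis using p1 Mq by simp
    qed
    ultimately show ?case using fr c(2) unfolding wp_simps(2) by auto
  qed (use qs in auto)
  moreover have "fits q" "fits (q + q)" "fits (q + q - 1)" using qs by (auto intro!: fits_small)
  ultimately have "wp ROUND ?T s" unfolding ROUND_def wp_simps(4) wp_simps(2)
    by (simp add: q_def p_def M_def)
  then show ?thesis
  proof (rule wp_conseq, goal_cases)
    case (1 t)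
    then obtain W' where "coll inp n (\<lambda>_. g * nat p) (\<lambda>_. q) {0..<2 * q - 1} W' (ar t)" "vr t 3 = q" "int (tk t) \<le> int (tk s) + 320000406 * M"
      by blast
    then show ?case using 1(2) unfolding q_def p_def M_def by (intro Q)
  qed
qed

text \<open>A round divides \<open>M\<close> by a prime and so at least halves it; its cost, linear
  in \<open>M\<close>, can be charged to the decrease of \<open>M\<close>. Increments of the trial
  divisor are charged to its growth, which is at most \<open>n\<close>.\<close>

lemma wp_MAIN:
  assumes b: "vr s 3 = n" "vr s 4 = 2" "0 < n" "8 * n \<le> sz"
    and C: "coll inp n (\<lambda>_. 1) (\<lambda>_. n) {0..<2 * n - 1} W (ar s)"
    and Q: "\<And>t W'. coll inp n (\<lambda>_. nat n) (\<lambda>_. 1) {0..<1} W' (ar t) \<Longrightarrow>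
      int (tk t) \<le> int (tk s) + 640000815 * n \<Longrightarrow> frame MAIN s t \<Longrightarrow> Q t"
  shows "wp MAIN Q s"
proof -
  \<comment> \<open>Twice 320000407, the cost of a round per unit of \<open>M\<close>, because
    \<open>M\<close> loses at least half of its value.\<close>
  define K :: int where "K = 640000814"
  define Inv where "Inv = (\<lambda>M p a. 1 \<le> M \<and> M \<le> n \<and> 2 \<le> p \<and> p \<le> n + 1 \<and> (\<forall>d. 2 \<le> d \<and> d < p \<longrightarrow> \<not> d dvd M) \<and>
    (\<exists>g W. int g * M = n \<and> coll inp n (\<lambda>_. g) (\<lambda>_. M) {0..<2 * M - 1} W a))"
  define tick where "tick = (\<lambda>t :: st. int (tk t) \<le> int (tk s) + K * (n - vr t 3) + (vr t 4 - 2))"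
  let ?T = "\<lambda>t. (\<exists>W'. coll inp n (\<lambda>_. nat n) (\<lambda>_. 1) {0..<1} W' (ar t)) \<and> int (tk t) \<le> int (tk s) + 640000815 * n"
  have "wp MAIN ?T s" unfolding MAIN_def
  proof (rule wp_Loop[where I = "\<lambda>t. Inv (vr t 3) (vr t 4) (ar t) \<and> tick t" and m = "\<lambda>t. nat (vr t 3 + (n + 2 - vr t 4))"], goal_cases)
    case 1
    have "\<exists>g W. int g * n = n \<and> coll inp n (\<lambda>_. g) (\<lambda>_. n) {0..<2 * n - 1} W (ar s)"
      using C by (intro exI[of _ 1] exI[of _ W]) auto
    then have "Inv n 2 (ar s)" using b unfolding Inv_def by auto
    then show ?case using b by (simp add: tick_def)
  next
    case (2 t)
    then show ?case by simp
  next
    case (3 t)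
    define M where "M = vr t 3"
    define p where "p = vr t 4"
    have I: "M \<le> n" "2 \<le> p" "p \<le> n + 1" "\<forall>d. 2 \<le> d \<and> d < p \<longrightarrow> \<not> d dvd M"
      "\<exists>g W. int g * M = n \<and> coll inp n (\<lambda>_. g) (\<lambda>_. M) {0..<2 * M - 1} W (ar t)"
      and tc: "int (tk t) \<le> int (tk s) + K * (n - M) + (p - 2)"
      using 3(1) unfolding Inv_def tick_def M_def p_def by blast+
    have M1: "1 < M" using 3(3) by (simp add: M_def)
    obtain g W where W: "int g * M = n" "coll inp n (\<lambda>_. g) (\<lambda>_. M) {0..<2 * M - 1} W (ar t)" using I(5) by blast
    let ?t = "t\<lparr>tk := tk t + 1\<rparr>"
    have ft: "fits (M mod p)" using I b by (intro fits_mod) auto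
    show ?case
    proof (cases "p dvd M")
      case True
      \<comment> \<open>No number from 2 to \<open>p - 1\<close> divides \<open>M\<close>; a proper
        divisor of \<open>p\<close> would.\<close>
      have pr: "prime p" unfolding prime_int_iff'
        using I(2,4) True dvd_trans by (metis atLeastLessThan_iff int_one_le_iff_zero_less linorder_not_le one_le_numeral order_trans verit_comp_simplify1(3) zless_add1_eq one_add_one)
      define q where "q = M div p"
      have Mq: "M = q * p" using True by (simp add: q_def)
      have q0: "0 < q" using Mq M1 I(2) by (smt (verit) mult_nonneg_nonpos2)
      have q2: "2 * q \<le> M" using Mq q0 I(2) mult_left_mono[of 2 p q] by simp
      have "wp ROUND (\<lambda>t'. (Inv (vr t' 3) (vr t' 4) (ar t') \<and> tick t') \<and> nat (vr t' 3 + (n + 2 - vr t' 4)) < nat (vr t 3 + (n + 2 - vr t 4))) ?t"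
      proof (rule wp_ROUND[where g = g and n = n and inp = inp and W = W], goal_cases)
        case (8 u W2)
        have u: "coll inp n (\<lambda>_. g * nat p) (\<lambda>_. q) {0..<2 * q - 1} W2 (ar u)" "vr u 3 = q" "int (tk u) \<le> int (tk t) + 1 + 320000406 * M"
          using 8(1-3) by (simp_all add: q_def p_def M_def)
        have u4: "vr u 4 = p" using frameD(1)[OF 8(4), of 4] by (simp add: p_def)
        have "int (g * nat p) * q = n" using W(1) Mq I(2) by (simp add: algebra_simps)
        then have ex: "\<exists>g W. int g * q = n \<and> coll inp n (\<lambda>_. g) (\<lambda>_. q) {0..<2 * q - 1} W (ar u)" using u(1) by blast
        have dv: "\<forall>d. 2 \<le> d \<and> d < p \<longrightarrow> \<not> d dvd q" using I(4) Mq by auto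
        have "Inv q p (ar u)" unfolding Inv_def using ex dv q0 q2 I by auto
        moreover have "int (tk u) \<le> int (tk s) + K * (n - q) + (p - 2)"
        proof -
          have "1 + 320000406 * M \<le> 320000407 * M" using M1 by simp
          also have "\<dots> \<le> K * (M - q)" using q2 by (simp add: K_def)
          finally have "1 + 320000406 * M \<le> K * (M - q)" .
          moreover have "K * (n - q) = K * (n - M) + K * (M - q)" by (simp add: algebra_simps)
          ultimately show ?thesis using tc u(3) by linarith
        qed
        moreover have "nat (q + (n + 2 - p)) < nat (M + (n + 2 - p))" using q2 q0 I(3) by auto
        ultimately show ?case using u(2) u4 by (simp add: tick_def M_def p_def)
      qed (use b I W M1 True pr in \<open>simp_all add: M_def[symmetric] p_def[symmetric]\<close>)
      then show ?thesis using True ft by (intro wp_CondT) (simp_all add: M_def p_def)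
    next
      case False
      have "p < M"
      proof -
        have "p \<le> M" using I(4) M1 by (metis dvd_refl int_one_le_iff_zero_less linorder_not_le one_add_one zless_imp_add1_zle)
        moreover have "p \<noteq> M" using False by auto
        ultimately show ?thesis by simp
      qed
      moreover have dv: "\<forall>d. 2 \<le> d \<and> d < p + 1 \<longrightarrow> \<not> d dvd M" using I(4) False by (metis zless_add1_eq)
      ultimately have "Inv M (p + 1) (ar t)" unfolding Inv_def using I M1 by auto
      moreover have "fits (p + 1)" using I b by (intro fits_small) auto
      ultimately have "wp (4 ::= V 4 .+ N 1) (\<lambda>t'. (Inv (vr t' 3) (vr t' 4) (ar t') \<and> tick t') \<and> nat (vr t' 3 + (n + 2 - vr t' 4)) < nat (vr t 3 + (n + 2 - vr t 4))) ?t"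
        unfolding wp_simps(2) using tc I M1 by (simp add: tick_def M_def[symmetric] p_def[symmetric])
      then show ?thesis using False ft by (intro wp_CondF) (simp_all add: M_def p_def dvd_eq_mod_eq_0)
    qed
  next
    case (4 t)
    have I: "1 \<le> vr t 3" "vr t 4 \<le> n + 1" "\<exists>g W. int g * vr t 3 = n \<and> coll inp n (\<lambda>_. g) (\<lambda>_. vr t 3) {0..<2 * vr t 3 - 1} W (ar t)"
      "int (tk t) \<le> int (tk s) + K * (n - vr t 3) + (vr t 4 - 2)"
      using 4(1) unfolding Inv_def tick_def by blast+
    have e: "vr t 3 = 1" using 4(3) I(1) by simp
    obtain g W where W: "int g = n" "coll inp n (\<lambda>_. g) (\<lambda>_. 1) {0..<1} W (ar t)" using I(3) unfolding e by auto
    have "g = nat n" using W(1) by auto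
    moreover have "int (tk t) \<le> int (tk s) + 640000815 * n" using I(2,4) b(3) unfolding e K_def by simp
    ultimately show ?case using W(2) by blast
  qed
  then show ?thesis
  proof (rule wp_conseq, goal_cases)
    case (1 t)
    then show ?case using Q by blast
  qed
qed

lemma wp_INIT:
  assumes b: "vr s 2 = n" "0 < n" "8 * n \<le> sz"
    and Q: "\<And>t W'. coll (ar s 0) n (\<lambda>_. 1) (\<lambda>_. n) {0..<2 * n - 1} W' (ar t) \<Longrightarrow> vr t 3 = n \<Longrightarrow> vr t 4 = 2 \<Longrightarrow> vr t 2 = n \<Longrightarrow>
      int (tk t) \<le> int (tk s) + 2 * n \<Longrightarrow> Q t"
  shows "wp INIT Q s"
proof -
  define inp where "inp = ar s 0"
  define J where "J = (\<lambda>k (a :: nat \<Rightarrow> int \<Rightarrow> int). a 0 = inp \<and> (\<forall>i. 0 \<le> i \<and> i < k \<longrightarrow>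
     a 1 i = inp (i + 1) mod n \<and> a 2 i = i + 1 \<and> a 3 i = i + 1 \<and> a 4 (i + 1) = -1))"
  let ?s = "s\<lparr>vr := (vr s)(43 := 2 * n - 1)\<rparr>"
  have "wp (For 30 43 (Sto 1 (V 30) (A 0 (V 30 .+ N 1) .mod V 2) ;; Sto 2 (V 30) (V 30 .+ N 1) ;;
       Sto 3 (V 30) (V 30 .+ N 1) ;; Sto 4 (V 30 .+ N 1) (N (-1)))) (wp (3 ::= V 2) (wp (4 ::= N 2) Q)) ?s"
  proof (rule wp_For[where P = "\<lambda>k t. J k (ar t) \<and> int (tk t) = int (tk s) + k"], goal_cases)
    case 1
    then show ?case by (simp add: J_def inp_def)
  next
    case (2 k t)
    have v2: "vr t 2 = n" using frameD(1)[OF 2(5), of 2] b by simp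
    have k: "0 \<le> k" "k < 2 * n - 1" "vr t 30 = k" using 2 by auto
    have J: "J k (ar t)" using 2(3) by simp
    define a where "a = (ar t)(1 := (ar t 1)(k := inp (k + 1) mod n), 2 := (ar t 2)(k := k + 1), 3 := (ar t 3)(k := k + 1), 4 := (ar t 4)(k + 1 := -1))"
    have "J (k + 1) a"
      unfolding J_def
    proof (intro conjI allI impI)
      show "a 0 = inp" using J by (simp add: a_def J_def)
      fix i assume i: "0 \<le> i \<and> i < k + 1"
      then have "i = k \<or> i < k" by auto
      then show "a 1 i = inp (i + 1) mod n" "a 2 i = i + 1" "a 3 i = i + 1" "a 4 (i + 1) = - 1"
        using J i by (auto simp: a_def J_def)
    qed
    moreover have "fits (k + 1)" "0 \<le> k" "k < sz" "k + 1 < sz" using k b by (auto intro!: fits_small)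
    moreover have "fits (inp (k + 1) mod n)" using b by (intro fits_mod) auto
    moreover have "ar t 0 = inp" using J by (simp add: J_def)
    ultimately show ?case unfolding wp_simps(3,4) using 2(3) k v2 by (simp add: a_def)
  next
    case (3 t)
    have v2: "vr t 2 = n" using frameD(1)[OF 3(3), of 2] b by simp
    have J: "J (2 * n - 1) (ar t)" and tt: "int (tk t) = int (tk s) + (2 * n - 1)" using 3(1) by auto
    have "coll inp n (\<lambda>_. 1) (\<lambda>_. n) {0..<2 * n - 1} (\<lambda>i. [i + 1]) (ar t)"
      unfolding coll_def itm_def using J b by (auto simp: J_def cong_def)
    then show ?case unfolding wp_simps(2) using v2 tt b
      by (auto intro!: Q fits_small simp: inp_def)
  qed (use b in auto)
  moreover have "fits (n + n)" "fits (n + n - 1)" using b by (auto intro!: fits_small)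
  ultimately show ?thesis unfolding INIT_def wp_simps(4) wp_simps(2) using b by simp
qed

lemma wp_OUTPUT:
  assumes b: "vr s 2 = n" "0 < n" "8 * n \<le> sz"
    and ys: "islist (ar s 4) (ar s 2 0) ys" "length ys = nat n" "set ys \<subseteq> {1..2 * n - 1}"
    and Q: "\<And>t. (\<forall>i<length ys. ar t 0 (int i + 1) = ys ! i) \<Longrightarrow> int (tk t) = int (tk s) + n \<Longrightarrow> Q t"
  shows "wp OUTPUT Q s"
proof -
  define J where "J = (\<lambda>k v (a :: nat \<Rightarrow> int \<Rightarrow> int). islist (a 4) v (drop (nat k) ys) \<and> (\<forall>i<nat k. a 0 (int i + 1) = ys ! i))"
  let ?s = "s\<lparr>vr := (vr s)(31 := ar s 2 0)\<rparr>"
  have "wp (For 30 2 (Sto 0 (V 30 .+ N 1) (V 31) ;; 31 ::= A 4 (V 31))) Q ?s"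
  proof (rule wp_For[where P = "\<lambda>k t. J k (vr t 31) (ar t) \<and> int (tk t) = int (tk s) + k"], goal_cases)
    case 1
    then show ?case using ys by (simp add: J_def)
  next
    case (2 k t)
    have k: "0 \<le> k" "k < n" "vr t 30 = k" using 2 b by auto
    have kl: "nat k < length ys" using k ys(2) by auto
    have dr: "drop (nat k) ys = ys ! nat k # drop (nat (k + 1)) ys" using kl k by (simp add: Cons_nth_drop_Suc nat_add_distrib)
    have J: "islist (ar t 4) (vr t 31) (drop (nat k) ys)" "\<forall>i<nat k. ar t 0 (int i + 1) = ys ! i" using 2(3) by (auto simp: J_def)
    have v: "vr t 31 = ys ! nat k" "islist (ar t 4) (ar t 4 (vr t 31)) (drop (nat (k + 1)) ys)" using J(1) unfolding dr by auto
    have "ys ! nat k \<in> set ys" using kl by simp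
    then have vb: "0 \<le> vr t 31" "vr t 31 < sz" using v(1) ys(3) b by auto
    have "J (k + 1) (ar t 4 (vr t 31)) ((ar t)(0 := (ar t 0)(k + 1 := vr t 31)))"
      unfolding J_def
    proof (intro conjI allI impI)
      fix i assume "i < nat (k + 1)"
      then have "i = nat k \<or> i < nat k" using k by auto
      then show "((ar t)(0 := (ar t 0)(k + 1 := vr t 31))) 0 (int i + 1) = ys ! i" using J(2) v(1) k by auto
    qed (use v in simp)
    moreover have "fits (k + 1)" "0 \<le> k + 1" "k + 1 < sz" using k b by (auto intro!: fits_small)
    ultimately show ?case unfolding wp_simps(3,4) wp_simps(2) using 2(3) k vb by simp
  next
    case (3 t)
    then show ?case using b ys(2) by (intro Q) (auto simp: J_def)
  qed (use b in auto)
  moreover have "0 < sz" using sz_pos .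
  ultimately show ?thesis unfolding OUTPUT_def wp_simps(4) wp_simps(2) by simp
qed

lemma wp_EGZ:
  assumes b: "vr s 2 = n" "0 < n" "8 * n \<le> sz"
    and Q: "\<And>t ys. distinct ys \<Longrightarrow> length ys = nat n \<Longrightarrow> set ys \<subseteq> {1..2 * n - 1} \<Longrightarrow> [sum_list (map (ar s 0) ys) = 0] (mod n) \<Longrightarrow>
      (\<forall>i<length ys. ar t 0 (int i + 1) = ys ! i) \<Longrightarrow> int (tk t) \<le> int (tk s) + 640000818 * n \<Longrightarrow> Q t"
  shows "wp EGZ Q s"
  unfolding EGZ_def wp_simps(4)
proof (rule wp_INIT[OF b])
  fix t :: st and W assume t: "coll (ar s 0) n (\<lambda>_. 1) (\<lambda>_. n) {0..<2 * n - 1} W (ar t)" "vr t 3 = n" "vr t 4 = 2" "vr t 2 = n"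
    "int (tk t) \<le> int (tk s) + 2 * n"
  show "wp MAIN (wp OUTPUT Q) t"
  proof (rule wp_MAIN[OF t(2,3) b(2,3) t(1)])
    fix u :: st and W' assume u: "coll (ar s 0) n (\<lambda>_. nat n) (\<lambda>_. 1) {0..<1} W' (ar u)" "int (tk u) \<le> int (tk t) + 640000815 * n" "frame MAIN t u"
    have v2: "vr u 2 = n" using frameD(1)[OF u(3), of 2] t(4) by simp
    have it: "distinct (W' 0)" "islist (ar u 4) (ar u 2 0) (W' 0)" "length (W' 0) = nat n" "set (W' 0) \<subseteq> {1..2 * n - 1}"
      "[sum_list (map (ar s 0) (W' 0)) = int (nat n) * ar u 1 0] (mod n)"
      using u(1) unfolding coll_def itm_def by auto
    have "[int (nat n) * ar u 1 0 = 0] (mod n)" using b(2) by (simp add: cong_0_iff)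
    then have c: "[sum_list (map (ar s 0) (W' 0)) = 0] (mod n)" using it(5) cong_trans by blast
    show "wp OUTPUT Q u"
    proof (rule wp_OUTPUT[OF v2 b(2,3) it(2-4)])
      fix x :: st assume x: "\<forall>i<length (W' 0). ar x 0 (int i + 1) = W' 0 ! i" "int (tk x) = int (tk u) + n"
      have "int (tk x) \<le> int (tk s) + 640000818 * n" using x(2) u(2) t(5) by linarith
      then show "Q x" using x(1) it c by (intro Q)
    qed
  qed
qed

end

section \<open>Word length, asymptotic bounds and the complete program\<close>

lemma room_of_log:
  fixes n w :: nat
  assumes n: "n \<ge> 1" and k: "128 * log 2 (real n + 1) \<le> real w"
  shows "ram (16 * int n) w"
proof
  have "1 \<le> log 2 (real n + 1)" using n by simp
  then have w: "128 \<le> w" using k by linarith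
  then show "w \<ge> 20" by simp
  show "0 < 16 * int n" using n by simp
  have "log 2 ((real n + 1) ^ 128) \<le> real w" using k by (subst log_nat_power) simp_all
  then have "(real n + 1) ^ 128 \<le> 2 powr real w" by (subst (asm) log_le_iff) simp_all
  also have "\<dots> = 2 ^ w" by (rule powr_realpow) simp
  finally have "real ((n + 1) ^ 128) \<le> real (2 ^ w)"
    by (simp only: of_nat_power of_nat_add of_nat_1 of_nat_numeral)
  then have pw: "(n + 1) ^ 128 \<le> 2 ^ w" by (simp only: of_nat_le_iff)
  \<comment> \<open>Of the 128 factors \<open>n + 1 \<ge> 2\<close> two bound the square of
    \<open>n\<close>, and the other 126 absorb the constant
    \<open>2 ^ 68 = 2 ^ 60 * 16 ^ 2\<close>.\<close>
  have "(2::nat) ^ 126 * (n + 1) ^ 2 \<le> (n + 1) ^ 126 * (n + 1) ^ 2" using n by (intro mult_right_mono power_mono) auto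
  also have "\<dots> = (n + 1) ^ 128" by (simp flip: power_add)
  also have "\<dots> \<le> 2 ^ w" by (rule pw)
  finally have "int (2 ^ 126 * (n + 1) ^ 2) \<le> int (2 ^ w)" by (simp only: of_nat_le_iff)
  then have a: "2 ^ 126 * (int n + 1) ^ 2 \<le> 2 ^ w" by (simp add: add.commute)
  have ww: "(2::int) ^ w = 2 * 2 ^ (w - 1)" using w by (cases w) auto
  have sq: "int n * int n \<le> (int n + 1) ^ 2" by (simp add: power2_eq_square algebra_simps)
  have "2 ^ 68 * y < z" if "2 ^ 126 * x \<le> 2 * z" "y \<le> x" "0 < x" for x y z :: int
    using that by simp
  from this[OF a[unfolded ww] sq] have "2 ^ 68 * (int n * int n) < 2 ^ (w - 1)" by simp
  moreover have "2 ^ 60 * (16 * int n) * (16 * int n) = 2 ^ 68 * (int n * int n)" by (simp add: algebra_simps)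
  ultimately have "2 ^ 60 * (16 * int n) * (16 * int n) < 2 ^ (w - 1)" by (simp only:)
  moreover have "- (2 ^ (w - 1)) \<le> (0 :: int)" "0 \<le> 2 ^ 60 * (16 * int n) * (16 * int n)" by simp_all
  then have "- (2 ^ (w - 1)) \<le> 2 ^ 60 * (16 * int n) * (16 * int n)" by (rule order_trans)
  ultimately show "is_word w (2 ^ 60 * (16 * int n) * (16 * int n))"
    using w unfolding is_word_def by (intro conjI) simp_all
qed

lemma affine_in_bigo:
  fixes a b :: nat
  shows "(\<lambda>n. real (a + b * n)) \<in> O(\<lambda>n. real n)"
proof (rule bigoI[of _ "real (a + b)"])
  show "eventually (\<lambda>n. norm (real (a + b * n)) \<le> real (a + b) * norm (real n)) at_top"
  proof (rule eventually_mono[OF eventually_ge_at_top[of 1]])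
    fix n :: nat assume n: "1 \<le> n"
    have "a * 1 + b * n \<le> a * n + b * n" using n by (intro add_mono mult_left_mono) auto
    then have "real (a + b * n) \<le> real ((a + b) * n)" by (simp only: of_nat_le_iff) (simp add: algebra_simps)
    then show "norm (real (a + b * n)) \<le> real (a + b) * norm (real n)" by simp
  qed
qed

text \<open>The preamble reads \<open>n\<close> from cell 0 into register 2 and puts the segment
  size \<open>16 * n\<close> into register 99. Array 0 begins at address 0, so the input and the
  output cells are its entries. The 50 segments occupy \<open>800 * n\<close> cells.\<close>

definition egz_program :: program where
  "egz_program = [Const 100 0, Load 2 100, Const 101 16, Op Mul 99 2 101] @ cc EGZ 4"

lemma egz_program_correct:
  fixes n w :: nat and a :: "nat \<Rightarrow> int"
  assumes n: "n \<ge> 1" and k: "128 * log 2 (real n + 1) \<le> real w" and a: "\<forall>i\<in>{1..2 * n - 1}. is_word w (a i)"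
  shows "\<exists>s I. halts_within w egz_program (input_config n a) (4 + clen EGZ * (1 + 640000818 * n)) (800 * n) s \<and>
    outputs s n I \<and> I \<subseteq> {1..2 * n - 1} \<and> card I = n \<and> [(\<Sum>i\<in>I. a i) = 0] (mod int n)"
proof -
  define sz where "sz = 16 * int n"
  interpret ram sz w unfolding sz_def by (rule room_of_log[OF n k])
  let ?ic = "input_config n a"
  define cf where "cf = \<lparr>pc = Suc (Suc (Suc (Suc 0))), reg = (\<lambda>_. 0)(100 := 0, 2 := int n, 101 := 16, 99 := sz), mem = mem ?ic\<rparr>"
  \<comment> \<open>The initial arrays are read off the memory, so the structured state matches the
    configuration without any copying.\<close>
  define s0 where "s0 = \<lparr>vr = (\<lambda>x. if x = 2 then int n else 0), ar = (\<lambda>k i. mem ?ic (int k * sz + i)), tk = 0\<rparr>"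
  have f: "fits 16" "fits sz" "fits (int n)" "fits (int n * 16)" using n by (auto intro!: fits_small simp: sz_def)
  have sze: "int n * 16 = sz" by (simp add: sz_def)
  have P: "egz_program ! 0 = Const 100 0" "egz_program ! Suc 0 = Load 2 100" "egz_program ! Suc (Suc 0) = Const 101 16"
    "egz_program ! Suc (Suc (Suc 0)) = Op Mul 99 2 101" "length egz_program = 4 + clen EGZ"
    by (simp_all add: egz_program_def)
  have ex1: "exs egz_program 4 ?ic cf"
  proof -
    have "exs egz_program (Suc (Suc (Suc (Suc 0)))) ?ic cf"
      using f sz_pos sze by (intro exs_Suc) (simp_all add: P input_config_def cf_def wrap_word)
    then show ?thesis by (simp add: numeral_eq_Suc)
  qed
  have m0: "matches s0 cf"
    unfolding matches_def
  proof (intro conjI allI impI)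
    fix x :: nat assume "x < 99"
    then show "reg cf x = vr s0 x" "fits (vr s0 x)" using f by (auto simp: cf_def s0_def)
  next
    show "reg cf 99 = sz" by (simp add: cf_def)
  next
    fix k :: nat and i :: int
    show "mem cf (int k * sz + i) = ar s0 k i" by (simp add: cf_def s0_def)
    have "fits (mem ?ic x)" for x
    proof (cases "1 \<le> x \<and> x \<le> 2 * int n - 1")
      case True
      then have "nat x \<in> {1..2 * n - 1}" by auto
      then show ?thesis using True a by (simp add: input_config_def)
    next
      case False
      then show ?thesis using f by (auto simp: input_config_def)
    qed
    then show "fits (ar s0 k i)" by (simp add: s0_def)
  qed
  have inp: "ar s0 0 i = a (nat i)" if "i \<in> {1..2 * int n - 1}" for i
    using that by (auto simp: s0_def input_config_def)
  have "wp EGZ (\<lambda>t. \<exists>ys. distinct ys \<and> length ys = n \<and> set ys \<subseteq> {1..2 * int n - 1} \<and>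
     [sum_list (map (ar s0 0) ys) = 0] (mod int n) \<and> (\<forall>i<n. ar t 0 (int i + 1) = ys ! i) \<and> int (tk t) \<le> 640000818 * int n) s0"
  proof (rule wp_EGZ[where n = "int n"])
    fix t :: st and ys assume "distinct ys" "length ys = nat (int n)" "set ys \<subseteq> {1..2 * int n - 1}"
      "[sum_list (map (ar s0 0) ys) = 0] (mod int n)" "\<forall>i<length ys. ar t 0 (int i + 1) = ys ! i"
      "int (tk t) \<le> int (tk s0) + 640000818 * int n"
    then show "\<exists>ys. distinct ys \<and> length ys = n \<and> set ys \<subseteq> {1..2 * int n - 1} \<and>
     [sum_list (map (ar s0 0) ys) = 0] (mod int n) \<and> (\<forall>i<n. ar t 0 (int i + 1) = ys ! i) \<and> int (tk t) \<le> 640000818 * int n"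
      by (intro exI[of _ ys]) (simp add: s0_def)
  qed (use n in \<open>simp_all add: s0_def sz_def\<close>)
  then obtain s1 ys where s1: "bs EGZ s0 s1" and ys: "distinct ys" "length ys = n" "set ys \<subseteq> {1..2 * int n - 1}"
    "[sum_list (map (ar s0 0) ys) = 0] (mod int n)" "\<forall>i<n. ar s1 0 (int i + 1) = ys ! i" and tk: "int (tk s1) \<le> 640000818 * int n"
    unfolding wp_def by blast
  have cd: "code_at egz_program 4 (cc EGZ 4)" by (auto simp: code_at_def egz_program_def nth_append)
  have "pc cf = 4" by (simp add: cf_def)
  then obtain t cf' where t: "t \<le> clen EGZ * (1 + (tk s1 - tk s0))" "exs egz_program t cf cf'" "matches s1 cf'" "pc cf' = 4 + clen EGZ"
    using cc_correct[OF s1 cd _ m0] by blast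
  have ex: "exs egz_program (4 + t) ?ic cf'" by (rule exs_trans[OF ex1 t(2)])
  have "tk s1 - tk s0 \<le> 640000818 * n" using tk by (simp add: s0_def)
  then have "clen EGZ * (1 + (tk s1 - tk s0)) \<le> clen EGZ * (1 + 640000818 * n)" by (intro mult_le_mono2) simp
  then have "4 + t \<le> 4 + clen EGZ * (1 + 640000818 * n)" using t(1) by linarith
  moreover have "50 * sz = int (800 * n)" by (simp add: sz_def)
  ultimately have hw: "halts_within w egz_program ?ic (4 + clen EGZ * (1 + 640000818 * n)) (800 * n) cf'"
    unfolding halts_within_def using ex t(4) P(5) unfolding exs_def halted_def
    by (intro exI[of _ "4 + t"]) simp
  define I where "I = nat ` set ys"
  have inj: "inj_on nat (set ys)" using ys(3) by (intro inj_on_inverseI[of _ int]) auto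
  have iI: "int ` I = set ys"
  proof -
    have "int ` I = id ` set ys" unfolding I_def image_image using ys(3) by (intro image_cong) auto
    then show ?thesis by simp
  qed
  have mem: "mem cf' (int i + 1) = ys ! i" if "i < n" for i
  proof -
    have "0 \<le> int i + 1" "int i + 1 < sz" using that by (auto simp: sz_def)
    then have "mem cf' (int 0 * sz + (int i + 1)) = ar s1 0 (int i + 1)"
      using t(3) unfolding matches_def by (elim conjE) (drule spec[of _ 0], simp)
    then show ?thesis using ys(5) that by simp
  qed
  have "mem cf' ` {1..int n} = set ys"
  proof -
    have "{1..int n} = (\<lambda>i. int i + 1) ` {..<n}"
    proof (intro equalityI subsetI)
      fix x assume "x \<in> {1..int n}"
      then show "x \<in> (\<lambda>i. int i + 1) ` {..<n}" by (intro image_eqI[of _ _ "nat (x - 1)"]) auto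
    qed auto
    then have "mem cf' ` {1..int n} = (\<lambda>i. mem cf' (int i + 1)) ` {..<n}" by (simp add: image_image)
    also have "\<dots> = (\<lambda>i. ys ! i) ` {..<n}" using mem by (intro image_cong) auto
    also have "\<dots> = set ys" using ys(2) by (auto simp: set_conv_nth)
    finally show ?thesis .
  qed
  then have "outputs cf' n I" unfolding outputs_def iI .
  moreover have "I \<subseteq> {1..2 * n - 1}" using ys(3) by (auto simp: I_def subset_iff)
  moreover have "card I = n" unfolding I_def using card_image[OF inj] distinct_card[OF ys(1)] ys(2) by simp
  moreover have "[(\<Sum>i\<in>I. a i) = 0] (mod int n)"
  proof -
    have "(\<Sum>i\<in>I. a i) = (\<Sum>x\<in>set ys. a (nat x))" unfolding I_def by (simp add: sum.reindex[OF inj])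
    also have "\<dots> = (\<Sum>x\<in>set ys. ar s0 0 x)" using ys(3) inp by (intro sum.cong) auto
    also have "\<dots> = sum_list (map (ar s0 0) ys)" using ys(1) by (simp add: sum_list_distinct_conv_sum_set)
    finally show ?thesis using ys(4) by simp
  qed
  ultimately show ?thesis using hw by blast
qed

theorem theorem6:
  shows "\<exists>(P :: program) (k :: real). \<forall>c :: real. \<exists>(T :: nat \<Rightarrow> nat) (S :: nat \<Rightarrow> nat).
    (\<lambda>n. real (T n)) \<in> O(\<lambda>n. real n) \<and> (\<lambda>n. real (S n)) \<in> O(\<lambda>n. real n) \<and>
    (\<forall>(n :: nat) (w :: nat) (a :: nat \<Rightarrow> int).
       n \<ge> 1 \<and> k * log 2 (real n + 1) \<le> real w \<and> real w \<le> c * log 2 (real n + 1) \<and>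
       (\<forall>i\<in>{1..2 * n - 1}. is_word w (a i)) \<longrightarrow>
       (\<exists>s I. halts_within w P (input_config n a) (T n) (S n) s \<and> outputs s n I \<and>
          I \<subseteq> {1..2 * n - 1} \<and> card I = n \<and> [(\<Sum>i\<in>I. a i) = 0] (mod int n)))"
proof (rule exI[of _ egz_program], rule exI[of _ 128], rule allI,
    rule exI[of _ "\<lambda>n. 4 + clen EGZ * (1 + 640000818 * n)"], rule exI[of _ "\<lambda>n. 800 * n"], intro conjI allI impI)
  fix c :: real
  have "4 + clen EGZ * (1 + 640000818 * n) = (4 + clen EGZ) + (clen EGZ * 640000818) * n" for n :: nat
    by (simp add: algebra_simps)
  then show "(\<lambda>n. real (4 + clen EGZ * (1 + 640000818 * n))) \<in> O(\<lambda>n. real n)"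
    using affine_in_bigo[of "4 + clen EGZ" "clen EGZ * 640000818"] by (simp only:)
  show "(\<lambda>n. real (800 * n)) \<in> O(\<lambda>n. real n)" using affine_in_bigo[of 0 800] by simp
qed (use egz_program_correct in blast)

end
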